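(* The category $\mathcal{B}_q^{iso,f}$ is equivalent to the category of finite dimensional $\mathbb{C}^\ast/q^{\mathbb{Z}}$-graded complex vector spaces $V$ endowed with nilpotent operators which preserve the grading, that moreover have the following property: let $\lambda_1,\dots,\lambda_n\in\mathbb{C}^\ast$ be a set of representatives of the classes of $\mathbb{C}^\ast/q^{\mathbb{Z}}$ corresponding to the non-zero homogeneous components of $V$, and let $$\underline{\Lambda}=\{\lambda_i\lambda_j^{-1}: i,j=1,\dots,n;\ \lambda_i\lambda_j^{-1}\notin q^{\mathbb{Z}_{\le 0}}\};$$ then the series $\phi_{(q;\underline{\Lambda})}(x)$ is convergent.
   Context: Fix $q\in\mathbb{C}$ with $|q|=1$, $q$ not a root of unity, and assume that the series $\sum_{n\ge 0}\frac{x^n}{(q;q)_n}$ is convergent, where $(\lambda;q)_0=1$ and $(\lambda;q)_n=(1-\lambda)(1-q\lambda)\cdots(1-q^{n-1}\lambda)$ for $n\ge 1$. A power series is called convergent if its radius of convergence is positive. For a finite set $\Lambda\subset\mathbb{C}^\ast\smallsetminus q^{\mathbb{Z}_{\le 0}}$ put $$\phi_{(q;\Lambda)}(x)=\sum_{n\ge 0}\frac{x^n}{\prod_{\lambda\in\Lambda}(\lambda;q)_n}.$$ Let $\mathbf{K}=\mathbb{C}(\{x\})$ be the field of germs of meromorphic functions at $0$, $\widehat{\mathbf{K}}=\mathbb{C}((x))$, and $\sigma_q f(x)=f(qx)$. A $q$-difference module over $F\in\{\mathbf{K},\widehat{\mathbf{K}}\}$ is a finite-dimensional $F$-vector space $M$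 with a bijective $\mathbb{C}$-linear map $\Sigma_q:M\to M$ such that $\Sigma_q(fm)=\sigma_q(f)\Sigma_q(m)$ for $f\in F$, $m\in M$; a morphism is an $F$-linear map commuting with the $\Sigma_q$'s. Let $\mathcal{B}_q$ (resp. $\widehat{\mathcal{B}}_q$) be the category of $q$-difference modules over $\mathbf{K}$ (resp. $\widehat{\mathbf{K}}$); extension of scalars sends $\mathcal{M}=(M,\Sigma_q)$ to $\mathcal{M}_{\widehat{\mathbf{K}}}=(M\otimes_{\mathbf{K}}\widehat{\mathbf{K}},\Sigma_q\otimes\sigma_q)$. $\mathcal{B}_q^{iso}$ is the full subcategory of $\mathcal{B}_q$ whose objects are the $\mathcal{M}$ such that every object $\mathcal{N}$ of $\mathcal{B}_q$ with $\mathcal{N}_{\widehat{\mathbf{K}}}\cong\mathcal{M}_{\widehat{\mathbf{K}}}$ in $\widehat{\mathcal{B}}_q$ is isomorphic to $\mathcal{M}$ in $\mathcal{B}_q$. Newton polygon: by the cyclic vector lemma, $M\cong\mathbf{K}[\sigma_q,\sigma_q^{-1}]/\mathbf{K}[\sigma_q,\sigma_q^{-1}]\mathcal{L}$ for some $\mathcal{L}=\sum_{i=0}^{\nu}a_i(x)\sigma_q^i$ with $a_i$ convergent power series and $\nu=\dim M$. The Newton polygon of $\mathcal{L}$ is the convex hull in $\mathbb{R}^2$ of $\{(i,k)\in\mathbb{Z}\times\mathbb{R}: 0\le i\le\nu,\ a_i\ne 0,\ k\ge \mathrm{ord}_x a_i\}$; its finite slopes, with the lengths of their projections on the horizontal axis,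 depend only on $M$. $\mathcal{B}_q^{iso,f}$ is the full subcategory of $\mathcal{B}_q^{iso}$ of the objects whose Newton polygon has only one slope, equal to zero. Morphisms of graded vector spaces with nilpotent operators are the linear maps preserving the grading and commuting with the nilpotent operators. *)

theory Defs
  imports "HOL-Complex_Analysis.Complex_Analysis" "HOL-Algebra.AbelCoset" "Jordan_Normal_Form.VS_Connect"
begin

section \<open>Categories and equivalences\<close>

text \<open>Composition and the arrow part of a functor take the objects involved as arguments, because
  distinct hom-sets may share elements (two structures on the same carrier).\<close>

record ('o, 'a) cat =
  Obj :: "'o set"
  Hom :: "'o \<Rightarrow> 'o \<Rightarrow> 'a set"
  Ident :: "'o \<Rightarrow> 'a"
  Comp :: "'o \<Rightarrow> 'o \<Rightarrow> 'o \<Rightarrow> 'a \<Rightarrow> 'a \<Rightarrow> 'a"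

definition is_category :: "('o, 'a) cat \<Rightarrow> bool" where
  "is_category C \<longleftrightarrow>
     (\<forall>A\<in>Obj C. Ident C A \<in> Hom C A A) \<and>
     (\<forall>A\<in>Obj C. \<forall>B\<in>Obj C. \<forall>D\<in>Obj C. \<forall>f\<in>Hom C A B. \<forall>g\<in>Hom C B D.
        Comp C A B D g f \<in> Hom C A D) \<and>
     (\<forall>A\<in>Obj C. \<forall>B\<in>Obj C. \<forall>f\<in>Hom C A B.
        Comp C A A B f (Ident C A) = f \<and> Comp C A B B (Ident C B) f = f) \<and>
     (\<forall>A\<in>Obj C. \<forall>B\<in>Obj C. \<forall>D\<in>Obj C. \<forall>E\<in>Obj C.
        \<forall>f\<in>Hom C A B. \<forall>g\<in>Hom C B D. \<forall>h\<in>Hom C D E.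
        Comp C A D E h (Comp C A B D g f) = Comp C A B E (Comp C B D E h g) f)"

definition is_iso :: "('o, 'a) cat \<Rightarrow> 'o \<Rightarrow> 'o \<Rightarrow> 'a \<Rightarrow> bool" where
  "is_iso C A B f \<longleftrightarrow> f \<in> Hom C A B \<and>
     (\<exists>g\<in>Hom C B A. Comp C A B A g f = Ident C A \<and> Comp C B A B f g = Ident C B)"

definition isomorphic_in :: "('o, 'a) cat \<Rightarrow> 'o \<Rightarrow> 'o \<Rightarrow> bool" where
  "isomorphic_in C A B \<longleftrightarrow> A \<in> Obj C \<and> B \<in> Obj C \<and> (\<exists>f. is_iso C A B f)"

definition is_functor ::
  "('o, 'a) cat \<Rightarrow> ('p, 'b) cat \<Rightarrow> ('o \<Rightarrow> 'p) \<Rightarrow> ('o \<Rightarrow> 'o \<Rightarrow> 'a \<Rightarrow> 'b) \<Rightarrow> bool" where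
  "is_functor C D Fo Fa \<longleftrightarrow>
     (\<forall>A\<in>Obj C. Fo A \<in> Obj D) \<and>
     (\<forall>A\<in>Obj C. \<forall>B\<in>Obj C. \<forall>f\<in>Hom C A B. Fa A B f \<in> Hom D (Fo A) (Fo B)) \<and>
     (\<forall>A\<in>Obj C. Fa A A (Ident C A) = Ident D (Fo A)) \<and>
     (\<forall>A\<in>Obj C. \<forall>B\<in>Obj C. \<forall>E\<in>Obj C. \<forall>f\<in>Hom C A B. \<forall>g\<in>Hom C B E.
        Fa A E (Comp C A B E g f) = Comp D (Fo A) (Fo B) (Fo E) (Fa B E g) (Fa A B f))"

text \<open>\<open>\<eta>\<close> is an isomorphism from the endofunctor \<open>(To, Ta)\<close> of \<open>C\<close> to the identity functor.\<close>

definition nat_iso_to_id ::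
  "('o, 'a) cat \<Rightarrow> ('o \<Rightarrow> 'o) \<Rightarrow> ('o \<Rightarrow> 'o \<Rightarrow> 'a \<Rightarrow> 'a) \<Rightarrow> ('o \<Rightarrow> 'a) \<Rightarrow> bool" where
  "nat_iso_to_id C To Ta \<eta> \<longleftrightarrow>
     (\<forall>A\<in>Obj C. is_iso C (To A) A (\<eta> A)) \<and>
     (\<forall>A\<in>Obj C. \<forall>B\<in>Obj C. \<forall>f\<in>Hom C A B.
        Comp C (To A) (To B) B (\<eta> B) (Ta A B f) = Comp C (To A) A B f (\<eta> A))"

definition equivalent_categories :: "('o, 'a) cat \<Rightarrow> ('p, 'b) cat \<Rightarrow> bool" where
  "equivalent_categories C D \<longleftrightarrow> is_category C \<and> is_category D \<and>
     (\<exists>Fo Fa Go Ga \<eta> \<epsilon>. is_functor C D Fo Fa \<and> is_functor D C Go Ga \<and>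
        nat_iso_to_id C (\<lambda>A. Go (Fo A)) (\<lambda>A B f. Ga (Fo A) (Fo B) (Fa A B f)) \<eta> \<and>
        nat_iso_to_id D (\<lambda>X. Fo (Go X)) (\<lambda>X Y g. Fa (Go X) (Go Y) (Ga X Y g)) \<epsilon>)"

definition full_subcategory :: "('o, 'a) cat \<Rightarrow> ('o \<Rightarrow> bool) \<Rightarrow> ('o, 'a) cat" where
  "full_subcategory C P = C\<lparr>Obj := {A \<in> Obj C. P A}\<rparr>"


section \<open>The series \<open>\<phi>\<close>\<close>

definition qpoch :: "complex \<Rightarrow> complex \<Rightarrow> nat \<Rightarrow> complex" where
  "qpoch q a n = (\<Prod>k<n. 1 - q ^ k * a)"

definition phi :: "complex \<Rightarrow> complex set \<Rightarrow> complex fps" where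
  "phi q \<Lambda> = Abs_fps (\<lambda>n. 1 / (\<Prod>a\<in>\<Lambda>. qpoch q a n))"


section \<open>\<open>q\<close>-difference modules\<close>

abbreviation K_hat :: "complex fls ring" where
  "K_hat \<equiv> class_ring"

text \<open>Germs of meromorphic functions at 0 are represented by their Laurent expansions.\<close>

definition K_conv :: "complex fls ring" where
  "K_conv = K_hat\<lparr>carrier := {f. fls_conv_radius f > 0}\<rparr>"

definition sigma_q :: "complex \<Rightarrow> complex fls \<Rightarrow> complex fls" where
  "sigma_q q f = fls_compose_fps f (fps_const q * fps_X)"

record 'm qmod = "(complex fls, 'm) module" +
  Sig :: "'m \<Rightarrow> 'm"

text \<open>\<open>\<complex>\<close>-homogeneity of \<open>Sig\<close> is the last condition for constant \<open>f\<close>.\<close>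

definition q_difference_module :: "complex fls ring \<Rightarrow> complex \<Rightarrow> 'm qmod \<Rightarrow> bool" where
  "q_difference_module F q M \<longleftrightarrow>
     vectorspace F M \<and> vectorspace.fin_dim F M \<and>
     bij_betw (Sig M) (carrier M) (carrier M) \<and>
     (\<forall>m\<in>carrier M. \<forall>n\<in>carrier M. Sig M (m \<oplus>\<^bsub>M\<^esub> n) = Sig M m \<oplus>\<^bsub>M\<^esub> Sig M n) \<and>
     (\<forall>f\<in>carrier F. \<forall>m\<in>carrier M. Sig M (f \<odot>\<^bsub>M\<^esub> m) = sigma_q q f \<odot>\<^bsub>M\<^esub> Sig M m)"

definition qmod_hom :: "complex fls ring \<Rightarrow> 'm qmod \<Rightarrow> 'n qmod \<Rightarrow> ('m \<Rightarrow> 'n) set" where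
  "qmod_hom F M N = {h \<in> module_hom F M N. h \<in> extensional (carrier M) \<and>
     (\<forall>m\<in>carrier M. h (Sig M m) = Sig N (h m))}"

text \<open>The objects are the modules whose carrier is a subset of the type \<open>'m\<close>, which thus plays the role of
  a universe; it must be large enough to contain a copy of \<open>F\<^sup>n\<close> for all \<open>n\<close>.\<close>

definition qmod_category :: "complex fls ring \<Rightarrow> complex \<Rightarrow> ('m qmod, 'm \<Rightarrow> 'm) cat" where
  "qmod_category F q =
     \<lparr>Obj = {M. q_difference_module F q M},
      Hom = qmod_hom F,
      Ident = (\<lambda>M. \<lambda>m\<in>carrier M. m),
      Comp = (\<lambda>L M N g f. compose (carrier L) g f)\<rparr>"

abbreviation Bq :: "complex \<Rightarrow> ('m qmod, 'm \<Rightarrow> 'm) cat" where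
  "Bq \<equiv> qmod_category K_conv"

abbreviation Bq_hat :: "complex \<Rightarrow> ('m qmod, 'm \<Rightarrow> 'm) cat" where
  "Bq_hat \<equiv> qmod_category K_hat"

text \<open>Quotient by a \<open>Sig\<close>-stable submodule. The fields \<open>mult\<close> and \<open>one\<close>, inherited from the ring
  record underlying modules, play no role for modules.\<close>

definition qmod_quot :: "'m qmod \<Rightarrow> 'm set \<Rightarrow> 'm set qmod" where
  "qmod_quot M H =
     \<lparr>carrier = a_rcosets\<^bsub>M\<^esub> H,
      mult = undefined,
      one = undefined,
      zero = H,
      add = (\<lambda>X Y. X <+>\<^bsub>M\<^esub> Y),
      smult = (\<lambda>a X. \<Union>x\<in>X. H +>\<^bsub>M\<^esub> (a \<odot>\<^bsub>M\<^esub> x)),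
      Sig = (\<lambda>X. \<Union>x\<in>X. H +>\<^bsub>M\<^esub> (Sig M x))\<rparr>"


subsection \<open>Extension of scalars\<close>

text \<open>The tensor product \<open>M \<otimes> K_hat\<close> over \<open>K_conv\<close> is the \<open>K_hat\<close>-vector space with generators
  \<open>m \<otimes> 1\<close>, for \<open>m\<close> in \<open>M\<close>, modulo the relations \<open>(m + n) \<otimes> 1 = m \<otimes> 1 + n \<otimes> 1\<close> and
  \<open>(f m) \<otimes> 1 = f (m \<otimes> 1)\<close> for \<open>f\<close> in \<open>K_conv\<close>. In the free vector space on \<open>M\<close>, the finitely
  supported function \<open>g\<close> stands for the sum of the \<open>m \<otimes> g m\<close>, and the operator sends \<open>m \<otimes> a\<close>
  to \<open>Sig m \<otimes> sigma_q a\<close>.\<close>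

definition free_qmod :: "complex \<Rightarrow> 'm qmod \<Rightarrow> ('m \<Rightarrow> complex fls) qmod" where
  "free_qmod q M =
     \<lparr>carrier = {g. finite {m. g m \<noteq> 0} \<and> {m. g m \<noteq> 0} \<subseteq> carrier M},
      mult = undefined,
      one = undefined,
      zero = (\<lambda>m. 0),
      add = (\<lambda>g h m. g m + h m),
      smult = (\<lambda>a g m. a * g m),
      Sig = (\<lambda>g n. \<Sum>m | g m \<noteq> 0 \<and> Sig M m = n. sigma_q q (g m))\<rparr>"

definition single :: "'i \<Rightarrow> 'i \<Rightarrow> complex fls" where
  "single i = (\<lambda>j. if j = i then 1 else 0)"

definition tensor_relations :: "'m qmod \<Rightarrow> ('m \<Rightarrow> complex fls) set" where
  "tensor_relations M =
     {(\<lambda>x. single (m \<oplus>\<^bsub>M\<^esub> n) x - single m x - single n x) | m n.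
        m \<in> carrier M \<and> n \<in> carrier M} \<union>
     {(\<lambda>x. single (f \<odot>\<^bsub>M\<^esub> m) x - f * single m x) | f m.
        f \<in> carrier K_conv \<and> m \<in> carrier M}"

definition base_change :: "complex \<Rightarrow> 'm qmod \<Rightarrow> ('m \<Rightarrow> complex fls) set qmod" where
  "base_change q M = qmod_quot (free_qmod q M)
     (LinearCombinations.module.span K_hat (free_qmod q M) (tensor_relations M))"


subsection \<open>\<open>q\<close>-difference operators and the Newton polygon\<close>

text \<open>The function \<open>P\<close> stands for the operator given by the sum of the \<open>P i \<cdot> \<sigma>\<^sub>q\<^sup>i\<close>; the product is
  determined by \<open>\<sigma>\<^sub>q\<^sup>i \<cdot> f = f(q\<^sup>i x) \<cdot> \<sigma>\<^sub>q\<^sup>i\<close>.\<close>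

definition qop_carrier :: "(int \<Rightarrow> complex fls) set" where
  "qop_carrier = {P. finite {i. P i \<noteq> 0} \<and> (\<forall>i. P i \<in> carrier K_conv)}"

definition qop_mult ::
  "complex \<Rightarrow> (int \<Rightarrow> complex fls) \<Rightarrow> (int \<Rightarrow> complex fls) \<Rightarrow> (int \<Rightarrow> complex fls)" where
  "qop_mult q P Q = (\<lambda>k. \<Sum>i | P i \<noteq> 0. P i * sigma_q (q powi i) (Q (k - i)))"

definition qop_qmod :: "complex \<Rightarrow> (int \<Rightarrow> complex fls) qmod" where
  "qop_qmod q =
     \<lparr>carrier = qop_carrier,
      mult = qop_mult q,
      one = single 0,
      zero = (\<lambda>i. 0),
      add = (\<lambda>P Q i. P i + Q i),
      smult = (\<lambda>a P i. a * P i),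
      Sig = qop_mult q (single 1)\<rparr>"

definition cyclic_qmod :: "complex \<Rightarrow> (int \<Rightarrow> complex fls) \<Rightarrow> (int \<Rightarrow> complex fls) set qmod" where
  "cyclic_qmod q L = qmod_quot (qop_qmod q) {qop_mult q P L | P. P \<in> qop_carrier}"

definition cyclic_presentation :: "complex \<Rightarrow> 'm qmod \<Rightarrow> (int \<Rightarrow> complex fls) \<Rightarrow> bool" where
  "cyclic_presentation q M L \<longleftrightarrow>
     L \<in> qop_carrier \<and> (\<forall>i. fls_subdegree (L i) \<ge> 0) \<and>
     (\<forall>i. i \<notin> {0..int (vectorspace.dim K_conv M)} \<longrightarrow> L i = 0) \<and>
     (\<exists>h\<in>qmod_hom K_conv M (cyclic_qmod q L).
        bij_betw h (carrier M) (carrier (cyclic_qmod q L)))"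

definition newton_polygon :: "(int \<Rightarrow> complex fls) \<Rightarrow> (real \<times> real) set" where
  "newton_polygon L = convex hull
     {(real_of_int i, k) | i k. L i \<noteq> 0 \<and> k \<ge> real_of_int (fls_subdegree (L i))}"

definition finite_slopes :: "(real \<times> real) set \<Rightarrow> real set" where
  "finite_slopes P = {(snd b - snd a) / (fst b - fst a) | a b e.
     e edge_of P \<and> a \<in> e \<and> b \<in> e \<and> fst a \<noteq> fst b}"

text \<open>The zero module, which has no finite slope, is included.\<close>

definition only_slope_zero :: "complex \<Rightarrow> 'm qmod \<Rightarrow> bool" where
  "only_slope_zero q M \<longleftrightarrow>
     (\<exists>L. cyclic_presentation q M L \<and> finite_slopes (newton_polygon L) \<subseteq> {0})"


subsection \<open>The categories of isoformal modules\<close>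

definition Bq_iso :: "complex \<Rightarrow> ('m qmod, 'm \<Rightarrow> 'm) cat" where
  "Bq_iso q = full_subcategory (Bq q) (\<lambda>M. \<forall>N\<in>Obj (Bq q).
     isomorphic_in (Bq_hat q) (base_change q N) (base_change q M) \<longrightarrow>
     isomorphic_in (Bq q) N M)"

definition Bq_iso_f :: "complex \<Rightarrow> ('m qmod, 'm \<Rightarrow> 'm) cat" where
  "Bq_iso_f q = full_subcategory (Bq_iso q) (only_slope_zero q)"


section \<open>Graded vector spaces with nilpotent operators\<close>

abbreviation C_field :: "complex ring" where
  "C_field \<equiv> class_ring"

definition q_class :: "complex \<Rightarrow> complex \<Rightarrow> complex set" where
  "q_class q a = {a * q powi k | k. True}"

definition q_classes :: "complex \<Rightarrow> complex set set" where
  "q_classes q = q_class q ` (- {0})"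

record 'v grnil = "(complex, 'v) module" +
  component :: "complex set \<Rightarrow> 'v set"
  Nil_op :: "'v \<Rightarrow> 'v"

definition graded_nilpotent_space :: "complex \<Rightarrow> 'v grnil \<Rightarrow> bool" where
  "graded_nilpotent_space q V \<longleftrightarrow>
     vectorspace C_field V \<and> vectorspace.fin_dim C_field V \<and>
     (\<forall>c\<in>q_classes q. VectorSpace.subspace C_field (component V c) V) \<and>
     (\<forall>v\<in>carrier V. \<exists>!w. w \<in> Pi\<^sub>E (q_classes q) (component V) \<and>
        finite {c \<in> q_classes q. w c \<noteq> \<zero>\<^bsub>V\<^esub>} \<and>
        v = finsum V w {c \<in> q_classes q. w c \<noteq> \<zero>\<^bsub>V\<^esub>}) \<and>
     Nil_op V \<in> module_hom C_field V V \<and>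
     (\<forall>c\<in>q_classes q. Nil_op V ` component V c \<subseteq> component V c) \<and>
     (\<exists>k. \<forall>v\<in>carrier V. (Nil_op V ^^ k) v = \<zero>\<^bsub>V\<^esub>)"

definition grnil_hom :: "complex \<Rightarrow> 'v grnil \<Rightarrow> 'v grnil \<Rightarrow> ('v \<Rightarrow> 'v) set" where
  "grnil_hom q V W = {h \<in> module_hom C_field V W. h \<in> extensional (carrier V) \<and>
     (\<forall>c\<in>q_classes q. h ` component V c \<subseteq> component W c) \<and>
     (\<forall>v\<in>carrier V. h (Nil_op V v) = Nil_op W (h v))}"

definition grnil_category :: "complex \<Rightarrow> ('v grnil, 'v \<Rightarrow> 'v) cat" where
  "grnil_category q =
     \<lparr>Obj = {V. graded_nilpotent_space q V},
      Hom = grnil_hom q,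
      Ident = (\<lambda>V. \<lambda>v\<in>carrier V. v),
      Comp = (\<lambda>U V W g f. compose (carrier U) g f)\<rparr>"

definition ratio_set :: "complex \<Rightarrow> complex set \<Rightarrow> complex set" where
  "ratio_set q R = {a * inverse b | a b. a \<in> R \<and> b \<in> R} - {q powi k | k. k \<le> 0}"

definition phi_condition :: "complex \<Rightarrow> 'v grnil \<Rightarrow> bool" where
  "phi_condition q V \<longleftrightarrow>
     (\<forall>R. R \<subseteq> - {0} \<and>
        bij_betw (q_class q) R {c \<in> q_classes q. component V c \<noteq> {\<zero>\<^bsub>V\<^esub>}} \<longrightarrow>
        fps_conv_radius (phi q (ratio_set q R)) > 0)"

end

theory Submission imports Defs "Jordan_Normal_Form.Char_Poly" begin

text \<open>Both categories are equivalent to a category of matrices. A module whose only slope is zero has, over the formal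
  Laurent series, a constant upper triangular matrix \<open>A\<close> whose eigenvalues are chosen representatives of classes in
  \<open>\<complex>\<^sup>*/q\<^sup>\<int>\<close> and which does not mix different eigenvalues. The diagonal of \<open>A\<close> gives a grading and the rest of \<open>A\<close> a
  nilpotent operator preserving it. The absence of resonances forces all morphisms, even the formal ones, to be constant.

  The coefficients of a formal gauge transformation to \<open>A\<close> solve Sylvester equations with divisors
  \<open>q\<^sup>m \<lambda>\<^sub>i - \<lambda>\<^sub>j\<close>. If the \<open>1/(1 - q\<^sup>m \<lambda>\<^sub>i/\<lambda>\<^sub>j)\<close> with \<open>\<lambda>\<^sub>i \<noteq> \<lambda>\<^sub>j\<close> grow at most geometrically, then so do their products over
  \<open>m\<close>, because \<open>\<Sum>x\<^sup>n/(q;q)\<^sub>n\<close> converges, and all these gauge transformations converge. If one of the sequences grows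
  faster, a perturbation of \<open>A\<close> gives a module that is formally but not analytically isomorphic to that of \<open>A\<close>. So being
  determined by the formal module is the same growth condition as the convergence of the series \<open>\<phi>\<close>.\<close>

no_notation fps_nth (infixl "$" 75)
unbundle no vec_syntax

section \<open>Coordinates on vector spaces over a subfield\<close>

text \<open>Convergent and formal modules differ only in the field of coefficients. Vectors,
  matrices and presentations are therefore taken relative to a subset \<open>S\<close> of one field
  of Laurent series that forms a subfield, either \<open>conv_fls\<close> or \<open>UNIV\<close>.
  The same matrix then describes a module and its extension of scalars, although the two live in
  different types, and isoformality asks whether a formal solution of
  \<open>P * A = B * sigm q P\<close> can be replaced by a convergent one. A module has no canonical
  basis, so neither side of the equivalence has a functor to matrices given by a formula.
  Coordinates are chosen, and only the relation "\<open>P\<close> is the matrix of \<open>f\<close>"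
  is handled. The analytic obstacle is a mismatch: a single perturbed entry detects individual
  divisors, while solving for all coefficients of a gauge transformation multiplies divisors of all
  orders, and for several pairs of eigenvalues at once. Growth is therefore measured by
  \<open>geo\<close>, a class closed under products, fixed powers and shifts, and maxima of divisors
  are replaced by products. Since objects have carriers in one fixed type, every matrix to be
  compared with a given module first needs a copy in that type.\<close>

definition subfld :: "'a::field set \<Rightarrow> bool" where
  "subfld S \<longleftrightarrow> 0 \<in> S \<and> 1 \<in> S \<and> (\<forall>x\<in>S. \<forall>y\<in>S. x + y \<in> S \<and> x * y \<in> S) \<and>
     (\<forall>x\<in>S. - x \<in> S \<and> inverse x \<in> S)"

definition subfld_ring :: "'a::field set \<Rightarrow> 'a ring" where
  "subfld_ring S = class_ring\<lparr>carrier := S\<rparr>"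

definition vecs :: "'a set \<Rightarrow> nat \<Rightarrow> 'a vec set" where
  "vecs S n = {v \<in> carrier_vec n. \<forall>i<n. v $ i \<in> S}"

definition mats :: "'a set \<Rightarrow> nat \<Rightarrow> nat \<Rightarrow> 'a mat set" where
  "mats S m n = {A \<in> carrier_mat m n. \<forall>i<m. \<forall>j<n. A $$ (i, j) \<in> S}"

lemma vecs_carrier: "v \<in> vecs S n \<Longrightarrow> v \<in> carrier_vec n"
  and vecs_dim: "v \<in> vecs S n \<Longrightarrow> dim_vec v = n"
  by (auto simp: vecs_def)

lemma mats_carrier: "A \<in> mats S m n \<Longrightarrow> A \<in> carrier_mat m n"
  and mats_index: "A \<in> mats S m n \<Longrightarrow> i < m \<Longrightarrow> j < n \<Longrightarrow> A $$ (i, j) \<in> S"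
  by (auto simp: mats_def)

lemma subfld_UNIV: "subfld UNIV"
  by (simp add: subfld_def)

lemma subfld_ring_UNIV: "subfld_ring UNIV = class_ring"
  by (simp add: subfld_ring_def)

lemma subfld_ring_simps [simp]:
  "carrier (subfld_ring S) = S" "mult (subfld_ring S) = (*)" "add (subfld_ring S) = (+)"
  "one (subfld_ring S) = 1" "zero (subfld_ring S) = 0"
  by (simp_all add: subfld_ring_def)

context
  fixes S :: "'a::field set"
  assumes S: "subfld S"
begin

lemma subfld_zero [simp]: "0 \<in> S"
  and subfld_one [simp]: "1 \<in> S"
  and subfld_add: "x \<in> S \<Longrightarrow> y \<in> S \<Longrightarrow> x + y \<in> S"
  and subfld_mult: "x \<in> S \<Longrightarrow> y \<in> S \<Longrightarrow> x * y \<in> S"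
  and subfld_minus: "x \<in> S \<Longrightarrow> - x \<in> S"
  and subfld_inverse: "x \<in> S \<Longrightarrow> inverse x \<in> S"
  using S by (auto simp: subfld_def)

lemma subfld_sum: "(\<And>x. x \<in> A \<Longrightarrow> f x \<in> S) \<Longrightarrow> sum f A \<in> S"
  by (induction A rule: infinite_finite_induct) (auto intro: subfld_add)

lemma subfld_prod: "(\<And>x. x \<in> A \<Longrightarrow> f x \<in> S) \<Longrightarrow> prod f A \<in> S"
  by (induction A rule: infinite_finite_induct) (auto intro: subfld_mult)

lemma field_subfld_ring: "field (subfld_ring S)"
proof -
  have "cring (subfld_ring S)"
    by (intro cringI abelian_groupI comm_monoidI)
      (auto simp: algebra_simps subfld_add subfld_mult intro!: bexI[of _ "- _"] subfld_minus)
  then show ?thesis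
  proof (rule cring.cring_fieldI2)
    fix a assume "a \<in> carrier (subfld_ring S)" "a \<noteq> \<zero>\<^bsub>subfld_ring S\<^esub>"
    then show "\<exists>b\<in>carrier (subfld_ring S). a \<otimes>\<^bsub>subfld_ring S\<^esub> b = \<one>\<^bsub>subfld_ring S\<^esub>"
      by (auto intro!: bexI[of _ "inverse a"] subfld_inverse)
  qed auto
qed

lemma vecs_zero: "0\<^sub>v n \<in> vecs S n"
  and vecs_add: "v \<in> vecs S n \<Longrightarrow> w \<in> vecs S n \<Longrightarrow> v + w \<in> vecs S n"
  and vecs_smult: "a \<in> S \<Longrightarrow> v \<in> vecs S n \<Longrightarrow> a \<cdot>\<^sub>v v \<in> vecs S n"
  and vecs_unit: "unit_vec n i \<in> vecs S n"
  by (auto simp: vecs_def subfld_add subfld_mult subfld_minus unit_vec_def)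

lemma mats_mult_vec: "A \<in> mats S m n \<Longrightarrow> v \<in> vecs S n \<Longrightarrow> A *\<^sub>v v \<in> vecs S m"
  by (auto simp: mats_def vecs_def scalar_prod_def intro!: subfld_sum subfld_mult)

lemma mats_mult: "A \<in> mats S m n \<Longrightarrow> B \<in> mats S n k \<Longrightarrow> A * B \<in> mats S m k"
  by (auto simp: mats_def scalar_prod_def intro!: subfld_sum subfld_mult)

lemma det_subfld: assumes "A \<in> mats S n n" shows "det A \<in> S"
proof -
  have "signof p \<in> S" for p :: "nat \<Rightarrow> nat"
    by (auto simp: sign_def subfld_minus)
  moreover have "p i < n" if "p permutes {0..<n}" "i < n" for p i
    using that by (metis atLeastLessThan_iff permutes_in_image zero_le)
  ultimately show ?thesis
    using assms unfolding mats_def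
    by (auto simp: det_def' intro!: subfld_sum subfld_mult subfld_prod)
qed

text \<open>Cramer's rule: the adjugate of \<open>P\<close> has entries in \<open>S\<close> and
  equals \<open>det P\<close> times \<open>Q\<close>. So an inverse found over the large field, such
  as the formal inverse of a convergent matrix, already lies over \<open>S\<close>.\<close>

lemma mats_inverse:
  assumes "P \<in> mats S n n" "Q \<in> carrier_mat n n" "P * Q = 1\<^sub>m n"
  shows "Q \<in> mats S n n"
proof -
  have Pc: "P \<in> carrier_mat n n" using assms(1) by (simp add: mats_def)
  have d: "det P \<noteq> 0"
    using det_mult[OF Pc assms(2)] assms(3) by auto
  have QP: "Q * P = 1\<^sub>m n" using mat_mult_left_right_inverse[OF Pc assms(2,3)] .
  have adj: "adj_mat P \<in> carrier_mat n n" "P * adj_mat P = det P \<cdot>\<^sub>m 1\<^sub>m n"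
    using adj_mat[OF Pc] by auto
  have "Q * (P * adj_mat P) = adj_mat P"
    using assoc_mult_mat[OF assms(2) Pc adj(1)] QP adj(1) by simp
  moreover have "Q * (det P \<cdot>\<^sub>m 1\<^sub>m n) = det P \<cdot>\<^sub>m Q"
    using mult_smult_distrib[OF assms(2) one_carrier_mat] right_mult_one_mat[OF assms(2)] by simp
  ultimately have eq: "adj_mat P = det P \<cdot>\<^sub>m Q" by (simp add: adj(2))
  have "adj_mat P \<in> mats S n n"
  proof -
    have "cofactor P i j \<in> S" if ij: "i < n" "j < n" for i j
    proof -
      have "mat_delete P i j \<in> mats S (n - 1) (n - 1)"
        using assms(1) ij by (auto simp: mats_def mat_delete_def)
      then have "det (mat_delete P i j) \<in> S" by (rule det_subfld)
      moreover have "(- 1 :: 'a) ^ k \<in> S" for k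
        by (induction k) (auto intro: subfld_mult subfld_minus)
      ultimately show ?thesis unfolding cofactor_def by (simp only: subfld_mult)
    qed
    then show ?thesis using Pc by (auto simp: mats_def adj_mat_def)
  qed
  moreover have "Q $$ (i, j) = inverse (det P) * adj_mat P $$ (i, j)" if "i < n" "j < n" for i j
    using that d assms(2) by (simp add: eq)
  moreover have "det P \<in> S" by (rule det_subfld[OF assms(1)])
  ultimately show ?thesis
    using assms(2) by (auto simp: mats_def intro!: subfld_mult subfld_inverse)
qed

lemma linear_vecs_matrix:
  assumes T: "\<And>v. v \<in> vecs S n \<Longrightarrow> T v \<in> vecs S m"
    and add: "\<And>v w. v \<in> vecs S n \<Longrightarrow> w \<in> vecs S n \<Longrightarrow> T (v + w) = T v + T w"
    and smult: "\<And>a v. a \<in> S \<Longrightarrow> v \<in> vecs S n \<Longrightarrow> T (a \<cdot>\<^sub>v v) = a \<cdot>\<^sub>v T v"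
  shows "\<exists>P\<in>mats S m n. \<forall>v\<in>vecs S n. T v = P *\<^sub>v v"
proof -
  define P where "P = mat m n (\<lambda>(i, j). T (unit_vec n j) $ i)"
  have P: "P \<in> mats S m n"
    using T[OF vecs_unit] by (auto simp: P_def mats_def vecs_def)
  have Pc: "P \<in> carrier_mat m n" using P by (simp add: mats_def)
  have Tu: "T (unit_vec n j) = P *\<^sub>v unit_vec n j" if "j < n" for j
    using that T[OF vecs_unit, of j] by (intro eq_vecI) (auto simp: P_def vecs_def)
  \<comment> \<open>Induction on the number \<open>l\<close> of leading coordinates that may be
    nonzero. That \<open>T\<close> vanishes at 0 is not assumed but follows from homogeneity with
    the scalar 0.\<close>
  have *: "\<forall>v\<in>vecs S n. (\<forall>i<n. i \<ge> l \<longrightarrow> v $ i = 0) \<longrightarrow> T v = P *\<^sub>v v" if "l \<le> n" for l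
    using that
  proof (induction l)
    case 0
    show ?case
    proof safe
      fix v assume v: "v \<in> vecs S n" "\<forall>i<n. 0 \<le> i \<longrightarrow> v $ i = 0"
      then have "v = 0 \<cdot>\<^sub>v v" by (intro eq_vecI) (auto simp: vecs_def)
      then have "T v = 0 \<cdot>\<^sub>v T v" using smult[of 0 v] v(1) by simp
      moreover have "0 \<cdot>\<^sub>v T v = 0\<^sub>v m" using T[OF v(1)] by (intro eq_vecI) (auto simp: vecs_def)
      ultimately have "T v = 0\<^sub>v m" by simp
      moreover have "v = 0\<^sub>v n" using v by (intro eq_vecI) (auto simp: vecs_def)
      ultimately show "T v = P *\<^sub>v v" using Pc by auto
    qed
  next
    case (Suc l)
    show ?case
    proof safe
      fix v assume v: "v \<in> vecs S n" "\<forall>i<n. Suc l \<le> i \<longrightarrow> v $ i = 0"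
      have l: "l < n" using Suc.prems by simp
      define w where "w = vec n (\<lambda>i. if i = l then 0 else v $ i)"
      have w: "w \<in> vecs S n" using v(1) by (auto simp: w_def vecs_def)
      have veq: "v = w + v $ l \<cdot>\<^sub>v unit_vec n l"
        using v(1) l by (intro eq_vecI) (auto simp: w_def vecs_def unit_vec_def)
      have vl: "v $ l \<in> S" using v(1) l by (auto simp: vecs_def)
      have "T w = P *\<^sub>v w"
        using Suc w v(2) l by (auto simp: w_def)
      moreover have "T v = T w + v $ l \<cdot>\<^sub>v T (unit_vec n l)"
        by (subst veq) (simp add: add w vecs_smult vl vecs_unit smult)
      moreover have "P *\<^sub>v v = P *\<^sub>v w + v $ l \<cdot>\<^sub>v (P *\<^sub>v unit_vec n l)"
        using w Pc unfolding vecs_def by (subst veq) (auto simp: mult_add_distrib_mat_vec mult_mat_vec)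
      ultimately show "T v = P *\<^sub>v v" using Tu[OF l] by simp
    qed
  qed
  show ?thesis using *[of n] P by auto
qed

lemma mats_eqI:
  assumes "P \<in> carrier_mat m n" "Q \<in> carrier_mat m n" "\<And>v. v \<in> vecs S n \<Longrightarrow> P *\<^sub>v v = Q *\<^sub>v v"
  shows "P = Q"
proof (rule eq_matI)
  fix i j assume ij: "i < dim_row Q" "j < dim_col Q"
  have "(P *\<^sub>v unit_vec n j) $ i = (Q *\<^sub>v unit_vec n j) $ i"
    using assms(3)[OF vecs_unit[of n j]] by simp
  moreover have "j < n" "i < m" using ij assms(2) by auto
  ultimately show "P $$ (i, j) = Q $$ (i, j)"
    using assms(1,2) by simp
qed (use assms in auto)

end

text \<open>Closure of the carrier and the value at zero are part of the notion, so that an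
  explicitly built structure is shown to be a vector space by exhibiting coordinates
  (\<open>coord_vectorspace\<close>). The operations are constrained on the carrier only.\<close>

definition coord :: "'a::field set \<Rightarrow> ('a, 'm, 'z) module_scheme \<Rightarrow> nat \<Rightarrow> ('m \<Rightarrow> 'a vec) \<Rightarrow> bool" where
  "coord S M n h \<longleftrightarrow> bij_betw h (carrier M) (vecs S n) \<and>
     (\<forall>x\<in>carrier M. \<forall>y\<in>carrier M. x \<oplus>\<^bsub>M\<^esub> y \<in> carrier M \<and> h (x \<oplus>\<^bsub>M\<^esub> y) = h x + h y) \<and>
     (\<forall>a\<in>S. \<forall>x\<in>carrier M. a \<odot>\<^bsub>M\<^esub> x \<in> carrier M \<and> h (a \<odot>\<^bsub>M\<^esub> x) = a \<cdot>\<^sub>v h x) \<and>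
     \<zero>\<^bsub>M\<^esub> \<in> carrier M \<and> h \<zero>\<^bsub>M\<^esub> = 0\<^sub>v n"

lemma coordD:
  assumes "coord S M n h"
  shows "bij_betw h (carrier M) (vecs S n)" "inj_on h (carrier M)"
    "x \<in> carrier M \<Longrightarrow> h x \<in> vecs S n"
    "x \<in> carrier M \<Longrightarrow> h x \<in> carrier_vec n"
    "x \<in> carrier M \<Longrightarrow> y \<in> carrier M \<Longrightarrow> x \<oplus>\<^bsub>M\<^esub> y \<in> carrier M"
    "x \<in> carrier M \<Longrightarrow> y \<in> carrier M \<Longrightarrow> h (x \<oplus>\<^bsub>M\<^esub> y) = h x + h y"
    "a \<in> S \<Longrightarrow> x \<in> carrier M \<Longrightarrow> a \<odot>\<^bsub>M\<^esub> x \<in> carrier M"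
    "a \<in> S \<Longrightarrow> x \<in> carrier M \<Longrightarrow> h (a \<odot>\<^bsub>M\<^esub> x) = a \<cdot>\<^sub>v h x"
    "\<zero>\<^bsub>M\<^esub> \<in> carrier M" "h \<zero>\<^bsub>M\<^esub> = 0\<^sub>v n"
  using assms by (auto simp: coord_def bij_betw_def vecs_def)

abbreviation cinv :: "('m \<Rightarrow> 'a vec) \<Rightarrow> ('a, 'm, 'z) module_scheme \<Rightarrow> 'a vec \<Rightarrow> 'm" where
  "cinv h M \<equiv> inv_into (carrier M) h"

lemma coord_cinv:
  assumes "coord S M n h"
  shows "v \<in> vecs S n \<Longrightarrow> cinv h M v \<in> carrier M" "v \<in> vecs S n \<Longrightarrow> h (cinv h M v) = v"
    "x \<in> carrier M \<Longrightarrow> cinv h M (h x) = x"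
  using coordD(1,2)[OF assms] by (auto simp: bij_betw_def inv_into_into f_inv_into_f)

lemma coord_eqI:
  "coord S M n h \<Longrightarrow> x \<in> carrier M \<Longrightarrow> y \<in> carrier M \<Longrightarrow> h x = h y \<Longrightarrow> x = y"
  by (meson coordD(2) inj_onD)

text \<open>Each axiom is an equation between elements of the carrier, and \<open>h\<close> is
  injective there, so the axioms are pulled back from coordinate vectors. Negatives come from the
  scalar -1.\<close>

lemma coord_vectorspace:
  assumes S: "subfld S" and c: "coord S M n h"
  shows "vectorspace (subfld_ring S) M"
proof -
  note D = coordD[OF c]
  note closed = D(5,7,9)
  note vc = D(4)
  have neg: "\<exists>n\<in>carrier M. v \<oplus>\<^bsub>M\<^esub> n = \<zero>\<^bsub>M\<^esub>" if v: "v \<in> carrier M" for v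
  proof
    have m: "- 1 \<in> S" using subfld_minus[OF S] subfld_one[OF S] by simp
    show w: "(- 1) \<odot>\<^bsub>M\<^esub> v \<in> carrier M" using D(7) m v by blast
    have "h (v \<oplus>\<^bsub>M\<^esub> ((- 1) \<odot>\<^bsub>M\<^esub> v)) = h \<zero>\<^bsub>M\<^esub>"
      using vc[OF v] by (simp add: D(6)[OF v w] D(8)[OF m v] D(10)) (auto intro!: eq_vecI)
    then show "v \<oplus>\<^bsub>M\<^esub> ((- 1) \<odot>\<^bsub>M\<^esub> v) = \<zero>\<^bsub>M\<^esub>"
      using coord_eqI[OF c] w v closed by blast
  qed
  have eq: "x = y" if "x \<in> carrier M" "y \<in> carrier M" "h x = h y" for x y
    using coord_eqI[OF c] that by blast
  show ?thesis
  proof (rule vs_criteria)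
    show "field (subfld_ring S)" by (rule field_subfld_ring[OF S])
    show "\<forall>v w. v \<in> carrier M \<and> w \<in> carrier M \<longrightarrow> v \<oplus>\<^bsub>M\<^esub> w = w \<oplus>\<^bsub>M\<^esub> v"
      by (intro allI impI eq) (auto intro!: closed comm_add_vec vc simp: D(6))
    show "\<forall>v w x. v \<in> carrier M \<and> w \<in> carrier M \<and> x \<in> carrier M \<longrightarrow>
        (v \<oplus>\<^bsub>M\<^esub> w) \<oplus>\<^bsub>M\<^esub> x = v \<oplus>\<^bsub>M\<^esub> (w \<oplus>\<^bsub>M\<^esub> x)"
      by (intro allI impI eq) (auto intro!: closed assoc_add_vec vc simp: D(6) closed)
    show "\<forall>v\<in>carrier M. v \<oplus>\<^bsub>M\<^esub> \<zero>\<^bsub>M\<^esub> = v"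
      by (intro ballI eq) (auto intro!: closed right_zero_vec vc simp: D(6,9,10))
    show "\<forall>a b v. a \<in> carrier (subfld_ring S) \<and> b \<in> carrier (subfld_ring S) \<and> v \<in> carrier M \<longrightarrow>
        (a \<otimes>\<^bsub>subfld_ring S\<^esub> b) \<odot>\<^bsub>M\<^esub> v = a \<odot>\<^bsub>M\<^esub> (b \<odot>\<^bsub>M\<^esub> v)"
      by (intro allI impI eq) (auto intro!: closed simp: D(8) closed subfld_mult[OF S] smult_smult_assoc)
    show "\<forall>v\<in>carrier M. \<one>\<^bsub>subfld_ring S\<^esub> \<odot>\<^bsub>M\<^esub> v = v"
      by (intro ballI eq) (auto intro!: closed simp: D(8) subfld_one[OF S])
    show "\<forall>a b v. a \<in> carrier (subfld_ring S) \<and> b \<in> carrier (subfld_ring S) \<and> v \<in> carrier M \<longrightarrow>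
        (a \<oplus>\<^bsub>subfld_ring S\<^esub> b) \<odot>\<^bsub>M\<^esub> v = (a \<odot>\<^bsub>M\<^esub> v) \<oplus>\<^bsub>M\<^esub> (b \<odot>\<^bsub>M\<^esub> v)"
      by (intro allI impI eq) (auto intro!: closed simp: D(6,8) closed subfld_add[OF S] add_smult_distrib_vec)
    show "\<forall>a v w. a \<in> carrier (subfld_ring S) \<and> v \<in> carrier M \<and> w \<in> carrier M \<longrightarrow>
        a \<odot>\<^bsub>M\<^esub> (v \<oplus>\<^bsub>M\<^esub> w) = (a \<odot>\<^bsub>M\<^esub> v) \<oplus>\<^bsub>M\<^esub> (a \<odot>\<^bsub>M\<^esub> w)"
      by (intro allI impI eq) (auto intro!: closed smult_add_distrib_vec vc simp: D(6,8) closed)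
  qed (use closed neg in auto)
qed

lemma coord_finsum:
  assumes S: "subfld S" and c: "coord S M n h" and finA: "finite A" and f: "f \<in> A \<rightarrow> carrier M" and i: "i < n"
  shows "h (finsum M f A) $ i = (\<Sum>a\<in>A. h (f a) $ i)"
proof -
  interpret vectorspace "subfld_ring S" M by (rule coord_vectorspace[OF S c])
  show ?thesis using finA f
  proof (induction A)
    case empty
    then show ?case using i by (simp add: coordD(10)[OF c])
  next
    case (insert a A)
    then have f: "f a \<in> carrier M" "f \<in> A \<rightarrow> carrier M" by auto
    then have fA: "finsum M f A \<in> carrier M" by (rule_tac finsum_closed)
    have "h (finsum M f (insert a A)) = h (f a) + h (finsum M f A)"
      using insert.hyps f by (simp add: finsum_insert coordD(6)[OF c _ fA])
    then show ?case
      using insert f i coordD(4)[OF c fA] coordD(4)[OF c f(1)] by simp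
  qed
qed

text \<open>Converts the number \<open>n\<close> of coordinates into the abstract dimension, which
  is the one that \<open>cyclic_presentation\<close> refers to.\<close>

lemma coord_basis:
  assumes S: "subfld S" and c: "coord S M n h"
  shows "vectorspace.basis (subfld_ring S) M ((\<lambda>i. cinv h M (unit_vec n i)) ` {..<n})"
    "card ((\<lambda>i. cinv h M (unit_vec n i)) ` {..<n}) = n"
proof -
  interpret vectorspace "subfld_ring S" M by (rule coord_vectorspace[OF S c])
  let ?b = "\<lambda>i. cinv h M (unit_vec n i)"
  have hb: "h (?b i) = unit_vec n i" and bM: "?b i \<in> carrier M" for i
    using coord_cinv[OF c] vecs_unit[OF S] by auto
  have inj: "inj_on ?b {..<n}"
  proof (rule inj_onI)
    fix i j assume ij: "i \<in> {..<n}" "j \<in> {..<n}" "?b i = ?b j"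
    then have "unit_vec n i = (unit_vec n j :: 'a vec)" using hb by metis
    then show "i = j" using ij by (simp add: unit_vec_eq)
  qed
  then show "card (?b ` {..<n}) = n" by (simp add: card_image)
  have co: "h (lincomb a (?b ` {..<n})) $ k = a (?b k)" if a: "a \<in> ?b ` {..<n} \<rightarrow> S" and k: "k < n" for a k
  proof -
    have "h (lincomb a (?b ` {..<n})) $ k = (\<Sum>w\<in>?b ` {..<n}. h (a w \<odot>\<^bsub>M\<^esub> w) $ k)"
      unfolding lincomb_def using a bM k by (intro coord_finsum[OF S c]) (auto intro!: coordD(7)[OF c])
    also have "\<dots> = (\<Sum>i<n. h (a (?b i) \<odot>\<^bsub>M\<^esub> ?b i) $ k)"
      using inj by (simp add: sum.reindex)
    also have "\<dots> = (\<Sum>i<n. if i = k then a (?b i) else 0)"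
    proof (intro sum.cong refl)
      fix i assume "i \<in> {..<n}"
      moreover from this have "a (?b i) \<in> S" using a by auto
      ultimately show "h (a (?b i) \<odot>\<^bsub>M\<^esub> ?b i) $ k = (if i = k then a (?b i) else 0)"
        using coordD(8)[OF c, of "a (?b i)" "?b i"] bM k by (simp add: hb)
    qed
    also have "\<dots> = a (?b k)" using k by simp
    finally show ?thesis .
  qed
  show "basis (?b ` {..<n})"
  proof (subst basis_criterion; (intro allI impI)?)
    fix v assume v: "v \<in> carrier M"
    define a where "a = restrict (\<lambda>w. h v $ inv_into {..<n} ?b w) (?b ` {..<n})"
    have ab: "a (?b i) = h v $ i" if "i < n" for i
      using that inv_into_f_f[OF inj, of i] by (simp add: a_def)
    have aS: "a \<in> ?b ` {..<n} \<rightarrow>\<^sub>E S"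
      using ab coordD(3)[OF c v] by (auto simp: a_def vecs_def)
    show "\<exists>!a. a \<in> ?b ` {..<n} \<rightarrow>\<^sub>E carrier (subfld_ring S) \<and> lincomb a (?b ` {..<n}) = v"
    proof (rule ex1I[of _ a])
      have L: "lincomb a (?b ` {..<n}) \<in> carrier M"
        using aS bM by (intro lincomb_closed) auto
      have "h (lincomb a (?b ` {..<n})) = h v"
        using coordD(4)[OF c L] coordD(4)[OF c v] co[of a] aS ab by (intro eq_vecI) (auto simp: PiE_def)
      then show "a \<in> ?b ` {..<n} \<rightarrow>\<^sub>E carrier (subfld_ring S) \<and> lincomb a (?b ` {..<n}) = v"
        using coord_eqI[OF c L v] aS by simp
    next
      fix a' assume a': "a' \<in> ?b ` {..<n} \<rightarrow>\<^sub>E carrier (subfld_ring S) \<and> lincomb a' (?b ` {..<n}) = v"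
      show "a' = a"
      proof (rule PiE_ext[of _ "?b ` {..<n}" "\<lambda>_. S"])
        fix w assume "w \<in> ?b ` {..<n}"
        then obtain i where "i < n" "w = ?b i" by auto
        then show "a' w = a w" using a' co[of a' i] ab by (auto simp: PiE_def)
      qed (use a' aS in auto)
    qed
  qed (use bM in auto)
qed

lemma coord_fin_dim:
  assumes S: "subfld S" and c: "coord S M n h"
  shows "vectorspace.fin_dim (subfld_ring S) M" "vectorspace.dim (subfld_ring S) M = n"
proof -
  interpret vectorspace "subfld_ring S" M by (rule coord_vectorspace[OF S c])
  note b = coord_basis[OF S c]
  show "fin_dim"
    unfolding fin_dim_def
    by (intro exI[of _ "(\<lambda>i. cinv h M (unit_vec n i)) ` {..<n}"]) (use b(1) in \<open>simp add: basis_def\<close>)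
  show "dim = n" using dim_basis[OF _ b(1)] b(2) by simp
qed

lemma coord_exists:
  assumes S: "subfld S" and V: "vectorspace (subfld_ring S) M"
    and fd: "vectorspace.fin_dim (subfld_ring S) M"
  shows "\<exists>n h. coord S M n h"
proof -
  interpret vectorspace "subfld_ring S" M by fact
  obtain B where B: "finite B" "basis B" using finite_basis_exists[OF fd] by blast
  have BM: "B \<subseteq> carrier M" using B(2) by (simp add: basis_def)
  define n where "n = card B"
  obtain e where e: "bij_betw e B {..<n}"
    using B(1) ex_bij_betw_finite_nat unfolding n_def by (metis atLeast0LessThan)
  \<comment> \<open>The inverse of the coordinate map is the easier one to write down:
    \<open>e\<close> numbers the basis, and \<open>g v\<close> is the combination with coefficients
    \<open>v\<close>.\<close>
  define g where "g v = lincomb (\<lambda>w. v $ e w) B" for v :: "'a vec"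
  have eB: "e w < n" if "w \<in> B" for w using e that by (auto simp: bij_betw_def)
  have vB: "(\<lambda>w. v $ e w) \<in> B \<rightarrow> S" if "v \<in> vecs S n" for v
    using that eB by (auto simp: vecs_def)
  have gM: "g v \<in> carrier M" if "v \<in> vecs S n" for v
    unfolding g_def using vB[OF that] BM by (intro lincomb_closed) auto
  have gadd: "g (v + w) = g v \<oplus>\<^bsub>M\<^esub> g w" if "v \<in> vecs S n" "w \<in> vecs S n" for v w
  proof -
    have "g (v + w) = lincomb (\<lambda>u. v $ e u \<oplus>\<^bsub>subfld_ring S\<^esub> w $ e u) B"
      unfolding g_def using that eB vecs_add[OF S that] BM
      by (intro lincomb_cong) (auto simp: vecs_def subfld_add[OF S])
    also have "\<dots> = g v \<oplus>\<^bsub>M\<^esub> g w"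
      unfolding g_def using vB that B(1) BM by (intro lincomb_sum) auto
    finally show ?thesis .
  qed
  have gsm: "g (a \<cdot>\<^sub>v v) = a \<odot>\<^bsub>M\<^esub> g v" if "a \<in> S" "v \<in> vecs S n" for a v
  proof -
    have "g (a \<cdot>\<^sub>v v) = lincomb (\<lambda>u. a \<otimes>\<^bsub>subfld_ring S\<^esub> v $ e u) B"
      unfolding g_def using that eB BM
      by (intro lincomb_cong) (auto simp: vecs_def subfld_mult[OF S])
    also have "\<dots> = a \<odot>\<^bsub>M\<^esub> g v"
      unfolding g_def using vB that BM by (intro lincomb_smult) auto
    finally show ?thesis .
  qed
  have g0: "g (0\<^sub>v n) = \<zero>\<^bsub>M\<^esub>"
  proof -
    have "g (0\<^sub>v n) = g (0 \<cdot>\<^sub>v 0\<^sub>v n)" by (intro arg_cong[of _ _ g] eq_vecI) auto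
    also have "\<dots> = 0 \<odot>\<^bsub>M\<^esub> g (0\<^sub>v n)" by (rule gsm) (auto simp: vecs_zero[OF S] subfld_zero[OF S])
    also have "\<dots> = \<zero>\<^bsub>M\<^esub>" using smult_l_null[OF gM[OF vecs_zero[OF S]]] by simp
    finally show ?thesis .
  qed
  have bij: "bij_betw g (vecs S n) (carrier M)"
  proof (rule bij_betwI')
    fix v w assume v: "v \<in> vecs S n" and w: "w \<in> vecs S n"
    show "g v = g w \<longleftrightarrow> v = w"
    proof
      assume eq: "g v = g w"
      have "\<exists>!a. a \<in> B \<rightarrow>\<^sub>E carrier (subfld_ring S) \<and> lincomb a B = g v"
        using B(2) gM[OF v] by (subst (asm) basis_criterion) (use B(1) BM in auto)
      moreover have "restrict (\<lambda>u. x $ e u) B \<in> B \<rightarrow>\<^sub>E carrier (subfld_ring S)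
           \<and> lincomb (restrict (\<lambda>u. x $ e u) B) B = g x"
        if "x \<in> vecs S n" for x
        using vB[OF that] BM unfolding g_def by (auto intro!: lincomb_cong)
      ultimately have r: "restrict (\<lambda>u. v $ e u) B = restrict (\<lambda>u. w $ e u) B"
        using v w eq by metis
      show "v = w"
      proof (rule eq_vecI)
        fix i assume "i < dim_vec w"
        then have "i \<in> e ` B" using e w by (auto simp: bij_betw_def vecs_def)
        then obtain u where u: "u \<in> B" "i = e u" by blast
        have "restrict (\<lambda>u. v $ e u) B u = restrict (\<lambda>u. w $ e u) B u" using r by simp
        then show "v $ i = w $ i" using u by simp
      qed (use v w in \<open>auto simp: vecs_def\<close>)
    qed simp
  next
    fix m assume m: "m \<in> carrier M"
    have "\<exists>!a. a \<in> B \<rightarrow>\<^sub>E carrier (subfld_ring S) \<and> lincomb a B = m"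
      using B(2) m by (subst (asm) basis_criterion) (use B(1) BM in auto)
    then obtain a where a: "a \<in> B \<rightarrow>\<^sub>E S" "lincomb a B = m" by auto
    define v where "v = vec n (\<lambda>i. a (inv_into B e i))"
    have "v \<in> vecs S n"
      using a(1) e by (auto simp: v_def vecs_def bij_betw_def intro!: PiE_mem[OF a(1)] inv_into_into)
    moreover have "g v = m"
      unfolding g_def a(2)[symmetric] v_def using BM a(1) e eB
      by (intro lincomb_cong) (auto simp: bij_betw_def PiE_def)
    ultimately show "\<exists>v\<in>vecs S n. m = g v" by blast
  qed (rule gM)
  define h where "h = inv_into (vecs S n) g"
  have hg: "h (g v) = v" if "v \<in> vecs S n" for v
    using bij that by (simp add: h_def bij_betw_def inv_into_f_f)
  have gh: "g (h x) = x" "h x \<in> vecs S n" if "x \<in> carrier M" for x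
    using bij that by (auto simp: h_def bij_betw_def f_inv_into_f inv_into_into)
  have "coord S M n h"
    unfolding coord_def
  proof (intro conjI ballI)
    show "bij_betw h (carrier M) (vecs S n)" unfolding h_def by (rule bij_betw_inv_into[OF bij])
    fix x y assume "x \<in> carrier M" "y \<in> carrier M"
    then show "h (x \<oplus>\<^bsub>M\<^esub> y) = h x + h y"
      using gadd[of "h x" "h y"] gh hg vecs_add[OF S] by metis
  next
    fix a x assume "a \<in> S" "x \<in> carrier M"
    then show "h (a \<odot>\<^bsub>M\<^esub> x) = a \<cdot>\<^sub>v h x"
      using gsm[of a "h x"] gh hg vecs_smult[OF S] by metis
  next
    show "h \<zero>\<^bsub>M\<^esub> = 0\<^sub>v n" using g0 hg vecs_zero[OF S] by metis
  qed auto
  then show ?thesis by blast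
qed

lemma coord_hom_matrix:
  assumes S: "subfld S" and c: "coord S M n h" and d: "coord S N m k"
    and f: "f \<in> module_hom (subfld_ring S) M N"
  shows "\<exists>P\<in>mats S m n. \<forall>x\<in>carrier M. k (f x) = P *\<^sub>v h x"
proof -
  have fM: "f x \<in> carrier N" if "x \<in> carrier M" for x
    using f that by (auto simp: module_hom_def)
  have cc: "cinv h M (v + w) = cinv h M v \<oplus>\<^bsub>M\<^esub> cinv h M w" if "v \<in> vecs S n" "w \<in> vecs S n" for v w
    using that by (intro coord_eqI[OF c]) (auto simp: coord_cinv[OF c] vecs_add[OF S] coordD(5,6)[OF c])
  have cs: "cinv h M (a \<cdot>\<^sub>v v) = a \<odot>\<^bsub>M\<^esub> cinv h M v" if "a \<in> S" "v \<in> vecs S n" for a v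
    using that by (intro coord_eqI[OF c]) (auto simp: coord_cinv[OF c] vecs_smult[OF S] coordD(7,8)[OF c])
  have "\<exists>P\<in>mats S m n. \<forall>v\<in>vecs S n. k (f (cinv h M v)) = P *\<^sub>v v"
  proof (rule linear_vecs_matrix[OF S])
    fix v w assume "v \<in> vecs S n" "w \<in> vecs S n"
    then show "k (f (cinv h M (v + w))) = k (f (cinv h M v)) + k (f (cinv h M w))"
      using f by (simp add: cc module_hom_add coord_cinv[OF c] coordD(6)[OF d] fM)
  next
    fix a v assume "a \<in> S" "v \<in> vecs S n"
    then show "k (f (cinv h M (a \<cdot>\<^sub>v v))) = a \<cdot>\<^sub>v k (f (cinv h M v))"
      using f by (simp add: cs module_hom_smult coord_cinv[OF c] coordD(8)[OF d] fM)
  qed (auto intro!: coordD(3)[OF d] fM coord_cinv[OF c])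
  then obtain P where P: "P \<in> mats S m n" "\<forall>v\<in>vecs S n. k (f (cinv h M v)) = P *\<^sub>v v" by blast
  show ?thesis
  proof (intro bexI[OF _ P(1)] ballI)
    fix x assume "x \<in> carrier M"
    then show "k (f x) = P *\<^sub>v h x"
      using P(2)[rule_format, OF coordD(3)[OF c]] by (simp add: coord_cinv[OF c])
  qed
qed

lemma matrix_coord_hom:
  assumes S: "subfld S" and c: "coord S M n h" and d: "coord S N m k" and P: "P \<in> mats S m n"
  shows "(\<lambda>x\<in>carrier M. cinv k N (P *\<^sub>v h x)) \<in> module_hom (subfld_ring S) M N"
    "x \<in> carrier M \<Longrightarrow> k (cinv k N (P *\<^sub>v h x)) = P *\<^sub>v h x"
    "x \<in> carrier M \<Longrightarrow> cinv k N (P *\<^sub>v h x) \<in> carrier N"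
proof -
  have PV: "P *\<^sub>v h x \<in> vecs S m" if "x \<in> carrier M" for x
    by (rule mats_mult_vec[OF S P coordD(3)[OF c that]])
  show *: "x \<in> carrier M \<Longrightarrow> k (cinv k N (P *\<^sub>v h x)) = P *\<^sub>v h x" for x
    by (rule coord_cinv(2)[OF d PV])
  show **: "x \<in> carrier M \<Longrightarrow> cinv k N (P *\<^sub>v h x) \<in> carrier N" for x
    by (rule coord_cinv(1)[OF d PV])
  have Pc: "P \<in> carrier_mat m n" using P by (simp add: mats_def)
  show "(\<lambda>x\<in>carrier M. cinv k N (P *\<^sub>v h x)) \<in> module_hom (subfld_ring S) M N"
    unfolding module_hom_def
    using coordD(4)[OF c] Pc
    by (auto simp: ** coordD(5,7)[OF c] intro!: coord_eqI[OF d])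
      (auto simp: ** * coordD(5-8)[OF d] coordD(5-8)[OF c] mult_add_distrib_mat_vec mult_mat_vec
        coord_cinv(2)[OF d] vecs_add[OF S] vecs_smult[OF S] PV)
qed

section \<open>The automorphism \<open>\<sigma>\<^sub>q\<close> and matrices of \<open>q\<close>-difference modules\<close>

lemma sigma_q_nth: "q \<noteq> 0 \<Longrightarrow> fls_nth (sigma_q q f) n = q powi n * fls_nth f n"
  by (simp add: sigma_q_def fls_nth_fls_compose_fps_linear)

lemma sigma_q_0 [simp]: "sigma_q q 0 = 0"
  by (simp add: sigma_q_def)

lemma sigma_q_1 [simp]: "sigma_q q 1 = 1"
  by (simp add: sigma_q_def)

lemma sigma_q_inverse:
  assumes "q \<noteq> 0"
  shows "sigma_q q (sigma_q (inverse q) f) = f" "sigma_q (inverse q) (sigma_q q f) = f"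
  using assms by (auto intro!: fls_eqI simp: sigma_q_nth power_int_inverse)

lemma sigma_q_mult: "q \<noteq> 0 \<Longrightarrow> sigma_q q (f * g) = sigma_q q f * sigma_q q g"
  unfolding sigma_q_def by (rule fls_compose_fps_mult) auto

lemma sigma_q_hom: "q \<noteq> 0 \<Longrightarrow> semiring_hom (sigma_q q)"
  by unfold_locales
    (auto simp: sigma_q_def fls_compose_fps_mult fls_compose_fps_add)

lemma sigma_q_add: "q \<noteq> 0 \<Longrightarrow> sigma_q q (f + g) = sigma_q q f + sigma_q q g"
  unfolding sigma_q_def by (rule fls_compose_fps_add) auto

lemma sigma_q_sum: "q \<noteq> 0 \<Longrightarrow> sigma_q q (sum f A) = (\<Sum>x\<in>A. sigma_q q (f x))"
  by (induction A rule: infinite_finite_induct) (auto simp: sigma_q_add)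

section \<open>Convergent Laurent series and presentations by matrices\<close>

definition conv_fls :: "complex fls set" where
  "conv_fls = {f. fls_conv_radius f > 0}"

lemma K_conv_eq: "K_conv = subfld_ring conv_fls"
  by (simp add: K_conv_def subfld_ring_def conv_fls_def)

lemma subfld_conv_fls: "subfld conv_fls"
  unfolding subfld_def conv_fls_def
proof (intro conjI ballI; clarify?)
  fix f g :: "complex fls" assume "fls_conv_radius f > 0" "fls_conv_radius g > 0"
  then show "fls_conv_radius (f + g) > 0" "fls_conv_radius (f * g) > 0"
    using less_le_trans[OF _ fls_conv_radius_add, of 0 f g] less_le_trans[OF _ fls_conv_radius_mult, of 0 f g]
    by auto
next
  \<comment> \<open>Convergence of the inverse comes from function theory: the reciprocal of a
    meromorphic germ has a Laurent expansion, and this expansion is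
    \<open>inverse f\<close>.\<close>
  fix f :: "complex fls" assume f: "fls_conv_radius f > 0"
  have "eval_fls f has_laurent_expansion f"
    using f by (simp add: has_laurent_expansion_def)
  then have "(\<lambda>x. inverse (eval_fls f x)) has_laurent_expansion inverse f"
    by (rule has_laurent_expansion_inverse)
  then show "fls_conv_radius (inverse f) > 0" by (simp add: has_laurent_expansion_def)
qed auto

text \<open>On the unit circle \<open>sigma_q\<close> changes only the arguments of the
  coefficients, hence not the radius of convergence.\<close>

lemma sigma_q_conv_fls:
  assumes "norm q = 1" "f \<in> conv_fls" shows "sigma_q q f \<in> conv_fls"
proof -
  have q: "q \<noteq> 0" using assms(1) by auto
  have "conv_radius (\<lambda>n. norm (fls_nth (sigma_q q f) (int n))) = conv_radius (\<lambda>n. norm (fls_nth f (int n)))"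
    using assms(1) q by (simp add: sigma_q_nth norm_mult norm_power)
  then have "fls_conv_radius (sigma_q q f) = fls_conv_radius f"
    by (simp add: fls_conv_radius_def fps_conv_radius_def)
  then show ?thesis using assms(2) by (simp add: conv_fls_def)
qed

text \<open>Stability under \<open>sigma_q\<close> and its inverse makes \<open>sigv q\<close> a
  bijection of \<open>vecs S n\<close>, which allows passing between semilinear and linear
  maps.\<close>

definition qfield :: "complex \<Rightarrow> complex fls set \<Rightarrow> bool" where
  "qfield q S \<longleftrightarrow> q \<noteq> 0 \<and> subfld S \<and> (\<forall>f\<in>S. sigma_q q f \<in> S \<and> sigma_q (inverse q) f \<in> S)"

lemma qfield_conv: "norm q = 1 \<Longrightarrow> qfield q conv_fls"
  unfolding qfield_def using subfld_conv_fls sigma_q_conv_fls[of q] sigma_q_conv_fls[of "inverse q"]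
  by (auto simp: norm_inverse)

lemma qfield_UNIV: "norm q = 1 \<Longrightarrow> qfield q UNIV"
  unfolding qfield_def using subfld_UNIV by auto

abbreviation sigv :: "complex \<Rightarrow> complex fls vec \<Rightarrow> complex fls vec" where
  "sigv q \<equiv> map_vec (sigma_q q)"

abbreviation sigm :: "complex \<Rightarrow> complex fls mat \<Rightarrow> complex fls mat" where
  "sigm q \<equiv> map_mat (sigma_q q)"

definition inv_mats :: "'a::field set \<Rightarrow> nat \<Rightarrow> 'a mat set" where
  "inv_mats S n = {A \<in> mats S n n. \<exists>B\<in>mats S n n. A * B = 1\<^sub>m n \<and> B * A = 1\<^sub>m n}"

text \<open>Column j of \<open>A\<close> holds the coordinates of the image under \<open>Sig\<close>
  of the j-th basis vector; the unit vectors are fixed by \<open>sigv q\<close>.\<close>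

definition pres :: "complex fls set \<Rightarrow> complex \<Rightarrow> ('m, 'z) qmod_scheme \<Rightarrow> nat \<Rightarrow> complex fls mat \<Rightarrow>
    ('m \<Rightarrow> complex fls vec) \<Rightarrow> bool" where
  "pres S q M n A h \<longleftrightarrow> coord S M n h \<and> A \<in> inv_mats S n \<and>
     (\<forall>x\<in>carrier M. Sig M x \<in> carrier M \<and> h (Sig M x) = A *\<^sub>v sigv q (h x))"

lemma inv_mats_mats: "A \<in> inv_mats S n \<Longrightarrow> A \<in> mats S n n"
  and inv_mats_carrier: "A \<in> inv_mats S n \<Longrightarrow> A \<in> carrier_mat n n"
  by (auto simp: inv_mats_def mats_def)

lemma sigv_vecs: "qfield q S \<Longrightarrow> v \<in> vecs S n \<Longrightarrow> sigv q v \<in> vecs S n"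
  and sigv_inverse_vecs: "qfield q S \<Longrightarrow> v \<in> vecs S n \<Longrightarrow> sigv (inverse q) v \<in> vecs S n"
  and sigm_mats: "qfield q S \<Longrightarrow> P \<in> mats S m n \<Longrightarrow> sigm q P \<in> mats S m n"
  by (auto simp: qfield_def vecs_def mats_def)

lemma sigv_sigv_inverse:
  "q \<noteq> 0 \<Longrightarrow> sigv q (sigv (inverse q) v) = v" "q \<noteq> 0 \<Longrightarrow> sigv (inverse q) (sigv q v) = v"
  by (auto intro!: eq_vecI simp: sigma_q_inverse)

lemma sigv_add: "q \<noteq> 0 \<Longrightarrow> v \<in> carrier_vec n \<Longrightarrow> w \<in> carrier_vec n \<Longrightarrow> sigv q (v + w) = sigv q v + sigv q w"
  by (intro eq_vecI) (auto simp: sigma_q_add)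

lemma sigv_smult: "q \<noteq> 0 \<Longrightarrow> sigv q (a \<cdot>\<^sub>v v) = sigma_q q a \<cdot>\<^sub>v sigv q v"
  by (intro eq_vecI) (auto simp: sigma_q_mult)

lemma sigm_mult:
  "q \<noteq> 0 \<Longrightarrow> A \<in> carrier_mat m n \<Longrightarrow> B \<in> carrier_mat n k \<Longrightarrow> sigm q (A * B) = sigm q A * sigm q B"
  by (rule semiring_hom.mat_hom_mult[OF sigma_q_hom])

lemma sigv_mult_vec:
  "q \<noteq> 0 \<Longrightarrow> A \<in> carrier_mat m n \<Longrightarrow> v \<in> carrier_vec n \<Longrightarrow> sigv q (A *\<^sub>v v) = sigm q A *\<^sub>v sigv q v"
  by (rule semiring_hom.mult_mat_vec_hom[OF sigma_q_hom])

lemma sigm_one: "q \<noteq> 0 \<Longrightarrow> sigm q (1\<^sub>m n) = 1\<^sub>m n"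
  by (rule semiring_hom.mat_hom_one[OF sigma_q_hom])

lemma pres_exists:
  assumes Q: "qfield q S" and M: "q_difference_module (subfld_ring S) q M"
  shows "\<exists>n A h. pres S q M n A h"
proof -
  have S: "subfld S" and q: "q \<noteq> 0" using Q by (auto simp: qfield_def)
  have V: "vectorspace (subfld_ring S) M" "vectorspace.fin_dim (subfld_ring S) M"
    and bij: "bij_betw (Sig M) (carrier M) (carrier M)"
    and add: "\<And>m n. m \<in> carrier M \<Longrightarrow> n \<in> carrier M \<Longrightarrow> Sig M (m \<oplus>\<^bsub>M\<^esub> n) = Sig M m \<oplus>\<^bsub>M\<^esub> Sig M n"
    and smult: "\<And>f m. f \<in> S \<Longrightarrow> m \<in> carrier M \<Longrightarrow> Sig M (f \<odot>\<^bsub>M\<^esub> m) = sigma_q q f \<odot>\<^bsub>M\<^esub> Sig M m"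
    using M by (auto simp: q_difference_module_def)
  obtain n h where c: "coord S M n h" using coord_exists[OF S V] by blast
  have SM: "Sig M x \<in> carrier M" if "x \<in> carrier M" for x using bij that by (auto simp: bij_betw_def)
  \<comment> \<open>\<open>Sig\<close> is only semilinear. Undoing \<open>sigma_q\<close> on the
    coordinates first gives a linear map \<open>T\<close>, whose matrix will be \<open>A\<close>;
    \<open>U\<close> is its inverse and shows that \<open>A\<close> is invertible over
    \<open>S\<close>.\<close>
  define T where "T v = h (Sig M (cinv h M (sigv (inverse q) v)))" for v
  define U where "U v = sigv q (h (inv_into (carrier M) (Sig M) (cinv h M v)))" for v
  have cM: "cinv h M (sigv (inverse q) v) \<in> carrier M" if "v \<in> vecs S n" for v
    by (rule coord_cinv(1)[OF c sigv_inverse_vecs[OF Q that]])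
  have iq: "inverse q \<noteq> 0" using q by simp
  have si: "sigma_q (inverse q) a \<in> S" if "a \<in> S" for a using Q that by (simp add: qfield_def)
  have TU: "T (U v) = v" if "v \<in> vecs S n" for v
  proof -
    let ?x = "inv_into (carrier M) (Sig M) (cinv h M v)"
    have x: "?x \<in> carrier M" "Sig M ?x = cinv h M v"
      using bij coord_cinv(1)[OF c that] by (auto simp: bij_betw_def inv_into_into f_inv_into_f)
    show ?thesis unfolding T_def U_def sigv_sigv_inverse(2)[OF q]
      using x coord_cinv[OF c] that by simp
  qed
  have UT: "U (T v) = v" if "v \<in> vecs S n" for v
  proof -
    let ?y = "cinv h M (sigv (inverse q) v)"
    have "inv_into (carrier M) (Sig M) (Sig M ?y) = ?y"
      using bij cM[OF that] by (auto simp: bij_betw_def inv_into_f_f)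
    then show ?thesis unfolding T_def U_def
      using coord_cinv[OF c] cM[OF that] SM sigv_inverse_vecs[OF Q that] sigv_sigv_inverse(1)[OF q] by simp
  qed
  have TV: "T v \<in> vecs S n" if "v \<in> vecs S n" for v
    unfolding T_def by (intro coordD(3)[OF c] SM cM that)
  have UV: "U v \<in> vecs S n" if "v \<in> vecs S n" for v
    unfolding U_def using bij coord_cinv(1)[OF c that]
    by (intro sigv_vecs[OF Q] coordD(3)[OF c]) (auto simp: bij_betw_def inv_into_into)
  have Tadd: "T (v + w) = T v + T w" if "v \<in> vecs S n" "w \<in> vecs S n" for v w
  proof -
    have "cinv h M (sigv (inverse q) (v + w)) = cinv h M (sigv (inverse q) v) \<oplus>\<^bsub>M\<^esub> cinv h M (sigv (inverse q) w)"
      using that vecs_carrier[OF that(1)] vecs_carrier[OF that(2)]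
      by (intro coord_eqI[OF c])
        (auto simp: coordD(5,6)[OF c] coord_cinv[OF c] sigv_inverse_vecs[OF Q] vecs_add[OF S] sigv_add[OF iq, of _ n])
    then show ?thesis unfolding T_def using that by (simp add: add cM SM coordD(6)[OF c])
  qed
  have Tsm: "T (a \<cdot>\<^sub>v v) = a \<cdot>\<^sub>v T v" if "a \<in> S" "v \<in> vecs S n" for a v
  proof -
    have "cinv h M (sigv (inverse q) (a \<cdot>\<^sub>v v)) = sigma_q (inverse q) a \<odot>\<^bsub>M\<^esub> cinv h M (sigv (inverse q) v)"
      using that si[OF that(1)]
      by (intro coord_eqI[OF c])
        (auto simp: coordD(7,8)[OF c] coord_cinv[OF c] sigv_inverse_vecs[OF Q] vecs_smult[OF S] sigv_smult[OF iq])
    then show ?thesis unfolding T_def using that si[OF that(1)]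
      by (simp add: smult cM SM coordD(8)[OF c] sigma_q_inverse[OF q])
  qed
  have Uadd: "U (v + w) = U v + U w" if "v \<in> vecs S n" "w \<in> vecs S n" for v w
    using that UT[OF vecs_add[OF S], OF UV UV, of v w] Tadd[OF UV UV, of v w] TU by simp
  have Usm: "U (a \<cdot>\<^sub>v v) = a \<cdot>\<^sub>v U v" if "a \<in> S" "v \<in> vecs S n" for a v
    using that UT[OF vecs_smult[OF S], OF that(1) UV, of v] Tsm[OF that(1) UV, of v] TU by simp
  obtain A where A: "A \<in> mats S n n" "\<forall>v\<in>vecs S n. T v = A *\<^sub>v v"
    using linear_vecs_matrix[OF S TV Tadd Tsm] by blast
  obtain B where B: "B \<in> mats S n n" "\<forall>v\<in>vecs S n. U v = B *\<^sub>v v"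
    using linear_vecs_matrix[OF S UV Uadd Usm] by blast
  have AB: "A * B = 1\<^sub>m n"
    using A(2) B(2) TU UV mats_carrier[OF A(1)] mats_carrier[OF B(1)]
    by (intro mats_eqI[OF S, of _ n n])
      (auto simp: assoc_mult_mat_vec[OF mats_carrier[OF A(1)] mats_carrier[OF B(1)] vecs_carrier] dest: vecs_carrier)
  have BA: "B * A = 1\<^sub>m n"
    using A(2) B(2) UT TV mats_carrier[OF A(1)] mats_carrier[OF B(1)]
    by (intro mats_eqI[OF S, of _ n n])
      (auto simp: assoc_mult_mat_vec[OF mats_carrier[OF B(1)] mats_carrier[OF A(1)] vecs_carrier] dest: vecs_carrier)
  have "h (Sig M x) = A *\<^sub>v sigv q (h x)" if x: "x \<in> carrier M" for x
  proof -
    have "T (sigv q (h x)) = h (Sig M x)"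
      unfolding T_def sigv_sigv_inverse(2)[OF q] using coord_cinv(3)[OF c x] by simp
    then show ?thesis using A(2) sigv_vecs[OF Q coordD(3)[OF c x]] by auto
  qed
  then have "pres S q M n A h"
    unfolding pres_def inv_mats_def using c A B AB BA SM by blast
  then show ?thesis by blast
qed

lemma pres_qmod:
  assumes Q: "qfield q S" and P: "pres S q M n A h"
  shows "q_difference_module (subfld_ring S) q M"
proof -
  have S: "subfld S" and q: "q \<noteq> 0" using Q by (auto simp: qfield_def)
  have c: "coord S M n h" and SM: "\<And>x. x \<in> carrier M \<Longrightarrow> Sig M x \<in> carrier M"
    and hS: "\<And>x. x \<in> carrier M \<Longrightarrow> h (Sig M x) = A *\<^sub>v sigv q (h x)"
    and "A \<in> inv_mats S n"
    using P by (auto simp: pres_def)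
  then obtain B where AB: "A \<in> mats S n n" "B \<in> mats S n n" "A * B = 1\<^sub>m n" "B * A = 1\<^sub>m n"
    by (auto simp: inv_mats_def)
  note Ac = mats_carrier[OF AB(1)] note Bc = mats_carrier[OF AB(2)]
  have hc: "sigv q (h x) \<in> carrier_vec n" if "x \<in> carrier M" for x
    using coordD(4)[OF c that] by simp
  have sS: "sigma_q q f \<in> S" if "f \<in> S" for f using Q that by (simp add: qfield_def)
  show ?thesis
    unfolding q_difference_module_def
  proof (intro conjI ballI)
    show "vectorspace (subfld_ring S) M" "vectorspace.fin_dim (subfld_ring S) M"
      by (rule coord_vectorspace[OF S c], rule coord_fin_dim[OF S c])
    show "bij_betw (Sig M) (carrier M) (carrier M)"
    proof (rule bij_betwI')
      fix x y assume x: "x \<in> carrier M" and y: "y \<in> carrier M"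
      show "Sig M x = Sig M y \<longleftrightarrow> x = y"
      proof
        assume "Sig M x = Sig M y"
        then have "B *\<^sub>v (A *\<^sub>v sigv q (h x)) = B *\<^sub>v (A *\<^sub>v sigv q (h y))"
          using hS x y by metis
        then have "sigv q (h x) = sigv q (h y)"
          using assoc_mult_mat_vec[OF Bc Ac hc[OF x]] assoc_mult_mat_vec[OF Bc Ac hc[OF y]] hc x y
          by (simp add: AB)
        then have "h x = h y" using sigv_sigv_inverse(2)[OF q] by metis
        then show "x = y" using coord_eqI[OF c x y] by simp
      qed simp
    next
      fix y assume y: "y \<in> carrier M"
      \<comment> \<open>The preimage of \<open>y\<close> in coordinates, that is, the solution
        \<open>v\<close> of \<open>A *\<^sub>v sigv q v = h y\<close>.\<close>
      define v where "v = sigv (inverse q) (B *\<^sub>v h y)"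
      have v: "v \<in> vecs S n"
        unfolding v_def by (intro sigv_inverse_vecs[OF Q] mats_mult_vec[OF S AB(2)] coordD(3)[OF c y])
      have "h (Sig M (cinv h M v)) = A *\<^sub>v (B *\<^sub>v h y)"
        using hS coord_cinv(1,2)[OF c v] by (simp add: v_def sigv_sigv_inverse(1)[OF q])
      also have "\<dots> = h y" using assoc_mult_mat_vec[OF Ac Bc coordD(4)[OF c y]] coordD(4)[OF c y] by (simp add: AB)
      finally show "\<exists>x\<in>carrier M. y = Sig M x"
        using coord_eqI[OF c y SM] coord_cinv(1)[OF c v] by metis
    qed (rule SM)
  next
    fix x y assume xy: "x \<in> carrier M" "y \<in> carrier M"
    then show "Sig M (x \<oplus>\<^bsub>M\<^esub> y) = Sig M x \<oplus>\<^bsub>M\<^esub> Sig M y"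
      using coordD(4)[OF c] hc
      by (intro coord_eqI[OF c])
        (auto simp: SM hS coordD(5,6)[OF c] sigv_add[OF q, of _ n] mult_add_distrib_mat_vec[OF Ac])
  next
    fix f x assume xy: "f \<in> carrier (subfld_ring S)" "x \<in> carrier M"
    then show "Sig M (f \<odot>\<^bsub>M\<^esub> x) = sigma_q q f \<odot>\<^bsub>M\<^esub> Sig M x"
      using coordD(4)[OF c] hc
      by (intro coord_eqI[OF c])
        (auto simp: SM hS sS coordD(7,8)[OF c] sigv_smult[OF q] mult_mat_vec[OF Ac])
  qed
qed

lemma qmod_hom_matrix:
  assumes Q: "qfield q S" and M: "pres S q M n A h" and N: "pres S q N m B k"
    and f: "f \<in> qmod_hom (subfld_ring S) M N"
  shows "\<exists>P\<in>mats S m n. P * A = B * sigm q P \<and> (\<forall>x\<in>carrier M. k (f x) = P *\<^sub>v h x)"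
proof -
  have S: "subfld S" and q: "q \<noteq> 0" using Q by (auto simp: qfield_def)
  have c: "coord S M n h" and d: "coord S N m k" and AB: "A \<in> mats S n n" "B \<in> mats S m m"
    using M N by (auto simp: pres_def inv_mats_def)
  note Ac = mats_carrier[OF AB(1)] note Bc = mats_carrier[OF AB(2)]
  have fm: "f \<in> module_hom (subfld_ring S) M N" and fS: "\<And>x. x \<in> carrier M \<Longrightarrow> f (Sig M x) = Sig N (f x)"
    using f by (auto simp: qmod_hom_def)
  obtain P where P: "P \<in> mats S m n" "\<forall>x\<in>carrier M. k (f x) = P *\<^sub>v h x"
    using coord_hom_matrix[OF S c d fm] by blast
  note Pc = mats_carrier[OF P(1)]
  have "P * A = B * sigm q P"
  proof (rule mats_eqI[OF S, of _ m n])
    fix v assume v: "v \<in> vecs S n"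
    \<comment> \<open>With this choice \<open>sigv q (h x) = v\<close>, so that the two sides of the
      intertwining relation are compared on every vector.\<close>
    define x where "x = cinv h M (sigv (inverse q) v)"
    have x: "x \<in> carrier M" "sigv q (h x) = v"
      unfolding x_def using coord_cinv(1,2)[OF c sigv_inverse_vecs[OF Q v]] sigv_sigv_inverse(1)[OF q] by auto
    have fx: "f x \<in> carrier N" using fm x by (auto simp: module_hom_def)
    have "k (f (Sig M x)) = P *\<^sub>v (A *\<^sub>v v)"
      using P(2) x M by (auto simp: pres_def)
    moreover have "k (Sig N (f x)) = B *\<^sub>v (sigm q P *\<^sub>v v)"
      using P(2) x N fx sigv_mult_vec[OF q Pc coordD(4)[OF c x(1)]] by (auto simp: pres_def)
    ultimately show "P * A *\<^sub>v v = B * sigm q P *\<^sub>v v"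
      using fS x Pc Ac Bc vecs_carrier[OF v]
      by (simp add: assoc_mult_mat_vec[of _ m n _ n] assoc_mult_mat_vec[of _ m m _ n])
  qed (use Pc Ac Bc in auto)
  then show ?thesis using P by blast
qed

lemma matrix_qmod_hom:
  assumes Q: "qfield q S" and M: "pres S q M n A h" and N: "pres S q N m B k"
    and P: "P \<in> mats S m n" "P * A = B * sigm q P"
  shows "(\<lambda>x\<in>carrier M. cinv k N (P *\<^sub>v h x)) \<in> qmod_hom (subfld_ring S) M N"
proof -
  have S: "subfld S" and q: "q \<noteq> 0" using Q by (auto simp: qfield_def)
  have c: "coord S M n h" and d: "coord S N m k" and AB: "A \<in> mats S n n" "B \<in> mats S m m"
    using M N by (auto simp: pres_def inv_mats_def)
  note Ac = mats_carrier[OF AB(1)] note Bc = mats_carrier[OF AB(2)] note Pc = mats_carrier[OF P(1)]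
  note h = matrix_coord_hom[OF S c d P(1)]
  show ?thesis
    unfolding qmod_hom_def
  proof (intro CollectI conjI ballI)
    fix x assume x: "x \<in> carrier M"
    have Sx: "Sig M x \<in> carrier M" "h (Sig M x) = A *\<^sub>v sigv q (h x)"
      using M x by (auto simp: pres_def)
    have Sy: "Sig N y \<in> carrier N" "k (Sig N y) = B *\<^sub>v sigv q (k y)" if "y \<in> carrier N" for y
      using N that by (auto simp: pres_def)
    have hx: "h x \<in> carrier_vec n" "sigv q (h x) \<in> carrier_vec n" using coordD(4)[OF c x] by auto
    have "cinv k N (P *\<^sub>v h (Sig M x)) = Sig N (cinv k N (P *\<^sub>v h x))"
    proof (rule coord_eqI[OF d])
      show "cinv k N (P *\<^sub>v h (Sig M x)) \<in> carrier N" by (rule h(3)[OF Sx(1)])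
      show "Sig N (cinv k N (P *\<^sub>v h x)) \<in> carrier N" by (rule Sy(1)[OF h(3)[OF x]])
      have "k (cinv k N (P *\<^sub>v h (Sig M x))) = P * A *\<^sub>v sigv q (h x)"
        using h(2)[OF Sx(1)] Sx(2) assoc_mult_mat_vec[OF Pc Ac hx(2)] by simp
      also have "\<dots> = B *\<^sub>v sigv q (P *\<^sub>v h x)"
        unfolding P(2) using assoc_mult_mat_vec[OF Bc _ hx(2), of "sigm q P"] Pc sigv_mult_vec[OF q Pc hx(1)] by simp
      finally show "k (cinv k N (P *\<^sub>v h (Sig M x))) = k (Sig N (cinv k N (P *\<^sub>v h x)))"
        using Sy(2)[OF h(3)[OF x]] h(2)[OF x] by simp
    qed
    then show "(\<lambda>x\<in>carrier M. cinv k N (P *\<^sub>v h x)) (Sig M x) = Sig N ((\<lambda>x\<in>carrier M. cinv k N (P *\<^sub>v h x)) x)"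
      using Sx(1) x by simp
  qed (use h(1) in auto)
qed

text \<open>The traces of \<open>P * Q\<close> and \<open>Q * P\<close> agree, and in characteristic
  0 the trace of an identity matrix determines its size.\<close>

lemma invertible_matrix_square:
  assumes "(P :: 'a :: field_char_0 mat) \<in> carrier_mat m n" "Q \<in> carrier_mat n m" "P * Q = 1\<^sub>m m" "Q * P = 1\<^sub>m n"
  shows "m = n"
proof -
  have tr: "(\<Sum>i<k. (1\<^sub>m k :: 'a mat) $$ (i, i)) = of_nat k" for k by simp
  have "(of_nat m :: 'a) = (\<Sum>i<m. (P * Q) $$ (i, i))" unfolding assms(3) tr ..
  also have "\<dots> = (\<Sum>i<m. \<Sum>j<n. P $$ (i, j) * Q $$ (j, i))"
    using assms(1,2) by (auto simp: scalar_prod_def atLeast0LessThan intro!: sum.cong)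
  also have "\<dots> = (\<Sum>j<n. \<Sum>i<m. Q $$ (j, i) * P $$ (i, j))"
    by (subst sum.swap) (simp add: mult.commute)
  also have "\<dots> = (\<Sum>j<n. (Q * P) $$ (j, j))"
    using assms(1,2) by (auto simp: scalar_prod_def atLeast0LessThan intro!: sum.cong)
  also have "\<dots> = of_nat n" unfolding assms(4) tr ..
  finally show ?thesis by simp
qed

text \<open>\<open>P\<close> with \<open>P A = B \<sigma>\<^sub>q(P)\<close> is the matrix of a morphism from the module of \<open>A\<close> to that of \<open>B\<close>.\<close>

lemma isomorphic_matrix:
  fixes M N :: "'m qmod"
  assumes Q: "qfield q S" and M: "pres S q M n A h" and N: "pres S q N m B k"
  shows "isomorphic_in (qmod_category (subfld_ring S) q) M N \<longleftrightarrow>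
    n = m \<and> (\<exists>P\<in>inv_mats S n. P * A = B * sigm q P)"
proof -
  have S: "subfld S" and q: "q \<noteq> 0" using Q by (auto simp: qfield_def)
  have c: "coord S M n h" and d: "coord S N m k" using M N by (auto simp: pres_def)
  let ?C = "qmod_category (subfld_ring S) q :: ('m qmod, 'm \<Rightarrow> 'm) cat"
  have obj: "M \<in> Obj ?C" "N \<in> Obj ?C"
    using pres_qmod[OF Q M] pres_qmod[OF Q N] by (auto simp: qmod_category_def)
  show ?thesis
  proof
    assume "isomorphic_in ?C M N"
    then obtain f g where f: "f \<in> qmod_hom (subfld_ring S) M N" and g: "g \<in> qmod_hom (subfld_ring S) N M"
      and gf: "compose (carrier M) g f = (\<lambda>x\<in>carrier M. x)" and fg: "compose (carrier N) f g = (\<lambda>x\<in>carrier N. x)"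
      by (auto simp: isomorphic_in_def is_iso_def qmod_category_def)
    obtain P where P: "P \<in> mats S m n" "P * A = B * sigm q P" "\<forall>x\<in>carrier M. k (f x) = P *\<^sub>v h x"
      using qmod_hom_matrix[OF Q M N f] by blast
    obtain R where R: "R \<in> mats S n m" "\<forall>x\<in>carrier N. h (g x) = R *\<^sub>v k x"
      using qmod_hom_matrix[OF Q N M g] by blast
    have fM: "f x \<in> carrier N" if "x \<in> carrier M" for x using f that by (auto simp: qmod_hom_def module_hom_def)
    have gM: "g x \<in> carrier M" if "x \<in> carrier N" for x using g that by (auto simp: qmod_hom_def module_hom_def)
    note Pc = mats_carrier[OF P(1)] and Rc = mats_carrier[OF R(1)]
    have RP: "R * P = 1\<^sub>m n"
    proof (rule mats_eqI[OF S, of _ n n])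
      fix v assume v: "v \<in> vecs S n"
      let ?x = "cinv h M v"
      have x: "?x \<in> carrier M" "h ?x = v" using coord_cinv(1,2)[OF c v] by auto
      have "g (f ?x) = ?x" using fun_cong[OF gf, of ?x] x by (simp add: compose_def)
      then have "R *\<^sub>v (P *\<^sub>v v) = v" using P(3) R(2) x fM by metis
      then show "R * P *\<^sub>v v = 1\<^sub>m n *\<^sub>v v" using assoc_mult_mat_vec[OF Rc Pc] vecs_carrier[OF v] by simp
    qed (use Rc Pc in auto)
    have PR: "P * R = 1\<^sub>m m"
    proof (rule mats_eqI[OF S, of _ m m])
      fix v assume v: "v \<in> vecs S m"
      let ?x = "cinv k N v"
      have x: "?x \<in> carrier N" "k ?x = v" using coord_cinv(1,2)[OF d v] by auto
      have "f (g ?x) = ?x" using fun_cong[OF fg, of ?x] x by (simp add: compose_def)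
      then have "P *\<^sub>v (R *\<^sub>v v) = v" using P(3) R(2) x gM by metis
      then show "P * R *\<^sub>v v = 1\<^sub>m m *\<^sub>v v" using assoc_mult_mat_vec[OF Pc Rc] vecs_carrier[OF v] by simp
    qed (use Rc Pc in auto)
    have nm: "n = m" using invertible_matrix_square[OF Pc Rc PR RP] by simp
    then show "n = m \<and> (\<exists>P\<in>inv_mats S n. P * A = B * sigm q P)"
      using P R PR RP unfolding inv_mats_def nm by blast
  next
    assume "n = m \<and> (\<exists>P\<in>inv_mats S n. P * A = B * sigm q P)"
    then obtain P where nm: "n = m" and P: "P \<in> inv_mats S n" "P * A = B * sigm q P" by blast
    then obtain R where PR: "P \<in> mats S m n" "R \<in> mats S n m" "P * R = 1\<^sub>m m" "R * P = 1\<^sub>m n"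
      unfolding inv_mats_def nm by blast
    note Pc = mats_carrier[OF PR(1)] and Rc = mats_carrier[OF PR(2)]
    have Ac: "A \<in> carrier_mat n n" and Bc: "B \<in> carrier_mat m m"
      using M N by (auto simp: pres_def inv_mats_carrier)
    \<comment> \<open>Inserting this identity shows that the inverse matrix \<open>R\<close>
      intertwines in the opposite direction, so the inverse map is again a morphism.\<close>
    have sR: "sigm q P * sigm q R = 1\<^sub>m m"
      using sigm_mult[OF q Pc Rc] PR(3) sigm_one[OF q] by metis
    have "R * B = R * (B * (sigm q P * sigm q R))" using sR Bc by simp
    also have "\<dots> = R * (P * A * sigm q R)"
      unfolding P(2) using Bc Pc Rc by (subst assoc_mult_mat[of B m m _ n _ m]) auto
    also have "\<dots> = (R * P) * A * sigm q R"
      using Rc Pc Ac by (simp add: assoc_mult_mat[of R n m P n "A * sigm q R" m] assoc_mult_mat[of P m n A n "sigm q R" m]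
          assoc_mult_mat[of "R * P" n n A n "sigm q R" m] assoc_mult_mat[of R n m "P * A" n "sigm q R" m])
    finally have RB: "R * B = A * sigm q R" using PR(4) Ac by simp
    define f where "f = (\<lambda>x\<in>carrier M. cinv k N (P *\<^sub>v h x))"
    define g where "g = (\<lambda>x\<in>carrier N. cinv h M (R *\<^sub>v k x))"
    note hf = matrix_coord_hom[OF S c d PR(1)] note hg = matrix_coord_hom[OF S d c PR(2)]
    have "g (f x) = x" if x: "x \<in> carrier M" for x
      unfolding g_def f_def using x hf(2,3)[OF x] hg(2,3)[OF hf(3)[OF x]]
        assoc_mult_mat_vec[OF Rc Pc coordD(4)[OF c x]] coordD(4)[OF c x] PR(4)
      by (intro coord_eqI[OF c]) auto
    moreover have "f (g x) = x" if x: "x \<in> carrier N" for x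
      unfolding g_def f_def using x hg(2,3)[OF x] hf(2,3)[OF hg(3)[OF x]]
        assoc_mult_mat_vec[OF Pc Rc coordD(4)[OF d x]] coordD(4)[OF d x] PR(3)
      by (intro coord_eqI[OF d]) auto
    moreover have "f \<in> qmod_hom (subfld_ring S) M N" "g \<in> qmod_hom (subfld_ring S) N M"
      unfolding f_def g_def using matrix_qmod_hom[OF Q M N PR(1) P(2)] matrix_qmod_hom[OF Q N M PR(2) RB] by auto
    ultimately have "is_iso ?C M N f"
      unfolding is_iso_def by (auto simp: qmod_category_def compose_def intro!: bexI[of _ g] restrict_ext)
    then show "isomorphic_in ?C M N"
      unfolding isomorphic_in_def using obj by blast
  qed
qed

section \<open>Copies, quotients, extension of scalars and cyclic modules\<close>

lemma mult_mat_zero_vec: "A \<in> carrier_mat m n \<Longrightarrow> A *\<^sub>v 0\<^sub>v n = (0\<^sub>v m :: 'a :: semiring_0 vec)"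
  by (auto intro!: eq_vecI simp: scalar_prod_def)

text \<open>Isoformality quantifies over modules with carrier in the type \<open>'m\<close>, so
  every matrix to be tested needs a module there. The injection \<open>e\<close> encodes a vector by
  its sequence of coordinates, continued by 0.\<close>

lemma pres_copy_exists:
  assumes Q: "qfield q S" and A: "A \<in> inv_mats S n" and e: "\<exists>e :: (nat \<Rightarrow> complex fls) \<Rightarrow> 'm. inj e"
  shows "\<exists>(M :: 'm qmod) h. pres S q M n A h"
proof -
  have S: "subfld S" using Q by (auto simp: qfield_def)
  obtain e :: "(nat \<Rightarrow> complex fls) \<Rightarrow> 'm" where e: "inj e" using e by blast
  define enc where "enc v = e (\<lambda>i. if i < n then v $ i else 0)" for v :: "complex fls vec"
  define dec where "dec = inv_into (vecs S n) enc"
  define M :: "'m qmod" where "M = \<lparr>carrier = enc ` vecs S n, mult = undefined, one = undefined, zero = enc (0\<^sub>v n),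
    add = \<lambda>x y. enc (dec x + dec y), smult = \<lambda>a x. enc (a \<cdot>\<^sub>v dec x), Sig = \<lambda>x. enc (A *\<^sub>v sigv q (dec x))\<rparr>"
  have inj: "inj_on enc (vecs S n)"
  proof (rule inj_onI)
    fix v w assume v: "v \<in> vecs S n" and w: "w \<in> vecs S n" and "enc v = enc w"
    then have eq: "(\<lambda>i. if i < n then v $ i else 0) = (\<lambda>i. if i < n then w $ i else 0)"
      using e by (auto simp: enc_def inj_def)
    have "v $ i = w $ i" if "i < n" for i using fun_cong[OF eq, of i] that by simp
    then show "v = w" using v w by (intro eq_vecI) (auto simp: vecs_def)
  qed
  have de: "dec (enc v) = v" if "v \<in> vecs S n" for v
    using inj that by (simp add: dec_def)
  have T: "A *\<^sub>v sigv q v \<in> vecs S n" if "v \<in> vecs S n" for v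
    by (rule mats_mult_vec[OF S inv_mats_mats[OF A] sigv_vecs[OF Q that]])
  have "pres S q M n A dec"
    unfolding pres_def coord_def
    using A inj_on_inv_into[of "enc ` vecs S n" enc "vecs S n"]
    by (auto simp: M_def de vecs_add[OF S] vecs_smult[OF S] vecs_zero[OF S] T bij_betw_def image_image
        simp flip: dec_def)
  then show ?thesis by blast
qed

text \<open>The first isomorphism theorem in coordinates: the cosets of the kernel \<open>H\<close>
  are the fibres of the surjection \<open>\<Phi>\<close>. It serves both for extension of scalars
  and for cyclic modules. The hypothesis \<open>diff\<close> stands in for subtraction, since
  \<open>L\<close> is not assumed to be a group.\<close>

lemma pres_quot:
  assumes A: "A \<in> inv_mats S n" and S: "subfld S"
    and \<Phi>: "\<And>x. x \<in> carrier L \<Longrightarrow> \<Phi> x \<in> vecs S n" and surj: "\<And>v. v \<in> vecs S n \<Longrightarrow> \<exists>x\<in>carrier L. \<Phi> x = v"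
    and add: "\<And>x y. x \<in> carrier L \<Longrightarrow> y \<in> carrier L \<Longrightarrow> x \<oplus>\<^bsub>L\<^esub> y \<in> carrier L \<and> \<Phi> (x \<oplus>\<^bsub>L\<^esub> y) = \<Phi> x + \<Phi> y"
    and smult: "\<And>a x. a \<in> S \<Longrightarrow> x \<in> carrier L \<Longrightarrow> a \<odot>\<^bsub>L\<^esub> x \<in> carrier L \<and> \<Phi> (a \<odot>\<^bsub>L\<^esub> x) = a \<cdot>\<^sub>v \<Phi> x"
    and Sig: "\<And>x. x \<in> carrier L \<Longrightarrow> Sig L x \<in> carrier L \<and> \<Phi> (Sig L x) = A *\<^sub>v sigv q (\<Phi> x)"
    and diff: "\<And>x y. x \<in> carrier L \<Longrightarrow> y \<in> carrier L \<Longrightarrow> \<exists>d\<in>carrier L. y = d \<oplus>\<^bsub>L\<^esub> x"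
    and H: "H = {x \<in> carrier L. \<Phi> x = 0\<^sub>v n}"
  shows "\<exists>h. pres S q (qmod_quot L H) n A h"
proof -
  define fib where "fib v = {x \<in> carrier L. \<Phi> x = v}" for v
  have coset: "H +>\<^bsub>L\<^esub> x = fib (\<Phi> x)" if x: "x \<in> carrier L" for x
  proof safe
    fix y assume "y \<in> H +>\<^bsub>L\<^esub> x"
    then obtain d where d: "d \<in> H" "y = d \<oplus>\<^bsub>L\<^esub> x" by (auto simp: a_r_coset_def r_coset_def)
    then show "y \<in> fib (\<Phi> x)"
      using add[of d x] x vecs_carrier[OF \<Phi>[OF x]] by (auto simp: H fib_def)
  next
    fix y assume y: "y \<in> fib (\<Phi> x)"
    then obtain d where d: "d \<in> carrier L" "y = d \<oplus>\<^bsub>L\<^esub> x" using diff[OF x] by (auto simp: fib_def)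
    have eq: "\<Phi> d + \<Phi> x = \<Phi> x" using add[OF d(1) x] d(2) y by (simp add: fib_def)
    have "\<Phi> d = 0\<^sub>v n"
    proof (rule eq_vecI)
      fix i assume "i < dim_vec (0\<^sub>v n :: complex fls vec)"
      then have "(\<Phi> d + \<Phi> x) $ i = \<Phi> d $ i + \<Phi> x $ i" "i < n"
        using vecs_dim[OF \<Phi>[OF x]] vecs_dim[OF \<Phi>[OF d(1)]] by auto
      then show "\<Phi> d $ i = 0\<^sub>v n $ i" using eq by simp
    qed (use vecs_dim[OF \<Phi>[OF d(1)]] in simp)
    then show "y \<in> H +>\<^bsub>L\<^esub> x" using d by (auto simp: a_r_coset_def r_coset_def H)
  qed
  define h where "h X = \<Phi> (SOME x. x \<in> X)" for X
  have ne: "\<exists>x. x \<in> fib v" if "v \<in> vecs S n" for v using surj[OF that] by (auto simp: fib_def)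
  have hf: "h (fib v) = v" if "v \<in> vecs S n" for v
    using someI_ex[OF ne[OF that]] by (simp add: h_def fib_def)
  let ?Q = "qmod_quot L H"
  have carr: "carrier ?Q = fib ` vecs S n"
  proof -
    have "carrier ?Q = (\<lambda>x. fib (\<Phi> x)) ` carrier L"
      using coset by (force simp: qmod_quot_def A_RCOSETS_def RCOSETS_def a_r_coset_def)
    also have "\<dots> = fib ` vecs S n"
      using \<Phi> surj by (auto simp: image_iff)
    finally show ?thesis .
  qed
  have addf: "fib v \<oplus>\<^bsub>?Q\<^esub> fib w = fib (v + w)" if v: "v \<in> vecs S n" and w: "w \<in> vecs S n" for v w
  proof -
    have "\<exists>a\<in>fib v. \<exists>b\<in>fib w. y = a \<oplus>\<^bsub>L\<^esub> b" if y: "y \<in> fib (v + w)" for y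
    proof -
      obtain b where b: "b \<in> carrier L" "\<Phi> b = w" using surj[OF w] by blast
      obtain d where d: "d \<in> carrier L" "y = d \<oplus>\<^bsub>L\<^esub> b" using diff[OF b(1)] y by (auto simp: fib_def)
      have eq: "\<Phi> d + w = v + w" using add[OF d(1) b(1)] d(2) b(2) y by (simp add: fib_def)
      have "\<Phi> d = v"
      proof (rule eq_vecI)
        fix i assume "i < dim_vec v"
        then have "(\<Phi> d + w) $ i = \<Phi> d $ i + w $ i" "(v + w) $ i = v $ i + w $ i"
          using v w by (auto simp: vecs_dim)
        then show "\<Phi> d $ i = v $ i" using eq by simp
      qed (use v \<Phi>[OF d(1)] in \<open>simp add: vecs_dim\<close>)
      then show ?thesis using b d by (auto simp: fib_def)
    qed
    then show ?thesis
      using add by (fastforce simp: qmod_quot_def set_add_def set_mult_def fib_def)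
  qed
  have smf: "a \<odot>\<^bsub>?Q\<^esub> fib v = fib (a \<cdot>\<^sub>v v)" if a: "a \<in> S" and v: "v \<in> vecs S n" for a v
  proof -
    have "H +>\<^bsub>L\<^esub> (a \<odot>\<^bsub>L\<^esub> x) = fib (a \<cdot>\<^sub>v v)" if "x \<in> fib v" for x
      using coset[of "a \<odot>\<^bsub>L\<^esub> x"] smult[OF a, of x] that by (auto simp: fib_def)
    then show ?thesis using ne[OF v] by (auto simp: qmod_quot_def)
  qed
  have Sf: "Sig ?Q (fib v) = fib (A *\<^sub>v sigv q v)" if v: "v \<in> vecs S n" for v
  proof -
    have "H +>\<^bsub>L\<^esub> (Sig L x) = fib (A *\<^sub>v sigv q v)" if "x \<in> fib v" for x
      using coset[of "Sig L x"] Sig[of x] that by (auto simp: fib_def)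
    then show ?thesis using ne[OF v] by (auto simp: qmod_quot_def)
  qed
  have TV: "A *\<^sub>v sigv q v \<in> vecs S n" if v: "v \<in> vecs S n" for v
  proof -
    obtain x where "x \<in> carrier L" "\<Phi> x = v" using surj[OF v] by blast
    then show ?thesis using Sig[of x] \<Phi>[of "Sig L x"] by simp
  qed
  have zf: "\<zero>\<^bsub>?Q\<^esub> = fib (0\<^sub>v n)" by (simp add: qmod_quot_def H fib_def)
  have inj: "inj_on h (fib ` vecs S n)" by (rule inj_onI) (auto simp: hf)
  have "pres S q ?Q n A h"
    unfolding pres_def coord_def carr
    using A inj by (auto simp: bij_betw_def hf addf smf Sf zf vecs_add[OF S] vecs_smult[OF S] vecs_zero[OF S] TV
        image_image)
  then show ?thesis by blast
qed

text \<open>The map \<open>\<Phi>\<close> sends m \<otimes> a to a times \<open>h m\<close>. The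
  relations clearly lie in its kernel \<open>H\<close>; the point is that the kernel is no larger
  than their span \<open>W\<close>. This holds because, modulo \<open>W\<close>, every generator is
  a combination of the n generators that belong to a basis of \<open>M\<close>.\<close>

lemma pres_base_change:
  fixes M :: "'m qmod"
  assumes q: "norm q = 1" and M: "pres conv_fls q M n A h"
  shows "\<exists>k. pres UNIV q (base_change q M) n A k"
proof -
  have S: "subfld conv_fls" by (rule subfld_conv_fls)
  have q0: "q \<noteq> 0" using q by auto
  have c: "coord conv_fls M n h" using M by (simp add: pres_def)
  have AI: "A \<in> inv_mats conv_fls n" using M by (simp add: pres_def)
  then have AI': "A \<in> inv_mats UNIV n" by (auto simp: inv_mats_def mats_def)
  define supp :: "('m \<Rightarrow> complex fls) \<Rightarrow> 'm set" where "supp g = {m. g m \<noteq> 0}" for g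
  let ?G = "free_qmod q M"
  have G: "g \<in> carrier ?G \<longleftrightarrow> finite (supp g) \<and> supp g \<subseteq> carrier M" for g
    by (simp add: free_qmod_def supp_def)
  have Gop [simp]: "add ?G = (\<lambda>g h m. g m + h m)" "smult ?G = (\<lambda>a g m. a * g m)" "zero ?G = (\<lambda>m. 0)"
    by (auto simp: free_qmod_def)
  have addG: "(\<lambda>m. g m + g' m) \<in> carrier ?G" if "g \<in> carrier ?G" "g' \<in> carrier ?G" for g g'
  proof -
    have "supp (\<lambda>m. g m + g' m) \<subseteq> supp g \<union> supp g'" by (auto simp: supp_def)
    then show ?thesis using that unfolding G by (meson finite_UnI finite_subset sup_least order_trans)
  qed
  have smG: "(\<lambda>m. a * g m) \<in> carrier ?G" if "g \<in> carrier ?G" for a g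
  proof -
    have "supp (\<lambda>m. a * g m) \<subseteq> supp g" by (auto simp: supp_def)
    then show ?thesis using that unfolding G by (meson finite_subset order_trans)
  qed
  have zG: "(\<lambda>m. 0) \<in> carrier ?G" by (simp add: G supp_def)
  have siG: "single m \<in> carrier ?G" if "m \<in> carrier M" for m
    using that by (auto simp: G supp_def single_def)
  have mod: "Module.module K_hat ?G"
  proof (rule module_criteria)
    show "cring K_hat" by (rule class_cring.is_cring)
    show "\<forall>v\<in>carrier ?G. \<exists>neg_v\<in>carrier ?G. v \<oplus>\<^bsub>?G\<^esub> neg_v = \<zero>\<^bsub>?G\<^esub>"
    proof
      fix v assume "v \<in> carrier ?G"
      then show "\<exists>neg_v\<in>carrier ?G. v \<oplus>\<^bsub>?G\<^esub> neg_v = \<zero>\<^bsub>?G\<^esub>"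
        by (intro bexI[of _ "\<lambda>m. (- 1) * v m"] smG) auto
    qed
  qed (auto simp: addG smG zG algebra_simps)
  interpret G: Module.module K_hat ?G by (rule mod)
  define \<Phi> where "\<Phi> g = vec n (\<lambda>i. \<Sum>m\<in>supp g. g m * h m $ i)" for g
  have \<Phi>_on: "\<Phi> g $ i = (\<Sum>m\<in>F. g m * h m $ i)" if "finite F" "supp g \<subseteq> F" "i < n" for g F i
    using that by (auto simp: \<Phi>_def supp_def intro!: sum.mono_neutral_left)
  have \<Phi>V: "\<Phi> g \<in> vecs UNIV n" for g by (simp add: \<Phi>_def vecs_def)
  have \<Phi>add: "\<Phi> (\<lambda>m. g m + g' m) = \<Phi> g + \<Phi> g'" if "g \<in> carrier ?G" "g' \<in> carrier ?G" for g g'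
  proof (rule eq_vecI)
    fix i assume "i < dim_vec (\<Phi> g + \<Phi> g')"
    then have i: "i < n" by (simp add: \<Phi>_def)
    have f: "finite (supp g \<union> supp g')" using that by (simp add: G)
    have "\<Phi> (\<lambda>m. g m + g' m) $ i = (\<Sum>m\<in>supp g \<union> supp g'. (g m + g' m) * h m $ i)"
      using i f by (intro \<Phi>_on) (auto simp: supp_def)
    also have "\<dots> = \<Phi> g $ i + \<Phi> g' $ i"
      using i f \<Phi>_on[OF f _ i, of g] \<Phi>_on[OF f _ i, of g'] by (simp add: distrib_right sum.distrib)
    finally show "\<Phi> (\<lambda>m. g m + g' m) $ i = (\<Phi> g + \<Phi> g') $ i" using i by (simp add: \<Phi>_def)
  qed (simp add: \<Phi>_def)
  have \<Phi>sm: "\<Phi> (\<lambda>m. a * g m) = a \<cdot>\<^sub>v \<Phi> g" if "g \<in> carrier ?G" for a g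
  proof (rule eq_vecI)
    fix i assume "i < dim_vec (a \<cdot>\<^sub>v \<Phi> g)"
    then have i: "i < n" by (simp add: \<Phi>_def)
    have f: "finite (supp g)" using that by (simp add: G)
    have "\<Phi> (\<lambda>m. a * g m) $ i = (\<Sum>m\<in>supp g. a * g m * h m $ i)"
      using i f by (intro \<Phi>_on) (auto simp: supp_def)
    then show "\<Phi> (\<lambda>m. a * g m) $ i = (a \<cdot>\<^sub>v \<Phi> g) $ i"
      using i by (simp add: \<Phi>_def sum_distrib_left mult.assoc)
  qed (simp add: \<Phi>_def)
  have \<Phi>single: "\<Phi> (single m) = h m" if "m \<in> carrier M" for m
    using coordD(4)[OF c that] by (intro eq_vecI) (auto simp: \<Phi>_def supp_def single_def)
  define H where "H = {g \<in> carrier ?G. \<Phi> g = 0\<^sub>v n}"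
  have subH: "submodule K_hat H ?G"
    unfolding submodule_def
    using mod by (auto simp: H_def addG smG zG \<Phi>add \<Phi>sm) (auto simp: \<Phi>_def supp_def)
  let ?T = "tensor_relations M"
  have Msm: "f \<odot>\<^bsub>M\<^esub> m \<in> carrier M" "h (f \<odot>\<^bsub>M\<^esub> m) = f \<cdot>\<^sub>v h m" if "f \<in> conv_fls" "m \<in> carrier M" for f m
    using that coordD(7,8)[OF c] by auto
  have Madd: "m \<oplus>\<^bsub>M\<^esub> m' \<in> carrier M" "h (m \<oplus>\<^bsub>M\<^esub> m') = h m + h m'" if "m \<in> carrier M" "m' \<in> carrier M" for m m'
    using that coordD(5,6)[OF c] by auto
  have rel1: "(\<lambda>x. single (m \<oplus>\<^bsub>M\<^esub> m') x - single m x - single m' x) \<in> H"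
    if mm: "m \<in> carrier M" "m' \<in> carrier M" for m m'
  proof -
    have eq: "(\<lambda>x. single (m \<oplus>\<^bsub>M\<^esub> m') x - single m x - single m' x) =
      (\<lambda>x. single (m \<oplus>\<^bsub>M\<^esub> m') x + (- 1) * (single m x + single m' x))" by (auto simp: algebra_simps)
    have g1: "(\<lambda>x. single m x + single m' x) \<in> carrier ?G" by (intro addG siG mm)
    have g2: "(\<lambda>x. (- 1) * (single m x + single m' x)) \<in> carrier ?G" by (rule smG[OF g1])
    have g3: "single (m \<oplus>\<^bsub>M\<^esub> m') \<in> carrier ?G" by (intro siG Madd mm)
    have "\<Phi> (\<lambda>x. single (m \<oplus>\<^bsub>M\<^esub> m') x + (- 1) * (single m x + single m' x)) =
        (h m + h m') + (- 1) \<cdot>\<^sub>v (h m + h m')"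
      unfolding \<Phi>add[OF g3 g2] \<Phi>sm[OF g1] \<Phi>add[OF siG[OF mm(1)] siG[OF mm(2)]]
        \<Phi>single[OF mm(1)] \<Phi>single[OF mm(2)] \<Phi>single[OF Madd(1)[OF mm]] Madd(2)[OF mm] ..
    also have "\<dots> = 0\<^sub>v n"
      using coordD(4)[OF c mm(1)] coordD(4)[OF c mm(2)] by (intro eq_vecI) auto
    finally show ?thesis unfolding eq H_def using addG[OF g3 g2] by blast
  qed
  have rel2: "(\<lambda>x. single (f \<odot>\<^bsub>M\<^esub> m) x - f * single m x) \<in> H"
    if mm: "f \<in> conv_fls" "m \<in> carrier M" for f m
  proof -
    have eq: "(\<lambda>x. single (f \<odot>\<^bsub>M\<^esub> m) x - f * single m x) =
      (\<lambda>x. single (f \<odot>\<^bsub>M\<^esub> m) x + (- f) * single m x)" by (auto simp: algebra_simps)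
    have g2: "(\<lambda>x. (- f) * single m x) \<in> carrier ?G" by (intro smG siG mm)
    have g3: "single (f \<odot>\<^bsub>M\<^esub> m) \<in> carrier ?G" by (intro siG Msm mm)
    have "\<Phi> (\<lambda>x. single (f \<odot>\<^bsub>M\<^esub> m) x + (- f) * single m x) = f \<cdot>\<^sub>v h m + (- f) \<cdot>\<^sub>v h m"
      unfolding \<Phi>add[OF g3 g2] \<Phi>sm[OF siG[OF mm(2)]] \<Phi>single[OF mm(2)] \<Phi>single[OF Msm(1)[OF mm]] Msm(2)[OF mm] ..
    also have "\<dots> = 0\<^sub>v n"
      using coordD(4)[OF c mm(2)] by (intro eq_vecI) auto
    finally show ?thesis unfolding eq H_def using addG[OF g3 g2] by blast
  qed
  have TH: "?T \<subseteq> H"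
    unfolding tensor_relations_def K_conv_eq using rel1 rel2 by auto
  define W where "W = LinearCombinations.module.span K_hat ?G ?T"
  have TG: "?T \<subseteq> carrier ?G" using TH by (auto simp: H_def)
  have WH: "W \<subseteq> H" unfolding W_def by (rule G.span_is_subset[OF TH subH])
  have subW: "submodule K_hat W ?G" unfolding W_def by (rule G.span_is_submodule[OF TG])
  have TW: "?T \<subseteq> W" unfolding W_def by (rule G.in_own_span[OF TG])
  have Wadd: "(\<lambda>m. g m + g' m) \<in> W" if "g \<in> W" "g' \<in> W" for g g'
    using submodule.m_closed[OF subW that] by simp
  have Wsm: "(\<lambda>m. a * g m) \<in> W" if "g \<in> W" for a g
    using submodule.smult_closed[OF subW, of a g] that by simp
  have W0: "(\<lambda>m. 0) \<in> W" using submodule.zero_closed[OF subW] by simp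
  define b where "b i = cinv h M (unit_vec n i)" for i
  have b: "b i \<in> carrier M" "h (b i) = unit_vec n i" for i
    using coord_cinv(1,2)[OF c vecs_unit[OF S]] by (auto simp: b_def)
  \<comment> \<open>Expands the generator of \<open>m\<close> modulo \<open>W\<close> in the
    generators of the basis vectors \<open>b i\<close>, by induction on the number of leading
    coordinates of \<open>m\<close> that may be nonzero.\<close>
  have Wsingle: "\<forall>m\<in>carrier M. (\<forall>i<n. l \<le> i \<longrightarrow> h m $ i = 0) \<longrightarrow>
      (\<lambda>x. single m x - (\<Sum>i<l. h m $ i * single (b i) x)) \<in> W" if "l \<le> n" for l
    using that
  proof (induction l)
    case 0
    show ?case
    proof (intro ballI impI)
      fix m assume m: "m \<in> carrier M" "\<forall>i<n. 0 \<le> i \<longrightarrow> h m $ i = 0"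
      \<comment> \<open>Here \<open>m\<close> is the zero vector, and the homogeneity relation with
        scalar 0 puts its generator into \<open>W\<close>.\<close>
      have "m = 0 \<odot>\<^bsub>M\<^esub> m"
        using m coordD(4)[OF c m(1)] subfld_zero[OF S] Msm[of 0 m]
        by (intro coord_eqI[OF c]) (auto intro!: eq_vecI)
      moreover have "(\<lambda>x. single (0 \<odot>\<^bsub>M\<^esub> m) x - 0 * single m x) \<in> ?T"
        unfolding tensor_relations_def K_conv_eq using m subfld_zero[OF S] by auto
      ultimately show "(\<lambda>x. single m x - (\<Sum>i<0. h m $ i * single (b i) x)) \<in> W" using TW by auto
    qed
  next
    case (Suc l)
    have l: "l < n" using Suc.prems by simp
    show ?case
    proof (intro ballI impI)
      fix m assume m: "m \<in> carrier M" "\<forall>i<n. Suc l \<le> i \<longrightarrow> h m $ i = 0"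
      let ?c = "h m $ l"
      define v where "v = vec n (\<lambda>i. if i = l then 0 else h m $ i)"
      have v: "v \<in> vecs conv_fls n" using coordD(3)[OF c m(1)] subfld_zero[OF S] by (auto simp: v_def vecs_def)
      have cc: "?c \<in> conv_fls" using coordD(3)[OF c m(1)] l by (auto simp: vecs_def)
      define m' where "m' = cinv h M v"
      have m': "m' \<in> carrier M" "h m' = v" using coord_cinv(1,2)[OF c v] by (auto simp: m'_def)
      have meq: "m = m' \<oplus>\<^bsub>M\<^esub> (?c \<odot>\<^bsub>M\<^esub> b l)"
        using m(1) m' cc b coordD(4)[OF c m(1)]
        by (intro coord_eqI[OF c]) (auto simp: Madd Msm v_def unit_vec_def intro!: eq_vecI)
      have "(\<lambda>x. single (m' \<oplus>\<^bsub>M\<^esub> (?c \<odot>\<^bsub>M\<^esub> b l)) x - single m' x - single (?c \<odot>\<^bsub>M\<^esub> b l) x) \<in> ?T"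
        unfolding tensor_relations_def using m' cc b Msm by blast
      then have 1: "(\<lambda>x. single m x - single m' x - single (?c \<odot>\<^bsub>M\<^esub> b l) x) \<in> W" using TW meq by auto
      have "(\<lambda>x. single (?c \<odot>\<^bsub>M\<^esub> b l) x - ?c * single (b l) x) \<in> ?T"
        unfolding tensor_relations_def K_conv_eq subfld_ring_simps using cc b(1)[of l] by blast
      then have 2: "(\<lambda>x. single (?c \<odot>\<^bsub>M\<^esub> b l) x - ?c * single (b l) x) \<in> W" using TW by auto
      have 3: "(\<lambda>x. single m' x - (\<Sum>i<l. v $ i * single (b i) x)) \<in> W"
        using Suc.IH l m' m(2) by (auto simp: v_def)
      have "(\<Sum>i<l. v $ i * single (b i) x) = (\<Sum>i<l. h m $ i * single (b i) x)" for x
        using l by (intro sum.cong) (auto simp: v_def)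
      then show "(\<lambda>x. single m x - (\<Sum>i<Suc l. h m $ i * single (b i) x)) \<in> W"
        using Wadd[OF Wadd[OF 1 2] 3] by (simp add: algebra_simps)
    qed
  qed
  \<comment> \<open>By induction on the support, every \<open>g\<close> is congruent modulo
    \<open>W\<close> to the combination of the \<open>b i\<close> with coefficients
    \<open>\<Phi> g\<close>. For \<open>g\<close> in the kernel this combination is 0, whence
    \<open>g\<close> lies in \<open>W\<close>.\<close>
  have Wg: "\<forall>g. supp g \<subseteq> F \<longrightarrow> (\<lambda>x. g x - (\<Sum>i<n. \<Phi> g $ i * single (b i) x)) \<in> W"
    if "finite F" "F \<subseteq> carrier M" for F
    using that
  proof (induction F)
    case empty
    have "(\<lambda>x. g x - (\<Sum>i<n. \<Phi> g $ i * single (b i) x)) = (\<lambda>x. 0)" if "supp g = {}" for g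
      using that by (auto simp: supp_def \<Phi>_def)
    then show ?case using W0 by auto
  next
    case (insert m F)
    show ?case
    proof (intro allI impI)
      fix g assume g: "supp g \<subseteq> insert m F"
      define g' where "g' = g(m := 0)"
      have gG: "g' \<in> carrier ?G" "supp g' \<subseteq> F"
        using g insert by (auto simp: g'_def G supp_def intro: finite_subset[of _ F])
      have m: "m \<in> carrier M" using insert by simp
      have geq: "g = (\<lambda>x. g' x + g m * single m x)" by (auto simp: g'_def single_def)
      have "\<Phi> g = \<Phi> g' + g m \<cdot>\<^sub>v h m"
        by (subst geq) (simp add: \<Phi>add gG smG siG m \<Phi>sm \<Phi>single)
      then have \<Phi>g: "\<Phi> g $ i = \<Phi> g' $ i + g m * h m $ i" if "i < n" for i
        using that coordD(4)[OF c m] by (simp add: \<Phi>_def)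
      have 1: "(\<lambda>x. g' x - (\<Sum>i<n. \<Phi> g' $ i * single (b i) x)) \<in> W" using insert gG by auto
      have 2: "(\<lambda>x. single m x - (\<Sum>i<n. h m $ i * single (b i) x)) \<in> W"
        using Wsingle[of n] m by auto
      have "(\<lambda>x. g x - (\<Sum>i<n. \<Phi> g $ i * single (b i) x)) =
        (\<lambda>x. (g' x - (\<Sum>i<n. \<Phi> g' $ i * single (b i) x)) + g m * (single m x - (\<Sum>i<n. h m $ i * single (b i) x)))"
      proof
        fix x
        have "(\<Sum>i<n. \<Phi> g $ i * single (b i) x) =
          (\<Sum>i<n. \<Phi> g' $ i * single (b i) x) + g m * (\<Sum>i<n. h m $ i * single (b i) x)"
          by (simp add: \<Phi>g distrib_right sum.distrib sum_distrib_left mult.assoc)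
        then show "g x - (\<Sum>i<n. \<Phi> g $ i * single (b i) x) =
          (g' x - (\<Sum>i<n. \<Phi> g' $ i * single (b i) x)) + g m * (single m x - (\<Sum>i<n. h m $ i * single (b i) x))"
          using fun_cong[OF geq, of x] by (simp add: algebra_simps)
      qed
      then show "(\<lambda>x. g x - (\<Sum>i<n. \<Phi> g $ i * single (b i) x)) \<in> W" using Wadd[OF 1 Wsm[OF 2]] by simp
    qed
  qed
  have HW: "H \<subseteq> W"
  proof
    fix g assume g: "g \<in> H"
    then have "(\<lambda>x. g x - (\<Sum>i<n. \<Phi> g $ i * single (b i) x)) \<in> W"
      using Wg[of "supp g"] by (auto simp: H_def G)
    moreover have "(\<Sum>i<n. \<Phi> g $ i * single (b i) x) = 0" for x
      using g by (auto simp: H_def)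
    ultimately show "g \<in> W" by simp
  qed
  \<comment> \<open>The value of the operator at \<open>y\<close> is a sum over the part of the
    support that \<open>Sig M\<close> maps to \<open>y\<close>; summing over all \<open>y\<close>
    restores one sum over the support.\<close>
  have SigG: "Sig ?G g \<in> carrier ?G \<and> \<Phi> (Sig ?G g) = A *\<^sub>v sigv q (\<Phi> g)" if g: "g \<in> carrier ?G" for g
  proof
    have Sg: "Sig ?G g = (\<lambda>y. \<Sum>m\<in>{m \<in> supp g. Sig M m = y}. sigma_q q (g m))"
      by (simp add: free_qmod_def supp_def)
    have sub: "supp (Sig ?G g) \<subseteq> Sig M ` supp g"
    proof (rule ccontr)
      assume "\<not> supp (Sig ?G g) \<subseteq> Sig M ` supp g"
      then obtain y where y: "Sig ?G g y \<noteq> 0" "y \<notin> Sig M ` supp g" by (auto simp: supp_def)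
      have "Sig ?G g y = 0"
        unfolding Sg by (rule sum.neutral) (use y(2) in \<open>auto\<close>)
      then show False using y(1) by simp
    qed
    have fin: "finite (supp g)" "supp g \<subseteq> carrier M" using g by (auto simp: G)
    have SM: "Sig M m \<in> carrier M" "h (Sig M m) = A *\<^sub>v sigv q (h m)" if "m \<in> carrier M" for m
      using M that by (auto simp: pres_def)
    show "Sig ?G g \<in> carrier ?G"
      unfolding G using sub fin SM(1) by (auto intro: finite_subset)
    show "\<Phi> (Sig ?G g) = A *\<^sub>v sigv q (\<Phi> g)"
    proof (rule eq_vecI)
      fix i assume "i < dim_vec (A *\<^sub>v sigv q (\<Phi> g))"
      then have i: "i < n" using inv_mats_carrier[OF AI] by simp
      have "\<Phi> (Sig ?G g) $ i = (\<Sum>y\<in>Sig M ` supp g. Sig ?G g y * h y $ i)"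
        using fin sub i by (intro \<Phi>_on) auto
      also have "\<dots> = (\<Sum>y\<in>Sig M ` supp g. \<Sum>m\<in>{m \<in> supp g. Sig M m = y}. sigma_q q (g m) * h (Sig M m) $ i)"
        unfolding Sg by (auto simp: sum_distrib_right intro!: sum.cong)
      also have "\<dots> = (\<Sum>m\<in>supp g. sigma_q q (g m) * h (Sig M m) $ i)"
        by (rule sum.image_gen[OF fin(1), symmetric])
      also have "\<dots> = (\<Sum>m\<in>supp g. \<Sum>j<n. A $$ (i, j) * sigma_q q (g m * h m $ j))"
      proof (intro sum.cong refl)
        fix m assume "m \<in> supp g"
        then have m: "m \<in> carrier M" using fin by auto
        show "sigma_q q (g m) * h (Sig M m) $ i = (\<Sum>j<n. A $$ (i, j) * sigma_q q (g m * h m $ j))"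
          using i inv_mats_carrier[OF AI] coordD(4)[OF c m]
          by (auto simp: SM(2)[OF m] scalar_prod_def atLeast0LessThan sum_distrib_left sigma_q_mult[OF q0] intro!: sum.cong)
      qed
      also have "\<dots> = (\<Sum>j<n. A $$ (i, j) * (\<Sum>m\<in>supp g. sigma_q q (g m * h m $ j)))"
        by (subst sum.swap) (simp add: sum_distrib_left)
      also have "\<dots> = (A *\<^sub>v sigv q (\<Phi> g)) $ i"
        using i inv_mats_carrier[OF AI]
        by (auto simp: scalar_prod_def atLeast0LessThan \<Phi>_def sigma_q_sum[OF q0] intro!: sum.cong)
      finally show "\<Phi> (Sig ?G g) $ i = (A *\<^sub>v sigv q (\<Phi> g)) $ i" .
    qed (use inv_mats_carrier[OF AI] in \<open>simp add: \<Phi>_def\<close>)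
  qed
  show ?thesis
    unfolding base_change_def
  proof (rule pres_quot[OF AI' subfld_UNIV, where \<Phi> = \<Phi>])
    show "LinearCombinations.module.span K_hat ?G ?T = {x \<in> carrier ?G. \<Phi> x = 0\<^sub>v n}"
      using HW WH unfolding W_def H_def by simp
    fix v :: "complex fls vec" assume v: "v \<in> vecs UNIV n"
    define g where "g = (\<lambda>x. \<Sum>i<n. v $ i * single (b i) x)"
    have "(\<lambda>x. \<Sum>i<l. v $ i * single (b i) x) \<in> carrier ?G \<and>
        \<Phi> (\<lambda>x. \<Sum>i<l. v $ i * single (b i) x) = vec n (\<lambda>i. if i < l then v $ i else 0)" if "l \<le> n" for l
      using that
    proof (induction l)
      case 0
      then show ?case using zG by (auto simp: \<Phi>_def supp_def intro!: eq_vecI)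
    next
      case (Suc l)
      then show ?case
        by (auto simp: addG smG siG b \<Phi>add \<Phi>sm \<Phi>single unit_vec_def less_Suc_eq intro!: eq_vecI)
    qed
    from this[of n] have "g \<in> carrier ?G" "\<Phi> g = v" using v by (auto simp: g_def vecs_def)
    then show "\<exists>x\<in>carrier ?G. \<Phi> x = v" by blast
  next
    fix x y assume "x \<in> carrier ?G" "y \<in> carrier ?G"
    then have "(\<lambda>m. y m + (- 1) * x m) \<in> carrier ?G" by (intro addG smG)
    then show "\<exists>d\<in>carrier ?G. y = d \<oplus>\<^bsub>?G\<^esub> x" by (rule bexI[rotated]) simp
  qed (auto simp: \<Phi>V addG smG \<Phi>add \<Phi>sm SigG)
qed

subsection \<open>Cyclic modules\<close>

text \<open>This is the product \<open>\<sigma>\<^sub>q\<^sup>i * L\<close> in the algebra of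
  operators.\<close>

definition twist :: "complex \<Rightarrow> int \<Rightarrow> (int \<Rightarrow> complex fls) \<Rightarrow> int \<Rightarrow> complex fls" where
  "twist q i L = (\<lambda>k. sigma_q (q powi i) (L (k - i)))"

text \<open>The matrix of left multiplication by \<open>\<sigma>\<^sub>q\<close> on the classes of
  its powers 0, ..., n - 1 modulo \<open>L\<close>. The last column rewrites the n-th power by means
  of \<open>L\<close>.\<close>

definition companion :: "nat \<Rightarrow> (int \<Rightarrow> complex fls) \<Rightarrow> complex fls mat" where
  "companion n L = mat n n (\<lambda>(i, j). if Suc j = n then - L (int i) / L (int n) else if i = Suc j then 1 else 0)"

text \<open>In a kernel vector, row 0 kills the last entry because \<open>a 0\<close> is nonzero;
  then row \<open>Suc j\<close> kills entry \<open>j\<close>.\<close>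

lemma det_companion:
  fixes a :: "nat \<Rightarrow> 'a :: field"
  assumes "0 < n \<Longrightarrow> a 0 \<noteq> 0"
  shows "det (mat n n (\<lambda>(i, j). if Suc j = n then a i else if i = Suc j then 1 else 0)) \<noteq> 0"
    (is "det ?A \<noteq> 0")
proof
  assume "det ?A = 0"
  then obtain v where v: "v \<in> carrier_vec n" "v \<noteq> 0\<^sub>v n" "?A *\<^sub>v v = 0\<^sub>v n"
    using det_0_iff_vec_prod_zero[of ?A n] by auto
  have n: "n > 0" using v by (cases n) auto
  then obtain m where m: "n = Suc m" by (cases n) auto
  have row: "(\<Sum>j<n. (if Suc j = n then a i else if i = Suc j then 1 else 0) * v $ j) = 0" if "i < n" for i
    using arg_cong[OF v(3), of "\<lambda>w. w $ i"] that v(1) by (simp add: scalar_prod_def atLeast0LessThan)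
  have vm: "v $ m = 0" using row[of 0] assms m by simp
  have "v $ j = 0" if "j < n" for j
  proof (cases "j = m")
    case False
    then have j: "Suc j < n" using that m by simp
    have "0 = (\<Sum>l<n. (if Suc l = n then a (Suc j) else if Suc j = Suc l then 1 else 0) * v $ l)"
      using row[OF j] by simp
    also have "\<dots> = (\<Sum>l<n. if l = j then v $ j else 0)"
      using vm m False by (intro sum.cong) auto
    also have "\<dots> = v $ j" using that by simp
    finally show ?thesis by simp
  qed (use vm in simp)
  then have "v = 0\<^sub>v n" using v(1) by (intro eq_vecI) auto
  then show False using v(2) by simp
qed

lemma inv_matsI:
  assumes S: "subfld S" and A: "A \<in> mats S n n" "det A \<noteq> 0"
  shows "A \<in> inv_mats S n"
proof -
  have Ac: "A \<in> carrier_mat n n" using A(1) by (rule mats_carrier)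
  obtain B where B: "B \<in> carrier_mat n n" "A * B = 1\<^sub>m n" "B * A = 1\<^sub>m n"
    using det_non_zero_imp_unit[OF Ac A(2), of "()"]
    by (auto simp: Units_def ring_mat_def)
  then show ?thesis using A mats_inverse[OF S A(1) B(1,2)] by (auto simp: inv_mats_def)
qed

lemma companion_inv_mats:
  assumes "L \<in> qop_carrier" "L 0 \<noteq> 0" "L (int n) \<noteq> 0"
  shows "companion n L \<in> inv_mats conv_fls n"
proof (rule inv_matsI[OF subfld_conv_fls])
  have "L i \<in> conv_fls" for i using assms(1) by (simp add: qop_carrier_def K_conv_eq)
  then show "companion n L \<in> mats conv_fls n n"
    using subfld_conv_fls
    by (auto simp: companion_def mats_def divide_inverse subfld_minus subfld_mult subfld_inverse)
  show "det (companion n L) \<noteq> 0"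
    unfolding companion_def by (rule det_companion) (use assms in auto)
qed

text \<open>\<open>\<Phi> P\<close> gives the coordinates of the class of the operator
  \<open>P\<close>. The kernel of \<open>\<Phi>\<close> is the left ideal of \<open>L\<close>, by
  division with remainder from the top. A nonzero \<open>L (int n)\<close> makes the division
  possible, a nonzero \<open>L 0\<close> makes the companion matrix invertible.\<close>

lemma pres_cyclic:
  assumes q: "norm q = 1" and L: "L \<in> qop_carrier" "L 0 \<noteq> 0" "L (int n) \<noteq> 0"
    and supL: "\<And>i. i \<notin> {0..int n} \<Longrightarrow> L i = 0"
  shows "\<exists>h. pres conv_fls q (cyclic_qmod q L) n (companion n L) h"
proof -
  have q0: "q \<noteq> 0" using q by auto
  have S: "subfld conv_fls" by (rule subfld_conv_fls)
  have Q: "qfield q conv_fls" by (rule qfield_conv[OF q])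
  let ?A = "companion n L"
  have A: "?A \<in> inv_mats conv_fls n" by (rule companion_inv_mats[OF L])
  then obtain B where B: "B \<in> mats conv_fls n n" "?A * B = 1\<^sub>m n" "B * ?A = 1\<^sub>m n"
    by (auto simp: inv_mats_def)
  note Ac = inv_mats_carrier[OF A] note Bc = mats_carrier[OF B(1)]

  \<comment> \<open>The module of operators and its map to coordinates\<close>
  let ?G = "qop_qmod q"
  define supp :: "(int \<Rightarrow> complex fls) \<Rightarrow> int set" where "supp P = {i. P i \<noteq> 0}" for P
  have G: "P \<in> carrier ?G \<longleftrightarrow> finite (supp P) \<and> (\<forall>i. P i \<in> conv_fls)" for P
    by (simp add: qop_qmod_def qop_carrier_def supp_def K_conv_eq)
  have GQ: "carrier ?G = qop_carrier" by (simp add: qop_qmod_def)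
  have Gop [simp]: "add ?G = (\<lambda>P R i. P i + R i)" "smult ?G = (\<lambda>a P i. a * P i)"
    by (auto simp: qop_qmod_def)
  have addG: "(\<lambda>m. g m + g' m) \<in> carrier ?G" if "g \<in> carrier ?G" "g' \<in> carrier ?G" for g g'
  proof -
    have "supp (\<lambda>m. g m + g' m) \<subseteq> supp g \<union> supp g'" by (auto simp: supp_def)
    then show ?thesis using that unfolding G by (auto intro: finite_subset subfld_add[OF S])
  qed
  have smG: "(\<lambda>m. a * g m) \<in> carrier ?G" if "a \<in> conv_fls" "g \<in> carrier ?G" for a g
  proof -
    have "supp (\<lambda>m. a * g m) \<subseteq> supp g" by (auto simp: supp_def)
    then show ?thesis using that unfolding G by (auto intro: finite_subset subfld_mult[OF S])
  qed
  have qi: "norm (q powi i) = 1" "q powi i \<noteq> 0" for i using q q0 by (auto simp: norm_power_int)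
  have sig0: "sigma_q (q powi i) f = 0 \<longleftrightarrow> f = 0" for i f
    using sigma_q_inverse(2)[OF qi(2), of i f] by auto
  have twG: "twist q i g \<in> carrier ?G" if "g \<in> carrier ?G" for i g
  proof -
    have "supp (twist q i g) = (\<lambda>k. k + i) ` supp g"
      by (force simp: supp_def twist_def sig0 image_iff intro: exI[of _ "_ - i"])
    then show ?thesis
      using that sigma_q_conv_fls[OF qi(1)] unfolding G by (auto simp: twist_def)
  qed
  \<comment> \<open>\<open>w i\<close> will be the coordinates of the class of
    \<open>\<sigma>\<^sub>q\<^sup>i\<close>, computed for negative \<open>i\<close> with the inverse
    of the semilinear operator.\<close>
  define w :: "int \<Rightarrow> complex fls vec" where "w i =
    (if i \<ge> 0 then ((\<lambda>v. ?A *\<^sub>v sigv q v) ^^ nat i) (unit_vec n 0)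
     else ((\<lambda>v. sigv (inverse q) (B *\<^sub>v v)) ^^ nat (- i)) (unit_vec n 0))" for i
  have TV: "?A *\<^sub>v sigv q v \<in> vecs conv_fls n" if "v \<in> vecs conv_fls n" for v
    by (rule mats_mult_vec[OF S inv_mats_mats[OF A] sigv_vecs[OF Q that]])
  have UV: "sigv (inverse q) (B *\<^sub>v v) \<in> vecs conv_fls n" if "v \<in> vecs conv_fls n" for v
    by (rule sigv_inverse_vecs[OF Q mats_mult_vec[OF S B(1) that]])
  have wV: "w i \<in> vecs conv_fls n" for i
  proof -
    have "((\<lambda>v. ?A *\<^sub>v sigv q v) ^^ m) (unit_vec n 0) \<in> vecs conv_fls n" for m
      by (induction m) (auto intro: TV vecs_unit[OF S])
    moreover have "((\<lambda>v. sigv (inverse q) (B *\<^sub>v v)) ^^ m) (unit_vec n 0) \<in> vecs conv_fls n" for m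
      by (induction m) (auto intro: UV vecs_unit[OF S])
    ultimately show ?thesis by (simp add: w_def)
  qed
  have TU: "?A *\<^sub>v sigv q (sigv (inverse q) (B *\<^sub>v v)) = v" if "v \<in> vecs conv_fls n" for v
    using assoc_mult_mat_vec[OF Ac Bc vecs_carrier[OF that]] vecs_carrier[OF that]
    by (simp add: sigv_sigv_inverse(1)[OF q0] B(2))
  have w_step: "w (i + 1) = ?A *\<^sub>v sigv q (w i)" for i
  proof (cases "i \<ge> 0")
    case True
    then have "nat (i + 1) = Suc (nat i)" by simp
    then show ?thesis using True by (simp add: w_def)
  next
    case False
    then obtain k where k: "nat (- i) = Suc k" by (cases "nat (- i)") auto
    then have ik: "i = - int (Suc k)" "i + 1 = - int k" using False by simp_all
    then have "w (i + 1) = ((\<lambda>v. sigv (inverse q) (B *\<^sub>v v)) ^^ k) (unit_vec n 0)"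
      by (cases "k = 0") (simp_all add: w_def ik(2))
    moreover have "w i = sigv (inverse q) (B *\<^sub>v (((\<lambda>v. sigv (inverse q) (B *\<^sub>v v)) ^^ k) (unit_vec n 0)))"
      by (simp add: w_def ik(1) nat_add_distrib)
    ultimately have "w i = sigv (inverse q) (B *\<^sub>v w (i + 1))" by simp
    then show ?thesis using TU[OF wV] by simp
  qed
  have sig_unit: "sigv q (unit_vec n j) = unit_vec n j" for j
    by (intro eq_vecI) (auto simp: unit_vec_def)
  have w_unit: "w (int j) = unit_vec n j" if "j < n" for j
    using that
  proof (induction j)
    case 0 then show ?case by (simp add: w_def)
  next
    case (Suc j)
    have "w (int (Suc j)) = ?A *\<^sub>v unit_vec n j"
      using w_step[of "int j"] Suc sig_unit by (simp add: add.commute)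
    also have "\<dots> = unit_vec n (Suc j)"
      using Suc.prems Ac by (intro eq_vecI) (auto simp: companion_def)
    finally show ?case .
  qed
  define \<Phi> where "\<Phi> g = vec n (\<lambda>k. \<Sum>i\<in>supp g. g i * w i $ k)" for g
  have \<Phi>_on: "\<Phi> g $ k = (\<Sum>i\<in>F. g i * w i $ k)" if "finite F" "supp g \<subseteq> F" "k < n" for g F k
    using that by (auto simp: \<Phi>_def supp_def intro!: sum.mono_neutral_left)
  have \<Phi>V: "\<Phi> g \<in> vecs conv_fls n" if "g \<in> carrier ?G" for g
    using that wV by (auto simp: \<Phi>_def vecs_def G intro!: subfld_sum[OF S] subfld_mult[OF S])
  have \<Phi>add: "\<Phi> (\<lambda>m. g m + g' m) = \<Phi> g + \<Phi> g'" if "g \<in> carrier ?G" "g' \<in> carrier ?G" for g g'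
  proof (rule eq_vecI)
    fix i assume "i < dim_vec (\<Phi> g + \<Phi> g')"
    then have i: "i < n" by (simp add: \<Phi>_def)
    have f: "finite (supp g \<union> supp g')" using that by (simp add: G)
    have "\<Phi> (\<lambda>m. g m + g' m) $ i = (\<Sum>m\<in>supp g \<union> supp g'. (g m + g' m) * w m $ i)"
      using i f by (intro \<Phi>_on) (auto simp: supp_def)
    also have "\<dots> = \<Phi> g $ i + \<Phi> g' $ i"
      using i f \<Phi>_on[OF f _ i, of g] \<Phi>_on[OF f _ i, of g'] by (simp add: distrib_right sum.distrib)
    finally show "\<Phi> (\<lambda>m. g m + g' m) $ i = (\<Phi> g + \<Phi> g') $ i" using i by (simp add: \<Phi>_def)
  qed (simp add: \<Phi>_def)
  have \<Phi>sm: "\<Phi> (\<lambda>m. a * g m) = a \<cdot>\<^sub>v \<Phi> g" if "g \<in> carrier ?G" for a g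
  proof (rule eq_vecI)
    fix i assume "i < dim_vec (a \<cdot>\<^sub>v \<Phi> g)"
    then have i: "i < n" by (simp add: \<Phi>_def)
    have f: "finite (supp g)" using that by (simp add: G)
    have "\<Phi> (\<lambda>m. a * g m) $ i = (\<Sum>m\<in>supp g. a * g m * w m $ i)"
      using i f by (intro \<Phi>_on) (auto simp: supp_def)
    then show "\<Phi> (\<lambda>m. a * g m) $ i = (a \<cdot>\<^sub>v \<Phi> g) $ i"
      using i by (simp add: \<Phi>_def sum_distrib_left mult.assoc)
  qed (simp add: \<Phi>_def)
  have \<Phi>tw: "\<Phi> (twist q 1 g) = ?A *\<^sub>v sigv q (\<Phi> g)" if g: "g \<in> carrier ?G" for g
  proof (rule eq_vecI)
    fix k assume "k < dim_vec (?A *\<^sub>v sigv q (\<Phi> g))"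
    then have k: "k < n" using Ac by simp
    have f: "finite (supp g)" using g by (simp add: G)
    have sub: "supp (twist q 1 g) \<subseteq> (\<lambda>i. i + 1) ` supp g"
    proof
      fix i assume "i \<in> supp (twist q 1 g)"
      then have "i - 1 \<in> supp g" by (auto simp: supp_def twist_def)
      then show "i \<in> (\<lambda>i. i + 1) ` supp g" using image_eqI[of i "\<lambda>i. i + 1" "i - 1"] by simp
    qed
    have "\<Phi> (twist q 1 g) $ k = (\<Sum>i\<in>(\<lambda>i. i + 1) ` supp g. twist q 1 g i * w i $ k)"
      using f k sub by (intro \<Phi>_on) auto
    also have "\<dots> = (\<Sum>i\<in>supp g. sigma_q q (g i) * w (i + 1) $ k)"
      by (subst sum.reindex) (auto simp: inj_on_def twist_def)
    also have "\<dots> = (\<Sum>i\<in>supp g. \<Sum>j<n. ?A $$ (k, j) * sigma_q q (g i * w i $ j))"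
      using k Ac vecs_dim[OF wV]
      by (auto simp: w_step scalar_prod_def atLeast0LessThan sum_distrib_left sigma_q_mult[OF q0] intro!: sum.cong)
    also have "\<dots> = (\<Sum>j<n. ?A $$ (k, j) * (\<Sum>i\<in>supp g. sigma_q q (g i * w i $ j)))"
      by (subst sum.swap) (simp add: sum_distrib_left)
    also have "\<dots> = (?A *\<^sub>v sigv q (\<Phi> g)) $ k"
      using k Ac by (auto simp: scalar_prod_def atLeast0LessThan \<Phi>_def sigma_q_sum[OF q0] intro!: sum.cong)
    finally show "\<Phi> (twist q 1 g) $ k = (?A *\<^sub>v sigv q (\<Phi> g)) $ k" .
  qed (use Ac in \<open>simp add: \<Phi>_def\<close>)
  have tw_add: "twist q (i + j) g = twist q i (twist q j g)" for i j g
    by (auto simp: twist_def fun_eq_iff sigma_q_nth q0 power_int_add power_int_mult_distrib algebra_simps intro!: fls_eqI)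
  have tw0: "twist q 0 g = g" for g
    by (auto simp: twist_def fun_eq_iff sigma_q_nth intro!: fls_eqI)
  have step0: "\<Phi> (twist q 1 g) = 0\<^sub>v n \<longleftrightarrow> \<Phi> g = 0\<^sub>v n" if g: "g \<in> carrier ?G" for g
  proof
    assume "\<Phi> g = 0\<^sub>v n"
    then show "\<Phi> (twist q 1 g) = 0\<^sub>v n"
      using \<Phi>tw[OF g] semiring_hom.vec_hom_zero[OF sigma_q_hom[OF q0]] Ac by (simp add: mult_mat_zero_vec)
  next
    assume "\<Phi> (twist q 1 g) = 0\<^sub>v n"
    then have "B *\<^sub>v (?A *\<^sub>v sigv q (\<Phi> g)) = 0\<^sub>v n" using \<Phi>tw[OF g] Bc by (simp add: mult_mat_zero_vec)
    then have "sigv q (\<Phi> g) = 0\<^sub>v n"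
      using assoc_mult_mat_vec[OF Bc Ac, of "sigv q (\<Phi> g)"] vecs_carrier[OF \<Phi>V[OF g]] by (simp add: B(3))
    then have "sigv (inverse q) (sigv q (\<Phi> g)) = sigv (inverse q) (0\<^sub>v n)" by simp
    then show "\<Phi> g = 0\<^sub>v n"
      using sigv_sigv_inverse(2)[OF q0] semiring_hom.vec_hom_zero[OF sigma_q_hom, of "inverse q"] q0 by simp
  qed
  \<comment> \<open>The kernel of \<open>\<Phi>\<close> is stable under left multiplication by all
    powers of \<open>\<sigma>\<^sub>q\<close>, negative ones included.\<close>
  have stepi: "\<Phi> (twist q i g) = 0\<^sub>v n \<longleftrightarrow> \<Phi> g = 0\<^sub>v n" if g: "g \<in> carrier ?G" for g i
  proof -
    have nat: "\<Phi> (twist q (int m) g) = 0\<^sub>v n \<longleftrightarrow> \<Phi> g = 0\<^sub>v n" if g: "g \<in> carrier ?G" for g m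
    proof (induction m)
      case (Suc m)
      have "twist q (int (Suc m)) g = twist q 1 (twist q (int m) g)" using tw_add[of 1 "int m" g] by simp
      then show ?case using Suc step0[OF twG[OF g]] by simp
    qed (simp add: tw0)
    show ?thesis
    proof (cases "i \<ge> 0")
      case True then show ?thesis using nat[OF g, of "nat i"] by simp
    next
      case False
      have "twist q (int (nat (- i))) (twist q i g) = g"
        using False tw_add[of "- i" i g] by (simp add: tw0)
      then show ?thesis using nat[OF twG[OF g], of "nat (- i)" i] by simp
    qed
  qed
  have LG: "L \<in> carrier ?G" using L(1) by (simp add: GQ)
  have \<Phi>L: "\<Phi> L = 0\<^sub>v n"
  proof (rule eq_vecI)
    fix k assume "k < dim_vec (0\<^sub>v n :: complex fls vec)"
    then have k: "k < n" by simp
    \<comment> \<open>\<open>w n\<close> is the last column of the companion matrix; this is what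
      makes the leading term of \<open>L\<close> cancel against the others.\<close>
    have wn: "w (int n) $ k = - L (int k) / L (int n)"
    proof -
      obtain m where m: "n = Suc m" using k by (cases n) auto
      have "w (int n) = ?A *\<^sub>v unit_vec n m"
        using w_step[of "int m"] w_unit[of m] sig_unit m by (simp add: add.commute)
      then show ?thesis using k m Ac by (simp add: companion_def)
    qed
    have "\<Phi> L $ k = (\<Sum>i\<in>int ` {..n}. L i * w i $ k)"
    proof (rule \<Phi>_on)
      show "supp L \<subseteq> int ` {..n}"
      proof
        fix i assume "i \<in> supp L"
        then have "i \<in> {0..int n}" using supL by (auto simp: supp_def)
        then show "i \<in> int ` {..n}" by (auto intro: image_eqI[of _ _ "nat i"])
      qed
    qed (use k in auto)
    also have "\<dots> = (\<Sum>i<n. L (int i) * w (int i) $ k) + L (int n) * w (int n) $ k"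
      by (subst sum.reindex) (auto simp: lessThan_Suc_atMost[symmetric])
    also have "(\<Sum>i<n. L (int i) * w (int i) $ k) = (\<Sum>i<n. if i = k then L (int k) else 0)"
      using k by (intro sum.cong) (auto simp: w_unit)
    also have "\<dots> + L (int n) * w (int n) $ k = 0" using k L(3) by (simp add: wn)
    finally show "\<Phi> L $ k = 0\<^sub>v n $ k" using k by simp
  qed (simp add: \<Phi>_def)

  \<comment> \<open>The kernel as the left ideal generated by \<open>L\<close>\<close>
  have mult_tw: "qop_mult q P L = (\<lambda>k. \<Sum>i\<in>supp P. P i * twist q i L k)" for P
    by (simp add: qop_mult_def twist_def supp_def)
  have mult_on: "qop_mult q P L = (\<lambda>k. \<Sum>i\<in>F. P i * twist q i L k)" if "finite F" "supp P \<subseteq> F" for P F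
    unfolding mult_tw using that by (intro ext sum.mono_neutral_left) (auto simp: supp_def)
  define H where "H = {qop_mult q P L | P. P \<in> qop_carrier}"
  have sum_ker: "(\<lambda>k. \<Sum>i\<in>F. P i * twist q i L k) \<in> carrier ?G \<and> \<Phi> (\<lambda>k. \<Sum>i\<in>F. P i * twist q i L k) = 0\<^sub>v n"
    if "finite F" "\<And>i. P i \<in> conv_fls" for F P
    using that(1)
  proof (induction F)
    case empty
    then show ?case using subfld_zero[OF S] by (auto simp: G supp_def \<Phi>_def)
  next
    case (insert i F)
    have 1: "(\<lambda>k. P i * twist q i L k) \<in> carrier ?G" by (intro smG twG LG that)
    have 2: "\<Phi> (\<lambda>k. P i * twist q i L k) = 0\<^sub>v n"
      using \<Phi>sm[OF twG[OF LG], of "P i" i] stepi[OF LG, of i] \<Phi>L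
      by (auto intro!: eq_vecI)
    show ?case using insert addG[OF 1, of "\<lambda>k. \<Sum>i\<in>F. P i * twist q i L k"]
        \<Phi>add[OF 1, of "\<lambda>k. \<Sum>i\<in>F. P i * twist q i L k"] 2 by simp
  qed
  have H_ker: "g \<in> carrier ?G \<and> \<Phi> g = 0\<^sub>v n" if "g \<in> H" for g
    using that sum_ker unfolding H_def mult_tw by (auto simp: GQ[symmetric] G)
  \<comment> \<open>Changes a single coefficient of the left factor, which is how quotient terms are
    collected during the division.\<close>
  have H_add: "(\<lambda>k. g k + c * twist q i L k) \<in> H" if g: "g \<in> H" and c: "c \<in> conv_fls" for g c i
  proof -
    obtain P where P: "P \<in> qop_carrier" "g = qop_mult q P L" using g by (auto simp: H_def)
    define P' where "P' = P(i := P i + c)"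
    have PG: "P \<in> carrier ?G" using P by (simp add: GQ)
    then have fin: "finite (supp P)" by (simp add: G)
    have sup': "supp P' \<subseteq> insert i (supp P)" by (auto simp: P'_def supp_def)
    have P'G: "P' \<in> carrier ?G"
      unfolding G using PG sup' fin c by (auto simp: P'_def G subfld_add[OF S] intro: finite_subset)
    have "qop_mult q P' L k = g k + c * twist q i L k" for k
    proof -
      have "qop_mult q P' L k = (\<Sum>j\<in>insert i (supp P). P' j * twist q j L k)"
        using mult_on[OF _ sup'] fin by simp
      also have "\<dots> = (\<Sum>j\<in>insert i (supp P). P j * twist q j L k + (if j = i then c * twist q i L k else 0))"
        by (intro sum.cong) (auto simp: P'_def algebra_simps)
      also have "\<dots> = (\<Sum>j\<in>insert i (supp P). P j * twist q j L k) + c * twist q i L k"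
        using fin by (simp add: sum.distrib)
      also have "\<dots> = g k + c * twist q i L k"
        using fun_cong[OF mult_on[OF finite.insertI[OF fin] subset_insertI], of k i] P(2) by simp
      finally show ?thesis .
    qed
    then show ?thesis using P'G unfolding H_def GQ by (auto intro!: exI[of _ P'])
  qed
  \<comment> \<open>Induction on the excess \<open>N\<close> of the width of the support over
    \<open>n\<close>. Without excess, a shift moves the support into 0, ..., n - 1, where the
    \<open>w i\<close> are unit vectors, so an operator in the kernel vanishes. Otherwise a multiple
    of a twist of \<open>L\<close> removes the top coefficient.\<close>
  have ker_H: "\<forall>P\<in>carrier ?G. \<Phi> P = 0\<^sub>v n \<longrightarrow> (\<forall>i. P i \<noteq> 0 \<longrightarrow> s \<le> i \<and> i < s + int n + int N) \<longrightarrow> P \<in> H" for s N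
  proof (induction N)
    case 0
    show ?case
    proof (intro ballI impI)
      fix P assume P: "P \<in> carrier ?G" "\<Phi> P = 0\<^sub>v n" "\<forall>i. P i \<noteq> 0 \<longrightarrow> s \<le> i \<and> i < s + int n + int 0"
      define R where "R = twist q (- s) P"
      have R: "R \<in> carrier ?G" "\<Phi> R = 0\<^sub>v n"
        using twG[OF P(1)] stepi[OF P(1)] P(2) by (auto simp: R_def)
      have supR: "supp R \<subseteq> int ` {..<n}"
      proof
        fix i assume "i \<in> supp R"
        then have "P (i + s) \<noteq> 0" by (auto simp: R_def twist_def supp_def)
        then have "0 \<le> i" "i < int n" using P(3)[rule_format, of "i + s"] by simp_all
        then show "i \<in> int ` {..<n}" by (auto intro: image_eqI[of _ _ "nat i"])
      qed
      have Rk: "R (int k) = 0" if k: "k < n" for k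
      proof -
        have "0 = \<Phi> R $ k" using R(2) k by simp
        also have "\<dots> = (\<Sum>i\<in>int ` {..<n}. R i * w i $ k)" using supR k by (intro \<Phi>_on) auto
        also have "\<dots> = (\<Sum>i<n. if i = k then R (int k) else 0)"
          by (subst sum.reindex, simp, unfold o_def, intro sum.cong) (auto simp: w_unit k)
        also have "\<dots> = R (int k)" using k by simp
        finally show ?thesis by simp
      qed
      have Pz: "P = (\<lambda>i. 0)"
      proof
        fix i
        show "P i = 0"
        proof (rule ccontr)
          assume nz: "P i \<noteq> 0"
          then have "R (i - s) \<noteq> 0" using sig0 by (simp add: R_def twist_def)
          moreover from this have "i - s \<in> int ` {..<n}" using supR by (auto simp: supp_def)
          ultimately show False using Rk by auto
        qed
      qed
      have "qop_mult q (\<lambda>i. 0) L \<in> H" unfolding H_def GQ[symmetric] using subfld_zero[OF S] by (auto simp: G supp_def)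
      then show "P \<in> H" using Pz by (simp add: qop_mult_def)
    qed
  next
    case (Suc N)
    show ?case
    proof (intro ballI impI)
      fix P assume P: "P \<in> carrier ?G" "\<Phi> P = 0\<^sub>v n" "\<forall>i. P i \<noteq> 0 \<longrightarrow> s \<le> i \<and> i < s + int n + int (Suc N)"
      \<comment> \<open>\<open>t\<close> is the highest index allowed for \<open>P\<close>, and
        \<open>T\<close> is \<open>L\<close> shifted so that its leading term sits there.\<close>
      define t where "t = s + int n + int N"
      define T where "T = twist q (t - int n) L"
      have Tt: "T t \<noteq> 0" using sig0 L(3) by (simp add: T_def twist_def)
      have TG: "T \<in> carrier ?G" unfolding T_def by (rule twG[OF LG])
      have T0: "\<Phi> T = 0\<^sub>v n" unfolding T_def using stepi[OF LG] \<Phi>L by simp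
      define c where "c = P t / T t"
      have c: "c \<in> conv_fls" "- c \<in> conv_fls"
        using P(1) TG unfolding G c_def divide_inverse
        by (auto intro!: subfld_minus[OF S] subfld_mult[OF S] subfld_inverse[OF S])
      define R where "R = (\<lambda>k. P k + (- c) * T k)"
      have cT: "(\<lambda>k. (- c) * T k) \<in> carrier ?G" by (rule smG[OF c(2) TG])
      have R: "R \<in> carrier ?G" unfolding R_def by (rule addG[OF P(1) cT])
      have "\<Phi> R = 0\<^sub>v n"
        unfolding R_def \<Phi>add[OF P(1) cT] \<Phi>sm[OF TG] P(2) T0 by (auto intro!: eq_vecI)
      moreover have "s \<le> i \<and> i < s + int n + int N" if "R i \<noteq> 0" for i
      proof -
        have "i \<noteq> t" using that Tt by (auto simp: R_def c_def)
        moreover have "s \<le> i \<and> i \<le> t"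
        proof (cases "P i = 0")
          case True
          then have "T i \<noteq> 0" using that by (auto simp: R_def)
          then have "L (i - (t - int n)) \<noteq> 0" by (auto simp: T_def twist_def)
          then have "i - (t - int n) \<in> {0..int n}" using supL by blast
          then show ?thesis by (auto simp: t_def)
        next
          case False then show ?thesis using P(3) by (force simp: t_def)
        qed
        ultimately show ?thesis by (auto simp: t_def)
      qed
      ultimately have "R \<in> H" using Suc R by blast
      then have "(\<lambda>k. R k + c * twist q (t - int n) L k) \<in> H" by (rule H_add[OF _ c(1)])
      then show "P \<in> H" by (simp add: R_def T_def)
    qed
  qed
  show ?thesis
    unfolding cyclic_qmod_def
  proof (rule pres_quot[OF A S, where \<Phi> = \<Phi>])
    show "{qop_mult q P L | P. P \<in> qop_carrier} = {x \<in> carrier ?G. \<Phi> x = 0\<^sub>v n}"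
    proof
      show "{qop_mult q P L | P. P \<in> qop_carrier} \<subseteq> {x \<in> carrier ?G. \<Phi> x = 0\<^sub>v n}"
        using H_ker unfolding H_def by blast
      show "{x \<in> carrier ?G. \<Phi> x = 0\<^sub>v n} \<subseteq> {qop_mult q P L | P. P \<in> qop_carrier}"
      proof safe
        fix P assume P: "P \<in> carrier ?G" "\<Phi> P = 0\<^sub>v n"
        then have fin: "finite (supp P)" by (simp add: G)
        obtain s where s: "\<forall>i\<in>supp P. s \<le> i" using fin by (meson bdd_below.unfold bdd_below_finite)
        obtain u where u: "\<forall>i\<in>supp P. i \<le> u" using fin by (meson bdd_above.unfold bdd_above_finite)
        have "\<forall>i. P i \<noteq> 0 \<longrightarrow> s \<le> i \<and> i < s + int n + int (nat (u - s + 1))"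
          using s u by (force simp: supp_def)
        then have "P \<in> H" using ker_H P by blast
        then show "\<exists>R. P = qop_mult q R L \<and> R \<in> qop_carrier" by (auto simp: H_def)
      qed
    qed
  next
    fix v assume v: "v \<in> vecs conv_fls n"
    define P where "P i = (if 0 \<le> i \<and> i < int n then v $ nat i else 0)" for i
    have sup: "supp P \<subseteq> int ` {..<n}"
      by (auto simp: supp_def P_def split: if_splits intro: image_eqI[of _ _ "nat _"])
    have PG: "P \<in> carrier ?G"
      unfolding G using v finite_subset[OF sup] subfld_zero[OF S] by (auto simp: P_def vecs_def)
    have "\<Phi> P = v"
    proof (rule eq_vecI)
      fix k assume "k < dim_vec v"
      then have k: "k < n" using v by (simp add: vecs_dim)
      have "\<Phi> P $ k = (\<Sum>i\<in>int ` {..<n}. P i * w i $ k)" using sup k by (intro \<Phi>_on) auto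
      also have "\<dots> = (\<Sum>i<n. if i = k then v $ k else 0)"
        by (subst sum.reindex, simp, unfold o_def, intro sum.cong) (auto simp: w_unit k P_def)
      finally show "\<Phi> P $ k = v $ k" using k by simp
    qed (use v in \<open>simp add: \<Phi>_def vecs_dim\<close>)
    then show "\<exists>x\<in>carrier ?G. \<Phi> x = v" using PG by blast
  next
    fix x y assume x: "x \<in> carrier ?G" and y: "y \<in> carrier ?G"
    have "- 1 \<in> conv_fls" using subfld_minus[OF S subfld_one[OF S]] .
    then have "(\<lambda>m. y m + (- 1) * x m) \<in> carrier ?G" using x y by (intro addG smG)
    then show "\<exists>d\<in>carrier ?G. y = d \<oplus>\<^bsub>?G\<^esub> x" by (rule bexI[rotated]) simp
  next
    fix x assume x: "x \<in> carrier ?G"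
    have "Sig ?G x = twist q 1 x"
      by (auto simp: qop_qmod_def qop_mult_def single_def twist_def fun_eq_iff)
    then show "Sig ?G x \<in> carrier ?G \<and> \<Phi> (Sig ?G x) = ?A *\<^sub>v sigv q (\<Phi> x)"
      using twG[OF x] \<Phi>tw[OF x] by simp
  qed (auto simp: \<Phi>V addG smG \<Phi>add \<Phi>sm)
qed

text \<open>A power of \<open>\<sigma>\<^sub>q\<close> is a unit in the algebra of operators, so
  \<open>L\<close> and its twist generate the same left ideal.\<close>

lemma cyclic_qmod_shift:
  assumes q: "q \<noteq> 0"
  shows "cyclic_qmod q (twist q (- a) L) = cyclic_qmod q L"
proof -
  \<comment> \<open>The left factor on the right-hand side is \<open>P\<close> times
    \<open>\<sigma>\<^sub>q\<^sup>b\<close>.\<close>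
  have eq: "qop_mult q P (twist q b L) = qop_mult q (\<lambda>j. P (j - b)) L" for P b L
  proof
    fix k
    have "qop_mult q P (twist q b L) k = (\<Sum>i | P i \<noteq> 0. P i * sigma_q (q powi (i + b)) (L (k - (i + b))))"
      unfolding qop_mult_def twist_def using q
      by (intro sum.cong refl arg_cong2[of _ _ _ _ "(*)"] fls_eqI) (auto simp: sigma_q_nth power_int_add power_int_mult_distrib algebra_simps)
    also have "\<dots> = (\<Sum>j\<in>(\<lambda>i. i + b) ` {i. P i \<noteq> 0}. P (j - b) * sigma_q (q powi j) (L (k - j)))"
      by (subst sum.reindex) (auto simp: inj_on_def)
    also have "(\<lambda>i. i + b) ` {i. P i \<noteq> 0} = {j. P (j - b) \<noteq> 0}"
      by (force simp: image_iff intro: exI[of _ "_ - b"])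
    finally show "qop_mult q P (twist q b L) k = qop_mult q (\<lambda>j. P (j - b)) L k" by (simp add: qop_mult_def)
  qed
  have sh: "(\<lambda>j. P (j - b)) \<in> qop_carrier" if P: "P \<in> qop_carrier" for P b
  proof -
    have "{j. P (j - b) \<noteq> 0} = (\<lambda>i. i + b) ` {i. P i \<noteq> 0}"
      by (force simp: image_iff intro: exI[of _ "_ - b"])
    then show ?thesis using P by (simp add: qop_carrier_def)
  qed
  have "{qop_mult q P (twist q (- a) L) | P. P \<in> qop_carrier} = {qop_mult q P L | P. P \<in> qop_carrier}"
  proof safe
    fix P :: "int \<Rightarrow> complex fls" assume "P \<in> qop_carrier"
    then show "\<exists>R. qop_mult q P (twist q (- a) L) = qop_mult q R L \<and> R \<in> qop_carrier"
      using eq[of P "- a" L] sh[of P "- a"] by blast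
    have "qop_mult q (\<lambda>j. P (j - a)) (twist q (- a) L) = qop_mult q P L"
      by (simp add: eq)
    then show "\<exists>R. qop_mult q P L = qop_mult q R (twist q (- a) L) \<and> R \<in> qop_carrier"
      using sh[of P a] \<open>P \<in> qop_carrier\<close> by metis
  qed
  then show ?thesis by (simp add: cyclic_qmod_def)
qed

section \<open>Geometric growth and small divisors\<close>

text \<open>One constant, at least 1, with exponent \<open>Suc n\<close> makes closure under
  products and shifts immediate. For complex sequences the notion is positivity of the radius of
  convergence (\<open>geo_conv_radius\<close>).\<close>

definition geo :: "(nat \<Rightarrow> 'a::real_normed_vector) \<Rightarrow> bool" where
  "geo f \<longleftrightarrow> (\<exists>C\<ge>1. \<forall>n. norm (f n) \<le> C ^ Suc n)"

lemma geoI: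
  assumes "\<And>n. norm (f n) \<le> K * r ^ n" shows "geo f"
proof -
  define C where "C = max 1 (max K r)"
  have "\<bar>r\<bar> ^ 0 = 1" by simp
  have "norm (f n) \<le> (max 1 (\<bar>K\<bar>)) * (max 1 \<bar>r\<bar>) ^ n" for n
  proof -
    have "norm (f n) \<le> \<bar>K * r ^ n\<bar>" using assms[of n] by linarith
    also have "\<dots> = \<bar>K\<bar> * \<bar>r\<bar> ^ n" by (simp add: abs_mult power_abs)
    also have "\<dots> \<le> (max 1 (\<bar>K\<bar>)) * (max 1 \<bar>r\<bar>) ^ n"
      by (intro mult_mono power_mono) auto
    finally show ?thesis .
  qed
  moreover have "(max 1 (\<bar>K\<bar>)) * (max 1 \<bar>r\<bar>) ^ n \<le> (max 1 (\<bar>K\<bar>) * (max 1 \<bar>r\<bar>)) ^ Suc n" for n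
  proof -
    have "(max 1 \<bar>K\<bar>) ^ 1 \<le> (max 1 \<bar>K\<bar>) ^ Suc n" by (rule power_increasing) auto
    moreover have "(max 1 \<bar>r\<bar>) ^ n \<le> (max 1 \<bar>r\<bar>) ^ Suc n" by (rule power_increasing) auto
    ultimately show ?thesis unfolding power_mult_distrib by (intro mult_mono) auto
  qed
  moreover have "1 \<le> max 1 (\<bar>K\<bar>) * (max 1 \<bar>r\<bar>)"
    using mult_mono[of 1 "max 1 \<bar>K\<bar>" 1 "max 1 \<bar>r\<bar>"] by simp
  ultimately show ?thesis unfolding geo_def using order_trans by blast
qed

lemma geo_mono: "geo f \<Longrightarrow> (\<And>n. norm (g n) \<le> norm (f n)) \<Longrightarrow> geo g"
  unfolding geo_def using order_trans by blast

lemma geo_mult: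
  fixes f g :: "nat \<Rightarrow> 'a::real_normed_algebra"
  assumes "geo f" "geo g" shows "geo (\<lambda>n. f n * g n)"
proof -
  obtain C D where C: "C \<ge> 1" "\<And>n. norm (f n) \<le> C ^ Suc n" and D: "D \<ge> 1" "\<And>n. norm (g n) \<le> D ^ Suc n"
    using assms by (auto simp: geo_def)
  have "norm (f n * g n) \<le> (C * D) * (C * D) ^ n" for n
  proof -
    have "norm (f n * g n) \<le> norm (f n) * norm (g n)" by (rule norm_mult_ineq)
    also have "\<dots> \<le> C ^ Suc n * D ^ Suc n" using C D by (intro mult_mono) auto
    also have "\<dots> = (C * D) * (C * D) ^ n" by (simp add: power_mult_distrib)
    finally show ?thesis .
  qed
  then show ?thesis by (rule geoI)
qed

lemma geo_const: "geo (\<lambda>n. c)"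
  by (rule geoI[of _ "norm c" 1]) simp

lemma geo_prod:
  fixes f :: "'i \<Rightarrow> nat \<Rightarrow> 'a::{real_normed_algebra_1, comm_monoid_mult}"
  shows "(\<And>i. i \<in> I \<Longrightarrow> geo (f i)) \<Longrightarrow> geo (\<lambda>n. \<Prod>i\<in>I. f i n)"
  by (induction I rule: infinite_finite_induct) (auto simp: geo_const geo_mult)

lemma geo_power:
  fixes f :: "nat \<Rightarrow> 'a::real_normed_algebra_1"
  shows "geo f \<Longrightarrow> geo (\<lambda>n. f n ^ k)"
  by (induction k) (auto simp: geo_const geo_mult)

lemma geo_shift:
  assumes "geo f" shows "geo (\<lambda>n. f (n + k))"
proof -
  obtain C where C: "C \<ge> 1" "\<And>n. norm (f n) \<le> C ^ Suc n" using assms by (auto simp: geo_def)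
  have "norm (f (n + k)) \<le> C ^ Suc k * C ^ n" for n
    using C(2)[of "n + k"] by (simp add: power_add mult_ac)
  then show ?thesis by (rule geoI)
qed

lemma geo_unshift:
  assumes "geo (\<lambda>n. f (Suc n))" shows "geo f"
proof -
  obtain C where C: "C \<ge> 1" "\<And>n. norm (f (Suc n)) \<le> C ^ Suc n" using assms by (auto simp: geo_def)
  have "norm (f n) \<le> max 1 (norm (f 0)) * C ^ n" for n
  proof (cases n)
    case (Suc m)
    have "norm (f n) \<le> 1 * C ^ n" using C(2)[of m] Suc by simp
    also have "\<dots> \<le> max 1 (norm (f 0)) * C ^ n" using C(1) by (intro mult_right_mono) auto
    finally show ?thesis .
  qed simp
  then show ?thesis by (rule geoI)
qed

lemma geo_finite_support:
  assumes "\<And>m. m > N \<Longrightarrow> f m = 0" shows "geo f"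
proof (rule geoI[of f "\<Sum>k\<le>N. norm (f k)" 1])
  fix m
  show "norm (f m) \<le> (\<Sum>k\<le>N. norm (f k)) * 1 ^ m"
  proof (cases "m \<le> N")
    case True
    then show ?thesis by (auto intro!: member_le_sum)
  next
    case False
    then show ?thesis using assms[of m] by (auto intro!: sum_nonneg)
  qed
qed

lemma geo_conv_radius:
  fixes f :: "nat \<Rightarrow> complex"
  shows "geo f \<longleftrightarrow> conv_radius f > 0"
proof
  assume "geo f"
  then obtain C where C: "C \<ge> 1" "\<And>n. norm (f n) \<le> C ^ Suc n" by (auto simp: geo_def)
  \<comment> \<open>At a point of modulus 1 / (2 C) the terms decay like powers of 1/2.\<close>
  define z :: complex where "z = of_real (1 / (2 * C))"
  have z: "norm z = 1 / (2 * C)" using C(1) by (simp add: z_def norm_divide)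
  have "summable (\<lambda>n. f n * z ^ n)"
  proof (rule summable_comparison_test')
    show "summable (\<lambda>n. C * (1 / 2) ^ n)" by (intro summable_mult summable_geometric) simp
    fix n :: nat
    have "norm (f n * z ^ n) \<le> C ^ Suc n * (1 / (2 * C)) ^ n"
      using C z by (simp add: norm_mult norm_power mult_right_mono)
    also have "\<dots> = C * (1 / 2) ^ n"
      using C(1) by (simp add: power_divide power_mult_distrib field_simps)
    finally show "norm (f n * z ^ n) \<le> C * (1 / 2) ^ n" .
  qed
  then have "conv_radius f \<ge> norm z" by (rule conv_radius_geI)
  moreover have "ereal (norm z) > 0" using C(1) z by simp
  ultimately show "conv_radius f > 0" by (rule less_le_trans[rotated])
next
  assume "conv_radius f > 0"
  then obtain r where r: "0 < ereal r" "ereal r < conv_radius f" using ereal_dense2 by blast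
  then have "summable (\<lambda>n. f n * of_real r ^ n)" by (intro summable_in_conv_radius) simp
  then have "Bseq (\<lambda>n. f n * of_real r ^ n)" by (rule convergent_imp_Bseq[OF convergentI[OF summable_LIMSEQ_zero]])
  then obtain K where K: "\<And>n. norm (f n * of_real r ^ n) \<le> K" by (auto simp: Bseq_def)
  have "norm (f n) \<le> K * (1 / r) ^ n" for n
    using K[of n] r(1) by (simp add: norm_mult norm_power power_divide field_simps)
  then show "geo f" by (rule geoI)
qed

text \<open>The polar part of a Laurent series is finite, so convergence concerns the coefficients
  of nonnegative index only.\<close>

lemma conv_fls_geo: "f \<in> conv_fls \<longleftrightarrow> geo (\<lambda>n. fls_nth f (int n))"
  by (simp add: conv_fls_def geo_conv_radius fls_conv_radius_def fps_conv_radius_def)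

section \<open>Pochhammer symbols and individual small divisors\<close>

lemma qpoch_Suc: "qpoch q a (Suc n) = qpoch q a n * (1 - q ^ n * a)"
  by (simp add: qpoch_def)

lemma qpoch_Suc': "qpoch q a (Suc n) = (1 - a) * qpoch q (q * a) n"
  unfolding qpoch_def by (subst prod.lessThan_Suc_shift) (simp add: mult_ac)

text \<open>Since |q| = 1, every factor has modulus at most 1 + |a|. This upper bound allows
  unwanted factors in a product of reciprocals to be cancelled.\<close>

lemma geo_qpoch:
  assumes "norm q = 1" shows "geo (qpoch q a)"
proof -
  have "norm (qpoch q a n) \<le> 1 * (1 + norm a) ^ n" for n
  proof -
    have "norm (qpoch q a n) = (\<Prod>k<n. norm (1 - q ^ k * a))" by (simp add: qpoch_def prod_norm)
    also have "\<dots> \<le> (\<Prod>k<n. 1 + norm a)"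
    proof (intro prod_mono conjI)
      fix k show "norm (1 - q ^ k * a) \<le> 1 + norm a"
        using norm_triangle_ineq4[of 1 "q ^ k * a"] assms by (simp add: norm_mult norm_power)
    qed auto
    finally show ?thesis by simp
  qed
  then show ?thesis by (rule geoI)
qed

text \<open>Growth of the individual reciprocals, not of their products. This is what a perturbed
  module detects, and it depends only on the class of \<open>a\<close>
  (\<open>small_div_powi\<close>).\<close>

definition small_div :: "complex \<Rightarrow> complex \<Rightarrow> bool" where
  "small_div q a \<longleftrightarrow> geo (\<lambda>n. 1 / (1 - q ^ n * a))"

text \<open>The reciprocal of one divisor is a quotient of two consecutive symbols: (a; q)_n divided
  by the next one.\<close>

lemma small_div_if_geo_qpoch:
  assumes "norm q = 1" "geo (\<lambda>n. 1 / qpoch q a n)" "\<And>n. qpoch q a n \<noteq> 0"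
  shows "small_div q a"
proof -
  have "(\<lambda>n. 1 / (1 - q ^ n * a)) = (\<lambda>n. qpoch q a n * (1 / qpoch q a (n + 1)))"
    using assms(3) by (auto simp: qpoch_Suc fun_eq_iff)
  then show ?thesis
    unfolding small_div_def using geo_mult[OF geo_qpoch[OF assms(1)] geo_shift[OF assms(2), of 1]] by simp
qed

text \<open>Induction on \<open>n\<close> through
  \<open>(1 - q\<^sup>n) / (a; q)\<^sub>n\<^sub>+\<^sub>1 = 1 / (a; q)\<^sub>n - q\<^sup>n / (q a; q)\<^sub>n\<close>, a partial fraction expansion in disguise: the only
  products of small divisors that enter are those of \<open>(q; q)\<^sub>n\<close>.\<close>

lemma geo_qpoch_if_small_div:
  assumes q: "norm q = 1" and nr: "\<And>n. n > 0 \<Longrightarrow> q ^ n \<noteq> 1" and qq: "geo (\<lambda>n. 1 / qpoch q q n)"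
    and sd: "small_div q a" and nz: "\<And>n. q ^ n * a \<noteq> 1"
  shows "geo (\<lambda>n. 1 / qpoch q a n)"
proof -
  obtain C where C: "C \<ge> 1" "\<And>n. norm (1 / (1 - q ^ n * a)) \<le> C ^ Suc n"
    using sd by (auto simp: small_div_def geo_def)
  have nzq: "qpoch q (q ^ j * a) n \<noteq> 0" for j n
  proof -
    have "1 - q ^ k * (q ^ j * a) \<noteq> 0" for k using nz[of "k + j"] by (auto simp: power_add mult_ac)
    then show ?thesis by (simp add: qpoch_def)
  qed
  have nzp: "qpoch q q n \<noteq> 0" for n
  proof -
    have "1 - q ^ k * q \<noteq> 0" for k using nr[of "Suc k"] by (auto simp: mult_ac)
    then show ?thesis by (simp add: qpoch_def)
  qed
  \<comment> \<open>The recursion also involves \<open>q * a\<close> in place of \<open>a\<close>,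
    so the bound is proved for all shifts \<open>j\<close> at once. The factor 2 per step counts the
    two terms of the recursion, and only the exponent of \<open>C\<close> sees the shift.\<close>
  have *: "norm (1 / qpoch q (q ^ j * a) (Suc n)) \<le> 2 ^ n * C ^ Suc (n + j) * norm (1 / qpoch q q n)" for n j
  proof (induction n arbitrary: j)
    case 0
    then show ?case using C(2)[of j] by (simp add: qpoch_def)
  next
    case (Suc n)
    let ?b = "q ^ j * a"
    have d: "1 - q ^ Suc n \<noteq> 0" using nr[of "Suc n"] by auto
    have b1: "1 - ?b \<noteq> 0" using nz[of j] by auto
    have eq: "1 / qpoch q ?b (Suc (Suc n)) =
        (1 / qpoch q ?b (Suc n) - q ^ Suc n * (1 / qpoch q (q * ?b) (Suc n))) / (1 - q ^ Suc n)"
    proof -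
      let ?X = "qpoch q ?b (Suc (Suc n))"
      have X: "?X \<noteq> 0" by (rule nzq)
      have 1: "1 / qpoch q ?b (Suc n) = (1 - q ^ Suc n * ?b) / ?X"
        using nzq[of j "Suc n"] X by (simp add: qpoch_Suc[of q ?b "Suc n"])
      have 2: "1 / qpoch q (q * ?b) (Suc n) = (1 - ?b) / ?X"
        using X b1 by (simp add: qpoch_Suc'[of q ?b "Suc n"])
      have "1 / qpoch q ?b (Suc n) - q ^ Suc n * (1 / qpoch q (q * ?b) (Suc n)) = (1 - q ^ Suc n) / ?X"
      proof -
        have "(1 - q ^ Suc n * ?b) - q ^ Suc n * (1 - ?b) = 1 - q ^ Suc n" by (simp add: algebra_simps)
        then show ?thesis unfolding 1 2 by (simp only: times_divide_eq_right flip: diff_divide_distrib)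
      qed
      then show ?thesis using d by simp
    qed
    have "norm (1 / qpoch q ?b (Suc (Suc n))) \<le>
        (norm (1 / qpoch q ?b (Suc n)) + norm (1 / qpoch q (q * ?b) (Suc n))) / norm (1 - q ^ Suc n)"
      unfolding eq norm_divide using q
      by (intro divide_right_mono order_trans[OF norm_triangle_ineq4])
        (auto simp: norm_mult norm_power norm_divide)
    also have "\<dots> \<le> (2 ^ n * C ^ Suc (n + j) * norm (1 / qpoch q q n) +
        2 ^ n * C ^ Suc (n + Suc j) * norm (1 / qpoch q q n)) / norm (1 - q ^ Suc n)"
      using Suc[of j] Suc[of "Suc j"] by (intro divide_right_mono add_mono) (auto simp: mult.assoc)
    also have "\<dots> \<le> (2 ^ n * C ^ Suc (n + Suc j) * norm (1 / qpoch q q n) +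
        2 ^ n * C ^ Suc (n + Suc j) * norm (1 / qpoch q q n)) / norm (1 - q ^ Suc n)"
      using C(1) by (intro divide_right_mono add_mono mult_right_mono mult_left_mono power_increasing) auto
    also have "\<dots> = 2 ^ Suc n * C ^ Suc (Suc n + j) * (norm (1 / qpoch q q n) / norm (1 - q ^ Suc n))"
      by simp
    also have "norm (1 / qpoch q q n) / norm (1 - q ^ Suc n) = norm (1 / qpoch q q (Suc n))"
      by (simp add: qpoch_Suc norm_divide norm_mult mult_ac)
    finally show ?case .
  qed
  have g1: "geo (\<lambda>n. 2 ^ n * C ^ Suc n)"
    by (rule geoI[of _ C "2 * C"]) (use C(1) in \<open>auto simp: power_mult_distrib abs_mult\<close>)
  have g2: "geo (\<lambda>n. norm (1 / qpoch q q n))"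
    by (rule geo_mono[OF qq]) simp
  have "geo (\<lambda>n. (2 ^ n * C ^ Suc n) * norm (1 / qpoch q q n))" by (rule geo_mult[OF g1 g2])
  then have "geo (\<lambda>n. 1 / qpoch q a (Suc n))"
    by (rule geo_mono) (use *[of 0] C(1) in \<open>auto simp: abs_mult\<close>)
  then show ?thesis by (rule geo_unshift)
qed

lemma small_div_shift:
  assumes "small_div q (q * a)" shows "small_div q a"
proof -
  have "(\<lambda>n. 1 / (1 - q ^ Suc n * a)) = (\<lambda>n. 1 / (1 - q ^ n * (q * a)))" by (simp add: mult_ac)
  then show ?thesis using assms geo_unshift[of "\<lambda>n. 1 / (1 - q ^ n * a)"] by (simp add: small_div_def)
qed

lemma small_div_shift':
  assumes "small_div q a" shows "small_div q (q * a)"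
proof -
  have "(\<lambda>n. 1 / (1 - q ^ (n + 1) * a)) = (\<lambda>n. 1 / (1 - q ^ n * (q * a)))" by (simp add: mult_ac)
  then show ?thesis using geo_shift[of "\<lambda>n. 1 / (1 - q ^ n * a)" 1] assms by (simp add: small_div_def)
qed

text \<open>Multiplication by \<open>q\<close> shifts the sequence of divisors by one place, so the
  growth condition belongs to the class of \<open>a\<close> modulo powers of
  \<open>q\<close>.\<close>

lemma small_div_powi:
  assumes "q \<noteq> 0" shows "small_div q (q powi k * a) \<longleftrightarrow> small_div q a"
proof -
  have 0: "small_div q (q * b) \<longleftrightarrow> small_div q b" for b
    using small_div_shift small_div_shift' by blast
  have 1: "small_div q (q ^ n * b) \<longleftrightarrow> small_div q b" for n b
    using 0 by (induction n) (simp_all add: mult.assoc)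
  show ?thesis
  proof (cases "k \<ge> 0")
    case True
    then show ?thesis using 1[of "nat k"] by (simp add: power_int_def)
  next
    case False
    have "q ^ nat (- k) * (q powi k * a) = a"
      using False assms by (simp add: power_int_def field_simps)
    then show ?thesis using 1[of "nat (- k)" "q powi k * a"] by metis
  qed
qed

section \<open>A recursion with small divisors\<close>

text \<open>The majorant is \<open>y 0 * P m * R ^ m\<close>, where \<open>P m\<close> collects the
  divisors up to \<open>m\<close>. As every \<open>D\<close> is at least 1, \<open>P\<close> is
  increasing and can be pulled out of the sum at its last value, so that each step contributes just
  one new factor \<open>D m\<close>.\<close>

lemma small_divisor_recursion:
  fixes y b D :: "nat \<Rightarrow> real"
  assumes y0: "\<And>m. y m \<ge> 0" and b: "\<And>k. 0 \<le> b k \<and> b k \<le> c * r ^ k" and c: "c \<ge> 0" "r \<ge> 1"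
    and D: "\<And>m. D m \<ge> 1" and DE: "geo (\<lambda>m. \<Prod>k<m. D (Suc k))"
    and rec: "\<And>m. m > 0 \<Longrightarrow> y m \<le> D m * (\<Sum>p<m. y p * b (m - p))"
  shows "geo y"
proof -
  define P where "P m = (\<Prod>k<m. D (Suc k))" for m
  \<comment> \<open>Chosen so that the remaining geometric sum telescopes: it equals
    \<open>r ^ m * ((1 + c) ^ m - 1)\<close>, which is at most \<open>R ^ m\<close>.\<close>
  define R where "R = r * (1 + c)"
  have R: "R \<ge> 1" unfolding R_def using c mult_mono[of 1 r 1 "1 + c"] by simp
  have P1: "P m \<ge> 1" for m unfolding P_def using D by (intro prod_ge_1) auto
  have Pmono: "P p \<le> P m" if "p \<le> m" for p m
    using that
  proof (induction m rule: dec_induct)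
    case (step k)
    have "P k * 1 \<le> P k * D (Suc k)" using P1[of k] D[of "Suc k"] by (intro mult_left_mono) auto
    then show ?case using step by (simp add: P_def)
  qed simp
  have geom: "(\<Sum>p<m. R ^ p * (c * r ^ (m - p))) \<le> R ^ m" for m
  proof -
    have "(\<Sum>p<m. R ^ p * (c * r ^ (m - p))) = (\<Sum>p<m. r ^ m * (c * (1 + c) ^ p))"
    proof (intro sum.cong refl)
      fix p assume "p \<in> {..<m}"
      then have "r ^ m = r ^ p * r ^ (m - p)" by (simp flip: power_add)
      then show "R ^ p * (c * r ^ (m - p)) = r ^ m * (c * (1 + c) ^ p)"
        by (simp add: R_def power_mult_distrib mult_ac)
    qed
    also have "\<dots> = r ^ m * ((1 + c) ^ m - 1)"
    proof -
      have "(\<Sum>p<m. c * (1 + c) ^ p) = (1 + c) ^ m - 1"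
        using power_diff_1_eq[of "1 + c" m] by (simp add: sum_distrib_left)
      then show ?thesis by (simp flip: sum_distrib_left)
    qed
    also have "\<dots> \<le> r ^ m * (1 + c) ^ m" using c by (intro mult_left_mono) auto
    finally show ?thesis by (simp add: R_def power_mult_distrib)
  qed
  have main: "y m \<le> y 0 * P m * R ^ m" for m
  proof (induction m rule: less_induct)
    case (less m)
    show ?case
    proof (cases m)
      case 0
      then show ?thesis by (simp add: P_def)
    next
      case (Suc k)
      have "y m \<le> D m * (\<Sum>p<m. y p * b (m - p))" by (rule rec) (simp add: Suc)
      also have "\<dots> \<le> D m * (\<Sum>p<m. (y 0 * P k * R ^ p) * (c * r ^ (m - p)))"
      proof (intro mult_left_mono sum_mono mult_mono)
        fix p assume p: "p \<in> {..<m}"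
        then have "y p \<le> y 0 * P p * R ^ p" using less by auto
        also have "\<dots> \<le> y 0 * P k * R ^ p"
          using Pmono[of p k] p Suc R y0[of 0] by (intro mult_right_mono mult_left_mono) auto
        finally show "y p \<le> y 0 * P k * R ^ p" .
        show "0 \<le> y 0 * P k * R ^ p" using y0[of 0] P1[of k] R by simp
        show "b (m - p) \<le> c * r ^ (m - p)" "0 \<le> b (m - p)" using b by auto
      next
        show "0 \<le> D m" using D[of m] by simp
      qed
      also have "\<dots> = y 0 * (D m * P k) * (\<Sum>p<m. R ^ p * (c * r ^ (m - p)))"
        by (simp add: sum_distrib_left mult_ac)
      also have "\<dots> \<le> y 0 * (D m * P k) * R ^ m"
        using geom y0[of 0] P1[of k] D[of m] by (intro mult_left_mono) auto
      also have "D m * P k = P m" by (simp add: P_def Suc)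
      finally show ?thesis .
    qed
  qed
  have "geo (\<lambda>m. (\<Prod>k<m. D (Suc k)) * (y 0 * R ^ m))"
    using DE R by (intro geo_mult geoI[of "\<lambda>m. y 0 * R ^ m" "\<bar>y 0\<bar>" R]) (auto simp: abs_mult)
  then show ?thesis
  proof (rule geo_mono)
    fix n
    have "0 \<le> P n * (y 0 * R ^ n)" using P1[of n] y0[of 0] R by simp
    then show "norm (y n) \<le> norm ((\<Prod>k<n. D (Suc k)) * (y 0 * R ^ n))"
      using main[of n] y0[of n] by (simp add: P_def mult_ac)
  qed
qed

section \<open>Normal forms\<close>

text \<open>The choice is made from the class as a set, so all elements of a class receive the same
  representative. The predicate \<open>is_rep\<close> singles out the chosen elements.\<close>

definition qrep :: "complex \<Rightarrow> complex \<Rightarrow> complex" where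
  "qrep q a = (SOME b. b \<in> q_class q a)"

definition is_rep :: "complex \<Rightarrow> complex \<Rightarrow> bool" where
  "is_rep q a \<longleftrightarrow> a \<noteq> 0 \<and> qrep q a = a"

lemma q_class_self: "a \<in> q_class q a"
  unfolding q_class_def by (auto intro: exI[of _ 0])

lemma q_class_eq:
  assumes "q \<noteq> 0" "b \<in> q_class q a" shows "q_class q b = q_class q a"
proof -
  obtain k where k: "b = a * q powi k" using assms(2) by (auto simp: q_class_def)
  show ?thesis
  proof safe
    fix x assume "x \<in> q_class q b"
    then obtain l where "x = b * q powi l" by (auto simp: q_class_def)
    then have "x = a * q powi (k + l)" using k assms(1) by (simp add: power_int_add)
    then show "x \<in> q_class q a" by (auto simp: q_class_def)
  next
    fix x assume "x \<in> q_class q a"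
    then obtain l where "x = a * q powi l" by (auto simp: q_class_def)
    then have "x = b * q powi (l - k)" using k assms(1) by (simp add: power_int_diff)
    then show "x \<in> q_class q b" by (auto simp: q_class_def)
  qed
qed

lemma qrep_in: "qrep q a \<in> q_class q a"
  unfolding qrep_def by (rule someI[of _ a]) (rule q_class_self)

lemma is_rep_qrep: "q \<noteq> 0 \<Longrightarrow> a \<noteq> 0 \<Longrightarrow> is_rep q (qrep q a)"
  using q_class_eq[OF _ qrep_in, of q a] qrep_in[of q a]
  by (auto simp: is_rep_def q_class_def) (simp add: qrep_def q_class_def)

lemma is_rep_unique:
  assumes "q \<noteq> 0" "is_rep q a" "is_rep q b" "q_class q a = q_class q b" shows "a = b"
  using assms by (simp add: is_rep_def qrep_def)

text \<open>Representatives whose quotient is a power of \<open>q\<close> lie in one class, hence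
  coincide; then the power is 1, and \<open>q\<close> is not a root of unity.\<close>

lemma is_rep_resonance:
  assumes q: "q \<noteq> 0" "\<And>n. n > 0 \<Longrightarrow> q ^ n \<noteq> 1" and ab: "is_rep q a" "is_rep q b" "q powi k * a = b"
  shows "a = b \<and> k = 0"
proof -
  have "b \<in> q_class q a" using ab(3) by (auto simp: q_class_def mult.commute)
  then have eq: "a = b" using is_rep_unique[OF q(1) ab(1,2)] q_class_eq[OF q(1)] by simp
  then have p: "q powi k = 1" using ab by (auto simp: is_rep_def)
  have "k = 0"
  proof (rule ccontr)
    assume "k \<noteq> 0"
    then consider "k > 0" | "k < 0" by linarith
    then show False
    proof cases
      case 1 then show False using q(2)[of "nat k"] p by (simp add: power_int_def)
    next
      case 2 then show False using q(2)[of "nat (- k)"] p by (simp add: power_int_def power_inverse)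
    qed
  qed
  then show ?thesis using eq by simp
qed

text \<open>Equal eigenvalues need not occupy consecutive places; the blocks may be interleaved,
  which spares any reordering of the basis.\<close>

definition normal_form :: "complex \<Rightarrow> nat \<Rightarrow> complex mat \<Rightarrow> bool" where
  "normal_form q n A \<longleftrightarrow> A \<in> carrier_mat n n \<and> (\<forall>i<n. is_rep q (A $$ (i, i))) \<and>
     (\<forall>i<n. \<forall>j<n. A $$ (i, j) \<noteq> 0 \<longrightarrow> i \<le> j \<and> A $$ (i, i) = A $$ (j, j))"

text \<open>The Sylvester equation \<open>t A X - X B = R\<close> is solved from the bottom left corner of \<open>X\<close> on.\<close>

lemma sylvester_bound:
  fixes A B :: "complex mat" and X R :: "nat \<Rightarrow> nat \<Rightarrow> complex"
  assumes A: "\<And>i j. i < n \<Longrightarrow> j < n \<Longrightarrow> A $$ (i, j) \<noteq> 0 \<Longrightarrow> i \<le> j \<and> A $$ (i, i) = A $$ (j, j)"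
    and B: "\<And>i j. i < m \<Longrightarrow> j < m \<Longrightarrow> B $$ (i, j) \<noteq> 0 \<Longrightarrow> i \<le> j \<and> B $$ (i, i) = B $$ (j, j)"
    and a: "\<And>i j. i < n \<Longrightarrow> j < n \<Longrightarrow> norm (A $$ (i, j)) \<le> a" "\<And>i j. i < m \<Longrightarrow> j < m \<Longrightarrow> norm (B $$ (i, j)) \<le> a" "a \<ge> 0"
    and t: "norm t = 1" and d: "0 < d" "d \<le> 1"
    and eq: "\<And>i j. i < n \<Longrightarrow> j < m \<Longrightarrow> t * (\<Sum>k<n. A $$ (i, k) * X k j) - (\<Sum>k<m. X i k * B $$ (k, j)) = R i j"
    and R: "\<And>i j. i < n \<Longrightarrow> j < m \<Longrightarrow> norm (R i j) \<le> \<rho>" "\<rho> \<ge> 0"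
    and good: "\<And>i j. i < n \<Longrightarrow> j < m \<Longrightarrow> P (A $$ (i, i)) (B $$ (j, j)) \<Longrightarrow> d \<le> norm (t * A $$ (i, i) - B $$ (j, j))"
    and ij: "i < n" "j < m" "P (A $$ (i, i)) (B $$ (j, j))"
  shows "norm (X i j) \<le> ((1 + real (n + m) * a) / d) ^ (n + m) * \<rho>"
proof -
  \<comment> \<open>For each step away from the corner, estimating the right-hand side costs at most
    the factor \<open>K\<close>, and dividing by the diagonal coefficient at most 1 /
    \<open>d\<close>.\<close>
  define K where "K = 1 + real (n + m) * a"
  have K: "K \<ge> 1" using a(3) by (simp add: K_def)
  have Kd: "K / d \<ge> 1" using K d by (simp add: field_simps)
  \<comment> \<open>The entry (i, j) is determined by entries further down in its column or further
    left in its row. Those belong to the same pair of eigenvalues, so the predicate \<open>P\<close>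
    is inherited, and a lower bound for the divisor is required only for pairs satisfying
    \<open>P\<close>.\<close>
  have *: "norm (X i j) \<le> (K / d) ^ Suc s * \<rho>"
    if "i < n" "j < m" "P (A $$ (i, i)) (B $$ (j, j))" "(n - 1 - i) + j = s" for i j s
    using that
  proof (induction s arbitrary: i j rule: less_induct)
    case (less s)
    note ij = less.prems
    let ?\<delta> = "t * A $$ (i, i) - B $$ (j, j)"
    have q1: "(K / d) ^ s \<ge> 1" using Kd by (rule one_le_power)
    have small: "norm (X i' j') \<le> (K / d) ^ s * \<rho>"
      if "i' < n" "j' < m" "P (A $$ (i', i')) (B $$ (j', j'))" "(n - 1 - i') + j' < s" for i' j'
    proof -
      have "norm (X i' j') \<le> (K / d) ^ Suc ((n - 1 - i') + j') * \<rho>" using less.IH[OF that(4,1,2,3)] by simp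
      also have "\<dots> \<le> (K / d) ^ s * \<rho>"
        using Kd that(4) R(2) by (intro mult_right_mono power_increasing) auto
      finally show ?thesis .
    qed
    have e: "?\<delta> * X i j = R i j - t * (\<Sum>k\<in>{..<n} - {i}. A $$ (i, k) * X k j) + (\<Sum>k\<in>{..<m} - {j}. X i k * B $$ (k, j))"
    proof -
      have "(\<Sum>k<n. A $$ (i, k) * X k j) = A $$ (i, i) * X i j + (\<Sum>k\<in>{..<n} - {i}. A $$ (i, k) * X k j)"
        using ij by (intro sum.remove) auto
      moreover have "(\<Sum>k<m. X i k * B $$ (k, j)) = X i j * B $$ (j, j) + (\<Sum>k\<in>{..<m} - {j}. X i k * B $$ (k, j))"
        using ij by (intro sum.remove) auto
      ultimately show ?thesis using eq[OF ij(1,2)] by (simp add: algebra_simps)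
    qed
    have n1: "norm (A $$ (i, k) * X k j) \<le> a * ((K / d) ^ s * \<rho>)" if k: "k \<in> {..<n} - {i}" for k
    proof (cases "A $$ (i, k) = 0")
      case False
      then have "i < k" "A $$ (k, k) = A $$ (i, i)" using A[of i k] k ij by auto
      then have "norm (X k j) \<le> (K / d) ^ s * \<rho>" using k ij by (intro small) auto
      then show ?thesis using a k ij by (auto simp: norm_mult intro!: mult_mono)
    qed (use a R q1 in auto)
    have n2: "norm (X i k * B $$ (k, j)) \<le> a * ((K / d) ^ s * \<rho>)" if k: "k \<in> {..<m} - {j}" for k
    proof (cases "B $$ (k, j) = 0")
      case False
      then have "k < j" "B $$ (k, k) = B $$ (j, j)" using B[of k j] k ij by auto
      then have "norm (X i k) \<le> (K / d) ^ s * \<rho>" using k ij by (intro small) auto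
      then show ?thesis using a k ij by (subst mult.commute) (auto simp: norm_mult intro!: mult_mono)
    qed (use a R q1 in auto)
    have c1: "norm (\<Sum>k\<in>{..<n} - {i}. A $$ (i, k) * X k j) \<le> real n * (a * ((K / d) ^ s * \<rho>))"
    proof -
      have "norm (\<Sum>k\<in>{..<n} - {i}. A $$ (i, k) * X k j) \<le> (\<Sum>k\<in>{..<n} - {i}. a * ((K / d) ^ s * \<rho>))"
        by (rule sum_norm_le) (rule n1)
      also have "\<dots> \<le> (\<Sum>k<n. a * ((K / d) ^ s * \<rho>))" using a R q1 by (intro sum_mono2) auto
      finally show ?thesis by simp
    qed
    have c2: "norm (\<Sum>k\<in>{..<m} - {j}. X i k * B $$ (k, j)) \<le> real m * (a * ((K / d) ^ s * \<rho>))"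
    proof -
      have "norm (\<Sum>k\<in>{..<m} - {j}. X i k * B $$ (k, j)) \<le> (\<Sum>k\<in>{..<m} - {j}. a * ((K / d) ^ s * \<rho>))"
        by (rule sum_norm_le) (rule n2)
      also have "\<dots> \<le> (\<Sum>k<m. a * ((K / d) ^ s * \<rho>))" using a R q1 by (intro sum_mono2) auto
      finally show ?thesis by simp
    qed
    have "d * norm (X i j) \<le> norm (?\<delta> * X i j)"
      using good[OF ij(1-3)] by (simp add: norm_mult mult_right_mono)
    also have "\<dots> \<le> norm (R i j) + norm (\<Sum>k\<in>{..<n} - {i}. A $$ (i, k) * X k j) + norm (\<Sum>k\<in>{..<m} - {j}. X i k * B $$ (k, j))"
    proof -
      have "norm (t * (\<Sum>k\<in>{..<n} - {i}. A $$ (i, k) * X k j)) = norm (\<Sum>k\<in>{..<n} - {i}. A $$ (i, k) * X k j)"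
        using t by (simp add: norm_mult)
      then show ?thesis unfolding e
        using norm_triangle_ineq[of "R i j - t * (\<Sum>k\<in>{..<n} - {i}. A $$ (i, k) * X k j)"
            "\<Sum>k\<in>{..<m} - {j}. X i k * B $$ (k, j)"]
          norm_triangle_ineq4[of "R i j" "t * (\<Sum>k\<in>{..<n} - {i}. A $$ (i, k) * X k j)"] by linarith
    qed
    also have "\<dots> \<le> (K / d) ^ s * \<rho> + real n * (a * ((K / d) ^ s * \<rho>)) + real m * (a * ((K / d) ^ s * \<rho>))"
    proof (intro add_mono c1 c2)
      have "1 * \<rho> \<le> (K / d) ^ s * \<rho>" using q1 R(2) by (rule mult_right_mono)
      then show "norm (R i j) \<le> (K / d) ^ s * \<rho>" using R(1)[OF ij(1,2)] by simp
    qed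
    also have "\<dots> = K * ((K / d) ^ s * \<rho>)" by (simp add: K_def algebra_simps)
    finally show ?case using d by (simp add: field_simps)
  qed
  have "norm (X i j) \<le> (K / d) ^ Suc ((n - 1 - i) + j) * \<rho>" by (rule *) (use ij in auto)
  also have "\<dots> \<le> (K / d) ^ (n + m) * \<rho>"
    using Kd ij R(2) by (intro mult_right_mono power_increasing) auto
  finally show ?thesis by (simp add: K_def)
qed

section \<open>Gauge transformations of normal forms\<close>

abbreviation cmat :: "complex mat \<Rightarrow> complex fls mat" where
  "cmat \<equiv> map_mat fls_const"

abbreviation fmat :: "complex fps mat \<Rightarrow> complex fls mat" where
  "fmat \<equiv> map_mat fps_to_fls"

definition cond :: "complex \<Rightarrow> nat \<Rightarrow> complex mat \<Rightarrow> bool" where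
  "cond q n A \<longleftrightarrow> (\<forall>i<n. \<forall>j<n. A $$ (i, i) \<noteq> A $$ (j, j) \<longrightarrow> small_div q (A $$ (i, i) / A $$ (j, j)))"

definition fps_sigma :: "complex \<Rightarrow> complex fps \<Rightarrow> complex fps" where
  "fps_sigma q f = Abs_fps (\<lambda>n. q ^ n * fps_nth f n)"

lemma fps_to_fls_sigma: "q \<noteq> 0 \<Longrightarrow> fps_to_fls (fps_sigma q f) = sigma_q q (fps_to_fls f)"
  by (intro fls_eqI) (auto simp: sigma_q_nth fps_sigma_def power_int_def)

lemma fps_to_fls_hom: "semiring_hom (fps_to_fls :: 'a::comm_ring_1 fps \<Rightarrow> 'a fls)"
  by unfold_locales (auto simp: fls_times_fps_to_fls)

lemma fls_const_hom: "semiring_hom (fls_const :: complex \<Rightarrow> complex fls)"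
  by unfold_locales (auto simp: fls_plus_const fls_const_mult_const)

lemma fps_nth_0_hom: "semiring_hom (\<lambda>f :: complex fps. fps_nth f 0)"
  by unfold_locales auto

lemma cmat_mult: "A \<in> carrier_mat m n \<Longrightarrow> B \<in> carrier_mat n k \<Longrightarrow> cmat (A * B) = cmat A * cmat B"
  by (rule semiring_hom.mat_hom_mult[OF fls_const_hom])

lemma fmat_mult: "A \<in> carrier_mat m n \<Longrightarrow> B \<in> carrier_mat n k \<Longrightarrow> fmat (A * B) = fmat A * fmat B"
  by (rule semiring_hom.mat_hom_mult[OF fps_to_fls_hom])

lemma cmat_one: "cmat (1\<^sub>m n) = 1\<^sub>m n"
  by (rule semiring_hom.mat_hom_one[OF fls_const_hom])

lemma fmat_one: "fmat (1\<^sub>m n) = 1\<^sub>m n"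
  by (rule semiring_hom.mat_hom_one[OF fps_to_fls_hom])

lemma sigm_cmat: "q \<noteq> 0 \<Longrightarrow> sigm q (cmat A) = cmat A"
  by (intro eq_matI) (auto intro!: fls_eqI simp: sigma_q_nth)

lemma sigm_fmat: "q \<noteq> 0 \<Longrightarrow> sigm q (fmat A) = fmat (map_mat (fps_sigma q) A)"
  by (intro eq_matI) (auto simp: fps_to_fls_sigma)

lemma fls_const_conv: "fls_const c \<in> conv_fls"
  using geoI[of "\<lambda>n. fls_nth (fls_const c) (int n)" "norm c" 1] by (simp add: conv_fls_geo)

lemma cmat_mats: "A \<in> carrier_mat m n \<Longrightarrow> cmat A \<in> mats conv_fls m n"
  by (auto simp: mats_def fls_const_conv)

lemma mat_mult_index:
  "A \<in> carrier_mat m n \<Longrightarrow> B \<in> carrier_mat n k \<Longrightarrow> i < m \<Longrightarrow> j < k \<Longrightarrow>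
    (A * B) $$ (i, j) = (\<Sum>l<n. A $$ (i, l) * B $$ (l, j))"
  by (auto simp: scalar_prod_def atLeast0LessThan)

lemma normal_form_cmat_inv:
  assumes "normal_form q n A" shows "cmat A \<in> inv_mats conv_fls n"
proof (rule inv_matsI[OF subfld_conv_fls])
  have A: "A \<in> carrier_mat n n" using assms by (simp add: normal_form_def)
  show "cmat A \<in> mats conv_fls n n" by (rule cmat_mats[OF A])
  have "upper_triangular (cmat A)" using assms A unfolding upper_triangular_def normal_form_def
    by (metis carrier_matD fls_const_0 index_map_mat(1,2) less_trans not_le)
  moreover have "0 \<notin> set (diag_mat (cmat A))"
  proof
    assume "0 \<in> set (diag_mat (cmat A))"
    then obtain i where i: "i < n" "fls_const (A $$ (i, i)) = 0" using A by (auto simp: diag_mat_def)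
    moreover have "is_rep q (A $$ (i, i))" using assms i(1) by (simp add: normal_form_def)
    ultimately show False by (simp add: is_rep_def)
  qed
  moreover have "cmat A \<in> carrier_mat n n" using A by simp
  ultimately show "det (cmat A) \<noteq> 0"
    using upper_triangular_imp_det_eq_0_iff by blast
qed

text \<open>The matrix form of the fact that the inverse of an isomorphism is a morphism: multiply
  by \<open>R\<close> on the left and by \<open>sigm q R\<close> on the right.\<close>

lemma inverse_intertwine:
  fixes P R :: "complex fls mat"
  assumes q: "q \<noteq> 0" and P: "P \<in> carrier_mat n n" "R \<in> carrier_mat n n" "P * R = 1\<^sub>m n" "R * P = 1\<^sub>m n"
    and AB: "A \<in> carrier_mat n n" "B \<in> carrier_mat n n" and eq: "P * A = B * sigm q P"
  shows "R * B = A * sigm q R"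
proof -
  have sR: "sigm q P * sigm q R = 1\<^sub>m n"
    using sigm_mult[OF q P(1,2)] P(3) sigm_one[OF q] by metis
  have sc: "sigm q P \<in> carrier_mat n n" "sigm q R \<in> carrier_mat n n" using P by auto
  have "R * B = R * (B * (sigm q P * sigm q R))" using sR AB by simp
  also have "\<dots> = R * ((B * sigm q P) * sigm q R)" using assoc_mult_mat[OF AB(2) sc] by simp
  also have "\<dots> = R * (P * (A * sigm q R))" unfolding eq[symmetric] using assoc_mult_mat[OF P(1) AB(1) sc(2)] by simp
  also have "\<dots> = (R * P) * (A * sigm q R)" using assoc_mult_mat[OF P(2,1), of "A * sigm q R" n] AB sc by simp
  finally show ?thesis using P(4) AB sc by simp
qed

lemma compose_intertwine:
  fixes P R :: "complex fls mat"
  assumes q: "q \<noteq> 0" and P: "P \<in> carrier_mat m n" "R \<in> carrier_mat k m"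
    and ABC: "A \<in> carrier_mat n n" "B \<in> carrier_mat m m" "C \<in> carrier_mat k k"
    and eq: "P * A = B * sigm q P" "R * B = C * sigm q R"
  shows "(R * P) * A = C * sigm q (R * P)"
proof -
  have sc: "sigm q P \<in> carrier_mat m n" "sigm q R \<in> carrier_mat k m" using P by auto
  have "(R * P) * A = R * (P * A)" using assoc_mult_mat[OF P(2,1) ABC(1)] .
  also have "\<dots> = (R * B) * sigm q P" unfolding eq(1) using assoc_mult_mat[OF P(2) ABC(2) sc(1)] by simp
  also have "\<dots> = C * (sigm q R * sigm q P)" unfolding eq(2) using assoc_mult_mat[OF ABC(3) sc(2,1)] .
  finally show ?thesis using sigm_mult[OF q P(2,1)] by simp
qed

lemma inv_mats_mult:
  assumes S: "subfld S" and A: "A \<in> inv_mats S n" and B: "B \<in> inv_mats S n"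
  shows "A * B \<in> inv_mats S n"
proof -
  obtain A' where A': "A \<in> mats S n n" "A' \<in> mats S n n" "A * A' = 1\<^sub>m n" "A' * A = 1\<^sub>m n" using A by (auto simp: inv_mats_def)
  obtain B' where B': "B \<in> mats S n n" "B' \<in> mats S n n" "B * B' = 1\<^sub>m n" "B' * B = 1\<^sub>m n" using B by (auto simp: inv_mats_def)
  note c = mats_carrier[OF A'(1)] mats_carrier[OF A'(2)] mats_carrier[OF B'(1)] mats_carrier[OF B'(2)]
  have cAB: "A * B \<in> carrier_mat n n" and cBA: "B' * A' \<in> carrier_mat n n" using c by auto
  have "(A * B) * (B' * A') = A * (B * (B' * A'))" using assoc_mult_mat[OF c(1,3) cBA] .
  also have "B * (B' * A') = A'" using assoc_mult_mat[OF c(3,4,2)] B'(3) c by simp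
  finally have 1: "(A * B) * (B' * A') = 1\<^sub>m n" using A'(3) by simp
  have "(B' * A') * (A * B) = B' * (A' * (A * B))" using assoc_mult_mat[OF c(4,2) cAB] .
  also have "A' * (A * B) = B" using assoc_mult_mat[OF c(2,1,3)] A'(4) c by simp
  finally have 2: "(B' * A') * (A * B) = 1\<^sub>m n" using B'(4) by simp
  show ?thesis unfolding inv_mats_def
    using 1 2 mats_mult[OF S A'(1) B'(1)] mats_mult[OF S B'(2) A'(2)] by blast
qed

text \<open>A power series with nonzero constant term is a unit, so the adjugate can be divided by
  the determinant.\<close>

lemma fps_mat_inverse:
  assumes U: "(U :: complex fps mat) \<in> carrier_mat n n" and d: "det (map_mat (\<lambda>f. fps_nth f 0) U) \<noteq> 0"
  shows "\<exists>V\<in>carrier_mat n n. U * V = 1\<^sub>m n \<and> V * U = 1\<^sub>m n"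
proof -
  have hom: "comm_ring_hom (\<lambda>f :: complex fps. fps_nth f 0)" by unfold_locales auto
  have "fps_nth (det U) 0 = det (map_mat (\<lambda>f. fps_nth f 0) U)"
    using comm_ring_hom.hom_det[OF hom, of U] by simp
  then have d0: "fps_nth (det U) 0 \<noteq> 0" using d by simp
  define V where "V = inverse (det U) \<cdot>\<^sub>m adj_mat U"
  note adj = adj_mat[OF U]
  have iv: "inverse (det U) * det U = 1" using d0 by (rule inverse_mult_eq_1)
  have "U * V = inverse (det U) \<cdot>\<^sub>m (U * adj_mat U)"
    unfolding V_def by (rule mult_smult_distrib[OF U adj(1)])
  also have "\<dots> = 1\<^sub>m n" unfolding adj(2) using iv by (intro eq_matI) auto
  finally have 1: "U * V = 1\<^sub>m n" .
  have "V * U = inverse (det U) \<cdot>\<^sub>m (adj_mat U * U)"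
    unfolding V_def by (rule mult_smult_assoc_mat[OF adj(1) U])
  also have "\<dots> = 1\<^sub>m n" unfolding adj(3) using iv by (intro eq_matI) auto
  finally have 2: "V * U = 1\<^sub>m n" .
  show ?thesis using 1 2 adj(1) by (intro bexI[of _ V]) (auto simp: V_def)
qed

lemma fls_eq_fps: "(\<And>l. l < 0 \<Longrightarrow> fls_nth f l = 0) \<Longrightarrow> fps_to_fls (fls_regpart f) = f"
  by (intro fls_eqI) auto

lemma fls_times_nth_nonneg:
  fixes f g :: "complex fls"
  assumes "\<And>l. l < 0 \<Longrightarrow> fls_nth f l = 0" "\<And>l. l < 0 \<Longrightarrow> fls_nth g l = 0"
  shows "fls_nth (f * g) (int m) = (\<Sum>p\<le>m. fls_nth f (int p) * fls_nth g (int (m - p)))"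
proof -
  have "f * g = fps_to_fls (fls_regpart f * fls_regpart g)"
    using fls_eq_fps[OF assms(1)] fls_eq_fps[OF assms(2)] by (simp add: fls_times_fps_to_fls)
  then have "fls_nth (f * g) (int m) = fps_nth (fls_regpart f * fls_regpart g) m" by simp
  then show ?thesis by (simp add: fps_mult_nth atLeast0AtMost)
qed

text \<open>\<open>geo_qq\<close> is the assumed convergence of the series with coefficients 1 / (q;
  q)_n, expressed through the growth of these coefficients.\<close>

locale small_q =
  fixes q :: complex
  assumes norm_q: "norm q = 1"
    and not_root: "\<And>n. n > 0 \<Longrightarrow> q ^ n \<noteq> 1"
    and geo_qq: "geo (\<lambda>n. 1 / qpoch q q n)"
begin

lemma q_nz: "q \<noteq> 0" using norm_q by auto

lemma norm_powi: "norm (q powi k) = 1"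
  using norm_q by (simp add: norm_power_int)

lemma powi_eq_1: "q powi k = 1 \<Longrightarrow> k = 0"
  using not_root[of "nat k"] not_root[of "nat (- k)"] by (cases "k = 0") (auto simp: power_int_def power_inverse split: if_splits)

text \<open>Morphisms between normal forms, even formal ones, are constant: their other coefficients satisfy a
  homogeneous Sylvester equation without resonance.\<close>

lemma formal_hom_const:
  assumes A: "normal_form q n A" and B: "normal_form q m B" and P: "P \<in> carrier_mat m n"
    and eq: "P * cmat A = cmat B * sigm q P"
  shows "\<exists>P0\<in>carrier_mat m n. P = cmat P0 \<and> P0 * A = B * P0 \<and>
    (\<forall>i<m. \<forall>j<n. P0 $$ (i, j) \<noteq> 0 \<longrightarrow> B $$ (i, i) = A $$ (j, j))"
proof -
  have Ac: "A \<in> carrier_mat n n" and Bc: "B \<in> carrier_mat m m" using A B by (auto simp: normal_form_def)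
  \<comment> \<open>The coefficient of x^l in the intertwining relation. It is a homogeneous
    Sylvester equation with t = q^l.\<close>
  have e: "(\<Sum>k<n. fls_nth (P $$ (i, k)) l * A $$ (k, j)) = q powi l * (\<Sum>k<m. B $$ (i, k) * fls_nth (P $$ (k, j)) l)"
    if ij: "i < m" "j < n" for i j l
  proof -
    have "fls_nth ((P * cmat A) $$ (i, j)) l = fls_nth ((cmat B * sigm q P) $$ (i, j)) l" using eq by simp
    then show ?thesis
      using ij P Ac Bc
      by (simp add: mat_mult_index[of P m n "cmat A" n] mat_mult_index[of "cmat B" m m "sigm q P" n]
          fls_nth_sum sigma_q_nth[OF q_nz] sum_distrib_left mult_ac del: index_mult_mat)
  qed
  obtain a where a: "a \<ge> 0" "\<And>i j. i < n \<Longrightarrow> j < n \<Longrightarrow> norm (A $$ (i, j)) \<le> a"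
      "\<And>i j. i < m \<Longrightarrow> j < m \<Longrightarrow> norm (B $$ (i, j)) \<le> a"
  proof
    let ?a = "(\<Sum>i<n. \<Sum>j<n. norm (A $$ (i, j))) + (\<Sum>i<m. \<Sum>j<m. norm (B $$ (i, j)))"
    show "?a \<ge> 0" by (intro add_nonneg_nonneg sum_nonneg) auto
    show "norm (A $$ (i, j)) \<le> ?a" if "i < n" "j < n" for i j
    proof -
      have "norm (A $$ (i, j)) \<le> (\<Sum>j<n. norm (A $$ (i, j)))" using that by (intro member_le_sum) auto
      also have "\<dots> \<le> (\<Sum>i<n. \<Sum>j<n. norm (A $$ (i, j)))"
        using that by (intro member_le_sum[of i _ "\<lambda>i. \<Sum>j<n. norm (A $$ (i, j))"]) (auto intro: sum_nonneg)
      finally show ?thesis by (simp add: add_increasing2 sum_nonneg)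
    qed
    show "norm (B $$ (i, j)) \<le> ?a" if "i < m" "j < m" for i j
    proof -
      have "norm (B $$ (i, j)) \<le> (\<Sum>j<m. norm (B $$ (i, j)))" using that by (intro member_le_sum) auto
      also have "\<dots> \<le> (\<Sum>i<m. \<Sum>j<m. norm (B $$ (i, j)))"
        using that by (intro member_le_sum[of i _ "\<lambda>i. \<Sum>j<m. norm (B $$ (i, j))"]) (auto intro: sum_nonneg)
      finally show ?thesis by (simp add: add_increasing sum_nonneg)
    qed
  qed
  have zero: "fls_nth (P $$ (i, j)) l = 0" if ij: "i < m" "j < n" and ne: "l \<noteq> 0 \<or> B $$ (i, i) \<noteq> A $$ (j, j)" for i j l
  proof -
    let ?\<delta> = "\<lambda>x y. q powi l * x - y"
    have nz: "?\<delta> (B $$ (i, i)) (A $$ (j, j)) \<noteq> 0"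
    proof
      assume "?\<delta> (B $$ (i, i)) (A $$ (j, j)) = 0"
      then have e: "q powi l * B $$ (i, i) = A $$ (j, j)" by simp
      have "is_rep q (B $$ (i, i))" "is_rep q (A $$ (j, j))" using A B ij by (auto simp: normal_form_def)
      from is_rep_resonance[OF q_nz not_root this e] show False using ne by simp
    qed
    \<comment> \<open>With right-hand side 0 any positive lower bound gives the conclusion; the
      least nonzero divisor for this \<open>l\<close>, capped at 1, is taken.\<close>
    let ?D = "insert 1 ((\<lambda>(i, j). norm (?\<delta> (B $$ (i, i)) (A $$ (j, j)))) ` ({..<m} \<times> {..<n}) - {0})"
    define d where "d = Min ?D"
    have "norm (fls_nth (P $$ (i, j)) l) \<le> ((1 + real (m + n) * a) / d) ^ (m + n) * 0"
    proof (rule sylvester_bound[where A = B and B = A and X = "\<lambda>i j. fls_nth (P $$ (i, j)) l" and R = "\<lambda>_ _. 0"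
          and t = "q powi l" and P = "\<lambda>x y. ?\<delta> x y \<noteq> 0"])
      show "0 < d" "d \<le> 1" unfolding d_def by (subst Min_gr_iff; auto) (rule Min_le; auto)
      show "q powi l * (\<Sum>k<m. B $$ (i, k) * fls_nth (P $$ (k, j)) l) - (\<Sum>k<n. fls_nth (P $$ (i, k)) l * A $$ (k, j)) = 0"
        if "i < m" "j < n" for i j using e[OF that, of l] by simp
      show "d \<le> norm (?\<delta> (B $$ (i, i)) (A $$ (j, j)))" if "i < m" "j < n" "?\<delta> (B $$ (i, i)) (A $$ (j, j)) \<noteq> 0" for i j
        unfolding d_def using that by (intro Min_le) (auto intro!: image_eqI[of _ _ "(i, j)"])
    qed (use a A B ij nz norm_powi in \<open>auto simp: normal_form_def\<close>)
    then show ?thesis by simp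
  qed
  define P0 where "P0 = mat m n (\<lambda>(i, j). fls_nth (P $$ (i, j)) 0)"
  have P0: "P0 \<in> carrier_mat m n" by (simp add: P0_def)
  have "P = cmat P0"
    using P zero by (intro eq_matI) (auto simp: P0_def intro!: fls_eqI)
  moreover have "P0 * A = B * P0"
  proof (rule eq_matI)
    fix i j assume "i < dim_row (B * P0)" "j < dim_col (B * P0)"
    then have ij: "i < m" "j < n" using Bc P0 by auto
    show "(P0 * A) $$ (i, j) = (B * P0) $$ (i, j)"
      using e[OF ij, of 0] ij unfolding mat_mult_index[OF P0 Ac ij] mat_mult_index[OF Bc P0 ij] by (simp add: P0_def)
  qed (use P0 Ac Bc in auto)
  moreover have "B $$ (i, i) = A $$ (j, j)" if "i < m" "j < n" "P0 $$ (i, j) \<noteq> 0" for i j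
    using zero[of i j 0] that by (auto simp: P0_def)
  ultimately show ?thesis using P0 by blast
qed

text \<open>Up to a geometric factor the product is the modulus of 1 / (q a / b; q)_M. The powers of
  \<open>q\<close> start at 1, so for a = b the symbol is (q; q)_M, controlled by
  \<open>geo_qq\<close>; for a \<noteq> b the small divisors of a / b control it. The maximum with 1
  is what \<open>small_divisor_recursion\<close> demands of its factors.\<close>

lemma small_div_product:
  assumes a: "is_rep q a" and b: "is_rep q b" and ab: "a \<noteq> b \<Longrightarrow> small_div q (a / b)"
  shows "geo (\<lambda>M. \<Prod>k<M. max 1 (1 / norm (q ^ Suc k * a - b)))"
proof -
  have b0: "b \<noteq> 0" and a0: "a \<noteq> 0" using a b by (auto simp: is_rep_def)
  have nz: "q ^ k * (a / b) \<noteq> 1" if "a \<noteq> b \<or> k > 0" for k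
  proof
    assume "q ^ k * (a / b) = 1"
    then have "q powi int k * a = b" using b0 by (simp add: field_simps)
    then show False using is_rep_resonance[OF q_nz not_root a b, of "int k"] that by auto
  qed
  have "geo (\<lambda>n. 1 / qpoch q (q * (a / b)) n)"
  proof (cases "a = b")
    case True then show ?thesis using b0 geo_qq by simp
  next
    case False
    have g: "geo (\<lambda>n. 1 / qpoch q (a / b) n)"
      by (rule geo_qpoch_if_small_div[OF norm_q not_root geo_qq ab[OF False]]) (use nz False in auto)
    have "1 - a / b \<noteq> 0" using False b0 by auto
    then have "(\<lambda>n. 1 / qpoch q (q * (a / b)) n) = (\<lambda>n. (1 - a / b) * (1 / qpoch q (a / b) (n + 1)))"
      by (simp add: qpoch_Suc')
    then show ?thesis using geo_mult[OF geo_const geo_shift[OF g, of 1]] by simp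
  qed
  then have "geo (\<lambda>M. (max 1 ((1 + norm a + norm b) / norm b)) ^ M * norm (1 / qpoch q (q * (a / b)) M))"
    by (intro geo_mult[OF geoI[of _ 1 "max 1 ((1 + norm a + norm b) / norm b)"] geo_mono]) auto
  then show ?thesis
  proof (rule geo_mono)
    fix M
    let ?K = "max 1 ((1 + norm a + norm b) / norm b)"
    have "(\<Prod>k<M. max 1 (1 / norm (q ^ Suc k * a - b))) \<le> (\<Prod>k<M. ?K * (1 / norm (1 - q ^ k * (q * (a / b)))))"
    proof (intro prod_mono conjI)
      fix k
      let ?x = "norm (q ^ Suc k * a - b)"
      have "q ^ Suc k * (a / b) \<noteq> 1" by (rule nz) simp
      then have x: "?x > 0" using b0 by (auto simp: field_simps)
      have xle: "?x \<le> norm a + norm b"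
        using norm_triangle_ineq4[of "q ^ Suc k * a" b] norm_q by (simp add: norm_mult norm_power)
      have "q ^ Suc k * a - b = - b * (1 - q ^ k * (q * (a / b)))" using b0 by (simp add: field_simps)
      then have xeq: "?x = norm b * norm (1 - q ^ k * (q * (a / b)))" by (simp add: norm_mult)
      \<comment> \<open>The divisor itself is at most |a| + |b|, so the numerator 1 + |a| + |b|
        absorbs the maximum with 1 as well.\<close>
      have "max 1 (1 / ?x) \<le> (1 + norm a + norm b) / ?x" using x xle by (auto simp: field_simps)
      also have "\<dots> = ((1 + norm a + norm b) / norm b) * (1 / norm (1 - q ^ k * (q * (a / b))))"
        by (simp only: xeq times_divide_times_eq mult_1_right)
      also have "\<dots> \<le> ?K * (1 / norm (1 - q ^ k * (q * (a / b))))" by (intro mult_right_mono) auto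
      finally show "max 1 (1 / ?x) \<le> ?K * (1 / norm (1 - q ^ k * (q * (a / b))))" .
    qed auto
    also have "\<dots> = ?K ^ M * norm (1 / qpoch q (q * (a / b)) M)"
      by (simp add: prod.distrib qpoch_def norm_divide prod_norm prod_dividef flip: prod_norm)
    finally have le: "(\<Prod>k<M. max 1 (1 / norm (q ^ Suc k * a - b))) \<le> ?K ^ M * norm (1 / qpoch q (q * (a / b)) M)" .
    have "0 \<le> (\<Prod>k<M. max 1 (1 / norm (q ^ Suc k * a - b)))" by (intro prod_nonneg) auto
    then show "norm (\<Prod>k<M. max 1 (1 / norm (q ^ Suc k * a - b))) \<le>
        norm (?K ^ M * norm (1 / qpoch q (q * (a / b)) M))" using le by simp
  qed
qed

text \<open>Since \<open>B\<close> has constant term \<open>A\<close>, the coefficient of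
  \<open>H\<close> of index m satisfies a Sylvester equation whose right-hand side \<open>R\<close>
  involves earlier coefficients only. \<open>sylvester_bound\<close> turns this into the scalar
  recursion of \<open>small_divisor_recursion\<close>, with \<open>y m\<close> the sum of the moduli
  of all entries.\<close>

lemma gauge_converges:
  assumes A: "normal_form q n A" and cond: "cond q n A"
    and H: "H \<in> carrier_mat n n" "\<And>i j l. i < n \<Longrightarrow> j < n \<Longrightarrow> l < 0 \<Longrightarrow> fls_nth (H $$ (i, j)) l = 0"
    and B: "B \<in> mats conv_fls n n" "\<And>i j l. i < n \<Longrightarrow> j < n \<Longrightarrow> l < 0 \<Longrightarrow> fls_nth (B $$ (i, j)) l = 0"
      "\<And>i j. i < n \<Longrightarrow> j < n \<Longrightarrow> fls_nth (B $$ (i, j)) 0 = A $$ (i, j)"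
    and eq: "H * B = cmat A * sigm q H"
  shows "H \<in> mats conv_fls n n"
proof -
  have Ac: "A \<in> carrier_mat n n" using A by (auto simp: normal_form_def)
  note Bc = mats_carrier[OF B(1)]
  define h where "h i j m = fls_nth (H $$ (i, j)) (int m)" for i j m
  define \<beta> where "\<beta> i j m = fls_nth (B $$ (i, j)) (int m)" for i j m
  define y where "y m = (\<Sum>i<n. \<Sum>j<n. norm (h i j m))" for m
  define b where "b m = (\<Sum>i<n. \<Sum>j<n. norm (\<beta> i j m))" for m
  have ent: "norm (f i j) \<le> (\<Sum>i<n. \<Sum>j<n. norm (f i j))" if "i < n" "j < n" for f :: "nat \<Rightarrow> nat \<Rightarrow> complex" and i j
  proof -
    have "norm (f i j) \<le> (\<Sum>j<n. norm (f i j))" using that by (intro member_le_sum) auto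
    also have "\<dots> \<le> (\<Sum>i<n. \<Sum>j<n. norm (f i j))"
      using that by (intro member_le_sum[of i _ "\<lambda>i. \<Sum>j<n. norm (f i j)"]) (auto intro: sum_nonneg)
    finally show ?thesis .
  qed
  define a where "a = (\<Sum>i<n. \<Sum>j<n. norm (A $$ (i, j)))"
  have a: "a \<ge> 0" "\<And>i j. i < n \<Longrightarrow> j < n \<Longrightarrow> norm (A $$ (i, j)) \<le> a"
    unfolding a_def using ent[of _ _ "\<lambda>i j. A $$ (i, j)"] by (auto intro!: sum_nonneg)
  define K where "K = 1 + real (n + n) * a"
  have K: "K \<ge> 1" using a by (simp add: K_def)
  define R where "R i j m = (\<Sum>k<n. \<Sum>p<m. h i k p * \<beta> k j (m - p))" for i j m
  have e: "q ^ m * (\<Sum>k<n. A $$ (i, k) * h k j m) - (\<Sum>k<n. h i k m * A $$ (k, j)) = R i j m"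
    if ij: "i < n" "j < n" for i j m
  proof -
    have "fls_nth ((H * B) $$ (i, j)) (int m) = (\<Sum>k<n. fls_nth (H $$ (i, k) * B $$ (k, j)) (int m))"
      unfolding mat_mult_index[OF H(1) Bc ij] by (simp add: fls_nth_sum)
    also have "\<dots> = (\<Sum>k<n. (\<Sum>p\<le>m. h i k p * \<beta> k j (m - p)))"
      unfolding h_def \<beta>_def using ij by (intro sum.cong refl fls_times_nth_nonneg) (auto simp: H B)
    also have "\<dots> = (\<Sum>k<n. h i k m * A $$ (k, j)) + R i j m"
    proof -
      have "(\<Sum>p\<le>m. h i k p * \<beta> k j (m - p)) = (\<Sum>p<m. h i k p * \<beta> k j (m - p)) + h i k m * A $$ (k, j)" if "k < n" for k
        using B(3)[OF that ij(2)] by (simp add: lessThan_Suc_atMost[symmetric] \<beta>_def)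
      then show ?thesis by (simp add: R_def sum.distrib)
    qed
    finally have 1: "fls_nth ((H * B) $$ (i, j)) (int m) = (\<Sum>k<n. h i k m * A $$ (k, j)) + R i j m" .
    have "fls_nth ((cmat A * sigm q H) $$ (i, j)) (int m) = q ^ m * (\<Sum>k<n. A $$ (i, k) * h k j m)"
      using ij H(1) Ac mat_mult_index[of "cmat A" n n "sigm q H" n i j]
      by (simp add: fls_nth_sum sigma_q_nth[OF q_nz] h_def sum_distrib_left mult_ac del: index_mult_mat)
    then show ?thesis using 1 eq by simp
  qed
  define p where "p i j m = max 1 (1 / norm (q ^ m * A $$ (i, i) - A $$ (j, j)))" for i j m
  \<comment> \<open>A product over all pairs instead of a maximum: its product over m splits into
    one product per pair of eigenvalues, to which \<open>small_div_product\<close> applies.\<close>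
  define p' where "p' m = (\<Prod>i<n. \<Prod>j<n. p i j m)" for m
  have p1: "p i j m \<ge> 1" for i j m by (simp add: p_def)
  have p'1: "p' m \<ge> 1" for m unfolding p'_def by (intro prod_ge_1) (auto intro!: prod_ge_1 p1)
  have pp': "p i j m \<le> p' m" if "i < n" "j < n" for i j m
  proof -
    have "p i j m * 1 \<le> p i j m * (\<Prod>j\<in>{..<n} - {j}. p i j m)" using p1[of i j m] by (intro mult_left_mono prod_ge_1 p1) auto
    also have "\<dots> = (\<Prod>j<n. p i j m)" using that by (subst prod.remove[of _ j]) auto
    finally have 1: "p i j m \<le> (\<Prod>j<n. p i j m)" by simp
    have "(\<Prod>j<n. p i j m) * 1 \<le> (\<Prod>j<n. p i j m) * (\<Prod>i\<in>{..<n} - {i}. \<Prod>j<n. p i j m)"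
      by (intro mult_left_mono prod_ge_1) (auto intro!: prod_ge_1 prod_nonneg p1 simp: order_trans[OF zero_le_one p1])
    also have "\<dots> = p' m" unfolding p'_def using that by (subst prod.remove[of _ i]) auto
    finally show ?thesis using 1 by simp
  qed
  \<comment> \<open>The loss in \<open>sylvester_bound\<close>, whose exponent is
    \<open>n + n\<close>, summed over the n^2 entries. The added 1 ensures that \<open>D\<close> is
    at least 1.\<close>
  define D where "D m = real (n * n) * (K * p' m) ^ (n + n) + 1" for m
  define E where "E = max 1 (real (n * n) * K ^ (n + n) + 1)"
  have DE: "D m \<le> E * (p' m) ^ (n + n)" for m
  proof -
    have "1 \<le> p' m ^ (n + n)" using p'1 by (rule one_le_power)
    then have "D m \<le> real (n * n) * K ^ (n + n) * p' m ^ (n + n) + p' m ^ (n + n)"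
      by (simp add: D_def power_mult_distrib mult.assoc)
    also have "\<dots> = (real (n * n) * K ^ (n + n) + 1) * p' m ^ (n + n)" by (simp add: algebra_simps)
    also have "\<dots> \<le> E * p' m ^ (n + n)"
      unfolding E_def using p'1[of m] by (intro mult_right_mono) auto
    finally show ?thesis .
  qed
  have gD: "geo (\<lambda>M. \<Prod>k<M. D (Suc k))"
  proof -
    have gp: "geo (\<lambda>M. \<Prod>k<M. p i j (Suc k))" if ij: "i < n" "j < n" for i j
      unfolding p_def using A cond ij
      by (intro small_div_product) (auto simp: normal_form_def cond_def)
    have "(\<Prod>k<M. p' (Suc k)) = (\<Prod>i<n. \<Prod>j<n. \<Prod>k<M. p i j (Suc k))" for M
    proof -
      have "(\<Prod>k<M. p' (Suc k)) = (\<Prod>i<n. \<Prod>k<M. \<Prod>j<n. p i j (Suc k))"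
        unfolding p'_def by (rule prod.swap)
      also have "\<dots> = (\<Prod>i<n. \<Prod>j<n. \<Prod>k<M. p i j (Suc k))"
        by (intro prod.cong refl prod.swap)
      finally show ?thesis .
    qed
    then have "geo (\<lambda>M. \<Prod>k<M. p' (Suc k))" by (auto intro!: geo_prod gp)
    then have "geo (\<lambda>M. E ^ M * (\<Prod>k<M. p' (Suc k)) ^ (n + n))"
      by (intro geo_mult[OF geoI[of _ 1 E] geo_power]) (auto simp: E_def)
    then show ?thesis
    proof (rule geo_mono)
      fix M
      have D0: "D k \<ge> 0" for k using K p'1[of k] by (simp add: D_def)
      have "(\<Prod>k<M. D (Suc k)) \<le> (\<Prod>k<M. E * (p' (Suc k)) ^ (n + n))"
        using DE D0 by (intro prod_mono) auto
      also have "\<dots> = E ^ M * (\<Prod>k<M. p' (Suc k)) ^ (n + n)" by (simp add: prod.distrib prod_power_distrib)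
      finally show "norm (\<Prod>k<M. D (Suc k)) \<le> norm (E ^ M * (\<Prod>k<M. p' (Suc k)) ^ (n + n))"
        using prod_nonneg[of "{..<M}" "\<lambda>k. D (Suc k)"] D0 by simp
    qed
  qed
  \<comment> \<open>The sum of the moduli of the entries of \<open>B\<close> is bounded by the
    product of the factors 1 + |entry|, to which \<open>geo_prod\<close> applies.\<close>
  have "geo (\<lambda>m. b m)"
  proof -
    have "geo (\<lambda>m. norm (\<beta> i j m))" if "i < n" "j < n" for i j
      using mats_index[OF B(1) that] by (simp add: conv_fls_geo \<beta>_def geo_def)
    then have gg: "geo (\<lambda>m. \<Prod>i<n. \<Prod>j<n. 1 + norm (\<beta> i j m))"
    proof (intro geo_prod)
      fix i j assume "i \<in> {..<n}" "j \<in> {..<n}"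
      then obtain C where C: "C \<ge> 1" "\<And>m. norm (\<beta> i j m) \<le> C ^ Suc m"
        using mats_index[OF B(1), of i j] by (auto simp: conv_fls_geo \<beta>_def geo_def)
      have "norm (1 + norm (\<beta> i j m)) \<le> (2 * C) * C ^ m" for m
        using C(2)[of m] one_le_power[OF C(1), of "Suc m"] by simp
      then show "geo (\<lambda>m. 1 + norm (\<beta> i j m))" by (rule geoI)
    qed
    have "(\<Sum>x\<in>X. g x) \<le> (\<Prod>x\<in>X. 1 + g x)" if "\<And>x. g x \<ge> 0" for X and g :: "nat \<Rightarrow> real"
    proof (induction X rule: infinite_finite_induct)
      case (insert x X)
      have "1 \<le> (\<Prod>x\<in>X. 1 + g x)" using that by (intro prod_ge_1) auto
      then have "g x * 1 \<le> g x * (\<Prod>x\<in>X. 1 + g x)" using that by (intro mult_left_mono) auto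
      then show ?case using insert by (simp add: algebra_simps)
    qed auto
    then have le: "(\<Sum>i<n. \<Sum>j<n. norm (\<beta> i j m)) \<le> (\<Prod>i<n. 1 + (\<Sum>j<n. norm (\<beta> i j m)))" for m
      by (simp add: sum_nonneg)
    have le2: "1 + (\<Sum>j\<in>X. g j) \<le> (\<Prod>j\<in>X. 1 + g j)" if "\<And>x. g x \<ge> 0" for X and g :: "nat \<Rightarrow> real"
    proof (induction X rule: infinite_finite_induct)
      case (insert x X)
      have "1 \<le> (\<Prod>x\<in>X. 1 + g x)" using that by (intro prod_ge_1) auto
      then have "g x * 1 \<le> g x * (\<Prod>x\<in>X. 1 + g x)" using that by (intro mult_left_mono) auto
      then show ?case using insert by (simp add: algebra_simps)
    qed auto
    have bl: "b m \<le> (\<Prod>i<n. \<Prod>j<n. 1 + norm (\<beta> i j m))" for m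
    proof -
      have "b m \<le> (\<Prod>i<n. 1 + (\<Sum>j<n. norm (\<beta> i j m)))" unfolding b_def by (rule le)
      also have "\<dots> \<le> (\<Prod>i<n. \<Prod>j<n. 1 + norm (\<beta> i j m))"
        by (intro prod_mono conjI le2) (auto intro!: add_nonneg_nonneg sum_nonneg)
      finally show ?thesis .
    qed
    have "norm (b m) \<le> norm (\<Prod>i<n. \<Prod>j<n. 1 + norm (\<beta> i j m))" for m
    proof -
      have "b m \<ge> 0" unfolding b_def by (intro sum_nonneg) auto
      then have "norm (b m) = b m" by simp
      also note bl
      also note abs_ge_self
      finally show ?thesis by simp
    qed
    then show ?thesis by (rule geo_mono[OF gg])
  qed
  then obtain C where C: "C \<ge> 1" "\<And>m. norm (b m) \<le> C ^ Suc m" by (auto simp: geo_def)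
  have b0: "b m \<ge> 0" for m unfolding b_def by (intro sum_nonneg) auto
  have y0: "y m \<ge> 0" for m unfolding y_def by (intro sum_nonneg) auto
  have D1: "D m \<ge> 1" for m using K p'1[of m] by (simp add: D_def)
  have "geo y"
  proof (rule small_divisor_recursion[where b = b and D = D and c = C and r = C])
    show "0 \<le> b k \<and> b k \<le> C * C ^ k" for k using b0[of k] C(2)[of k] by simp
    fix m :: nat assume m: "m > 0"
    define \<rho> where "\<rho> = (\<Sum>p<m. y p * b (m - p))"
    have \<rho>: "\<rho> \<ge> 0" unfolding \<rho>_def using y0 b0 by (intro sum_nonneg) auto
    have Rb: "norm (R i j m) \<le> \<rho>" if ij: "i < n" "j < n" for i j
    proof -
      have "norm (R i j m) \<le> (\<Sum>k<n. \<Sum>p<m. norm (h i k p) * norm (\<beta> k j (m - p)))"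
        unfolding R_def by (intro sum_norm_le) (auto simp: norm_mult[symmetric] intro!: sum_norm_le)
      also have "\<dots> = (\<Sum>p<m. \<Sum>k<n. norm (h i k p) * norm (\<beta> k j (m - p)))" by (rule sum.swap)
      also have "\<dots> \<le> (\<Sum>p<m. y p * b (m - p))"
      proof (intro sum_mono)
        fix p
        have "(\<Sum>k<n. norm (h i k p) * norm (\<beta> k j (m - p))) \<le> (\<Sum>k<n. norm (h i k p) * b (m - p))"
          unfolding b_def using ij ent[of _ _ "\<lambda>i j. \<beta> i j (m - p)"] by (intro sum_mono mult_left_mono) auto
        also have "\<dots> = (\<Sum>k<n. norm (h i k p)) * b (m - p)" by (simp add: sum_distrib_right)
        also have "\<dots> \<le> y p * b (m - p)"
          unfolding y_def using ij b0
          by (intro mult_right_mono member_le_sum[of i _ "\<lambda>i. \<Sum>j<n. norm (h i j p)"]) (auto intro: sum_nonneg)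
        finally show "(\<Sum>k<n. norm (h i k p) * norm (\<beta> k j (m - p))) \<le> y p * b (m - p)" .
      qed
      finally show ?thesis by (simp add: \<rho>_def)
    qed
    have hb: "norm (h i j m) \<le> (K * p' m) ^ (n + n) * \<rho>" if ij: "i < n" "j < n" for i j
    proof -
      have "norm (h i j m) \<le> ((1 + real (n + n) * a) / (1 / p' m)) ^ (n + n) * \<rho>"
      proof (rule sylvester_bound[where A = A and B = A and X = "\<lambda>i j. h i j m" and R = "\<lambda>i j. R i j m"
            and t = "q ^ m" and P = "\<lambda>x y. True"])
        show "0 < 1 / p' m" "1 / p' m \<le> 1" using p'1[of m] by (auto simp: field_simps)
        show "1 / p' m \<le> norm (q ^ m * A $$ (i, i) - A $$ (j, j))" if "i < n" "j < n" for i j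
        proof -
          let ?x = "norm (q ^ m * A $$ (i, i) - A $$ (j, j))"
          have "?x \<noteq> 0"
          proof
            assume "?x = 0"
            then have e: "q powi int m * A $$ (i, i) = A $$ (j, j)" by simp
            have "is_rep q (A $$ (i, i))" "is_rep q (A $$ (j, j))" using A that by (auto simp: normal_form_def)
            from is_rep_resonance[OF q_nz not_root this e] show False using m by simp
          qed
          then have x: "?x > 0" by simp
          have "1 / ?x \<le> p' m" using pp'[OF that, of m] by (simp add: p_def)
          then show ?thesis using x p'1[of m] by (simp add: field_simps)
        qed
      qed (use a A ij e Rb \<rho> norm_q in \<open>auto simp: normal_form_def norm_power\<close>)
      then show ?thesis by (simp add: K_def)
    qed
    have "y m \<le> (\<Sum>i<n. \<Sum>j<n. (K * p' m) ^ (n + n) * \<rho>)" unfolding y_def by (intro sum_mono hb) auto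
    also have "\<dots> = real (n * n) * (K * p' m) ^ (n + n) * \<rho>" by simp
    also have "\<dots> \<le> D m * \<rho>" using \<rho> by (intro mult_right_mono) (auto simp: D_def)
    finally show "y m \<le> D m * (\<Sum>p<m. y p * b (m - p))" by (simp add: \<rho>_def)
  qed (use y0 C D1 gD in auto)
  then have "geo (h i j)" if "i < n" "j < n" for i j
  proof (rule geo_mono)
    fix m
    have "norm (h i j m) \<le> y m" using ent[OF that, of "\<lambda>i j. h i j m"] by (simp add: y_def)
    then show "norm (h i j m) \<le> norm (y m)" by simp
  qed
  moreover have "h i j = (\<lambda>m. fls_nth (H $$ (i, j)) (int m))" for i j by (auto simp: h_def)
  ultimately show ?thesis using H(1) by (simp add: mats_def conv_fls_geo)
qed

text \<open>\<open>F\<close> may have poles and any leading term, so \<open>gauge_converges\<close>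
  does not apply to it directly. A Laurent polynomial \<open>T\<close> close to \<open>F\<close>
  takes over the polar part: the matrix H with H T = F is a power series with constant term 1, and
  it carries the convergent matrix \<open>B'\<close>, the transform of \<open>B\<close> by
  \<open>T\<close>, to \<open>A\<close>. Hence \<open>B'\<close> has constant term \<open>A\<close>,
  \<open>H\<close> converges, and so does \<open>F\<close>.\<close>

lemma formal_gauge_converges:
  assumes A: "normal_form q n A" and cond: "cond q n A" and B: "B \<in> inv_mats conv_fls n"
    and F: "F \<in> inv_mats UNIV n" and eq: "F * B = cmat A * sigm q F"
  shows "F \<in> inv_mats conv_fls n"
proof -
  have S: "subfld conv_fls" by (rule subfld_conv_fls)
  have Ac: "A \<in> carrier_mat n n" using A by (auto simp: normal_form_def)
  note Fc = inv_mats_carrier[OF F] and Bm = inv_mats_mats[OF B]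
  note Bc = mats_carrier[OF Bm]
  obtain G where G: "G \<in> carrier_mat n n" "F * G = 1\<^sub>m n" "G * F = 1\<^sub>m n"
    using F by (auto simp: inv_mats_def mats_def)
  \<comment> \<open>The poles of the inverse \<open>G\<close> have order at most \<open>s\<close>;
    this decides how far \<open>F\<close> must be kept.\<close>
  obtain s where s: "\<And>i j l. i < n \<Longrightarrow> j < n \<Longrightarrow> l < - s \<Longrightarrow> fls_nth (G $$ (i, j)) l = 0"
  proof
    let ?D = "(\<lambda>(i, j). fls_subdegree (G $$ (i, j))) ` ({..<n} \<times> {..<n})"
    fix i j l assume ij: "i < n" "j < n" and l: "l < - (- Min ?D)"
    have "fls_subdegree (G $$ (i, j)) \<in> ?D" using ij by (intro image_eqI[of _ _ "(i, j)"]) auto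
    then have "Min ?D \<le> fls_subdegree (G $$ (i, j))" by (intro Min_le) auto
    then have "l < fls_subdegree (G $$ (i, j))" using l by simp
    then show "fls_nth (G $$ (i, j)) l = 0" by simp
  qed
  \<comment> \<open>Terms of order above \<open>s\<close> are cut off; what remains is a Laurent
    polynomial and hence convergent.\<close>
  define trunc where "trunc f = Abs_fls (\<lambda>l. if l \<le> s then fls_nth f l else 0)" for f :: "complex fls"
  have tn: "fls_nth (trunc f) l = (if l \<le> s then fls_nth f l else 0)" for f l
    unfolding trunc_def
    by (rule nth_Abs_fls_lower_bound[of "fls_subdegree f"]) auto
  define T where "T = map_mat trunc F"
  have Tc: "T \<in> carrier_mat n n" using Fc by (simp add: T_def)
  have Tm: "T \<in> mats conv_fls n n"
  proof -
    have "trunc f \<in> conv_fls" for f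
    proof -
      have "geo (\<lambda>m. fls_nth (trunc f) (int m))"
        by (rule geo_finite_support[of "nat s"]) (auto simp: tn)
      then show ?thesis by (simp add: conv_fls_geo)
    qed
    then show ?thesis using Tc Fc by (auto simp: mats_def T_def)
  qed
  \<comment> \<open>\<open>F - T\<close> vanishes to an order greater than \<open>s\<close>, so
    \<open>T * G\<close> differs from \<open>F * G = 1\<close> in positive orders only.\<close>
  have UG: "fls_nth ((T * G) $$ (i, j)) l = (if l = 0 \<and> i = j then 1 else 0)" if ij: "i < n" "j < n" and l: "l \<le> 0" for i j l
  proof -
    have "fls_nth (T $$ (i, k) * G $$ (k, j)) l = fls_nth (F $$ (i, k) * G $$ (k, j)) l" if k: "k < n" for k
    proof -
      let ?d = "F $$ (i, k) - T $$ (i, k)"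
      have dz: "fls_nth ?d p = 0" if "p \<le> s" for p using that ij k Fc by (simp add: T_def tn)
      have "fls_nth (?d * G $$ (k, j)) l = 0"
      proof (cases "?d = 0 \<or> G $$ (k, j) = 0")
        case False
        then have "fls_subdegree ?d > s" using dz by (metis not_le nth_fls_subdegree_nonzero)
        moreover have "fls_subdegree (G $$ (k, j)) \<ge> - s"
          using False s[OF k ij(2)] by (metis not_le nth_fls_subdegree_nonzero)
        ultimately show ?thesis using l by (intro fls_times_nth_eq0) simp
      qed auto
      then show ?thesis by (simp add: left_diff_distrib)
    qed
    then have "fls_nth ((T * G) $$ (i, j)) l = fls_nth ((F * G) $$ (i, j)) l"
      unfolding mat_mult_index[OF Tc G(1) ij] mat_mult_index[OF Fc G(1) ij] fls_nth_sum by (intro sum.cong) auto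
    then show ?thesis using ij by (auto simp: G(2))
  qed
  define U where "U = map_mat fls_regpart (T * G)"
  have TGc: "T * G \<in> carrier_mat n n" using Tc G by simp
  have Uc: "U \<in> carrier_mat n n" using TGc by (simp add: U_def)
  have fU: "fmat U = T * G"
    using UG TGc by (intro eq_matI) (auto simp: U_def simp del: index_mult_mat intro!: fls_eq_fps)
  have U0: "map_mat (\<lambda>f. fps_nth f 0) U = 1\<^sub>m n"
    using UG TGc by (intro eq_matI) (auto simp: U_def simp del: index_mult_mat)
  obtain V where V: "V \<in> carrier_mat n n" "U * V = 1\<^sub>m n" "V * U = 1\<^sub>m n"
    using fps_mat_inverse[OF Uc] U0 by auto
  have V0: "map_mat (\<lambda>f. fps_nth f 0) V = 1\<^sub>m n"
  proof -
    have "map_mat (\<lambda>f. fps_nth f 0) U * map_mat (\<lambda>f. fps_nth f 0) V = 1\<^sub>m n"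
      using semiring_hom.mat_hom_mult[OF fps_nth_0_hom Uc V(1)] V(2) semiring_hom.mat_hom_one[OF fps_nth_0_hom]
      by metis
    then show ?thesis using V(1) by (simp add: U0)
  qed
  define H where "H = fmat V"
  have Hc: "H \<in> carrier_mat n n" using V by (simp add: H_def)
  have TGH: "T * G * H = 1\<^sub>m n" and HTG: "H * (T * G) = 1\<^sub>m n"
    using fmat_mult[OF Uc V(1)] fmat_mult[OF V(1) Uc] V fmat_one by (auto simp: H_def fU)
  have GHc: "G * H \<in> carrier_mat n n" using G Hc by simp
  have TI: "T * (G * H) = 1\<^sub>m n" using TGH assoc_mult_mat[OF Tc G(1) Hc] by simp
  have TI': "(G * H) * T = 1\<^sub>m n" by (rule mat_mult_left_right_inverse[OF Tc GHc TI])
  \<comment> \<open>\<open>G * H\<close> is the inverse of the convergent matrix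
    \<open>T\<close>.\<close>
  have GHm: "G * H \<in> mats conv_fls n n" by (rule mats_inverse[OF S Tm GHc TI])
  have HT: "H * T = F"
  proof -
    have "H * T = H * (T * (G * F))" using G Tc Hc by simp
    also have "\<dots> = H * ((T * G) * F)" using assoc_mult_mat[OF Tc G(1) Fc] by simp
    also have "\<dots> = (H * (T * G)) * F" using assoc_mult_mat[OF Hc TGc Fc] by simp
    finally show ?thesis using Fc by (simp add: HTG)
  qed
  have FGH: "F * (G * H) = H" using assoc_mult_mat[OF Fc G(1) Hc] G Hc by simp
  define B' where "B' = T * B * sigm q (G * H)"
  have Qc: "qfield q conv_fls" by (rule qfield_conv[OF norm_q])
  have B'm: "B' \<in> mats conv_fls n n"
    unfolding B'_def by (rule mats_mult[OF S mats_mult[OF S Tm Bm] sigm_mats[OF Qc GHm]])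
  note B'c = mats_carrier[OF B'm]
  have sc: "sigm q F \<in> carrier_mat n n" "sigm q (G * H) \<in> carrier_mat n n" using Fc GHc by auto
  have HB': "H * B' = cmat A * sigm q H"
  proof -
    have "H * B' = H * (T * (B * sigm q (G * H)))" unfolding B'_def using assoc_mult_mat[OF Tc Bc sc(2)] by simp
    also have "\<dots> = F * (B * sigm q (G * H))"
      using assoc_mult_mat[OF Hc Tc, of "B * sigm q (G * H)" n] Bc sc by (simp add: HT)
    also have "\<dots> = (cmat A * sigm q F) * sigm q (G * H)" using assoc_mult_mat[OF Fc Bc sc(2)] eq by simp
    also have "\<dots> = cmat A * sigm q (F * (G * H))"
      using assoc_mult_mat[OF _ sc, of "cmat A"] Ac sigm_mult[OF q_nz Fc GHc] by simp
    finally show ?thesis by (simp add: FGH)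
  qed
  define A1 where "A1 = map_mat fps_const A"
  have A1c: "A1 \<in> carrier_mat n n" using Ac by (simp add: A1_def)
  define W where "W = U * (A1 * map_mat (fps_sigma q) V)"
  have Wc: "W \<in> carrier_mat n n" using Uc A1c V by (simp add: W_def)
  \<comment> \<open>By its definition \<open>B'\<close> is convergent; this second description shows
    that it has no poles and that its constant term is \<open>A\<close>.\<close>
  have B'W: "B' = fmat W"
  proof -
    have "B' = T * G * (H * B')" using assoc_mult_mat[OF TGc Hc B'c] TGH B'c by simp
    also have "\<dots> = fmat U * (fmat A1 * fmat (map_mat (fps_sigma q) V))"
    proof -
      have "fmat A1 = cmat A" by (intro eq_matI) (auto simp: A1_def)
      then show ?thesis unfolding HB' fU using sigm_fmat[OF q_nz, of V] by (simp add: H_def)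
    qed
    also have "\<dots> = fmat W"
      unfolding W_def using fmat_mult[OF Uc, of "A1 * map_mat (fps_sigma q) V" n]
        fmat_mult[OF A1c, of "map_mat (fps_sigma q) V" n] A1c V by simp
    finally show ?thesis .
  qed
  have W0: "map_mat (\<lambda>f. fps_nth f 0) W = A"
  proof -
    have sV0: "map_mat (\<lambda>f. fps_nth f 0) (map_mat (fps_sigma q) V) = map_mat (\<lambda>f. fps_nth f 0) V"
      by (intro eq_matI) (auto simp: fps_sigma_def)
    have A10: "map_mat (\<lambda>f. fps_nth f 0) A1 = A" by (intro eq_matI) (auto simp: A1_def)
    show ?thesis
      unfolding W_def using semiring_hom.mat_hom_mult[OF fps_nth_0_hom Uc, of "A1 * map_mat (fps_sigma q) V" n]
        semiring_hom.mat_hom_mult[OF fps_nth_0_hom A1c, of "map_mat (fps_sigma q) V" n] A1c V Ac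
      by (simp add: U0 V0 sV0 A10)
  qed
  have "H \<in> mats conv_fls n n"
  proof (rule gauge_converges[OF A cond Hc _ B'm _ _ HB'])
    fix i j assume ij: "i < n" "j < n"
    show "fls_nth (B' $$ (i, j)) 0 = A $$ (i, j)"
      using arg_cong[OF W0, of "\<lambda>M. M $$ (i, j)"] ij Wc by (simp add: B'W)
  qed (use V Wc in \<open>auto simp: H_def B'W\<close>)
  then have "F \<in> mats conv_fls n n" using mats_mult[OF S _ Tm] HT by metis
  then show ?thesis
    using mats_inverse[OF S _ G(1,2)] G by (auto simp: inv_mats_def)
qed

text \<open>Perturbing one extremal entry of \<open>A\<close> gives a module formally isomorphic to that of \<open>A\<close> through
  \<open>1 + f e\<^sub>i\<^sub>j\<close> with coefficients \<open>f\<^sub>m = 1 / (q\<^sup>m A\<^sub>i\<^sub>i - A\<^sub>j\<^sub>j)\<close>.\<close>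

lemma cond_if_formal_gauges_converge:
  assumes A: "normal_form q n A"
    and iso: "\<And>B F. B \<in> inv_mats conv_fls n \<Longrightarrow> F \<in> inv_mats UNIV n \<Longrightarrow> F * B = cmat A * sigm q F \<Longrightarrow>
      \<exists>P\<in>inv_mats conv_fls n. P * B = cmat A * sigm q P"
  shows "cond q n A"
  unfolding cond_def
proof (intro allI impI)
  fix i' j' assume ij': "i' < n" "j' < n" and ne: "A $$ (i', i') \<noteq> A $$ (j', j')"
  have S: "subfld conv_fls" by (rule subfld_conv_fls)
  have Ac: "A \<in> carrier_mat n n" using A by (auto simp: normal_form_def)
  define \<kappa> where "\<kappa> = A $$ (i', i')"
  define \<mu> where "\<mu> = A $$ (j', j')"
  \<comment> \<open>The first place of the eigenvalue \<kappa> and the last place of \<mu>. Then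
    column \<open>i\<close> and row \<open>j\<close> of \<open>A\<close> vanish off the diagonal, so
    the matrix unit at (i, j) meets only the two diagonal entries.\<close>
  define i where "i = (LEAST i. i < n \<and> A $$ (i, i) = \<kappa>)"
  have i: "i < n" "A $$ (i, i) = \<kappa>"
    using LeastI[of "\<lambda>i. i < n \<and> A $$ (i, i) = \<kappa>" i'] ij' by (auto simp: i_def \<kappa>_def)
  have imin: "i \<le> k" if "k < n" "A $$ (k, k) = \<kappa>" for k
    unfolding i_def using that by (intro Least_le) auto
  define j where "j = Max {j. j < n \<and> A $$ (j, j) = \<mu>}"
  have "j \<in> {j. j < n \<and> A $$ (j, j) = \<mu>}"
    unfolding j_def using ij' by (intro Max_in) (auto simp: \<mu>_def)
  then have j: "j < n" "A $$ (j, j) = \<mu>" by auto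
  have jmax: "k \<le> j" if "k < n" "A $$ (k, k) = \<mu>" for k
    unfolding j_def using that by (intro Max_ge) auto
  have ij: "i \<noteq> j" "\<kappa> \<noteq> \<mu>" using i j ne by (auto simp: \<kappa>_def \<mu>_def)
  have rep: "is_rep q \<kappa>" "is_rep q \<mu>" using A ij' by (auto simp: normal_form_def \<kappa>_def \<mu>_def)
  have nz: "q ^ m * \<kappa> - \<mu> \<noteq> 0" for m
  proof
    assume "q ^ m * \<kappa> - \<mu> = 0"
    then have "q powi int m * \<kappa> = \<mu>" by simp
    then show False using is_rep_resonance[OF q_nz not_root rep, of "int m"] ij by auto
  qed
  have coli: "A $$ (k, i) = 0" if "k < n" "k \<noteq> i" for k
    using A that i imin[of k] unfolding normal_form_def by (metis le_antisym)
  have rowj: "A $$ (j, k) = 0" if "k < n" "k \<noteq> j" for k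
    using A that j jmax[of k] unfolding normal_form_def by (metis le_antisym)
  define f where "f = fps_to_fls (Abs_fps (\<lambda>m. 1 / (q ^ m * \<kappa> - \<mu>)))"
  \<comment> \<open>The series of 1 / (1 - x): convergent, and with all coefficients equal to 1, so
    that every divisor is tested.\<close>
  define g where "g = fps_to_fls (Abs_fps (\<lambda>m. 1 :: complex))"
  have fg: "fls_const \<kappa> * sigma_q q f - fls_const \<mu> * f = g"
  proof (rule fls_eqI)
    fix l
    show "fls_nth (fls_const \<kappa> * sigma_q q f - fls_const \<mu> * f) l = fls_nth g l"
    proof (cases "l < 0")
      case False
      define x where "x = 1 / (q ^ nat l * \<kappa> - \<mu>)"
      have "fls_nth f l = x" using False by (simp add: f_def x_def)
      then have "fls_nth (fls_const \<kappa> * sigma_q q f - fls_const \<mu> * f) l = (q ^ nat l * \<kappa> - \<mu>) * x"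
        using False by (simp add: sigma_q_nth[OF q_nz] power_int_def algebra_simps)
      then show ?thesis using nz False by (simp add: g_def x_def)
    qed (simp add: sigma_q_nth[OF q_nz] f_def g_def)
  qed
  have gc: "g \<in> conv_fls"
    using geo_const[of "1 :: complex"] by (simp add: conv_fls_geo g_def)
  define H where "H = mat n n (\<lambda>(a, b). if a = b then 1 else if a = i \<and> b = j then f else 0)"
  define H' where "H' = mat n n (\<lambda>(a, b). if a = b then 1 else if a = i \<and> b = j then - f else 0)"
  \<comment> \<open>The matrix for which \<open>H * B = cmat A * sigm q H\<close>. It differs from
    \<open>A\<close> by the convergent \<open>g\<close> in one place, although \<open>H\<close>
    itself may diverge.\<close>
  define B where "B = mat n n (\<lambda>(a, b). fls_const (A $$ (a, b)) + (if a = i \<and> b = j then g else 0))"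
  have c: "H \<in> carrier_mat n n" "H' \<in> carrier_mat n n" "B \<in> carrier_mat n n" "cmat A \<in> carrier_mat n n"
    using Ac by (auto simp: H_def H'_def B_def)
  have Hmul: "(H * X) $$ (a, b) = X $$ (a, b) + (if a = i then f * X $$ (j, b) else 0)"
    if "X \<in> carrier_mat n n" "a < n" "b < n" for X a b
  proof -
    have "(H * X) $$ (a, b) = (\<Sum>l<n. H $$ (a, l) * X $$ (l, b))" using mat_mult_index[OF c(1) that] .
    also have "\<dots> = (\<Sum>l<n. (if l = a then X $$ (a, b) else 0) + (if l = j then (if a = i then f * X $$ (j, b) else 0) else 0))"
      using that ij by (intro sum.cong) (auto simp: H_def)
    also have "\<dots> = X $$ (a, b) + (if a = i then f * X $$ (j, b) else 0)"
      unfolding sum.distrib using that j by simp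
    finally show ?thesis .
  qed
  have HH': "H * H' = 1\<^sub>m n"
    using c ij i j by (intro eq_matI) (auto simp: Hmul simp del: index_mult_mat, auto simp: H'_def)
  have eq: "H * B = cmat A * sigm q H"
  proof (rule eq_matI)
    fix a b assume "a < dim_row (cmat A * sigm q H)" "b < dim_col (cmat A * sigm q H)"
    then have ab: "a < n" "b < n" using c by auto
    have "(cmat A * sigm q H) $$ (a, b) = (\<Sum>l<n. fls_const (A $$ (a, l)) * sigma_q q (H $$ (l, b)))"
      using mat_mult_index[of "cmat A" n n "sigm q H" n a b] ab c Ac by (simp del: index_mult_mat)
    also have "\<dots> = (\<Sum>l<n. (if l = b then fls_const (A $$ (a, b)) else 0) +
        (if l = i then (if b = j then fls_const (A $$ (a, i)) * sigma_q q f else 0) else 0))"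
      using ab ij by (intro sum.cong) (auto simp: H_def)
    also have "\<dots> = fls_const (A $$ (a, b)) + (if b = j then fls_const (A $$ (a, i)) * sigma_q q f else 0)"
      unfolding sum.distrib using ab i by simp
    also have "\<dots> = (H * B) $$ (a, b)"
      using ab i j ij coli[of a] rowj[of b] unfolding Hmul[OF c(3) ab]
      by (auto simp: B_def fg[symmetric] algebra_simps)
    finally show "(H * B) $$ (a, b) = (cmat A * sigm q H) $$ (a, b)" ..
  qed (use c in auto)
  have H'H: "H' * H = 1\<^sub>m n" by (rule mat_mult_left_right_inverse[OF c(1,2) HH'])
  have HI: "H \<in> inv_mats UNIV n" "H' \<in> inv_mats UNIV n" using c HH' H'H by (auto simp: inv_mats_def mats_def)
  have BI: "B \<in> inv_mats conv_fls n"
  proof (rule inv_matsI[OF S])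
    show "B \<in> mats conv_fls n n"
      using gc fls_const_conv by (auto simp: mats_def B_def subfld_zero[OF S] intro!: subfld_add[OF S])
    have "det (cmat A) \<noteq> 0" "det (sigm q H) \<noteq> 0"
    proof -
      have d: "det X \<noteq> 0" if "X \<in> carrier_mat n n" "Y \<in> carrier_mat n n" "X * Y = 1\<^sub>m n" for X Y :: "complex fls mat"
        using det_mult[OF that(1,2)] that(3) by auto
      show "det (cmat A) \<noteq> 0" using normal_form_cmat_inv[OF A] d by (auto simp: inv_mats_def mats_def)
      have "sigm q H * sigm q H' = 1\<^sub>m n" using sigm_mult[OF q_nz c(1,2)] HH' sigm_one[OF q_nz] by metis
      then show "det (sigm q H) \<noteq> 0" using d[of "sigm q H" "sigm q H'"] c by auto
    qed
    then have "det (H * B) \<noteq> 0" unfolding eq using det_mult[of "cmat A" n "sigm q H"] c by auto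
    then show "det B \<noteq> 0" using det_mult[OF c(1,3)] by auto
  qed
  obtain P where P: "P \<in> inv_mats conv_fls n" "P * B = cmat A * sigm q P" using iso[OF BI HI(1) eq] by blast
  note Pc = inv_mats_carrier[OF P(1)]
  have eq': "H' * cmat A = B * sigm q H'" by (rule inverse_intertwine[OF q_nz c(1,2) HH' H'H c(3,4) eq])
  \<comment> \<open>A formal endomorphism of \<open>A\<close>, hence constant. So \<open>H'\<close>
    is the inverse of the convergent \<open>P\<close> times a constant matrix, and \<open>f\<close>
    has to converge.\<close>
  have "(P * H') * cmat A = cmat A * sigm q (P * H')"
    by (rule compose_intertwine[OF q_nz c(2) Pc c(4,3,4) eq' P(2)])
  then obtain Q where Q: "Q \<in> carrier_mat n n" "P * H' = cmat Q"
    using formal_hom_const[OF A A, of "P * H'"] Pc c by auto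
  obtain P' where P': "P' \<in> mats conv_fls n n" "P' * P = 1\<^sub>m n" using P(1) by (auto simp: inv_mats_def)
  have "H' = P' * cmat Q"
    using assoc_mult_mat[OF mats_carrier[OF P'(1)] Pc c(2)] P'(2) c Q(2) by simp
  then have "H' \<in> mats conv_fls n n" using mats_mult[OF S P'(1) cmat_mats[OF Q(1)]] by simp
  then have "- f \<in> conv_fls" using mats_index[of H' conv_fls n n i j] i j ij by (auto simp: H'_def)
  then have "f \<in> conv_fls" using subfld_minus[OF S, of "- f"] by simp
  then have "geo (\<lambda>m. 1 / (q ^ m * \<kappa> - \<mu>))" by (simp add: conv_fls_geo f_def)
  then have "geo (\<lambda>m. - \<mu> * (1 / (q ^ m * \<kappa> - \<mu>)))" by (rule geo_mult[OF geo_const])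
  moreover have "- \<mu> * (1 / (q ^ m * \<kappa> - \<mu>)) = 1 / (1 - q ^ m * (\<kappa> / \<mu>))" for m
    using nz[of m] rep(2) by (auto simp: is_rep_def field_simps)
  ultimately show "small_div q (A $$ (i', i') / A $$ (j', j'))"
    by (simp add: small_div_def \<kappa>_def \<mu>_def)
qed

end

section \<open>Formal reduction to normal form\<close>

lemma det_first_column:
  fixes B :: "'a :: idom mat"
  assumes B: "B \<in> carrier_mat (Suc k) (Suc k)" and z: "\<And>i. i < k \<Longrightarrow> B $$ (Suc i, 0) = 0"
  shows "det B = B $$ (0, 0) * det (mat k k (\<lambda>(i, j). B $$ (Suc i, Suc j)))"
proof -
  have "B = four_block_mat (mat 1 1 (\<lambda>_. B $$ (0, 0))) (mat 1 k (\<lambda>(i, j). B $$ (0, Suc j)))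
      (0\<^sub>m k 1) (mat k k (\<lambda>(i, j). B $$ (Suc i, Suc j)))"
  proof (rule eq_matI)
    fix i j assume "i < dim_row (four_block_mat (mat 1 1 (\<lambda>_. B $$ (0, 0))) (mat 1 k (\<lambda>(i, j). B $$ (0, Suc j)))
      (0\<^sub>m k 1) (mat k k (\<lambda>(i, j). B $$ (Suc i, Suc j))))" "j < dim_col (four_block_mat (mat 1 1 (\<lambda>_. B $$ (0, 0))) (mat 1 k (\<lambda>(i, j). B $$ (0, Suc j)))
      (0\<^sub>m k 1) (mat k k (\<lambda>(i, j). B $$ (Suc i, Suc j))))"
    then have ij: "i < Suc k" "j < Suc k" by auto
    then show "B $$ (i, j) = four_block_mat (mat 1 1 (\<lambda>_. B $$ (0, 0))) (mat 1 k (\<lambda>(i, j). B $$ (0, Suc j)))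
      (0\<^sub>m k 1) (mat k k (\<lambda>(i, j). B $$ (Suc i, Suc j))) $$ (i, j)"
      using z by (cases i; cases j) auto
  qed (use B in auto)
  also have "det \<dots> = det (mat 1 1 (\<lambda>_. B $$ (0, 0))) * det (mat k k (\<lambda>(i, j). B $$ (Suc i, Suc j)))"
    by (rule det_four_block_mat_lower_left_zero) auto
  also have "det (mat 1 1 (\<lambda>_. B $$ (0, 0))) = B $$ (0, 0)" by (subst det_single) auto
  finally show ?thesis .
qed

lemma complete_to_basis:
  fixes v :: "complex fps vec"
  assumes v: "v \<in> carrier_vec n" and r: "r < n" "fps_nth (v $ r) 0 \<noteq> 0"
  shows "\<exists>P\<in>carrier_mat n n. (\<forall>i<n. P $$ (i, 0) = v $ i) \<and> det (map_mat (\<lambda>f. fps_nth f 0) P) \<noteq> 0"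
proof -
  \<comment> \<open>Column 0 is \<open>v\<close>, column \<open>r\<close> takes the unit vector
    displaced from column 0, and the other columns are those of the identity.\<close>
  define P :: "complex fps mat" where "P = mat n n (\<lambda>(i, j). if j = 0 then v $ i
     else if j = r then (if i = 0 then 1 else 0) else (if i = j then 1 else 0))"
  let ?P0 = "map_mat (\<lambda>f. fps_nth f 0) P"
  have "det ?P0 \<noteq> 0"
  proof
    assume "det ?P0 = 0"
    then obtain y where y: "y \<in> carrier_vec n" "y \<noteq> 0\<^sub>v n" "?P0 *\<^sub>v y = 0\<^sub>v n"
      using det_0_iff_vec_prod_zero[of ?P0 n] by (auto simp: P_def)
    have row: "(\<Sum>j<n. ?P0 $$ (i, j) * y $ j) = 0" if "i < n" for i
      using arg_cong[OF y(3), of "\<lambda>w. w $ i"] that y(1) by (simp add: P_def scalar_prod_def atLeast0LessThan)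
    have "(\<Sum>j<n. ?P0 $$ (r, j) * y $ j) = (\<Sum>j<n. if j = 0 then fps_nth (v $ r) 0 * y $ 0 else 0)"
      using r by (intro sum.cong) (auto simp: P_def)
    then have y0: "y $ 0 = 0" using row[OF r(1)] r by simp
    have yi: "y $ i = 0" if "i < n" "i \<noteq> r" "i \<noteq> 0" for i
    proof -
      have "(\<Sum>j<n. ?P0 $$ (i, j) * y $ j) = (\<Sum>j<n. if j = i then y $ i else 0)"
        using that y0 by (intro sum.cong) (auto simp: P_def)
      then show ?thesis using row[OF that(1)] that by simp
    qed
    have yr: "y $ r = 0"
    proof (cases "r = 0")
      case False
      have "(\<Sum>j<n. ?P0 $$ (0, j) * y $ j) = (\<Sum>j<n. if j = r then y $ r else 0)"
        using False r y0 yi by (intro sum.cong) (auto simp: P_def)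
      then show ?thesis using row[of 0] r by simp
    qed (use y0 in simp)
    have "y $ i = 0" if "i < n" for i using yi[OF that] yr y0 by (cases "i = r \<or> i = 0") auto
    then have "y = 0\<^sub>v n" using y(1) by (intro eq_vecI) auto
    then show False using y(2) by simp
  qed
  then show ?thesis by (intro bexI[of _ P]) (auto simp: P_def)
qed

section \<open>Formal eigenvectors and induction on the size\<close>

context small_q
begin

text \<open>Repeated multiplication by 1 / q meets the finite spectrum only finitely often, because
  \<open>q\<close> is not a root of unity. The last eigenvalue met is taken.\<close>

lemma minimal_eigenvalue:
  assumes A: "(A :: complex mat) \<in> carrier_mat n n" and n: "n > 0" and d: "det A \<noteq> 0"
  shows "\<exists>\<kappa>. \<kappa> \<noteq> 0 \<and> eigenvalue A \<kappa> \<and> (\<forall>m>0. \<not> eigenvalue A (\<kappa> * inverse q ^ m))"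
proof -
  define E where "E = {k. eigenvalue A k}"
  have E: "E = {k. poly (char_poly A) k = 0}" by (simp add: E_def eigenvalue_root_char_poly[OF A])
  have deg: "degree (char_poly A) = n" using degree_monic_char_poly[OF A] by simp
  then have cp: "char_poly A \<noteq> 0" using n by auto
  have fin: "finite E" unfolding E using poly_roots_finite[OF cp] .
  obtain k0 where k0: "k0 \<in> E"
    unfolding E using fundamental_theorem_of_algebra[of "char_poly A"] n deg by (auto simp: constant_degree)
  have E0: "k \<noteq> 0" if kE: "k \<in> E" for k
  proof
    assume "k = 0"
    then obtain v where v: "v \<in> carrier_vec n" "v \<noteq> 0\<^sub>v n" "A *\<^sub>v v = 0 \<cdot>\<^sub>v v"
      using kE A by (auto simp: E_def eigenvalue_def eigenvector_def)
    then have "A *\<^sub>v v = 0\<^sub>v n" by auto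
    then show False using d det_0_iff_vec_prod_zero[OF A] v by blast
  qed
  define J where "J = {m. k0 * inverse q ^ m \<in> E}"
  have "inj (\<lambda>m. k0 * inverse q ^ m)"
  proof (rule injI)
    fix x y assume "k0 * inverse q ^ x = k0 * inverse q ^ y"
    then have "inverse q ^ x = inverse q ^ y" using E0[OF k0] by simp
    then have "q ^ x = q ^ y" by (simp add: power_inverse)
    then have "q powi (int x - int y) = 1" using q_nz by (simp add: power_int_diff)
    then show "x = y" using powi_eq_1 by fastforce
  qed
  then have J: "finite J" unfolding J_def by (rule finite_vimageI[OF fin, unfolded vimage_def])
  have J0: "0 \<in> J" using k0 by (simp add: J_def)
  define M where "M = Max J"
  have M: "M \<in> J" unfolding M_def using J J0 by (intro Max_in) auto
  have M': "M + m \<notin> J" if "m > 0" for m using Max_ge[OF J, of "M + m"] that by (auto simp: M_def)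
  show ?thesis
  proof (intro exI conjI allI impI)
    show "eigenvalue A (k0 * inverse q ^ M)" using M by (simp add: J_def E_def)
    show "k0 * inverse q ^ M \<noteq> 0" by (rule E0) (use M in \<open>simp add: J_def\<close>)
    fix m :: nat assume "m > 0"
    then show "\<not> eigenvalue A (k0 * inverse q ^ M * inverse q ^ m)"
      using M'[of m] by (simp add: J_def E_def power_add mult.assoc)
  qed
qed

text \<open>The coefficient v_x solves (\<kappa> - q^x A(0)) v_x = terms in earlier coefficients.
  That matrix is singular only if \<kappa> q^-x is an eigenvalue of A(0), which the choice of
  \<kappa> excludes for x > 0.\<close>

lemma formal_eigenvector:
  assumes A: "A \<in> carrier_mat n n" and n: "n > 0" and d: "det (map_mat (\<lambda>f. fps_nth f 0) A) \<noteq> 0"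
  shows "\<exists>\<kappa> v r. \<kappa> \<noteq> 0 \<and> v \<in> carrier_vec n \<and> r < n \<and> fps_nth (v $ r) 0 \<noteq> 0 \<and>
    (\<forall>i<n. (\<Sum>j<n. A $$ (i, j) * fps_sigma q (v $ j)) = fps_const \<kappa> * v $ i)"
proof -
  let ?A0 = "map_mat (\<lambda>f. fps_nth f 0) A"
  have A0: "?A0 \<in> carrier_mat n n" using A by simp
  obtain \<kappa> where \<kappa>: "\<kappa> \<noteq> 0" "eigenvalue ?A0 \<kappa>" "\<And>m. m > 0 \<Longrightarrow> \<not> eigenvalue ?A0 (\<kappa> * inverse q ^ m)"
    using minimal_eigenvalue[OF A0 n d] by blast
  obtain v0 where v0: "v0 \<in> carrier_vec n" "v0 \<noteq> 0\<^sub>v n" "?A0 *\<^sub>v v0 = \<kappa> \<cdot>\<^sub>v v0"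
    using \<kappa>(2) A by (auto simp: eigenvalue_def eigenvector_def)
  \<comment> \<open>The recursion for the coefficients, in the form required by well-founded choice:
    the condition at \<open>x\<close> depends on \<open>f\<close> below \<open>x\<close>
    only.\<close>
  define P where "P f x r \<longleftrightarrow> r \<in> carrier_vec n \<and> (if x = 0 then r = v0 else
      (\<forall>i<n. \<kappa> * r $ i - q ^ x * (\<Sum>j<n. fps_nth (A $$ (i, j)) 0 * r $ j) =
        (\<Sum>k<x. q ^ k * (\<Sum>j<n. fps_nth (A $$ (i, j)) (x - k) * f k $ j))))"
    for f :: "nat \<Rightarrow> complex vec" and x r
  have "\<exists>f. \<forall>x. P f x (f x)"
  proof (rule dependent_wellorder_choice)
    fix r :: "complex vec" and f g and x :: nat assume fg: "\<And>y. y < x \<Longrightarrow> f y = (g y :: complex vec)"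
    have "(\<Sum>k<x. q ^ k * (\<Sum>j<n. fps_nth (A $$ (i, j)) (x - k) * f k $ j)) =
       (\<Sum>k<x. q ^ k * (\<Sum>j<n. fps_nth (A $$ (i, j)) (x - k) * g k $ j))" for i
      by (intro sum.cong) (auto simp: fg)
    then show "P f x r = P g x r" by (simp add: P_def)
  next
    fix x and f :: "nat \<Rightarrow> complex vec"
    show "\<exists>r. P f x r"
    proof (cases "x = 0")
      case True
      then show ?thesis using v0 by (auto simp: P_def)
    next
      case False
      define b where "b = vec n (\<lambda>i. \<Sum>k<x. q ^ k * (\<Sum>j<n. fps_nth (A $$ (i, j)) (x - k) * f k $ j))"
      define Y where "Y = mat n n (\<lambda>(i, j). (if i = j then \<kappa> else 0) - q ^ x * fps_nth (A $$ (i, j)) 0)"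
      have Yc: "Y \<in> carrier_mat n n" by (simp add: Y_def)
      have Yi: "(Y *\<^sub>v w) $ i = \<kappa> * w $ i - q ^ x * (\<Sum>j<n. fps_nth (A $$ (i, j)) 0 * w $ j)"
        if "w \<in> carrier_vec n" "i < n" for w i
      proof -
        have "(Y *\<^sub>v w) $ i = (\<Sum>j<n. (if j = i then \<kappa> * w $ i else 0) - q ^ x * (fps_nth (A $$ (i, j)) 0 * w $ j))"
          using that by (auto simp: Y_def scalar_prod_def atLeast0LessThan left_diff_distrib intro!: sum.cong)
        also have "\<dots> = \<kappa> * w $ i - q ^ x * (\<Sum>j<n. fps_nth (A $$ (i, j)) 0 * w $ j)"
          using that by (simp add: sum_subtractf sum_distrib_left)
        finally show ?thesis .
      qed
      have "det Y \<noteq> 0"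
      proof
        assume "det Y = 0"
        then obtain w where w: "w \<in> carrier_vec n" "w \<noteq> 0\<^sub>v n" "Y *\<^sub>v w = 0\<^sub>v n"
          using det_0_iff_vec_prod_zero[OF Yc] by blast
        have "?A0 *\<^sub>v w = (\<kappa> * inverse q ^ x) \<cdot>\<^sub>v w"
        proof (rule eq_vecI)
          fix i assume "i < dim_vec ((\<kappa> * inverse q ^ x) \<cdot>\<^sub>v w)"
          then have i: "i < n" using w by simp
          have "\<kappa> * w $ i = q ^ x * (\<Sum>j<n. fps_nth (A $$ (i, j)) 0 * w $ j)"
            using Yi[OF w(1) i] w(3) i by simp
          moreover have "(?A0 *\<^sub>v w) $ i = (\<Sum>j<n. fps_nth (A $$ (i, j)) 0 * w $ j)"
            using A i w(1) by (simp add: scalar_prod_def atLeast0LessThan)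
          ultimately show "(?A0 *\<^sub>v w) $ i = ((\<kappa> * inverse q ^ x) \<cdot>\<^sub>v w) $ i"
            using w(1) i q_nz by (simp add: power_inverse field_simps)
        qed (use A w in auto)
        then have "eigenvalue ?A0 (\<kappa> * inverse q ^ x)"
          using w A by (auto simp: eigenvalue_def eigenvector_def)
        then show False using \<kappa>(3)[of x] False by simp
      qed
      then obtain Z where Z: "Z \<in> carrier_mat n n" "Y * Z = 1\<^sub>m n"
        using det_non_zero_imp_unit[OF Yc, of "()"] by (auto simp: Units_def ring_mat_def)
      have bc: "b \<in> carrier_vec n" by (simp add: b_def)
      have "Y *\<^sub>v (Z *\<^sub>v b) = b" using assoc_mult_mat_vec[OF Yc Z(1) bc] Z(2) bc by simp
      then have "\<kappa> * (Z *\<^sub>v b) $ i - q ^ x * (\<Sum>j<n. fps_nth (A $$ (i, j)) 0 * (Z *\<^sub>v b) $ j) = b $ i" if "i < n" for i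
        using Yi[of "Z *\<^sub>v b" i] Z bc that by simp
      then show ?thesis using False Z(1) by (intro exI[of _ "Z *\<^sub>v b"]) (auto simp: P_def b_def)
    qed
  qed
  then obtain f where f: "\<And>x. P f x (f x)" by blast
  have fc: "f x \<in> carrier_vec n" for x using f[of x] by (simp add: P_def)
  have f0: "f 0 = v0" using f[of 0] by (simp add: P_def)
  define v where "v = vec n (\<lambda>i. Abs_fps (\<lambda>m. f m $ i))"
  have fps_mult_nth': "fps_nth (a * b) m = (\<Sum>k\<le>m. fps_nth a (m - k) * fps_nth b k)" for a b :: "complex fps" and m
    unfolding mult.commute[of a b] fps_mult_nth atLeast0AtMost by (simp add: mult.commute)
  have eq: "(\<Sum>j<n. A $$ (i, j) * fps_sigma q (v $ j)) = fps_const \<kappa> * v $ i" if i: "i < n" for i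
  proof (rule fps_ext)
    fix m
    have "fps_nth (\<Sum>j<n. A $$ (i, j) * fps_sigma q (v $ j)) m =
        (\<Sum>j<n. \<Sum>k\<le>m. fps_nth (A $$ (i, j)) (m - k) * (q ^ k * f k $ j))"
      by (simp add: fps_sum_nth fps_mult_nth' v_def fps_sigma_def)
    also have "\<dots> = (\<Sum>k\<le>m. q ^ k * (\<Sum>j<n. fps_nth (A $$ (i, j)) (m - k) * f k $ j))"
      by (subst sum.swap) (simp add: sum_distrib_left mult_ac)
    also have "\<dots> = (\<Sum>k<m. q ^ k * (\<Sum>j<n. fps_nth (A $$ (i, j)) (m - k) * f k $ j)) +
        q ^ m * (\<Sum>j<n. fps_nth (A $$ (i, j)) 0 * f m $ j)"
      by (simp add: lessThan_Suc_atMost[symmetric])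
    also have "\<dots> = \<kappa> * f m $ i"
    proof (cases "m = 0")
      case True
      have "(?A0 *\<^sub>v v0) $ i = \<kappa> * v0 $ i" using v0 i by simp
      then show ?thesis using True f0 A i v0(1) by (simp add: scalar_prod_def atLeast0LessThan)
    next
      case False
      then show ?thesis using f[of m] i by (simp add: P_def algebra_simps)
    qed
    finally show "fps_nth (\<Sum>j<n. A $$ (i, j) * fps_sigma q (v $ j)) m = fps_nth (fps_const \<kappa> * v $ i) m"
      using i by (simp add: v_def)
  qed
  obtain r where r: "r < n" "v0 $ r \<noteq> 0"
    using v0(1,2) by (metis carrier_vecD eq_vecI index_zero_vec)
  have "v \<in> carrier_vec n" "fps_nth (v $ r) 0 \<noteq> 0" using r f0 by (auto simp: v_def)
  then show ?thesis
    using \<kappa>(1) r(1) eq by blast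
qed

text \<open>Coefficientwise division by q^m \<kappa> - \<mu>. The only resonance is m = 0 with
  \<kappa> = \<mu>; there the coefficient of \<open>t\<close> cannot be removed and becomes the
  constant \<open>r\<close>, an entry of the normal form.\<close>

lemma scalar_equation:
  assumes "is_rep q \<kappa>" "is_rep q \<mu>"
  shows "\<exists>u r. (r \<noteq> 0 \<longrightarrow> \<kappa> = \<mu>) \<and> fls_const \<kappa> * sigma_q q u - fls_const \<mu> * u = fls_const r - t"
proof -
  define u where "u = Abs_fls (\<lambda>m. if q powi m * \<kappa> = \<mu> then 0 else - fls_nth t m / (q powi m * \<kappa> - \<mu>))"
  define r where "r = (if \<kappa> = \<mu> then fls_nth t 0 else 0)"
  have un: "fls_nth u m = (if q powi m * \<kappa> = \<mu> then 0 else - fls_nth t m / (q powi m * \<kappa> - \<mu>))" for m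
    unfolding u_def by (rule nth_Abs_fls_lower_bound[of "fls_subdegree t"]) auto
  have "fls_const \<kappa> * sigma_q q u - fls_const \<mu> * u = fls_const r - t"
  proof (rule fls_eqI)
    fix m
    have "fls_nth (fls_const \<kappa> * sigma_q q u - fls_const \<mu> * u) m = (q powi m * \<kappa> - \<mu>) * fls_nth u m"
      by (simp add: sigma_q_nth[OF q_nz] algebra_simps)
    also have "\<dots> = fls_nth (fls_const r - t) m"
    proof (cases "q powi m * \<kappa> = \<mu>")
      case True
      then show ?thesis using is_rep_resonance[OF q_nz not_root assms True] by (simp add: r_def)
    next
      case False
      then have "q powi m * \<kappa> - \<mu> \<noteq> 0" by simp
      moreover have "m = 0 \<longrightarrow> \<kappa> \<noteq> \<mu>" using False by auto
      ultimately show ?thesis using False by (auto simp: un r_def)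
    qed
    finally show "fls_nth (fls_const \<kappa> * sigma_q q u - fls_const \<mu> * u) m = fls_nth (fls_const r - t) m" .
  qed
  then show ?thesis by (intro exI[of _ u] exI[of _ r]) (auto simp: r_def)
qed

text \<open>As \<open>A\<close> is upper triangular, equation \<open>j\<close> involves only the
  unknowns of index at most \<open>j\<close>. They are found one after the other, and a new value at
  \<open>l\<close> does not disturb the equations already solved.\<close>

lemma row_equation:
  assumes A: "normal_form q k A" and \<kappa>: "is_rep q \<kappa>" and "l \<le> k"
  shows "\<exists>u r. \<forall>j<l. (r j \<noteq> 0 \<longrightarrow> \<kappa> = A $$ (j, j)) \<and>
    fls_const \<kappa> * sigma_q q (u j) - (\<Sum>i<k. u i * fls_const (A $$ (i, j))) = fls_const (r j) - s j"
  using \<open>l \<le> k\<close>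
proof (induction l)
  case (Suc l)
  then obtain u r where ur: "\<forall>j<l. (r j \<noteq> 0 \<longrightarrow> \<kappa> = A $$ (j, j)) \<and>
    fls_const \<kappa> * sigma_q q (u j) - (\<Sum>i<k. u i * fls_const (A $$ (i, j))) = fls_const (r j) - s j" by auto
  have l: "l < k" using Suc.prems by simp
  define t where "t = s l - (\<Sum>i\<in>{..<k} - {l}. u i * fls_const (A $$ (i, l)))"
  have "is_rep q (A $$ (l, l))" using A l by (simp add: normal_form_def)
  then obtain x y where xy: "y \<noteq> 0 \<longrightarrow> \<kappa> = A $$ (l, l)"
    "fls_const \<kappa> * sigma_q q x - fls_const (A $$ (l, l)) * x = fls_const y - t"
    using scalar_equation[OF \<kappa>] by blast
  define u' where "u' = u(l := x)"
  define r' where "r' = r(l := y)"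
  have old: "(\<Sum>i<k. u' i * fls_const (A $$ (i, j))) = (\<Sum>i<k. u i * fls_const (A $$ (i, j)))" if "j < l" for j
  proof (intro sum.cong refl)
    fix i assume "i \<in> {..<k}"
    then have "A $$ (l, j) = 0" using A that l unfolding normal_form_def by (metis less_trans not_le)
    then show "u' i * fls_const (A $$ (i, j)) = u i * fls_const (A $$ (i, j))" by (simp add: u'_def)
  qed
  have new: "(\<Sum>i<k. u' i * fls_const (A $$ (i, l))) =
      x * fls_const (A $$ (l, l)) + (\<Sum>i\<in>{..<k} - {l}. u i * fls_const (A $$ (i, l)))"
    using l by (subst sum.remove[of _ l]) (auto simp: u'_def intro!: sum.cong)
  show ?case
  proof (intro exI allI impI)
    fix j assume "j < Suc l"
    then consider "j < l" | "j = l" by linarith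
    then show "(r' j \<noteq> 0 \<longrightarrow> \<kappa> = A $$ (j, j)) \<and>
      fls_const \<kappa> * sigma_q q (u' j) - (\<Sum>i<k. u' i * fls_const (A $$ (i, j))) = fls_const (r' j) - s j"
    proof cases
      case 1
      then show ?thesis using ur old[OF 1] by (simp add: u'_def r'_def)
    next
      case 2
      show ?thesis
        unfolding 2 new using xy by (auto simp: u'_def r'_def t_def algebra_simps)
    qed
  qed
qed simp

text \<open>A formal eigenvector, completed to a basis, splits off the first column; the remaining
  block is normalised by induction. A monomial factor turns the eigenvalue into its representative,
  and \<open>row_equation\<close> clears the first row up to resonant constants.\<close>

lemma formal_normal_form:
  assumes "A \<in> carrier_mat n n" "det (map_mat (\<lambda>f. fps_nth f 0) A) \<noteq> 0"
  shows "\<exists>A0 P. normal_form q n A0 \<and> P \<in> inv_mats UNIV n \<and> P * cmat A0 = fmat A * sigm q P"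
  using assms
proof (induction n arbitrary: A)
  case 0
  show ?case
    by (rule exI[of _ "1\<^sub>m 0"], rule exI[of _ "1\<^sub>m 0"]) (use 0 in \<open>auto simp: normal_form_def inv_mats_def mats_def\<close>)
next
  case (Suc k)
  let ?n = "Suc k"
  let ?z = "\<lambda>f :: complex fps. fps_nth f 0"
  have Ac: "A \<in> carrier_mat ?n ?n" using Suc by simp
  obtain \<kappa> v r where v: "\<kappa> \<noteq> 0" "v \<in> carrier_vec ?n" "r < ?n" "fps_nth (v $ r) 0 \<noteq> 0"
    "\<And>i. i < ?n \<Longrightarrow> (\<Sum>j<?n. A $$ (i, j) * fps_sigma q (v $ j)) = fps_const \<kappa> * v $ i"
    using formal_eigenvector[OF Suc.prems(1) zero_less_Suc Suc.prems(2)] by blast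
  obtain P where P: "P \<in> carrier_mat ?n ?n" "\<And>i. i < ?n \<Longrightarrow> P $$ (i, 0) = v $ i" "det (map_mat ?z P) \<noteq> 0"
    using complete_to_basis[OF v(2-4)] by blast
  obtain Q where Q: "Q \<in> carrier_mat ?n ?n" "P * Q = 1\<^sub>m ?n" "Q * P = 1\<^sub>m ?n"
    using fps_mat_inverse[OF P(1,3)] by blast
  let ?sP = "map_mat (fps_sigma q) P"
  have sPc: "?sP \<in> carrier_mat ?n ?n" using P by simp
  define X where "X = A * ?sP"
  have Xc: "X \<in> carrier_mat ?n ?n" using Ac P by (simp add: X_def)
  define A1 where "A1 = Q * X"
  have A1c: "A1 \<in> carrier_mat ?n ?n" using Q Xc by (simp add: A1_def)
  have X0: "X $$ (i, 0) = fps_const \<kappa> * P $$ (i, 0)" if "i < ?n" for i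
    unfolding X_def using mat_mult_index[OF Ac sPc that, of 0] P v(5)[OF that] that by (simp add: P(2))
  have A1_0: "A1 $$ (i, 0) = (if i = 0 then fps_const \<kappa> else 0)" if i: "i < ?n" for i
  proof -
    have "A1 $$ (i, 0) = (\<Sum>l<?n. Q $$ (i, l) * X $$ (l, 0))"
      unfolding A1_def by (rule mat_mult_index[OF Q(1) Xc i]) simp
    also have "\<dots> = fps_const \<kappa> * (\<Sum>l<?n. Q $$ (i, l) * P $$ (l, 0))"
      unfolding sum_distrib_left by (intro sum.cong) (auto simp: X0 mult_ac)
    also have "(\<Sum>l<?n. Q $$ (i, l) * P $$ (l, 0)) = (Q * P) $$ (i, 0)"
      by (rule mat_mult_index[OF Q(1) P(1) i, symmetric]) simp
    finally show ?thesis using i by (simp add: Q(3))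
  qed
  have PA1: "P * A1 = A * ?sP"
  proof -
    have "P * (Q * X) = X" using assoc_mult_mat[OF P(1) Q(1) Xc] left_mult_one_mat[OF Xc] Q(2) by simp
    then show ?thesis by (simp add: A1_def X_def)
  qed
  have dA1: "det (map_mat ?z A1) \<noteq> 0"
  proof -
    have sz: "map_mat ?z ?sP = map_mat ?z P" by (intro eq_matI) (auto simp: fps_sigma_def)
    have "map_mat ?z P * map_mat ?z A1 = map_mat ?z A * map_mat ?z P"
      using arg_cong[OF PA1, of "map_mat ?z"] semiring_hom.mat_hom_mult[OF fps_nth_0_hom P(1) A1c]
        semiring_hom.mat_hom_mult[OF fps_nth_0_hom Ac sPc] sz by simp
    then have "det (map_mat ?z P) * det (map_mat ?z A1) = det (map_mat ?z A) * det (map_mat ?z P)"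
      using det_mult[of "map_mat ?z P" ?n "map_mat ?z A1"] det_mult[of "map_mat ?z A" ?n "map_mat ?z P"] P A1c Ac by simp
    then show ?thesis using P(3) Suc.prems(2) by auto
  qed
  define A' where "A' = mat k k (\<lambda>(i, j). A1 $$ (Suc i, Suc j))"
  have A'c: "A' \<in> carrier_mat k k" by (simp add: A'_def)
  have "det (map_mat ?z A1) = \<kappa> * det (map_mat ?z A')"
  proof -
    have "mat k k (\<lambda>(i, j). map_mat ?z A1 $$ (Suc i, Suc j)) = map_mat ?z A'"
      using A1c by (intro eq_matI) (auto simp: A'_def)
    then show ?thesis
      using det_first_column[of "map_mat ?z A1" k] A1c A1_0 by simp
  qed
  then have "det (map_mat ?z A') \<noteq> 0" using dA1 by auto
  then obtain A0' P' where IH: "normal_form q k A0'" "P' \<in> inv_mats UNIV k" "P' * cmat A0' = fmat A' * sigm q P'"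
    using Suc.IH[OF A'c] by blast
  have A0'c: "A0' \<in> carrier_mat k k" using IH(1) by (simp add: normal_form_def)
  note P'c = inv_mats_carrier[OF IH(2)]
  obtain x where x: "qrep q \<kappa> = \<kappa> * q powi x" using qrep_in[of q \<kappa>] by (auto simp: q_class_def)
  define \<mu> where "\<mu> = qrep q \<kappa>"
  have \<mu>: "is_rep q \<mu>" unfolding \<mu>_def by (rule is_rep_qrep[OF q_nz v(1)])
  \<comment> \<open>A gauge transformation by a power of the variable multiplies the eigenvalue by
    the same power of \<open>q\<close>; the exponent may be negative.\<close>
  define Xx :: "complex fls" where "Xx = fls_X_intpow x"
  have Xx0: "Xx \<noteq> 0" by (simp add: Xx_def)
  have sXx: "fls_const \<kappa> * sigma_q q Xx = Xx * fls_const \<mu>"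
    by (rule fls_eqI) (auto simp: sigma_q_nth[OF q_nz] Xx_def \<mu>_def x)
  \<comment> \<open>The first row off the diagonal, as it looks after the lower block has been
    normalised by \<open>P'\<close> and the monomial divided out.\<close>
  define s where "s j = inverse Xx * (\<Sum>l<k. fps_to_fls (A1 $$ (0, Suc l)) * sigma_q q (P' $$ (l, j)))" for j
  obtain u r where ur: "\<forall>j<k. (r j \<noteq> 0 \<longrightarrow> \<mu> = A0' $$ (j, j)) \<and>
    fls_const \<mu> * sigma_q q (u j) - (\<Sum>i<k. u i * fls_const (A0' $$ (i, j))) = fls_const (r j) - s j"
    using row_equation[OF IH(1) \<mu> order_refl, of s] by blast
  \<comment> \<open>In block form: first row \<open>Xx\<close> times (1, u), lower right block
    \<open>P'\<close>, zeros below the corner.\<close>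
  define P2 where "P2 = mat ?n ?n (\<lambda>(i, j). if i = 0 then (if j = 0 then Xx else Xx * u (j - 1))
     else if j = 0 then 0 else P' $$ (i - 1, j - 1))"
  define A0 where "A0 = mat ?n ?n (\<lambda>(i, j). if i = 0 then (if j = 0 then \<mu> else r (j - 1))
     else if j = 0 then 0 else A0' $$ (i - 1, j - 1))"
  have P2c: "P2 \<in> carrier_mat ?n ?n" and A0c: "A0 \<in> carrier_mat ?n ?n" by (auto simp: P2_def A0_def)
  have nf: "normal_form q ?n A0"
    unfolding normal_form_def
  proof (intro conjI allI impI)
    fix i assume "i < ?n"
    then show "is_rep q (A0 $$ (i, i))"
      using \<mu> IH(1) by (cases i) (auto simp: A0_def normal_form_def)
  next
    fix i j assume ij: "i < ?n" "j < ?n" "A0 $$ (i, j) \<noteq> 0"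
    have IH': "A0' $$ (a, b) \<noteq> 0 \<Longrightarrow> a \<le> b \<and> A0' $$ (a, a) = A0' $$ (b, b)" if "a < k" "b < k" for a b
      using IH(1) that unfolding normal_form_def by blast
    have ur': "r b \<noteq> 0 \<Longrightarrow> \<mu> = A0' $$ (b, b)" if "b < k" for b using ur that by blast
    have "i \<le> j \<and> A0 $$ (i, i) = A0 $$ (j, j)"
      using ij IH'[of "i - 1" "j - 1"] ur'[of "j - 1"]
      by (cases i; cases j) (simp_all add: A0_def)
    then show "i \<le> j" "A0 $$ (i, i) = A0 $$ (j, j)" by simp_all
  qed (rule A0c)
  have P2I: "P2 \<in> inv_mats UNIV ?n"
  proof (rule inv_matsI[OF subfld_UNIV])
    obtain R where R: "R \<in> carrier_mat k k" "P' * R = 1\<^sub>m k" using IH(2) by (auto simp: inv_mats_def mats_def)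
    have "det P' \<noteq> 0" using det_mult[OF P'c R(1)] R(2) by auto
    moreover have "mat k k (\<lambda>(i, j). P2 $$ (Suc i, Suc j)) = P'" using P'c by (intro eq_matI) (auto simp: P2_def)
    ultimately show "det P2 \<noteq> 0"
      using det_first_column[OF P2c] Xx0 by (simp add: P2_def)
  qed (use P2c in \<open>simp add: mats_def\<close>)
  have eq2: "P2 * cmat A0 = fmat A1 * sigm q P2"
  proof (rule eq_matI)
    fix i j assume "i < dim_row (fmat A1 * sigm q P2)" "j < dim_col (fmat A1 * sigm q P2)"
    then have ij: "i < ?n" "j < ?n" using A1c P2c by auto
    have L: "(P2 * cmat A0) $$ (i, j) = P2 $$ (i, 0) * fls_const (A0 $$ (0, j)) +
        (\<Sum>l<k. P2 $$ (i, Suc l) * fls_const (A0 $$ (Suc l, j)))"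
      using mat_mult_index[of P2 ?n ?n "cmat A0" ?n i j] ij P2c A0c
      by (simp add: sum.lessThan_Suc_shift del: index_mult_mat sum.lessThan_Suc)
    have R: "(fmat A1 * sigm q P2) $$ (i, j) = fps_to_fls (A1 $$ (i, 0)) * sigma_q q (P2 $$ (0, j)) +
        (\<Sum>l<k. fps_to_fls (A1 $$ (i, Suc l)) * sigma_q q (P2 $$ (Suc l, j)))"
      using mat_mult_index[of "fmat A1" ?n ?n "sigm q P2" ?n i j] ij P2c A1c
      by (simp add: sum.lessThan_Suc_shift del: index_mult_mat sum.lessThan_Suc)
    show "(P2 * cmat A0) $$ (i, j) = (fmat A1 * sigm q P2) $$ (i, j)"
    proof (cases i)
      case i0: 0
      show ?thesis
      proof (cases j)
        case 0
        then show ?thesis unfolding L R using i0 A1_0[of 0] sXx by (simp add: P2_def A0_def)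
      next
        case (Suc j')
        then have j': "j' < k" using ij by simp
        have e: "fls_const \<mu> * sigma_q q (u j') + s j' = fls_const (r j') + (\<Sum>l<k. u l * fls_const (A0' $$ (l, j')))"
          using ur j' by (simp add: algebra_simps)
        have "(P2 * cmat A0) $$ (i, j) = Xx * (fls_const (r j') + (\<Sum>l<k. u l * fls_const (A0' $$ (l, j'))))"
          unfolding L using i0 Suc j' by (simp add: P2_def A0_def algebra_simps sum_distrib_left)
        also have "\<dots> = Xx * fls_const \<mu> * sigma_q q (u j') + Xx * s j'"
          unfolding e[symmetric] by (simp add: algebra_simps)
        also have "\<dots> = (fls_const \<kappa> * sigma_q q Xx) * sigma_q q (u j') +
            (\<Sum>l<k. fps_to_fls (A1 $$ (0, Suc l)) * sigma_q q (P' $$ (l, j')))"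
          unfolding sXx s_def using Xx0 by (simp flip: mult.assoc)
        also have "\<dots> = (fmat A1 * sigm q P2) $$ (i, j)"
          unfolding R using i0 Suc j' A1_0[of 0] by (simp add: P2_def sigma_q_mult[OF q_nz] mult.assoc)
        finally show ?thesis .
      qed
    next
      case i: (Suc i')
      then have i': "i' < k" using ij by simp
      show ?thesis
      proof (cases j)
        case 0
        then show ?thesis unfolding L R using i i' A1_0[of i] by (simp add: P2_def A0_def)
      next
        case (Suc j')
        then have j': "j' < k" using ij by simp
        have "(P' * cmat A0') $$ (i', j') = (fmat A' * sigm q P') $$ (i', j')" using IH(3) by simp
        then have "(\<Sum>l<k. P' $$ (i', l) * fls_const (A0' $$ (l, j'))) =
            (\<Sum>l<k. fps_to_fls (A' $$ (i', l)) * sigma_q q (P' $$ (l, j')))"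
          using mat_mult_index[of P' k k "cmat A0'" k i' j'] mat_mult_index[of "fmat A'" k k "sigm q P'" k i' j']
            i' j' P'c A0'c A'c by (simp del: index_mult_mat)
        then show ?thesis
          unfolding L R using i Suc i' j' A1_0[of i] by (simp add: P2_def A0_def A'_def)
      qed
    qed
  qed (use P2c A0c A1c in auto)
  have eq1: "fmat P * fmat A1 = fmat A * sigm q (fmat P)"
    using fmat_mult[OF P(1) A1c] fmat_mult[OF Ac sPc] PA1 sigm_fmat[OF q_nz, of P] by simp
  have PI: "fmat P \<in> inv_mats UNIV ?n"
    using fmat_mult[OF P(1) Q(1)] fmat_mult[OF Q(1) P(1)] Q P(1) fmat_one[of ?n]
    unfolding inv_mats_def by (auto simp: mats_def intro!: bexI[of _ "fmat Q"])
  have "(fmat P * P2) * cmat A0 = fmat A * sigm q (fmat P * P2)"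
    by (rule compose_intertwine[OF q_nz P2c _ _ _ _ eq2 eq1]) (use P(1) A0c A1c Ac in auto)
  then show ?case using nf inv_mats_mult[OF subfld_UNIV PI P2I] by blast
qed

end

section \<open>Cyclic vectors and the Newton polygon\<close>

definition fps_conv :: "complex fps set" where
  "fps_conv = {f. fps_to_fls f \<in> conv_fls}"

lemma fps_conv_add: "f \<in> fps_conv \<Longrightarrow> g \<in> fps_conv \<Longrightarrow> f + g \<in> fps_conv"
  and fps_conv_mult: "f \<in> fps_conv \<Longrightarrow> g \<in> fps_conv \<Longrightarrow> f * g \<in> fps_conv"
  and fps_conv_0: "0 \<in> fps_conv" and fps_conv_1: "1 \<in> fps_conv"
  using subfld_conv_fls
  by (auto simp: fps_conv_def fls_times_fps_to_fls subfld_add subfld_mult)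

lemma fps_conv_sum: "(\<And>x. x \<in> A \<Longrightarrow> f x \<in> fps_conv) \<Longrightarrow> sum f A \<in> fps_conv"
  by (induction A rule: infinite_finite_induct) (auto simp: fps_conv_0 fps_conv_add)

lemma fps_conv_sigma: "norm q = 1 \<Longrightarrow> f \<in> fps_conv \<Longrightarrow> fps_sigma q f \<in> fps_conv"
  using sigma_q_conv_fls[of q "fps_to_fls f"] fps_to_fls_sigma[of q f] by (cases "q = 0") (auto simp: fps_conv_def)

lemma fps_conv_const_X: "fps_const c * fps_X ^ m \<in> fps_conv"
proof -
  have "geo (fps_nth (fps_const c * fps_X ^ m))"
    by (rule geo_finite_support[of m]) (auto simp: fps_X_power_iff)
  then show ?thesis by (simp add: fps_conv_def conv_fls_geo)
qed

text \<open>A kernel vector is the coefficient vector of a nonzero polynomial of degree below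
  \<open>n\<close> that vanishes at the \<open>n\<close> distinct points \<open>d i\<close>.\<close>

lemma vandermonde_nonzero:
  fixes d :: "nat \<Rightarrow> 'a :: field"
  assumes "inj_on d {..<n}"
  shows "det (mat n n (\<lambda>(i, m). d i ^ m)) \<noteq> 0"
proof
  let ?W = "mat n n (\<lambda>(i, m). d i ^ m)"
  assume "det ?W = 0"
  then obtain y where y: "y \<in> carrier_vec n" "y \<noteq> 0\<^sub>v n" "?W *\<^sub>v y = 0\<^sub>v n"
    using det_0_iff_vec_prod_zero[of ?W n] by auto
  define p where "p = (\<Sum>m<n. Polynomial.monom (y $ m) m)"
  have coeff: "coeff p k = (if k < n then y $ k else 0)" for k
    by (simp add: p_def coeff_sum)
  have "p \<noteq> 0"
  proof
    assume "p = 0"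
    then have "y $ k = 0" if "k < n" for k using coeff[of k] that by simp
    then have "y = 0\<^sub>v n" using y(1) by (intro eq_vecI) auto
    then show False using y(2) by simp
  qed
  have n: "n > 0" using y by (cases n) auto
  have deg: "degree p \<le> n - 1" by (rule degree_le) (use coeff n in auto)
  have "d ` {..<n} \<subseteq> {x. poly p x = 0}"
  proof safe
    fix i assume i: "i < n"
    have "poly p (d i) = (\<Sum>m<n. d i ^ m * y $ m)" by (simp add: p_def poly_sum poly_monom mult.commute)
    also have "\<dots> = (?W *\<^sub>v y) $ i" using i y(1) by (simp add: scalar_prod_def atLeast0LessThan)
    finally show "poly p (d i) = 0" using y(3) i by simp
  qed
  then have "card (d ` {..<n}) \<le> card {x. poly p x = 0}"
    using poly_roots_finite[OF \<open>p \<noteq> 0\<close>] by (intro card_mono)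
  also have "\<dots> \<le> degree p" by (rule card_poly_roots_bound[OF \<open>p \<noteq> 0\<close>])
  finally show False using deg n card_image[OF assms] by simp
qed

text \<open>The gauge transformation by \<open>diag(1, x, x\<^sup>2, \<dots>)\<close> makes the eigenvalues at \<open>0\<close> pairwise distinct, so that
  a constant vector becomes cyclic over the convergent power series.\<close>

lemma (in small_q) normal_form_cyclic:
  assumes A: "normal_form q n A"
  shows "\<exists>L P. L \<in> qop_carrier \<and> (\<forall>i. fls_subdegree (L i) \<ge> 0) \<and> (\<forall>i. i \<notin> {0..int n} \<longrightarrow> L i = 0) \<and>
    L 0 \<noteq> 0 \<and> fls_subdegree (L 0) = 0 \<and> L (int n) = 1 \<and>
    P \<in> inv_mats conv_fls n \<and> P * companion n L = cmat A * sigm q P"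
proof -
  have S: "subfld conv_fls" by (rule subfld_conv_fls)
  have Ac: "A \<in> carrier_mat n n" using A by (simp add: normal_form_def)
  let ?z = "\<lambda>f :: complex fps. fps_nth f 0"
  \<comment> \<open>The eigenvalues at 0 after the diagonal transformation: equal ones are separated
    by different powers of \<open>q\<close>, and distinct representatives never differ by a power of
    \<open>q\<close>.\<close>
  define d where "d i = A $$ (i, i) * q ^ i" for i
  have dinj: "inj_on d {..<n}"
  proof (rule inj_onI)
    fix i j assume ij: "i \<in> {..<n}" "j \<in> {..<n}" "d i = d j"
    have "is_rep q (A $$ (i, i))" "is_rep q (A $$ (j, j))" using A ij by (auto simp: normal_form_def)
    moreover have "q powi (int i - int j) * A $$ (i, i) = A $$ (j, j)"
      using ij(3) q_nz by (simp add: d_def power_int_diff field_simps)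
    ultimately show "i = j" using is_rep_resonance[OF q_nz not_root] by fastforce
  qed
  have d0: "d i \<noteq> 0" if "i < n" for i
  proof -
    have "is_rep q (A $$ (i, i))" using A that by (simp add: normal_form_def)
    then show ?thesis using q_nz by (simp add: d_def is_rep_def)
  qed
  \<comment> \<open>With D = diag(1, x, x^2, ...) this is D^-1 A \<sigma>(D), \<sigma> being
    \<open>sigm q\<close>. It has no poles because \<open>A\<close> is upper triangular.\<close>
  define E where "E = mat n n (\<lambda>(i, j). if i \<le> j then fps_const (A $$ (i, j) * q ^ j) * fps_X ^ (j - i) else 0)"
  have Ec: "E \<in> carrier_mat n n" by (simp add: E_def)
  have E0: "map_mat ?z E = mat n n (\<lambda>(i, j). if i = j then d i else 0)"
    by (intro eq_matI) (auto simp: E_def d_def)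
  \<comment> \<open>Iterates of the semilinear operator on the constant vector (1, ..., 1). Their
    constant terms form a Vandermonde matrix in the \<open>d i\<close>, so the first
    \<open>n\<close> of them are a basis over the power series.\<close>
  define w where "w m = ((\<lambda>v. E *\<^sub>v map_vec (fps_sigma q) v) ^^ m) (vec n (\<lambda>_. 1))" for m
  have w_Suc: "w (Suc m) = E *\<^sub>v map_vec (fps_sigma q) (w m)" for m by (simp add: w_def)
  have wc: "w m \<in> carrier_vec n" for m
    by (induction m) (simp add: w_def, simp only: w_Suc mult_mat_vec_carrier[OF Ec] map_carrier_vec)
  have w_conv: "w m $ i \<in> fps_conv" if "i < n" for m i
    using that
  proof (induction m arbitrary: i)
    case 0 then show ?case by (simp add: w_def fps_conv_1)
  next
    case (Suc m)
    have "E $$ (i, j) \<in> fps_conv" if "j < n" for j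
      using that Suc.prems fps_conv_const_X fps_conv_0 by (simp add: E_def)
    then show ?case
      using Suc wc[of m] Ec norm_q unfolding w_Suc
      by (auto simp: scalar_prod_def intro!: fps_conv_sum fps_conv_mult fps_conv_sigma)
  qed
  have w0: "?z (w m $ i) = d i ^ m" if "i < n" for m i
    using that
  proof (induction m arbitrary: i)
    case 0 then show ?case by (simp add: w_def)
  next
    case (Suc m)
    have "?z (w (Suc m) $ i) = (\<Sum>j<n. ?z (E $$ (i, j)) * ?z (w m $ j))"
      using Suc.prems wc[of m] Ec unfolding w_Suc
      by (simp add: scalar_prod_def fps_sum_nth fps_sigma_def atLeast0LessThan)
    also have "\<dots> = (\<Sum>j<n. if j = i then d i * d i ^ m else 0)"
      using Suc by (intro sum.cong) (auto simp: E_def d_def)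
    finally show ?case using Suc.prems by simp
  qed
  define W where "W = mat n n (\<lambda>(i, m). w m $ i)"
  have Wc: "W \<in> carrier_mat n n" by (simp add: W_def)
  have "map_mat ?z W = mat n n (\<lambda>(i, m). d i ^ m)" by (intro eq_matI) (auto simp: W_def w0)
  then have dW: "det (map_mat ?z W) \<noteq> 0" using vandermonde_nonzero[OF dinj] by simp
  obtain V where V: "V \<in> carrier_mat n n" "W * V = 1\<^sub>m n" "V * W = 1\<^sub>m n"
    using fps_mat_inverse[OF Wc dW] by blast
  have dE: "det (map_mat ?z E) \<noteq> 0"
  proof -
    have "upper_triangular (map_mat ?z E)" using Ec by (auto simp: upper_triangular_def E_def)
    moreover have "0 \<notin> set (diag_mat (map_mat ?z E))" unfolding E0 using d0 by (auto simp: diag_mat_def)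
    ultimately show ?thesis using upper_triangular_imp_det_eq_0_iff[of "map_mat ?z E" n] Ec by simp
  qed
  obtain E' where E': "E' \<in> carrier_mat n n" "E * E' = 1\<^sub>m n" "E' * E = 1\<^sub>m n"
    using fps_mat_inverse[OF Ec dE] by blast
  have Wm: "fmat W \<in> mats conv_fls n n" using w_conv Wc by (auto simp: mats_def W_def fps_conv_def)
  have WV: "fmat W * fmat V = 1\<^sub>m n" and VW: "fmat V * fmat W = 1\<^sub>m n"
    using fmat_mult[OF Wc V(1)] fmat_mult[OF V(1) Wc] V fmat_one[of n] by auto
  have Vm: "fmat V \<in> mats conv_fls n n" by (rule mats_inverse[OF S Wm _ WV]) (use V in simp)
  \<comment> \<open>The coefficients that express the n-th iterate by the earlier ones; they are the
    coefficients of the operator \<open>L\<close>, up to sign.\<close>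
  define c where "c = V *\<^sub>v w n"
  have cc: "c \<in> carrier_vec n" unfolding c_def by (rule mult_mat_vec_carrier[OF V(1) wc])
  have c_conv: "fps_to_fls (c $ i) \<in> conv_fls" if "i < n" for i
  proof -
    have "V $$ (i, j) \<in> fps_conv" if "j < n" for j using mats_index[OF Vm \<open>i < n\<close> that] that \<open>i < n\<close> V by (simp add: fps_conv_def)
    then have "c $ i \<in> fps_conv"
      using that V wc[of n] w_conv by (auto simp: c_def scalar_prod_def intro!: fps_conv_sum fps_conv_mult)
    then show ?thesis by (simp add: fps_conv_def)
  qed
  have Wcol: "W *\<^sub>v c = w n"
  proof -
    have "W *\<^sub>v c = (W * V) *\<^sub>v w n" unfolding c_def by (rule assoc_mult_mat_vec[OF Wc V(1) wc, symmetric])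
    then show ?thesis unfolding V(2) using wc[of n] by simp
  qed
  define L where "L i = (if 0 \<le> i \<and> i < int n then - fps_to_fls (c $ nat i) else if i = int n then 1 else 0)" for i
  define C where "C = mat n n (\<lambda>(i, j). if Suc j = n then c $ i else if i = Suc j then 1 else 0)"
  have Cc: "C \<in> carrier_mat n n" by (simp add: C_def)
  have comp: "companion n L = fmat C"
    by (intro eq_matI) (auto simp: companion_def C_def L_def)
  let ?sW = "map_mat (fps_sigma q) W"
  have WC: "W * C = E * ?sW"
  proof (rule eq_matI)
    fix i j assume "i < dim_row (E * ?sW)" "j < dim_col (E * ?sW)"
    then have ij: "i < n" "j < n" using Ec Wc by auto
    have "(W * C) $$ (i, j) = w (Suc j) $ i"
    proof (cases "Suc j = n")
      case True
      have "(W * C) $$ (i, j) = (W *\<^sub>v c) $ i"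
        unfolding mat_mult_index[OF Wc Cc ij] using ij Wc cc True by (simp add: C_def scalar_prod_def atLeast0LessThan)
      then show ?thesis using Wcol True by simp
    next
      case False
      have "(W * C) $$ (i, j) = (\<Sum>l<n. if l = Suc j then w (Suc j) $ i else 0)"
        unfolding mat_mult_index[OF Wc Cc ij] using ij False by (intro sum.cong) (auto simp: C_def W_def)
      then show ?thesis using ij False by simp
    qed
    also have "\<dots> = (E * ?sW) $$ (i, j)"
      using mat_mult_index[of E n n ?sW n i j] ij Ec Wc wc[of j] unfolding w_Suc
      by (simp add: scalar_prod_def atLeast0LessThan W_def del: index_mult_mat)
    finally show "(W * C) $$ (i, j) = (E * ?sW) $$ (i, j)" .
  qed (use Wc Cc Ec in auto)
  \<comment> \<open>At x = 0 the companion matrix is similar to \<open>E\<close>, hence invertible,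
    and the only entry of its row 0 that can be nonzero is \<open>c $ 0\<close>.\<close>
  have c00: "fps_nth (c $ 0) 0 \<noteq> 0" if n: "n > 0"
  proof -
    have dC: "det (map_mat ?z C) \<noteq> 0"
    proof -
      have sz: "map_mat ?z ?sW = map_mat ?z W" by (intro eq_matI) (auto simp: fps_sigma_def)
      have sWc: "?sW \<in> carrier_mat n n" using Wc by simp
      have "map_mat ?z W * map_mat ?z C = map_mat ?z E * map_mat ?z W"
        using arg_cong[OF WC, of "map_mat ?z"] semiring_hom.mat_hom_mult[OF fps_nth_0_hom Wc Cc]
          semiring_hom.mat_hom_mult[OF fps_nth_0_hom Ec sWc] sz by simp
      moreover have "det (map_mat ?z W * map_mat ?z C) = det (map_mat ?z W) * det (map_mat ?z C)"
        by (rule det_mult) (use Wc Cc in \<open>auto\<close>)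
      moreover have "det (map_mat ?z E * map_mat ?z W) = det (map_mat ?z E) * det (map_mat ?z W)"
        by (rule det_mult) (use Wc Ec in \<open>auto\<close>)
      ultimately show ?thesis using dW dE by auto
    qed
    have zc: "map_mat ?z C \<in> carrier_mat n n" using Cc by simp
    obtain R where R: "R \<in> carrier_mat n n" "map_mat ?z C * R = 1\<^sub>m n"
      using det_non_zero_imp_unit[OF zc dC, of "()"] by (auto simp: Units_def ring_mat_def)
    have "1 = (map_mat ?z C * R) $$ (0, 0)" using R(2) n by simp
    also have "\<dots> = (\<Sum>l<n. map_mat ?z C $$ (0, l) * R $$ (l, 0))" by (rule mat_mult_index[OF zc R(1) n n])
    also have "\<dots> = (\<Sum>l<n. if l = n - 1 then fps_nth (c $ 0) 0 * R $$ (n - 1, 0) else 0)"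
      using n by (intro sum.cong) (auto simp: C_def)
    also have "\<dots> = fps_nth (c $ 0) 0 * R $$ (n - 1, 0)" using n by simp
    finally show ?thesis by auto
  qed
  define D where "D = mat n n (\<lambda>(i, j). if i = j then fls_X ^ i else (0 :: complex fls))"
  have Dc: "D \<in> carrier_mat n n" by (simp add: D_def)
  have DI: "D \<in> inv_mats conv_fls n"
  proof (rule inv_matsI[OF S])
    have "fls_X ^ i \<in> conv_fls" for i
    proof -
      have "(fls_X :: complex fls) ^ i = fps_to_fls (fps_const 1 * fps_X ^ i)" by (simp add: fps_to_fls_power)
      then show ?thesis using fps_conv_const_X[of 1 i] unfolding fps_conv_def by (simp only: mem_Collect_eq)
    qed
    then show "D \<in> mats conv_fls n n" by (auto simp: mats_def D_def subfld_zero[OF S])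
    have "upper_triangular D" by (auto simp: upper_triangular_def D_def)
    moreover have "0 \<notin> set (diag_mat D)" by (auto simp: diag_mat_def D_def)
    ultimately show "det D \<noteq> 0" using upper_triangular_imp_det_eq_0_iff[OF Dc] by blast
  qed
  have DE: "D * fmat E = cmat A * sigm q D"
  proof (rule eq_matI)
    fix i j assume "i < dim_row (cmat A * sigm q D)" "j < dim_col (cmat A * sigm q D)"
    then have ij: "i < n" "j < n" using Ac Dc by auto
    have "(D * fmat E) $$ (i, j) = (\<Sum>l<n. if l = i then fls_X ^ i * fps_to_fls (E $$ (i, j)) else 0)"
      unfolding mat_mult_index[OF Dc map_carrier_mat[THEN iffD2, OF Ec] ij]
      using ij Ec by (intro sum.cong) (auto simp: D_def)
    also have "\<dots> = fls_X ^ i * fps_to_fls (E $$ (i, j))" using ij by simp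
    also have "\<dots> = fls_const (A $$ (i, j)) * sigma_q q (fls_X ^ j)"
    proof (cases "A $$ (i, j) = 0")
      case True then show ?thesis using ij by (simp add: E_def)
    next
      case False
      then have le: "i \<le> j" using A ij by (auto simp: normal_form_def)
      have sX: "sigma_q q (fls_X ^ j) = fls_const (q ^ j) * fls_X ^ j"
        by (rule fls_eqI) (auto simp: sigma_q_nth[OF q_nz] fls_X_power_conv_shift_1 power_int_def)
      have "fls_X ^ i * fps_to_fls (E $$ (i, j)) = fls_const (A $$ (i, j) * q ^ j) * (fls_X ^ i * fls_X ^ (j - i))"
        using ij le by (simp add: E_def fls_times_fps_to_fls fps_to_fls_power mult_ac)
      also have "\<dots> = fls_const (A $$ (i, j)) * (fls_const (q ^ j) * fls_X ^ j)"
        using le by (simp add: fls_const_mult_const mult.assoc flip: power_add)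
      finally show ?thesis by (simp add: sX)
    qed
    also have "\<dots> = (\<Sum>l<n. if l = j then fls_const (A $$ (i, j)) * sigma_q q (fls_X ^ j) else 0)" using ij by simp
    also have "\<dots> = (cmat A * sigm q D) $$ (i, j)"
      unfolding mat_mult_index[OF map_carrier_mat[THEN iffD2, OF Ac] map_carrier_mat[THEN iffD2, OF Dc] ij]
      using ij Ac Dc by (intro sum.cong) (auto simp: D_def)
    finally show "(D * fmat E) $$ (i, j) = (cmat A * sigm q D) $$ (i, j)" .
  qed (use Dc Ec Ac in auto)
  have WCf: "fmat W * companion n L = fmat E * sigm q (fmat W)"
    unfolding comp using fmat_mult[OF Wc Cc] fmat_mult[OF Ec, of ?sW n] Wc WC sigm_fmat[OF q_nz, of W] by simp
  have WI: "fmat W \<in> inv_mats conv_fls n" using Wm Vm WV VW by (auto simp: inv_mats_def)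
  have eq: "(D * fmat W) * companion n L = cmat A * sigm q (D * fmat W)"
    by (rule compose_intertwine[OF q_nz _ Dc _ _ _ WCf DE]) (use Wc Ec Ac in \<open>auto simp: companion_def\<close>)
  have LQ: "L \<in> qop_carrier"
  proof -
    have "{i. L i \<noteq> 0} \<subseteq> {0..int n}" by (auto simp: L_def split: if_splits)
    then have "finite {i. L i \<noteq> 0}" by (rule finite_subset) simp
    moreover have "L i \<in> conv_fls" for i
      using c_conv[of "nat i"] subfld_minus[OF S, of "fps_to_fls (c $ nat i)"] subfld_zero[OF S] subfld_one[OF S]
      by (auto simp: L_def)
    ultimately show ?thesis by (simp add: qop_carrier_def K_conv_eq)
  qed
  have sub: "fls_subdegree (L i) \<ge> 0" for i by (auto simp: L_def fls_subdegree_fls_to_fps_gt0)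
  have L00: "fls_nth (L 0) 0 \<noteq> 0" using c00 by (cases "n = 0") (auto simp: L_def)
  then have "L 0 \<noteq> 0" "fls_subdegree (L 0) = 0"
    using sub[of 0] fls_subdegree_leI[OF L00] by auto
  then show ?thesis
    using LQ sub eq inv_mats_mult[OF S DI WI]
    by (intro exI[of _ L] exI[of _ "D * fmat W"]) (auto simp: L_def)
qed

text \<open>The hypotheses describe a horizontal lower boundary of the polygon: dividing by the top
  coefficient leaves power series, and the quotient for index 0 is a unit.\<close>

lemma companion_regular:
  assumes L: "L 0 \<noteq> 0" "L (int n) \<noteq> 0" and le: "\<And>i. L i \<noteq> 0 \<Longrightarrow> fls_subdegree (L i) \<ge> fls_subdegree (L (int n))"
    and eq: "fls_subdegree (L 0) = fls_subdegree (L (int n))"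
  shows "\<exists>C\<in>carrier_mat n n. companion n L = fmat C \<and> det (map_mat (\<lambda>f. fps_nth f 0) C) \<noteq> 0"
proof -
  define a where "a i = - L (int i) / L (int n)" for i
  have an: "fls_nth (a i) l = 0" if "l < 0" for i l
  proof (cases "L (int i) = 0")
    case False
    then have "fls_subdegree (a i) = fls_subdegree (L (int i)) - fls_subdegree (L (int n))"
      using L by (simp add: a_def fls_divide_subdegree)
    then show ?thesis using le[OF False] that by simp
  qed (simp add: a_def)
  have a0: "fls_nth (a 0) 0 \<noteq> 0"
  proof -
    have "a 0 \<noteq> 0" using L by (simp add: a_def)
    moreover have "fls_subdegree (a 0) = 0" using L eq by (simp add: a_def fls_divide_subdegree)
    ultimately show ?thesis using nth_fls_subdegree_nonzero[of "a 0"] by simp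
  qed
  define C where "C = mat n n (\<lambda>(i, j). if Suc j = n then fls_regpart (a i) else if i = Suc j then 1 else 0)"
  have "companion n L = fmat C"
  proof (rule eq_matI)
    fix i j assume "i < dim_row (fmat C)" "j < dim_col (fmat C)"
    then show "companion n L $$ (i, j) = fmat C $$ (i, j)"
      using fls_eq_fps[of "a i"] an by (simp add: companion_def C_def a_def)
  qed (auto simp: companion_def C_def)
  moreover have "map_mat (\<lambda>f. fps_nth f 0) C = mat n n (\<lambda>(i, j). if Suc j = n then fls_nth (a i) 0 else if i = Suc j then 1 else 0)"
    by (intro eq_matI) (auto simp: C_def)
  ultimately show ?thesis
    using det_companion[of n "\<lambda>i. fls_nth (a i) 0"] a0 by (intro bexI[of _ C]) (auto simp: C_def)
qed

section \<open>Supporting lines and edges of the Newton polygon\<close>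

lemma newton_polygon_ge:
  assumes "(x, y) \<in> newton_polygon L"
    and "\<And>i k. L i \<noteq> 0 \<Longrightarrow> k \<ge> real_of_int (fls_subdegree (L i)) \<Longrightarrow> b \<le> k - s * real_of_int i"
  shows "b \<le> y - s * x"
proof -
  have eq: "{p. inner (- s, 1) p \<ge> b} = {p :: real \<times> real. b \<le> snd p - s * fst p}"
    by (auto simp: inner_prod_def algebra_simps)
  have "newton_polygon L \<subseteq> {p. inner (- s, 1) p \<ge> b}"
    unfolding newton_polygon_def using assms(2)
    by (intro hull_minimal convex_halfspace_ge) (auto simp: inner_prod_def algebra_simps)
  then show ?thesis using assms(1) eq by auto
qed

lemma newton_vertex:
  "L i \<noteq> 0 \<Longrightarrow> k \<ge> real_of_int (fls_subdegree (L i)) \<Longrightarrow> (real_of_int i, k) \<in> newton_polygon L"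
  unfolding newton_polygon_def by (rule hull_inc) auto

text \<open>The line of slope \<open>s\<close> lies below the polygon and meets it in two points
  with different abscissae, so it cuts out a face of dimension 1, that is, an edge.\<close>

lemma finite_slopes_supporting:
  assumes ge: "\<And>i k. L i \<noteq> 0 \<Longrightarrow> k \<ge> real_of_int (fls_subdegree (L i)) \<Longrightarrow> b \<le> k - s * real_of_int i"
    and i: "L i \<noteq> 0" "real_of_int (fls_subdegree (L i)) - s * real_of_int i = b"
    and j: "L j \<noteq> 0" "real_of_int (fls_subdegree (L j)) - s * real_of_int j = b"
    and ij: "i \<noteq> j"
  shows "s \<in> finite_slopes (newton_polygon L)"
proof -
  let ?N = "newton_polygon L"
  define e where "e = ?N \<inter> {p. inner (- s, 1) p = b}"
  have conv: "convex ?N" by (simp add: newton_polygon_def convex_convex_hull)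
  have face: "e face_of ?N"
    unfolding e_def
  proof (rule face_of_Int_supporting_hyperplane_ge[OF conv])
    fix p assume "p \<in> ?N"
    then show "inner (- s, 1) p \<ge> b"
      using newton_polygon_ge[of "fst p" "snd p" L b s] ge by (cases p) (auto simp: inner_prod_def algebra_simps)
  qed
  let ?a = "(real_of_int i, real_of_int (fls_subdegree (L i)))"
  let ?c = "(real_of_int j, real_of_int (fls_subdegree (L j)))"
  have a: "?a \<in> e" "?c \<in> e"
    using newton_vertex[of L i "real_of_int (fls_subdegree (L i))"] newton_vertex[of L j "real_of_int (fls_subdegree (L j))"] i(1) j(1) i(2) j(2) by (auto simp: e_def inner_prod_def algebra_simps)
  have "aff_dim e \<le> aff_dim {p :: real \<times> real. inner (- s, 1) p = b}"
    by (rule aff_dim_subset) (auto simp: e_def)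
  also have "\<dots> = 1" by (subst aff_dim_hyperplane) (auto simp: zero_prod_def)
  finally have "aff_dim e \<le> 1" .
  moreover have "aff_dim {?a, ?c} \<le> aff_dim e" by (rule aff_dim_subset) (use a in auto)
  moreover have "aff_dim {?a, ?c} = 1" using ij by (simp add: aff_dim_2)
  ultimately have "e edge_of ?N" using face by (simp add: edge_of_def)
  moreover have "s = (snd ?c - snd ?a) / (fst ?c - fst ?a)"
    using i(2) j(2) ij by (simp add: field_simps)
  moreover have "fst ?a \<noteq> fst ?c" using ij by simp
  ultimately show ?thesis unfolding finite_slopes_def using a by blast
qed

text \<open>A coefficient of smaller order than \<open>L 0\<close> would make the steepest descent
  from the left end an edge of negative slope; symmetrically, one of smaller order than the top
  coefficient would give an edge of positive slope at the right end.\<close>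

lemma only_zero_slope_subdegrees:
  assumes L: "L 0 \<noteq> 0" "L (int n) \<noteq> 0" and sup: "\<And>i. i \<notin> {0..int n} \<Longrightarrow> L i = 0"
    and slopes: "finite_slopes (newton_polygon L) \<subseteq> {0}"
  shows "fls_subdegree (L 0) = fls_subdegree (L (int n))"
    "L i \<noteq> 0 \<Longrightarrow> fls_subdegree (L i) \<ge> fls_subdegree (L (int n))"
proof -
  define od where "od i = real_of_int (fls_subdegree (L i))" for i
  have left: "od i \<ge> od 0" if "L i \<noteq> 0" for i
  proof (rule ccontr)
    assume neg: "\<not> od i \<ge> od 0"
    let ?I = "{j. L j \<noteq> 0 \<and> j \<noteq> 0}"
    have I: "finite ?I" "i \<in> ?I"
    proof -
      have "?I \<subseteq> {0..int n}" using sup by blast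
      then show "finite ?I" by (rule finite_subset) simp
      show "i \<in> ?I" using that neg by auto
    qed
    have pos: "j > 0" if "j \<in> ?I" for j using that sup[of j] by force
    \<comment> \<open>The least slope of a segment from the left end to another point; the line
      through the left end with this slope supports the polygon.\<close>
    define s where "s = Min ((\<lambda>j. (od j - od 0) / real_of_int j) ` ?I)"
    have sle: "s \<le> (od j - od 0) / real_of_int j" if "j \<in> ?I" for j
      unfolding s_def using I that by (intro Min_le) auto
    have "s \<in> (\<lambda>j. (od j - od 0) / real_of_int j) ` ?I" unfolding s_def using I by (intro Min_in) auto
    then obtain j where j: "j \<in> ?I" "s = (od j - od 0) / real_of_int j" by blast
    have "s \<in> finite_slopes (newton_polygon L)"
    proof (rule finite_slopes_supporting[where b = "od 0" and i = 0 and j = j])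
      fix l k assume l: "L l \<noteq> 0" "k \<ge> real_of_int (fls_subdegree (L l))"
      show "od 0 \<le> k - s * real_of_int l"
      proof (cases "l = 0")
        case True then show ?thesis using l by (simp add: od_def)
      next
        case False
        then have "l \<in> ?I" using l by simp
        then have "s * real_of_int l \<le> od l - od 0" using sle[of l] pos[of l] by (simp add: field_simps)
        then show ?thesis using l(2) by (simp add: od_def)
      qed
    qed (use L j pos[OF j(1)] in \<open>auto simp: od_def field_simps\<close>)
    then have "s = 0" using slopes by blast
    moreover have "s < 0"
    proof -
      have "(od i - od 0) / real_of_int i < 0" using neg pos[OF I(2)] by (simp add: divide_neg_pos)
      then show ?thesis using sle[OF I(2)] by simp
    qed
    ultimately show False by simp
  qed
  have right: "od i \<ge> od (int n)" if "L i \<noteq> 0" for i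
  proof (rule ccontr)
    assume neg: "\<not> od i \<ge> od (int n)"
    let ?I = "{j. L j \<noteq> 0 \<and> j \<noteq> int n}"
    have I: "finite ?I" "i \<in> ?I"
    proof -
      have "?I \<subseteq> {0..int n}" using sup by blast
      then show "finite ?I" by (rule finite_subset) simp
      show "i \<in> ?I" using that neg by auto
    qed
    have pos: "j < int n" if "j \<in> ?I" for j using that sup[of j] by force
    \<comment> \<open>The mirror image: the greatest slope of a segment that arrives at the right
      end.\<close>
    define s where "s = Max ((\<lambda>j. (od (int n) - od j) / real_of_int (int n - j)) ` ?I)"
    have sge: "s \<ge> (od (int n) - od j) / real_of_int (int n - j)" if "j \<in> ?I" for j
      unfolding s_def using I that by (intro Max_ge) auto
    have "s \<in> (\<lambda>j. (od (int n) - od j) / real_of_int (int n - j)) ` ?I" unfolding s_def using I by (intro Max_in) auto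
    then obtain j where j: "j \<in> ?I" "s = (od (int n) - od j) / real_of_int (int n - j)" by blast
    have key: "s * real_of_int (int n - l) \<ge> od (int n) - od l" if "l \<in> ?I" for l
    proof -
      have "real_of_int (int n - l) > 0" using pos[OF that] by simp
      then show ?thesis using sge[OF that] by (simp only: pos_divide_le_eq)
    qed
    have keyj: "s * real_of_int (int n - j) = od (int n) - od j"
      using pos[OF j(1)] j(2) by simp
    have "s \<in> finite_slopes (newton_polygon L)"
    proof (rule finite_slopes_supporting[where b = "od (int n) - s * real n" and i = "int n" and j = j])
      fix l k assume l: "L l \<noteq> 0" "k \<ge> real_of_int (fls_subdegree (L l))"
      show "od (int n) - s * real n \<le> k - s * real_of_int l"
      proof (cases "l = int n")
        case True then show ?thesis using l by (simp add: od_def)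
      next
        case False
        then have "l \<in> ?I" using l by simp
        then show ?thesis using key[of l] l(2) by (simp add: od_def algebra_simps)
      qed
    next
      show "real_of_int (fls_subdegree (L j)) - s * real_of_int j = od (int n) - s * real n"
        using keyj by (simp add: od_def algebra_simps)
    qed (use L j in \<open>auto simp: od_def\<close>)
    then have "s = 0" using slopes by blast
    moreover have "s > 0"
    proof -
      have "(od (int n) - od i) / real_of_int (int n - i) > 0"
        using neg pos[OF I(2)] by (intro divide_pos_pos) auto
      then show ?thesis using sge[OF I(2)] by simp
    qed
    ultimately show False by simp
  qed
  show "fls_subdegree (L 0) = fls_subdegree (L (int n))"
    using left[OF L(2)] right[OF L(1)] by (simp add: od_def)
  show "L i \<noteq> 0 \<Longrightarrow> fls_subdegree (L i) \<ge> fls_subdegree (L (int n))"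
    using right[of i] by (simp add: od_def)
qed

text \<open>A point of the polygon that is not on its bottom line is interior to a vertical segment.\<close>

lemma zero_slope_if_subdegrees:
  assumes L: "L 0 \<noteq> 0" "L (int n) \<noteq> 0" and sup: "\<And>i. i \<notin> {0..int n} \<Longrightarrow> L i = 0"
    and sub: "\<And>i. fls_subdegree (L i) \<ge> 0" "fls_subdegree (L 0) = 0" "fls_subdegree (L (int n)) = 0"
  shows "finite_slopes (newton_polygon L) \<subseteq> {0}"
proof -
  let ?N = "newton_polygon L"
  \<comment> \<open>The polygon is the whole half strip of width \<open>n\<close> above the
    horizontal axis.\<close>
  have N: "p \<in> ?N \<longleftrightarrow> 0 \<le> fst p \<and> fst p \<le> real n \<and> 0 \<le> snd p" for p
  proof
    assume p: "p \<in> ?N"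
    have "0 \<le> snd p - 0 * fst p"
    proof (rule newton_polygon_ge[of _ _ L])
      show "0 \<le> k - 0 * real_of_int i" if "k \<ge> real_of_int (fls_subdegree (L i))" for i k
        using sub(1)[of i] that by simp
    qed (use p in \<open>simp\<close>)
    then have y: "0 \<le> snd p" by simp
    have supD: "0 \<le> i \<and> i \<le> int n" if "L i \<noteq> 0" for i using sup[of i] that by fastforce
    have "?N \<subseteq> {p. inner (1, 0) p \<ge> 0}"
      unfolding newton_polygon_def
      by (intro hull_minimal convex_halfspace_ge) (auto simp: inner_prod_def dest!: supD)
    moreover have "?N \<subseteq> {p. inner (1, 0) p \<le> real n}"
      unfolding newton_polygon_def
      by (intro hull_minimal convex_halfspace_le) (auto simp: inner_prod_def dest!: supD)
    ultimately
    show "0 \<le> fst p \<and> fst p \<le> real n \<and> 0 \<le> snd p" using p y by (auto simp: inner_prod_def)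
  next
    assume p: "0 \<le> fst p \<and> fst p \<le> real n \<and> 0 \<le> snd p"
    have v: "(0, snd p) \<in> ?N" "(real n, snd p) \<in> ?N"
      using newton_vertex[of L 0 "snd p"] newton_vertex[of L "int n" "snd p"] L sub p by auto
    have conv: "convex ?N" by (simp add: newton_polygon_def convex_convex_hull)
    show "p \<in> ?N"
    proof (cases "n = 0")
      case True
      then have "p = (0, snd p)" using p by (simp add: prod_eq_iff)
      then show ?thesis using v(1) by simp
    next
      case False
      define t where "t = fst p / real n"
      have "(1 - t) *\<^sub>R (0, snd p) + t *\<^sub>R (real n, snd p) \<in> ?N"
        using p False by (intro convexD_alt[OF conv v]) (auto simp: t_def)
      moreover have "(1 - t) *\<^sub>R (0, snd p) + t *\<^sub>R (real n, snd p) = p"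
        using False by (simp add: t_def prod_eq_iff algebra_simps)
      ultimately show ?thesis by simp
    qed
  qed
  have key: False if e: "e edge_of ?N" and a: "a \<in> e" and b: "b \<in> e" and ab: "fst a \<noteq> fst b" "snd b > 0" for a b e
  proof -
    have face: "e face_of ?N" and dim: "aff_dim e = 1" using e by (auto simp: edge_of_def)
    have bN: "b \<in> ?N" using face b by (auto simp: face_of_def)
    \<comment> \<open>\<open>b\<close> is the midpoint of this vertical segment, so a face
      containing \<open>b\<close> contains both ends. Together with \<open>a\<close>, at another
      abscissa, they are not collinear, which contradicts dimension 1.\<close>
    let ?u = "(fst b, 0)" and ?v = "(fst b, 2 * snd b)"
    have uv: "?u \<in> ?N" "?v \<in> ?N" using bN N ab by auto
    have "b = (1 - 1 / 2) *\<^sub>R ?u + (1 / 2) *\<^sub>R ?v" by (simp add: prod_eq_iff)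
    moreover have "?u \<noteq> ?v" using ab by simp
    ultimately have "b \<in> open_segment ?u ?v"
      unfolding in_segment by (intro conjI exI[of _ "1 / 2"]) auto
    then have uve: "?u \<in> e" "?v \<in> e" using face uv b by (auto simp: face_of_def)
    have "\<not> collinear {a, ?u, ?v}"
    proof
      assume "collinear {a, ?u, ?v}"
      then have "collinear {?v, ?u, a}" by (simp add: insert_commute)
      then consider "?v = a" | t where "?u = t *\<^sub>R ?v + (1 - t) *\<^sub>R a"
        unfolding collinear_3_expand by blast
      then show False
      proof cases
        case 1 then show False using ab(1) by auto
      next
        case 2
        then have e: "fst b = t * fst b + (1 - t) * fst a" "0 = t * (2 * snd b) + (1 - t) * snd a"
          by (auto simp: prod_eq_iff)
        have "(1 - t) * (fst b - fst a) = 0" using e(1) by (simp add: algebra_simps)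
        then have "t = 1" using ab(1) by simp
        then show False using e(2) ab(2) by simp
      qed
    qed
    moreover have "collinear e" using dim by (simp add: collinear_aff_dim)
    ultimately show False using collinear_subset[of e "{a, ?u, ?v}"] a uve by auto
  qed
  show ?thesis
  proof
    fix s assume "s \<in> finite_slopes ?N"
    then obtain a b e where e: "s = (snd b - snd a) / (fst b - fst a)" "e edge_of ?N" "a \<in> e" "b \<in> e" "fst a \<noteq> fst b"
      by (auto simp: finite_slopes_def)
    have "a \<in> ?N" "b \<in> ?N" using e by (auto simp: edge_of_def face_of_def)
    then have "snd a \<ge> 0" "snd b \<ge> 0" using N by auto
    moreover have "\<not> snd b > 0" using key[OF e(2-5)] by blast
    moreover have "\<not> snd a > 0" using key[OF e(2,4,3)] e(5) by fastforce
    ultimately show "s \<in> {0}" using e(1) by simp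
  qed
qed

section \<open>Fully faithful functors and equivalences\<close>

lemma cat_ident: "is_category C \<Longrightarrow> A \<in> Obj C \<Longrightarrow> Ident C A \<in> Hom C A A"
  and cat_comp: "is_category C \<Longrightarrow> A \<in> Obj C \<Longrightarrow> B \<in> Obj C \<Longrightarrow> D \<in> Obj C \<Longrightarrow> f \<in> Hom C A B \<Longrightarrow> g \<in> Hom C B D \<Longrightarrow>
    Comp C A B D g f \<in> Hom C A D"
  and cat_ident_right: "is_category C \<Longrightarrow> A \<in> Obj C \<Longrightarrow> B \<in> Obj C \<Longrightarrow> f \<in> Hom C A B \<Longrightarrow> Comp C A A B f (Ident C A) = f"
  and cat_ident_left: "is_category C \<Longrightarrow> A \<in> Obj C \<Longrightarrow> B \<in> Obj C \<Longrightarrow> f \<in> Hom C A B \<Longrightarrow> Comp C A B B (Ident C B) f = f"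
  and cat_assoc: "is_category C \<Longrightarrow> A \<in> Obj C \<Longrightarrow> B \<in> Obj C \<Longrightarrow> D \<in> Obj C \<Longrightarrow> E \<in> Obj C \<Longrightarrow>
    f \<in> Hom C A B \<Longrightarrow> g \<in> Hom C B D \<Longrightarrow> h \<in> Hom C D E \<Longrightarrow>
    Comp C A D E h (Comp C A B D g f) = Comp C A B E (Comp C B D E h g) f"
  by (simp_all add: is_category_def)

definition fully_faithful ::
  "('o, 'a) cat \<Rightarrow> ('p, 'b) cat \<Rightarrow> ('o \<Rightarrow> 'p) \<Rightarrow> ('o \<Rightarrow> 'o \<Rightarrow> 'a \<Rightarrow> 'b) \<Rightarrow> bool" where
  "fully_faithful C D Fo Fa \<longleftrightarrow> is_functor C D Fo Fa \<and>
     (\<forall>A\<in>Obj C. \<forall>B\<in>Obj C. bij_betw (Fa A B) (Hom C A B) (Hom D (Fo A) (Fo B)))"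

definition ess_surj :: "('o, 'a) cat \<Rightarrow> ('p, 'b) cat \<Rightarrow> ('o \<Rightarrow> 'p) \<Rightarrow> bool" where
  "ess_surj C D Fo \<longleftrightarrow> (\<forall>X\<in>Obj D. \<exists>A\<in>Obj C. \<exists>i. is_iso D (Fo A) X i)"

lemma functor_obj: "is_functor C D Fo Fa \<Longrightarrow> A \<in> Obj C \<Longrightarrow> Fo A \<in> Obj D"
  and functor_hom: "is_functor C D Fo Fa \<Longrightarrow> A \<in> Obj C \<Longrightarrow> B \<in> Obj C \<Longrightarrow> f \<in> Hom C A B \<Longrightarrow> Fa A B f \<in> Hom D (Fo A) (Fo B)"
  and functor_ident: "is_functor C D Fo Fa \<Longrightarrow> A \<in> Obj C \<Longrightarrow> Fa A A (Ident C A) = Ident D (Fo A)"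
  and functor_comp: "is_functor C D Fo Fa \<Longrightarrow> A \<in> Obj C \<Longrightarrow> B \<in> Obj C \<Longrightarrow> E \<in> Obj C \<Longrightarrow> f \<in> Hom C A B \<Longrightarrow> g \<in> Hom C B E \<Longrightarrow>
    Fa A E (Comp C A B E g f) = Comp D (Fo A) (Fo B) (Fo E) (Fa B E g) (Fa A B f)"
  by (simp_all add: is_functor_def)

lemma fully_faithful_inj:
  "fully_faithful C D Fo Fa \<Longrightarrow> A \<in> Obj C \<Longrightarrow> B \<in> Obj C \<Longrightarrow> f \<in> Hom C A B \<Longrightarrow> g \<in> Hom C A B \<Longrightarrow> Fa A B f = Fa A B g \<Longrightarrow> f = g"
  unfolding fully_faithful_def bij_betw_def by (meson inj_onD)

lemma fully_faithful_surj:
  "fully_faithful C D Fo Fa \<Longrightarrow> A \<in> Obj C \<Longrightarrow> B \<in> Obj C \<Longrightarrow> g \<in> Hom D (Fo A) (Fo B) \<Longrightarrow> \<exists>f\<in>Hom C A B. Fa A B f = g"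
  unfolding fully_faithful_def bij_betw_def by (metis (no_types, lifting) imageE)

lemma fully_faithful_iso:
  assumes C: "is_category C" and F: "fully_faithful C D Fo Fa" and AB: "A \<in> Obj C" "B \<in> Obj C"
    and i: "is_iso D (Fo A) (Fo B) i"
  shows "\<exists>f\<in>Hom C A B. Fa A B f = i \<and> is_iso C A B f"
proof -
  have Ff: "is_functor C D Fo Fa" using F by (simp add: fully_faithful_def)
  obtain j where j: "i \<in> Hom D (Fo A) (Fo B)" "j \<in> Hom D (Fo B) (Fo A)"
    "Comp D (Fo A) (Fo B) (Fo A) j i = Ident D (Fo A)" "Comp D (Fo B) (Fo A) (Fo B) i j = Ident D (Fo B)"
    using i by (auto simp: is_iso_def)
  obtain f where f: "f \<in> Hom C A B" "Fa A B f = i" using fully_faithful_surj[OF F AB j(1)] by blast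
  obtain g where g: "g \<in> Hom C B A" "Fa B A g = j" using fully_faithful_surj[OF F AB(2,1) j(2)] by blast
  have "Comp C A B A g f = Ident C A"
    by (rule fully_faithful_inj[OF F AB(1) AB(1) cat_comp[OF C AB(1,2,1) f(1) g(1)] cat_ident[OF C AB(1)]])
      (simp add: functor_comp[OF Ff AB(1,2,1) f(1) g(1)] functor_ident[OF Ff AB(1)] f g j)
  moreover have "Comp C B A B f g = Ident C B"
    by (rule fully_faithful_inj[OF F AB(2) AB(2) cat_comp[OF C AB(2,1,2) g(1) f(1)] cat_ident[OF C AB(2)]])
      (simp add: functor_comp[OF Ff AB(2,1,2) g(1) f(1)] functor_ident[OF Ff AB(2)] f g j)
  ultimately show ?thesis using f g by (auto simp: is_iso_def)
qed

lemma iso_cancel_left: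
  assumes C: "is_category C" and A: "A \<in> Obj C" "B \<in> Obj C" "D \<in> Obj C" and i: "is_iso C B D i"
    and f: "f \<in> Hom C A B" "g \<in> Hom C A B" and eq: "Comp C A B D i f = Comp C A B D i g"
  shows "f = g"
proof -
  obtain j where j: "i \<in> Hom C B D" "j \<in> Hom C D B" "Comp C B D B j i = Ident C B"
    using i by (auto simp: is_iso_def)
  have "Comp C A D B j (Comp C A B D i h) = h" if h: "h \<in> Hom C A B" for h
    using cat_assoc[OF C A(1-3) A(2) h j(1,2)] cat_ident_left[OF C A(1,2) h] j(3) by simp
  then show ?thesis using f eq by metis
qed

lemma iso_cancel_right:
  assumes C: "is_category C" and A: "A \<in> Obj C" "B \<in> Obj C" "D \<in> Obj C" and i: "is_iso C A B i"
    and f: "f \<in> Hom C B D" "g \<in> Hom C B D" and eq: "Comp C A B D f i = Comp C A B D g i"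
  shows "f = g"
proof -
  obtain j where j: "i \<in> Hom C A B" "j \<in> Hom C B A" "Comp C B A B i j = Ident C B"
    using i by (auto simp: is_iso_def)
  have "Comp C B A D (Comp C A B D h i) j = h" if h: "h \<in> Hom C B D" for h
    using cat_assoc[OF C A(2,1,2,3) j(2,1) h] cat_ident_right[OF C A(2,3) h] j(3) by simp
  then show ?thesis using f eq by metis
qed

lemma iso_comp:
  assumes C: "is_category C" and A: "A \<in> Obj C" "B \<in> Obj C" "D \<in> Obj C" and i: "is_iso C A B i" and k: "is_iso C B D k"
  shows "is_iso C A D (Comp C A B D k i)"
proof -
  obtain j where j: "i \<in> Hom C A B" "j \<in> Hom C B A" "Comp C A B A j i = Ident C A" "Comp C B A B i j = Ident C B"
    using i by (auto simp: is_iso_def)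
  obtain l where l: "k \<in> Hom C B D" "l \<in> Hom C D B" "Comp C B D B l k = Ident C B" "Comp C D B D k l = Ident C D"
    using k by (auto simp: is_iso_def)
  have ki: "Comp C A B D k i \<in> Hom C A D" by (rule cat_comp[OF C A j(1) l(1)])
  have jl: "Comp C D B A j l \<in> Hom C D A" by (rule cat_comp[OF C A(3,2,1) l(2) j(2)])
  have "Comp C A D A (Comp C D B A j l) (Comp C A B D k i) = Comp C A B A j (Comp C A D B l (Comp C A B D k i))"
    using cat_assoc[OF C A(1,3,2,1) ki l(2) j(2)] by simp
  also have "Comp C A D B l (Comp C A B D k i) = i"
    using cat_assoc[OF C A(1,2,3,2) j(1) l(1,2)] cat_ident_left[OF C A(1,2) j(1)] l(3) by simp
  finally have 1: "Comp C A D A (Comp C D B A j l) (Comp C A B D k i) = Ident C A" using j(3) by simp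
  have "Comp C D A D (Comp C A B D k i) (Comp C D B A j l) = Comp C D B D k (Comp C D A B i (Comp C D B A j l))"
    using cat_assoc[OF C A(3,1,2,3) jl j(1) l(1)] by simp
  also have "Comp C D A B i (Comp C D B A j l) = l"
    using cat_assoc[OF C A(3,2,1,2) l(2) j(2,1)] cat_ident_left[OF C A(3,2) l(2)] j(4) by simp
  finally have 2: "Comp C D A D (Comp C A B D k i) (Comp C D B A j l) = Ident C D" using l(4) by simp
  show ?thesis unfolding is_iso_def using ki jl 1 2 by blast
qed

text \<open>Objects are lifted by essential surjectivity of \<open>Wo\<close>. An arrow is lifted to
  the only arrow whose image corresponds to that of \<open>Ua\<close> under the chosen isomorphisms;
  this uniqueness yields functoriality.\<close>

lemma lift_functor:
  assumes C: "is_category C" and D: "is_category D" and S: "is_category S"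
    and U: "is_functor C S Uo Ua" and W: "fully_faithful D S Wo Wa" "ess_surj D S Wo"
  shows "\<exists>Fo Fa i. is_functor C D Fo Fa \<and> (\<forall>A\<in>Obj C. is_iso S (Wo (Fo A)) (Uo A) (i A)) \<and>
    (\<forall>A\<in>Obj C. \<forall>B\<in>Obj C. \<forall>f\<in>Hom C A B.
      Comp S (Wo (Fo A)) (Wo (Fo B)) (Uo B) (i B) (Wa (Fo A) (Fo B) (Fa A B f)) = Comp S (Wo (Fo A)) (Uo A) (Uo B) (Ua A B f) (i A))"
proof -
  have Wf: "is_functor D S Wo Wa" using W(1) by (simp add: fully_faithful_def)
  have "\<forall>A\<in>Obj C. \<exists>X i. X \<in> Obj D \<and> is_iso S (Wo X) (Uo A) i"
    using W(2) functor_obj[OF U] unfolding ess_surj_def by meson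
  then obtain Fo i where Fi: "\<And>A. A \<in> Obj C \<Longrightarrow> Fo A \<in> Obj D \<and> is_iso S (Wo (Fo A)) (Uo A) (i A)" by metis
  have FD: "Fo A \<in> Obj D" and ii: "is_iso S (Wo (Fo A)) (Uo A) (i A)" if "A \<in> Obj C" for A using Fi[OF that] by auto
  have WF: "Wo (Fo A) \<in> Obj S" and UA: "Uo A \<in> Obj S" if "A \<in> Obj C" for A
    using functor_obj[OF Wf FD[OF that]] functor_obj[OF U that] by auto
  have iH: "i A \<in> Hom S (Wo (Fo A)) (Uo A)" if "A \<in> Obj C" for A using ii[OF that] by (simp add: is_iso_def)
  define P where "P A B f g \<longleftrightarrow> g \<in> Hom D (Fo A) (Fo B) \<and>
    Comp S (Wo (Fo A)) (Wo (Fo B)) (Uo B) (i B) (Wa (Fo A) (Fo B) g) = Comp S (Wo (Fo A)) (Uo A) (Uo B) (Ua A B f) (i A)" for A B f g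
  have ex: "\<exists>g. P A B f g" if A: "A \<in> Obj C" and B: "B \<in> Obj C" and f: "f \<in> Hom C A B" for A B f
  proof -
    obtain j where j: "j \<in> Hom S (Uo B) (Wo (Fo B))" "Comp S (Uo B) (Wo (Fo B)) (Uo B) (i B) j = Ident S (Uo B)"
      using ii[OF B] by (auto simp: is_iso_def)
    let ?u = "Comp S (Wo (Fo A)) (Uo A) (Uo B) (Ua A B f) (i A)"
    have u: "?u \<in> Hom S (Wo (Fo A)) (Uo B)"
      by (rule cat_comp[OF S WF[OF A] UA[OF A] UA[OF B] iH[OF A] functor_hom[OF U A B f]])
    let ?g = "Comp S (Wo (Fo A)) (Uo B) (Wo (Fo B)) j ?u"
    have g: "?g \<in> Hom S (Wo (Fo A)) (Wo (Fo B))" by (rule cat_comp[OF S WF[OF A] UA[OF B] WF[OF B] u j(1)])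
    obtain h where h: "h \<in> Hom D (Fo A) (Fo B)" "Wa (Fo A) (Fo B) h = ?g"
      using fully_faithful_surj[OF W(1) FD[OF A] FD[OF B] g] by blast
    have "Comp S (Wo (Fo A)) (Wo (Fo B)) (Uo B) (i B) ?g = ?u"
      using cat_assoc[OF S WF[OF A] UA[OF B] WF[OF B] UA[OF B] u j(1) iH[OF B]] cat_ident_left[OF S WF[OF A] UA[OF B] u] j(2) by simp
    then show ?thesis using h by (auto simp: P_def)
  qed
  have uniq: "g = g'" if A: "A \<in> Obj C" and B: "B \<in> Obj C" and g: "P A B f g" "P A B f g'" for A B f g g'
  proof -
    have gH: "g \<in> Hom D (Fo A) (Fo B)" "g' \<in> Hom D (Fo A) (Fo B)" using g by (auto simp: P_def)
    have "Wa (Fo A) (Fo B) g = Wa (Fo A) (Fo B) g'"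
      by (rule iso_cancel_left[OF S WF[OF A] WF[OF B] UA[OF B] ii[OF B]
            functor_hom[OF Wf FD[OF A] FD[OF B] gH(1)] functor_hom[OF Wf FD[OF A] FD[OF B] gH(2)]])
        (use g in \<open>simp add: P_def\<close>)
    then show ?thesis by (rule fully_faithful_inj[OF W(1) FD[OF A] FD[OF B] gH])
  qed
  define Fa where "Fa A B f = (SOME g. P A B f g)" for A B f
  have Fa: "P A B f (Fa A B f)" if "A \<in> Obj C" "B \<in> Obj C" "f \<in> Hom C A B" for A B f
    unfolding Fa_def by (rule someI_ex[OF ex[OF that]])
  have fctr: "is_functor C D Fo Fa"
    unfolding is_functor_def
  proof (intro conjI ballI)
    fix A B f assume "A \<in> Obj C" "B \<in> Obj C" "f \<in> Hom C A B"
    then show "Fa A B f \<in> Hom D (Fo A) (Fo B)" using Fa by (simp add: P_def)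
  next
    fix A assume A: "A \<in> Obj C"
    have "P A A (Ident C A) (Ident D (Fo A))"
      unfolding P_def using cat_ident[OF D FD[OF A]] cat_ident_left[OF S WF[OF A] UA[OF A] iH[OF A]]
        cat_ident_right[OF S WF[OF A] UA[OF A] iH[OF A]]
      by (simp add: functor_ident[OF Wf FD[OF A]] functor_ident[OF U A])
    then show "Fa A A (Ident C A) = Ident D (Fo A)"
      using uniq[OF A A Fa[OF A A cat_ident[OF C A]]] by simp
  next
    fix A B E f g assume A: "A \<in> Obj C" and B: "B \<in> Obj C" and E: "E \<in> Obj C"
      and f: "f \<in> Hom C A B" and g: "g \<in> Hom C B E"
    let ?h = "Comp D (Fo A) (Fo B) (Fo E) (Fa B E g) (Fa A B f)"
    have Ff: "Fa A B f \<in> Hom D (Fo A) (Fo B)" and Fg: "Fa B E g \<in> Hom D (Fo B) (Fo E)"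
      and ef: "Comp S (Wo (Fo A)) (Wo (Fo B)) (Uo B) (i B) (Wa (Fo A) (Fo B) (Fa A B f)) = Comp S (Wo (Fo A)) (Uo A) (Uo B) (Ua A B f) (i A)"
      and eg: "Comp S (Wo (Fo B)) (Wo (Fo E)) (Uo E) (i E) (Wa (Fo B) (Fo E) (Fa B E g)) = Comp S (Wo (Fo B)) (Uo B) (Uo E) (Ua B E g) (i B)"
      using Fa[OF A B f] Fa[OF B E g] by (auto simp: P_def)
    note wf = functor_hom[OF Wf FD[OF A] FD[OF B] Ff] and wg = functor_hom[OF Wf FD[OF B] FD[OF E] Fg]
    note uf = functor_hom[OF U A B f] and ug = functor_hom[OF U B E g]
    have "Comp S (Wo (Fo A)) (Wo (Fo E)) (Uo E) (i E) (Wa (Fo A) (Fo E) ?h) =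
        Comp S (Wo (Fo A)) (Wo (Fo B)) (Uo E) (Comp S (Wo (Fo B)) (Wo (Fo E)) (Uo E) (i E) (Wa (Fo B) (Fo E) (Fa B E g))) (Wa (Fo A) (Fo B) (Fa A B f))"
      unfolding functor_comp[OF Wf FD[OF A] FD[OF B] FD[OF E] Ff Fg]
      by (rule cat_assoc[OF S WF[OF A] WF[OF B] WF[OF E] UA[OF E] wf wg iH[OF E]])
    also have "\<dots> = Comp S (Wo (Fo A)) (Uo B) (Uo E) (Ua B E g) (Comp S (Wo (Fo A)) (Uo A) (Uo B) (Ua A B f) (i A))"
      unfolding eg ef[symmetric] by (rule cat_assoc[OF S WF[OF A] WF[OF B] UA[OF B] UA[OF E] wf iH[OF B] ug, symmetric])
    also have "\<dots> = Comp S (Wo (Fo A)) (Uo A) (Uo E) (Ua A E (Comp C A B E g f)) (i A)"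
      unfolding functor_comp[OF U A B E f g] by (rule cat_assoc[OF S WF[OF A] UA[OF A] UA[OF B] UA[OF E] iH[OF A] uf ug])
    finally have "P A E (Comp C A B E g f) ?h"
      using cat_comp[OF D FD[OF A] FD[OF B] FD[OF E] Ff Fg] by (simp add: P_def)
    then show "Fa A E (Comp C A B E g f) = ?h"
      using uniq[OF A E Fa[OF A E cat_comp[OF C A B E f g]]] by simp
  qed (rule FD)
  show ?thesis
    by (rule exI[of _ Fo], rule exI[of _ Fa], rule exI[of _ i]) (use fctr ii Fa in \<open>auto simp: P_def\<close>)
qed

text \<open>The quasi-inverse is the lift of the identity functor of \<open>D\<close> along the
  given functor. The second natural isomorphism consists of preimages of the \<epsilon>'s, and its
  naturality is checked after applying the faithful functor.\<close>

lemma equivalent_if_fully_faithful: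
  assumes C: "is_category C" and D: "is_category D"
    and F: "fully_faithful C D Fo Fa" "ess_surj C D Fo"
  shows "equivalent_categories C D"
proof -
  have Ff: "is_functor C D Fo Fa" using F(1) by (simp add: fully_faithful_def)
  have "is_functor D D (\<lambda>X. X) (\<lambda>X Y g. g)" by (simp add: is_functor_def)
  from lift_functor[OF D C D this F] obtain Go Ga \<epsilon> where G: "is_functor D C Go Ga"
    and \<epsilon>: "\<And>X. X \<in> Obj D \<Longrightarrow> is_iso D (Fo (Go X)) X (\<epsilon> X)"
      "\<And>X Y g. X \<in> Obj D \<Longrightarrow> Y \<in> Obj D \<Longrightarrow> g \<in> Hom D X Y \<Longrightarrow>
        Comp D (Fo (Go X)) (Fo (Go Y)) Y (\<epsilon> Y) (Fa (Go X) (Go Y) (Ga X Y g)) = Comp D (Fo (Go X)) X Y g (\<epsilon> X)"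
    by blast
  have FA: "Fo A \<in> Obj D" if "A \<in> Obj C" for A by (rule functor_obj[OF Ff that])
  have GX: "Go X \<in> Obj C" if "X \<in> Obj D" for X by (rule functor_obj[OF G that])
  have "\<forall>A\<in>Obj C. \<exists>h. Fa (Go (Fo A)) A h = \<epsilon> (Fo A) \<and> is_iso C (Go (Fo A)) A h"
    using fully_faithful_iso[OF C F(1) GX[OF FA] _ \<epsilon>(1)[OF FA]] by blast
  then obtain \<eta> where \<eta>: "\<And>A. A \<in> Obj C \<Longrightarrow> Fa (Go (Fo A)) A (\<eta> A) = \<epsilon> (Fo A) \<and> is_iso C (Go (Fo A)) A (\<eta> A)"
    by metis
  have "nat_iso_to_id C (\<lambda>A. Go (Fo A)) (\<lambda>A B f. Ga (Fo A) (Fo B) (Fa A B f)) \<eta>"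
    unfolding nat_iso_to_id_def
  proof (intro conjI ballI)
    fix A B f assume A: "A \<in> Obj C" and B: "B \<in> Obj C" and f: "f \<in> Hom C A B"
    note GA = GX[OF FA[OF A]] and GB = GX[OF FA[OF B]]
    note Fh = functor_hom[OF Ff A B f]
    note GFh = functor_hom[OF G FA[OF A] FA[OF B] Fh]
    have \<eta>A: "\<eta> A \<in> Hom C (Go (Fo A)) A" and \<eta>B: "\<eta> B \<in> Hom C (Go (Fo B)) B"
      using \<eta>[OF A] \<eta>[OF B] by (auto simp: is_iso_def)
    show "Comp C (Go (Fo A)) (Go (Fo B)) B (\<eta> B) (Ga (Fo A) (Fo B) (Fa A B f)) = Comp C (Go (Fo A)) A B f (\<eta> A)"
    proof (rule fully_faithful_inj[OF F(1) GA B])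
      show "Fa (Go (Fo A)) B (Comp C (Go (Fo A)) (Go (Fo B)) B (\<eta> B) (Ga (Fo A) (Fo B) (Fa A B f))) =
          Fa (Go (Fo A)) B (Comp C (Go (Fo A)) A B f (\<eta> A))"
        unfolding functor_comp[OF Ff GA GB B GFh \<eta>B] functor_comp[OF Ff GA A B \<eta>A f]
        using \<epsilon>(2)[OF FA[OF A] FA[OF B] Fh] \<eta>[OF A] \<eta>[OF B] by simp
    qed (rule cat_comp[OF C GA GB B GFh \<eta>B], rule cat_comp[OF C GA A B \<eta>A f])
  qed (use \<eta> in blast)
  moreover have "nat_iso_to_id D (\<lambda>X. Fo (Go X)) (\<lambda>X Y g. Fa (Go X) (Go Y) (Ga X Y g)) \<epsilon>"
    unfolding nat_iso_to_id_def using \<epsilon> by blast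
  ultimately show ?thesis unfolding equivalent_categories_def using C D Ff G by blast
qed

text \<open>The lift of the first functor along the second becomes naturally isomorphic to the first
  one in \<open>S\<close>. Full faithfulness and essential surjectivity can therefore be transferred
  to it through \<open>S\<close>.\<close>

lemma equivalent_if_common_skeleton:
  assumes C: "is_category C" and D: "is_category D" and S: "is_category S"
    and U: "fully_faithful C S Uo Ua" "ess_surj C S Uo" and W: "fully_faithful D S Wo Wa" "ess_surj D S Wo"
  shows "equivalent_categories C D"
proof -
  have Uf: "is_functor C S Uo Ua" and Wf: "is_functor D S Wo Wa" using U W by (auto simp: fully_faithful_def)
  from lift_functor[OF C D S Uf W] obtain Fo Fa i where F: "is_functor C D Fo Fa"
    and i: "\<And>A. A \<in> Obj C \<Longrightarrow> is_iso S (Wo (Fo A)) (Uo A) (i A)"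
    and nat: "\<And>A B f. A \<in> Obj C \<Longrightarrow> B \<in> Obj C \<Longrightarrow> f \<in> Hom C A B \<Longrightarrow>
      Comp S (Wo (Fo A)) (Wo (Fo B)) (Uo B) (i B) (Wa (Fo A) (Fo B) (Fa A B f)) = Comp S (Wo (Fo A)) (Uo A) (Uo B) (Ua A B f) (i A)"
    by blast
  have FD: "Fo A \<in> Obj D" if "A \<in> Obj C" for A by (rule functor_obj[OF F that])
  have WF: "Wo (Fo A) \<in> Obj S" and UA: "Uo A \<in> Obj S" and iH: "i A \<in> Hom S (Wo (Fo A)) (Uo A)" if "A \<in> Obj C" for A
    using functor_obj[OF Wf FD[OF that]] functor_obj[OF Uf that] i[OF that] by (auto simp: is_iso_def)
  have "fully_faithful C D Fo Fa"
    unfolding fully_faithful_def bij_betw_def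
  proof (intro conjI ballI F)
    fix A B assume A: "A \<in> Obj C" and B: "B \<in> Obj C"
    show "inj_on (Fa A B) (Hom C A B)"
    proof (rule inj_onI)
      fix f g assume f: "f \<in> Hom C A B" and g: "g \<in> Hom C A B" and eq: "Fa A B f = Fa A B g"
      have "Ua A B f = Ua A B g"
        by (rule iso_cancel_right[OF S WF[OF A] UA[OF A] UA[OF B] i[OF A] functor_hom[OF Uf A B f] functor_hom[OF Uf A B g]])
          (use nat[OF A B f] nat[OF A B g] eq in \<open>simp\<close>)
      then show "f = g" by (rule fully_faithful_inj[OF U(1) A B f g])
    qed
    show "Fa A B ` Hom C A B = Hom D (Fo A) (Fo B)"
    proof safe
      fix f assume "f \<in> Hom C A B"
      then show "Fa A B f \<in> Hom D (Fo A) (Fo B)" by (rule functor_hom[OF F A B])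
    next
      fix g assume g: "g \<in> Hom D (Fo A) (Fo B)"
      obtain j where j: "j \<in> Hom S (Uo A) (Wo (Fo A))" "Comp S (Wo (Fo A)) (Uo A) (Wo (Fo A)) j (i A) = Ident S (Wo (Fo A))"
        using i[OF A] by (auto simp: is_iso_def)
      note wg = functor_hom[OF Wf FD[OF A] FD[OF B] g]
      \<comment> \<open>The image of \<open>g\<close> in \<open>S\<close> is carried by the
        isomorphisms \<open>i\<close> to an arrow from \<open>Uo A\<close> to \<open>Uo B\<close>,
        which is then lifted to \<open>C\<close>.\<close>
      let ?v = "Comp S (Wo (Fo A)) (Wo (Fo B)) (Uo B) (i B) (Wa (Fo A) (Fo B) g)"
      have v: "?v \<in> Hom S (Wo (Fo A)) (Uo B)" by (rule cat_comp[OF S WF[OF A] WF[OF B] UA[OF B] wg iH[OF B]])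
      have "Comp S (Uo A) (Wo (Fo A)) (Uo B) ?v j \<in> Hom S (Uo A) (Uo B)"
        by (rule cat_comp[OF S UA[OF A] WF[OF A] UA[OF B] j(1) v])
      from fully_faithful_surj[OF U(1) A B this]
      obtain f where f: "f \<in> Hom C A B" "Ua A B f = Comp S (Uo A) (Wo (Fo A)) (Uo B) ?v j" by blast
      have "Comp S (Wo (Fo A)) (Uo A) (Uo B) (Ua A B f) (i A) = ?v"
        unfolding f(2) using cat_assoc[OF S WF[OF A] UA[OF A] WF[OF A] UA[OF B] iH[OF A] j(1) v]
          cat_ident_right[OF S WF[OF A] UA[OF B] v] j(2) by simp
      then have "Comp S (Wo (Fo A)) (Wo (Fo B)) (Uo B) (i B) (Wa (Fo A) (Fo B) (Fa A B f)) = ?v"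
        using nat[OF A B f(1)] by simp
      then have "Wa (Fo A) (Fo B) (Fa A B f) = Wa (Fo A) (Fo B) g"
        by (rule iso_cancel_left[OF S WF[OF A] WF[OF B] UA[OF B] i[OF B]
              functor_hom[OF Wf FD[OF A] FD[OF B] functor_hom[OF F A B f(1)]] wg])
      then have "Fa A B f = g"
        by (rule fully_faithful_inj[OF W(1) FD[OF A] FD[OF B] functor_hom[OF F A B f(1)] g])
      then show "g \<in> Fa A B ` Hom C A B" using f(1) by blast
    qed
  qed
  moreover have "ess_surj C D Fo"
    unfolding ess_surj_def
  proof
    fix X assume X: "X \<in> Obj D"
    have WX: "Wo X \<in> Obj S" by (rule functor_obj[OF Wf X])
    then obtain A u where A: "A \<in> Obj C" and u: "is_iso S (Uo A) (Wo X) u" using U(2) by (auto simp: ess_surj_def)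
    have "is_iso S (Wo (Fo A)) (Wo X) (Comp S (Wo (Fo A)) (Uo A) (Wo X) u (i A))"
      by (rule iso_comp[OF S WF[OF A] UA[OF A] WX i[OF A] u])
    then show "\<exists>A\<in>Obj C. \<exists>i. is_iso D (Fo A) X i"
      using fully_faithful_iso[OF D W(1) FD[OF A] X] A by blast
  qed
  ultimately show ?thesis by (rule equivalent_if_fully_faithful[OF C D])
qed

text \<open>\<open>R A B f P\<close> reads: the arrow \<open>f\<close> is given by \<open>P\<close>.
  For a relation that is bijective on every hom-set and respects identities and composition, the
  arrow part of the functor can be obtained by choice, without a formula.\<close>

lemma functor_from_relation:
  assumes C: "is_category C" and S: "is_category S"
    and s: "\<And>A. A \<in> Obj C \<Longrightarrow> s A \<in> Obj S"
    and ex: "\<And>A B f. A \<in> Obj C \<Longrightarrow> B \<in> Obj C \<Longrightarrow> f \<in> Hom C A B \<Longrightarrow> \<exists>P\<in>Hom S (s A) (s B). R A B f P"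
    and uniq: "\<And>A B f P Q. A \<in> Obj C \<Longrightarrow> B \<in> Obj C \<Longrightarrow> f \<in> Hom C A B \<Longrightarrow> P \<in> Hom S (s A) (s B) \<Longrightarrow> Q \<in> Hom S (s A) (s B) \<Longrightarrow>
      R A B f P \<Longrightarrow> R A B f Q \<Longrightarrow> P = Q"
    and inj: "\<And>A B f g P. A \<in> Obj C \<Longrightarrow> B \<in> Obj C \<Longrightarrow> f \<in> Hom C A B \<Longrightarrow> g \<in> Hom C A B \<Longrightarrow> P \<in> Hom S (s A) (s B) \<Longrightarrow>
      R A B f P \<Longrightarrow> R A B g P \<Longrightarrow> f = g"
    and surj: "\<And>A B P. A \<in> Obj C \<Longrightarrow> B \<in> Obj C \<Longrightarrow> P \<in> Hom S (s A) (s B) \<Longrightarrow> \<exists>f\<in>Hom C A B. R A B f P"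
    and ident: "\<And>A. A \<in> Obj C \<Longrightarrow> R A A (Ident C A) (Ident S (s A))"
    and comp: "\<And>A B E f g P Q. A \<in> Obj C \<Longrightarrow> B \<in> Obj C \<Longrightarrow> E \<in> Obj C \<Longrightarrow> f \<in> Hom C A B \<Longrightarrow> g \<in> Hom C B E \<Longrightarrow>
      P \<in> Hom S (s A) (s B) \<Longrightarrow> Q \<in> Hom S (s B) (s E) \<Longrightarrow> R A B f P \<Longrightarrow> R B E g Q \<Longrightarrow>
      R A E (Comp C A B E g f) (Comp S (s A) (s B) (s E) Q P)"
  shows "\<exists>Fa. fully_faithful C S s Fa"
proof -
  define Fa where "Fa A B f = (SOME P. P \<in> Hom S (s A) (s B) \<and> R A B f P)" for A B f
  have Fa: "Fa A B f \<in> Hom S (s A) (s B) \<and> R A B f (Fa A B f)" if "A \<in> Obj C" "B \<in> Obj C" "f \<in> Hom C A B" for A B f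
    unfolding Fa_def by (rule someI_ex) (use ex[OF that] in blast)
  have eq: "Fa A B f = P" if "A \<in> Obj C" "B \<in> Obj C" "f \<in> Hom C A B" "P \<in> Hom S (s A) (s B)" "R A B f P" for A B f P
    using uniq[OF that(1-3) _ that(4) _ that(5)] Fa[OF that(1-3)] by blast
  have "is_functor C S s Fa"
    unfolding is_functor_def
  proof (intro conjI ballI)
    fix A assume A: "A \<in> Obj C"
    show "Fa A A (Ident C A) = Ident S (s A)"
      by (rule eq[OF A A cat_ident[OF C A] cat_ident[OF S s[OF A]] ident[OF A]])
  next
    fix A B E f g assume A: "A \<in> Obj C" and B: "B \<in> Obj C" and E: "E \<in> Obj C" and f: "f \<in> Hom C A B" and g: "g \<in> Hom C B E"
    note Ff = Fa[OF A B f] and Fg = Fa[OF B E g]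
    show "Fa A E (Comp C A B E g f) = Comp S (s A) (s B) (s E) (Fa B E g) (Fa A B f)"
    proof (rule eq[OF A E cat_comp[OF C A B E f g]])
      show "Comp S (s A) (s B) (s E) (Fa B E g) (Fa A B f) \<in> Hom S (s A) (s E)"
        by (rule cat_comp[OF S s[OF A] s[OF B] s[OF E]]) (use Ff Fg in auto)
      show "R A E (Comp C A B E g f) (Comp S (s A) (s B) (s E) (Fa B E g) (Fa A B f))"
        by (rule comp[OF A B E f g]) (use Ff Fg in auto)
    qed
  qed (use s Fa in auto)
  moreover have "bij_betw (Fa A B) (Hom C A B) (Hom S (s A) (s B))" if A: "A \<in> Obj C" and B: "B \<in> Obj C" for A B
    unfolding bij_betw_def
  proof
    show "inj_on (Fa A B) (Hom C A B)"
      by (rule inj_onI) (metis A B Fa inj)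
    show "Fa A B ` Hom C A B = Hom S (s A) (s B)"
    proof safe
      fix P assume P: "P \<in> Hom S (s A) (s B)"
      then obtain f where "f \<in> Hom C A B" "R A B f P" using surj[OF A B] by blast
      then show "P \<in> Fa A B ` Hom C A B" using eq[OF A B _ P] by (metis image_eqI)
    qed (use Fa[OF A B] in blast)
  qed
  ultimately show ?thesis unfolding fully_faithful_def by blast
qed

section \<open>The skeleton of normal forms\<close>

text \<open>The condition on the entries says that \<open>P\<close> preserves the grading by
  eigenvalues. Under it, the intertwining relation concerns the nilpotent parts alone
  (\<open>nf_intertwine_nilpart\<close>).\<close>

definition nf_hom :: "nat \<times> complex mat \<Rightarrow> nat \<times> complex mat \<Rightarrow> complex mat set" where
  "nf_hom X Y = {P \<in> carrier_mat (fst Y) (fst X). P * snd X = snd Y * P \<and>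
     (\<forall>i<fst Y. \<forall>j<fst X. P $$ (i, j) \<noteq> 0 \<longrightarrow> snd Y $$ (i, i) = snd X $$ (j, j))}"

definition nf_category :: "complex \<Rightarrow> (nat \<times> complex mat, complex mat) cat" where
  "nf_category q =
     \<lparr>Obj = {X. normal_form q (fst X) (snd X) \<and> cond q (fst X) (snd X)},
      Hom = nf_hom,
      Ident = (\<lambda>X. 1\<^sub>m (fst X)),
      Comp = (\<lambda>X Y Z g f. g * f)\<rparr>"

lemma nf_hom_comp:
  assumes "snd X \<in> carrier_mat (fst X) (fst X)" "snd Y \<in> carrier_mat (fst Y) (fst Y)" "snd Z \<in> carrier_mat (fst Z) (fst Z)"
    and P: "P \<in> nf_hom X Y" and Q: "Q \<in> nf_hom Y Z"
  shows "Q * P \<in> nf_hom X Z"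
proof -
  have Pc: "P \<in> carrier_mat (fst Y) (fst X)" and Qc: "Q \<in> carrier_mat (fst Z) (fst Y)" using P Q by (auto simp: nf_hom_def)
  have "Q * P * snd X = Q * (snd Y * P)"
    using assoc_mult_mat[OF Qc Pc assms(1)] P by (simp add: nf_hom_def)
  also have "\<dots> = (snd Z * Q) * P"
    using assoc_mult_mat[OF Qc assms(2) Pc] Q by (simp add: nf_hom_def)
  finally have eq: "Q * P * snd X = snd Z * (Q * P)" using assoc_mult_mat[OF assms(3) Qc Pc] by simp
  have "snd Z $$ (i, i) = snd X $$ (j, j)" if ij: "i < fst Z" "j < fst X" and nz: "(Q * P) $$ (i, j) \<noteq> 0" for i j
  proof -
    obtain l where l: "l < fst Y" "Q $$ (i, l) * P $$ (l, j) \<noteq> 0"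
      using nz unfolding mat_mult_index[OF Qc Pc ij] by (metis (no_types, lifting) lessThan_iff sum.neutral)
    then show ?thesis using P Q ij by (auto simp: nf_hom_def)
  qed
  then show ?thesis using eq Pc Qc by (auto simp: nf_hom_def simp del: index_mult_mat)
qed

lemma is_category_nf: "is_category (nf_category q)"
proof -
  have c: "snd X \<in> carrier_mat (fst X) (fst X)" if "X \<in> Obj (nf_category q)" for X
    using that by (auto simp: nf_category_def normal_form_def)
  show ?thesis
    unfolding is_category_def
  proof (intro conjI ballI)
    fix X assume X: "X \<in> Obj (nf_category q)"
    then show "Ident (nf_category q) X \<in> Hom (nf_category q) X X"
      using c[OF X] by (auto simp: nf_category_def nf_hom_def)
  next
    fix X Y Z P Q assume XYZ: "X \<in> Obj (nf_category q)" "Y \<in> Obj (nf_category q)" "Z \<in> Obj (nf_category q)"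
      and "P \<in> Hom (nf_category q) X Y" "Q \<in> Hom (nf_category q) Y Z"
    then show "Comp (nf_category q) X Y Z Q P \<in> Hom (nf_category q) X Z"
      using nf_hom_comp[OF c[OF XYZ(1)] c[OF XYZ(2)] c[OF XYZ(3)]] by (simp add: nf_category_def)
  next
    fix X Y P assume "P \<in> Hom (nf_category q) X Y"
    then show "Comp (nf_category q) X X Y P (Ident (nf_category q) X) = P"
      "Comp (nf_category q) X Y Y (Ident (nf_category q) Y) P = P"
      by (auto simp: nf_category_def nf_hom_def)
  next
    fix X Y Z T P Q R assume "P \<in> Hom (nf_category q) X Y" "Q \<in> Hom (nf_category q) Y Z" "R \<in> Hom (nf_category q) Z T"
    then show "Comp (nf_category q) X Z T R (Comp (nf_category q) X Y Z Q P) =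
        Comp (nf_category q) X Y T (Comp (nf_category q) Y Z T R Q) P"
      using assoc_mult_mat[of R "fst T" "fst Z" Q "fst Y" P "fst X"] by (simp add: nf_category_def nf_hom_def)
  qed
qed

lemma full_subcategory_category:
  assumes "is_category C" shows "is_category (full_subcategory C P)"
  using assms unfolding is_category_def full_subcategory_def by simp

lemma is_category_qmod: "is_category (qmod_category F q)"
proof -
  have comp: "compose (carrier L) g f \<in> qmod_hom F L N"
    if L: "q_difference_module F q L" and f: "f \<in> qmod_hom F L M" and g: "g \<in> qmod_hom F M N"
    for L M N :: "'a qmod" and f g
  proof -
    have vs: "vectorspace F L" and bij: "bij_betw (Sig L) (carrier L) (carrier L)"
      using L by (auto simp: q_difference_module_def)
    interpret vectorspace F L by (rule vs)
    have "Sig L x \<in> carrier L" if "x \<in> carrier L" for x using bij that by (auto simp: bij_betw_def)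
    then show ?thesis
      using f g by (auto simp: qmod_hom_def module_hom_def compose_def Pi_def)
  qed
  have idn: "(\<lambda>m\<in>carrier M. m) \<in> qmod_hom F M M" if L: "q_difference_module F q M" for M :: "'a qmod"
  proof -
    have vs: "vectorspace F M" and bij: "bij_betw (Sig M) (carrier M) (carrier M)"
      using L by (auto simp: q_difference_module_def)
    interpret vectorspace F M by (rule vs)
    have "Sig M x \<in> carrier M" if "x \<in> carrier M" for x using bij that by (auto simp: bij_betw_def)
    then show ?thesis by (auto simp: qmod_hom_def module_hom_def)
  qed
  show ?thesis
    unfolding is_category_def
  proof (intro conjI ballI)
    fix A B :: "'a qmod" and f assume "f \<in> Hom (qmod_category F q) A B"
    then have f: "f \<in> carrier A \<rightarrow> carrier B" "f \<in> extensional (carrier A)" by (auto simp: qmod_category_def qmod_hom_def module_hom_def)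
    show "Comp (qmod_category F q) A A B f (Ident (qmod_category F q) A) = f"
      "Comp (qmod_category F q) A B B (Ident (qmod_category F q) B) f = f"
      using f by (auto simp: qmod_category_def compose_def extensional_def Pi_def fun_eq_iff)
  next
    fix A B D E :: "'a qmod" and f g h
    assume "f \<in> Hom (qmod_category F q) A B" "g \<in> Hom (qmod_category F q) B D"
    then have "f \<in> carrier A \<rightarrow> carrier B" by (auto simp: qmod_category_def qmod_hom_def module_hom_def)
    then show "Comp (qmod_category F q) A D E h (Comp (qmod_category F q) A B D g f) =
        Comp (qmod_category F q) A B E (Comp (qmod_category F q) B D E h g) f"
      by (auto simp: qmod_category_def compose_def Pi_def fun_eq_iff)
  qed (auto simp: qmod_category_def comp idn)
qed

section \<open>Coordinates for the isoformal modules\<close>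

text \<open>A gauge transformation with entries in \<open>S\<close> is a change of basis of one and
  the same module.\<close>

lemma pres_change:
  assumes Q: "qfield q S" and M: "pres S q M n B h" and A: "A \<in> inv_mats S n" and R: "R \<in> inv_mats S n"
    and eq: "R * B = A * sigm q R"
  shows "pres S q M n A (\<lambda>x. R *\<^sub>v h x)"
proof -
  have S: "subfld S" and q: "q \<noteq> 0" using Q by (auto simp: qfield_def)
  have c: "coord S M n h" and BI: "B \<in> inv_mats S n" using M by (auto simp: pres_def)
  obtain T where RT: "R \<in> mats S n n" "T \<in> mats S n n" "R * T = 1\<^sub>m n" "T * R = 1\<^sub>m n" using R by (auto simp: inv_mats_def)
  note Rc = mats_carrier[OF RT(1)] note Tc = mats_carrier[OF RT(2)]
  note Bc = inv_mats_carrier[OF BI] note Ac = inv_mats_carrier[OF A]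
  have bR: "bij_betw (\<lambda>v. R *\<^sub>v v) (vecs S n) (vecs S n)"
  proof (rule bij_betw_byWitness[where f' = "\<lambda>v. T *\<^sub>v v"])
    show "\<forall>v\<in>vecs S n. T *\<^sub>v (R *\<^sub>v v) = v" "\<forall>v\<in>vecs S n. R *\<^sub>v (T *\<^sub>v v) = v"
      using assoc_mult_mat_vec[OF Tc Rc vecs_carrier] assoc_mult_mat_vec[OF Rc Tc vecs_carrier] RT(3,4)
      by (auto simp flip: assoc_mult_mat_vec[OF Tc Rc vecs_carrier] assoc_mult_mat_vec[OF Rc Tc vecs_carrier] dest: vecs_carrier)
  qed (auto intro: mats_mult_vec[OF S RT(1)] mats_mult_vec[OF S RT(2)])
  have bij: "bij_betw (\<lambda>x. R *\<^sub>v h x) (carrier M) (vecs S n)"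
    using bij_betw_trans[OF coordD(1)[OF c] bR] by (simp add: comp_def)
  have SM: "Sig M x \<in> carrier M" if "x \<in> carrier M" for x using M that by (simp add: pres_def)
  have Sg: "R *\<^sub>v h (Sig M x) = A *\<^sub>v sigv q (R *\<^sub>v h x)" if x: "x \<in> carrier M" for x
  proof -
    have hx: "h x \<in> carrier_vec n" "sigv q (h x) \<in> carrier_vec n" using coordD(4)[OF c x] by auto
    have sR: "sigm q R \<in> carrier_mat n n" using Rc by simp
    have "R *\<^sub>v h (Sig M x) = R * B *\<^sub>v sigv q (h x)"
      using M x assoc_mult_mat_vec[OF Rc Bc hx(2)] by (simp add: pres_def)
    also have "\<dots> = A *\<^sub>v (sigm q R *\<^sub>v sigv q (h x))" unfolding eq by (rule assoc_mult_mat_vec[OF Ac sR hx(2)])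
    finally show ?thesis using sigv_mult_vec[OF q Rc hx(1)] by simp
  qed
  show ?thesis
    unfolding pres_def coord_def
    using bij A coordD(4,5,6,7,8,9,10)[OF c] Rc
    by (auto simp: mult_add_distrib_mat_vec mult_mat_vec mult_mat_zero_vec Sg SM)
qed

lemma pres_transport:
  assumes Q: "qfield q S" and N: "pres S q N n A k"
    and M: "q_difference_module (subfld_ring S) q M"
    and g: "g \<in> qmod_hom (subfld_ring S) M N" and bij: "bij_betw g (carrier M) (carrier N)"
  shows "pres S q M n A (\<lambda>x. k (g x))"
proof -
  have S: "subfld S" using Q by (simp add: qfield_def)
  have vM: "vectorspace (subfld_ring S) M" using M by (simp add: q_difference_module_def)
  have c: "coord S N n k" using N by (simp add: pres_def)
  interpret M: vectorspace "subfld_ring S" M by (rule vM)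
  have gm: "g \<in> module_hom (subfld_ring S) M N" using g by (simp add: qmod_hom_def)
  have gN: "g x \<in> carrier N" if "x \<in> carrier M" for x using gm that by (auto simp: module_hom_def)
  interpret N: vectorspace "subfld_ring S" N by (rule coord_vectorspace[OF S c])
  have SM: "Sig M x \<in> carrier M" if "x \<in> carrier M" for x
    using M that by (auto simp: q_difference_module_def bij_betw_def)
  have g0: "g \<zero>\<^bsub>M\<^esub> = \<zero>\<^bsub>N\<^esub>"
  proof -
    interpret mod_hom "subfld_ring S" M N g by unfold_locales (rule gm)
    show ?thesis by (rule f0_is_0)
  qed
  have "bij_betw (\<lambda>x. k (g x)) (carrier M) (vecs S n)"
    using bij_betw_trans[OF bij coordD(1)[OF c]] by (simp add: o_def)
  then show ?thesis
    unfolding pres_def coord_def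
    using N gN SM g M.smult_closed
    by (auto simp: pres_def g0 module_hom_add[OF gm] module_hom_smult[OF gm] coordD(6,8,10)[OF c] qmod_hom_def)
qed

lemma matrix_qmod_bij:
  assumes S: "subfld S" and c: "coord S M n h" and d: "coord S N n k" and P: "P \<in> inv_mats S n"
  shows "bij_betw (\<lambda>x\<in>carrier M. cinv k N (P *\<^sub>v h x)) (carrier M) (carrier N)"
proof -
  obtain R where PR: "P \<in> mats S n n" "R \<in> mats S n n" "P * R = 1\<^sub>m n" "R * P = 1\<^sub>m n" using P by (auto simp: inv_mats_def)
  note Pc = mats_carrier[OF PR(1)] note Rc = mats_carrier[OF PR(2)]
  note f = matrix_coord_hom[OF S c d PR(1)] note g = matrix_coord_hom[OF S d c PR(2)]
  show ?thesis
  proof (rule bij_betw_byWitness[where f' = "\<lambda>x. cinv h M (R *\<^sub>v k x)"])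
    show "\<forall>x\<in>carrier M. cinv h M (R *\<^sub>v k ((\<lambda>x\<in>carrier M. cinv k N (P *\<^sub>v h x)) x)) = x"
    proof
      fix x assume x: "x \<in> carrier M"
      have "R *\<^sub>v (P *\<^sub>v h x) = h x"
        using assoc_mult_mat_vec[OF Rc Pc coordD(4)[OF c x]] PR(4) coordD(4)[OF c x] by simp
      then show "cinv h M (R *\<^sub>v k ((\<lambda>x\<in>carrier M. cinv k N (P *\<^sub>v h x)) x)) = x"
        using x f(2)[OF x] coord_cinv(3)[OF c x] by simp
    qed
    show "\<forall>x\<in>carrier N. (\<lambda>x\<in>carrier M. cinv k N (P *\<^sub>v h x)) (cinv h M (R *\<^sub>v k x)) = x"
    proof
      fix x assume x: "x \<in> carrier N"
      have "P *\<^sub>v (R *\<^sub>v k x) = k x"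
        using assoc_mult_mat_vec[OF Pc Rc coordD(4)[OF d x]] PR(3) coordD(4)[OF d x] by simp
      then show "(\<lambda>x\<in>carrier M. cinv k N (P *\<^sub>v h x)) (cinv h M (R *\<^sub>v k x)) = x"
        using g(2,3)[OF x] coord_cinv(3)[OF d x] by simp
    qed
  qed (use f(3) g(3) in auto)
qed

text \<open>Extension of scalars keeps the matrix, so the formal comparison concerns the same two
  matrices with a larger set of admissible \<open>P\<close>.\<close>

lemma isomorphic_base_change:
  fixes M N :: "'m qmod"
  assumes q: "norm q = 1" and M: "pres conv_fls q M n A h" and N: "pres conv_fls q N m B k"
  shows "isomorphic_in (Bq_hat q) (base_change q M) (base_change q N) \<longleftrightarrow>
    n = m \<and> (\<exists>P\<in>inv_mats UNIV n. P * A = B * sigm q P)"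
proof -
  obtain h' where h': "pres UNIV q (base_change q M) n A h'" using pres_base_change[OF q M] by blast
  obtain k' where k': "pres UNIV q (base_change q N) m B k'" using pres_base_change[OF q N] by blast
  show ?thesis using isomorphic_matrix[OF qfield_UNIV[OF q] h' k'] by (simp only: subfld_ring_UNIV)
qed

lemma isomorphic_conv:
  fixes M N :: "'m qmod"
  assumes q: "norm q = 1" and M: "pres conv_fls q M n A h" and N: "pres conv_fls q N m B k"
  shows "isomorphic_in (Bq q) M N \<longleftrightarrow> n = m \<and> (\<exists>P\<in>inv_mats conv_fls n. P * A = B * sigm q P)"
  using isomorphic_matrix[OF qfield_conv[OF q] M N] by (simp only: K_conv_eq)

lemma Bq_iso_f_obj: "M \<in> Obj (Bq_iso_f q) \<longleftrightarrow> q_difference_module K_conv q M \<and>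
    (\<forall>N. q_difference_module K_conv q N \<longrightarrow> isomorphic_in (Bq_hat q) (base_change q N) (base_change q M) \<longrightarrow>
       isomorphic_in (Bq q) N M) \<and> only_slope_zero q M"
  by (auto simp: Bq_iso_f_def Bq_iso_def full_subcategory_def qmod_category_def)

text \<open>Padding with zeros gives square matrices, for which a right inverse is also a left
  inverse; but the product in the other order has a zero at (n, n).\<close>

lemma right_inverse_dim_le:
  fixes P :: "'a :: field mat"
  assumes "P \<in> carrier_mat m n" "Q \<in> carrier_mat n m" "P * Q = 1\<^sub>m m"
  shows "m \<le> n"
proof (rule ccontr)
  assume "\<not> m \<le> n"
  then have nm: "n < m" by simp
  define P' where "P' = mat m m (\<lambda>(i, j). if j < n then P $$ (i, j) else 0)"
  define Q' where "Q' = mat m m (\<lambda>(i, j). if i < n then Q $$ (i, j) else 0)"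
  have c: "P' \<in> carrier_mat m m" "Q' \<in> carrier_mat m m" by (auto simp: P'_def Q'_def)
  have "P' * Q' = 1\<^sub>m m"
  proof (rule eq_matI)
    fix i j assume "i < dim_row (1\<^sub>m m :: 'a mat)" "j < dim_col (1\<^sub>m m :: 'a mat)"
    then have ij: "i < m" "j < m" by auto
    have "(P' * Q') $$ (i, j) = (\<Sum>l<m. P' $$ (i, l) * Q' $$ (l, j))" by (rule mat_mult_index[OF c ij])
    also have "\<dots> = (\<Sum>l<n. P $$ (i, l) * Q $$ (l, j))"
      by (rule sum.mono_neutral_cong_right) (use ij nm in \<open>auto simp: P'_def Q'_def\<close>)
    also have "\<dots> = (P * Q) $$ (i, j)" by (rule mat_mult_index[OF assms(1,2) ij, symmetric])
    finally show "(P' * Q') $$ (i, j) = 1\<^sub>m m $$ (i, j)" using assms(3) by simp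
  qed (use c in auto)
  then have "Q' * P' = 1\<^sub>m m" by (rule mat_mult_left_right_inverse[OF c])
  moreover have "(Q' * P') $$ (n, n) = (\<Sum>l<m. Q' $$ (n, l) * P' $$ (l, n))" by (rule mat_mult_index[OF c(2,1)]) (use nm in auto)
  ultimately show False using nm by (simp add: P'_def Q'_def)
qed

text \<open>A cyclic module with \<open>L = 0\<close> is the module of all operators, which is not finite-dimensional: the first \<open>n + 1\<close>
  coefficients would give a surjection from \<open>K\<^sup>n\<close> onto \<open>K\<^sup>n\<^sup>+\<^sup>1\<close>.\<close>

lemma cyclic_presentation_nonzero:
  assumes M: "q_difference_module K_conv q M" and g: "g \<in> qmod_hom K_conv M (cyclic_qmod q L)"
    and bij: "bij_betw g (carrier M) (carrier (cyclic_qmod q L))"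
  shows "L \<noteq> (\<lambda>i. 0)"
proof
  assume L0: "L = (\<lambda>i. 0)"
  have S: "subfld conv_fls" by (rule subfld_conv_fls)
  have vs: "vectorspace (subfld_ring conv_fls) M" "vectorspace.fin_dim (subfld_ring conv_fls) M"
    using M by (auto simp: q_difference_module_def K_conv_eq)
  obtain n h where c: "coord conv_fls M n h" using coord_exists[OF S vs] by blast
  let ?G = "qop_qmod q"
  have "(\<lambda>i. 0) \<in> qop_carrier" by (simp add: qop_carrier_def K_conv_eq subfld_zero[OF S])
  \<comment> \<open>The left ideal of 0 is 0, so all cosets are singletons and the quotient is the
    module of operators itself.\<close>
  then have H: "{qop_mult q P L | P. P \<in> qop_carrier} = {\<lambda>i. 0}" by (auto simp: L0 qop_mult_def)
  have coset: "{\<lambda>i. 0} +>\<^bsub>?G\<^esub> P = {P}" for P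
    by (auto simp: a_r_coset_def r_coset_def qop_qmod_def)
  have Q: "cyclic_qmod q L = qmod_quot ?G {\<lambda>i. 0}" by (simp only: cyclic_qmod_def H)
  have carr: "carrier (cyclic_qmod q L) = (\<lambda>P. {P}) ` qop_carrier"
    unfolding Q qmod_quot_def partial_object.select_convs A_RCOSETS_def RCOSETS_def
    using coset by (auto simp: a_r_coset_def qop_qmod_def)
  have addq: "{P} \<oplus>\<^bsub>cyclic_qmod q L\<^esub> {R} = {\<lambda>i. P i + R i}" for P R
    unfolding Q by (simp add: qmod_quot_def set_add_def set_mult_def qop_qmod_def)
  have smq: "a \<odot>\<^bsub>cyclic_qmod q L\<^esub> {P} = {\<lambda>i. a * P i}" for a P
    unfolding Q using coset by (simp add: qmod_quot_def qop_qmod_def)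
  define \<phi> where "\<phi> x = the_elem (g x)" for x
  have g\<phi>: "g x = {\<phi> x}" "\<phi> x \<in> qop_carrier" if "x \<in> carrier M" for x
  proof -
    have "g x \<in> (\<lambda>P. {P}) ` qop_carrier" using bij that carr by (metis bij_betw_apply)
    then obtain P where P: "P \<in> qop_carrier" "g x = {P}" by blast
    then have "\<phi> x = P" by (simp add: \<phi>_def)
    then show "g x = {\<phi> x}" "\<phi> x \<in> qop_carrier" using P by simp_all
  qed
  have gm: "g \<in> module_hom (subfld_ring conv_fls) M (cyclic_qmod q L)" using g by (simp add: qmod_hom_def K_conv_eq)
  have \<phi>add: "\<phi> (x \<oplus>\<^bsub>M\<^esub> y) = (\<lambda>i. \<phi> x i + \<phi> y i)" if "x \<in> carrier M" "y \<in> carrier M" for x y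
  proof -
    have "g (x \<oplus>\<^bsub>M\<^esub> y) = {\<lambda>i. \<phi> x i + \<phi> y i}"
      unfolding module_hom_add[OF gm that] g\<phi>(1)[OF that(1)] g\<phi>(1)[OF that(2)] by (rule addq)
    then show ?thesis by (simp only: \<phi>_def[of "x \<oplus>\<^bsub>M\<^esub> y"] the_elem_eq)
  qed
  have \<phi>sm: "\<phi> (a \<odot>\<^bsub>M\<^esub> x) = (\<lambda>i. a * \<phi> x i)" if "a \<in> conv_fls" "x \<in> carrier M" for a x
  proof -
    have "g (a \<odot>\<^bsub>M\<^esub> x) = {\<lambda>i. a * \<phi> x i}"
      using module_hom_smult[OF gm _ that(2), of a] that(1) unfolding g\<phi>(1)[OF that(2)] smq by simp
    then show ?thesis by (simp only: \<phi>_def[of "a \<odot>\<^bsub>M\<^esub> x"] the_elem_eq)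
  qed
  \<comment> \<open>The coefficients of index 0, ..., n of the operator that corresponds to the
    element with coordinates \<open>v\<close>.\<close>
  define T where "T v = vec (Suc n) (\<lambda>i. \<phi> (cinv h M v) (int i))" for v
  have cc: "cinv h M (v + w) = cinv h M v \<oplus>\<^bsub>M\<^esub> cinv h M w" if "v \<in> vecs conv_fls n" "w \<in> vecs conv_fls n" for v w
    using that by (intro coord_eqI[OF c]) (auto simp: coord_cinv[OF c] vecs_add[OF S] coordD(5,6)[OF c])
  have cs: "cinv h M (a \<cdot>\<^sub>v v) = a \<odot>\<^bsub>M\<^esub> cinv h M v" if "a \<in> conv_fls" "v \<in> vecs conv_fls n" for a v
    using that by (intro coord_eqI[OF c]) (auto simp: coord_cinv[OF c] vecs_smult[OF S] coordD(7,8)[OF c])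
  have "\<exists>P\<in>mats conv_fls (Suc n) n. \<forall>v\<in>vecs conv_fls n. T v = P *\<^sub>v v"
  proof (rule linear_vecs_matrix[OF S])
    fix v assume "v \<in> vecs conv_fls n"
    then have "\<phi> (cinv h M v) \<in> qop_carrier" by (intro g\<phi> coord_cinv[OF c])
    then show "T v \<in> vecs conv_fls (Suc n)" by (auto simp: T_def vecs_def qop_carrier_def K_conv_eq)
  next
    fix v w assume "v \<in> vecs conv_fls n" "w \<in> vecs conv_fls n"
    then show "T (v + w) = T v + T w" by (auto simp: T_def cc \<phi>add coord_cinv[OF c])
  next
    fix a v assume "a \<in> conv_fls" "v \<in> vecs conv_fls n"
    then show "T (a \<cdot>\<^sub>v v) = a \<cdot>\<^sub>v T v" by (auto simp: T_def cs \<phi>sm coord_cinv[OF c])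
  qed
  then obtain P where P: "P \<in> mats conv_fls (Suc n) n" "\<forall>v\<in>vecs conv_fls n. T v = P *\<^sub>v v" by blast
  have "\<exists>v\<in>vecs conv_fls n. T v = unit_vec (Suc n) j" for j
  proof -
    define R :: "int \<Rightarrow> complex fls" where "R i = (if i = int j \<and> j < Suc n then 1 else 0)" for i
    have "{i. R i \<noteq> 0} \<subseteq> {int j}" by (auto simp: R_def)
    then have "R \<in> qop_carrier"
      using subfld_zero[OF S] subfld_one[OF S] by (auto simp: qop_carrier_def K_conv_eq R_def intro: finite_subset)
    then have "{R} \<in> g ` carrier M" using bij carr by (auto simp: bij_betw_def)
    then obtain x where x: "x \<in> carrier M" "g x = {R}" by auto
    then have "\<phi> x = R" by (simp add: \<phi>_def)
    then have "T (h x) = unit_vec (Suc n) j"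
      using coord_cinv(3)[OF c x(1)] by (intro eq_vecI) (auto simp: T_def R_def unit_vec_def)
    then show ?thesis using coordD(3)[OF c x(1)] by blast
  qed
  then obtain w where w: "\<And>j. w j \<in> vecs conv_fls n" "\<And>j. T (w j) = unit_vec (Suc n) j" by metis
  define Qm where "Qm = mat n (Suc n) (\<lambda>(i, j). w j $ i)"
  note Pc = mats_carrier[OF P(1)]
  have "P * Qm = 1\<^sub>m (Suc n)"
  proof (rule eq_matI)
    fix i j assume "i < dim_row (1\<^sub>m (Suc n) :: complex fls mat)" "j < dim_col (1\<^sub>m (Suc n) :: complex fls mat)"
    then have ij: "i < Suc n" "j < Suc n" by auto
    have "col Qm j = w j" using ij vecs_dim[OF w(1), of j] by (intro eq_vecI) (auto simp: Qm_def)
    then have "(P * Qm) $$ (i, j) = (P *\<^sub>v w j) $ i" using ij Pc by (simp add: Qm_def)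
    also have "P *\<^sub>v w j = unit_vec (Suc n) j" using P(2) w by metis
    finally show "(P * Qm) $$ (i, j) = 1\<^sub>m (Suc n) $$ (i, j)" using ij by (simp add: unit_vec_def)
  qed (use Pc in \<open>auto simp: Qm_def\<close>)
  then show False using right_inverse_dim_le[OF Pc, of Qm] by (simp add: Qm_def)
qed

section \<open>Isoformal modules of slope zero and their normal forms\<close>

context small_q
begin

text \<open>A module formally isomorphic to \<open>M\<close> has a formal gauge transformation to
  \<open>A\<close>, which converges by \<open>formal_gauge_converges\<close>. The slope is read off
  the operator of \<open>normal_form_cyclic\<close>.\<close>

lemma Bq_iso_f_if_normal_form:
  fixes M :: "'m qmod"
  assumes A: "normal_form q n A" "cond q n A" and M: "pres conv_fls q M n (cmat A) h"
  shows "M \<in> Obj (Bq_iso_f q)"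
  unfolding Bq_iso_f_obj
proof (intro conjI allI impI)
  have Q: "qfield q conv_fls" by (rule qfield_conv[OF norm_q])
  have S: "subfld conv_fls" by (rule subfld_conv_fls)
  show MK: "q_difference_module K_conv q M" using pres_qmod[OF Q M] by (simp add: K_conv_eq)
  fix N :: "'m qmod"
  assume N: "q_difference_module K_conv q N" and iso: "isomorphic_in (Bq_hat q) (base_change q N) (base_change q M)"
  obtain m B k where B: "pres conv_fls q N m B k" using pres_exists[OF Q, of N] N by (auto simp: K_conv_eq)
  have BI: "B \<in> inv_mats conv_fls m" using B by (simp add: pres_def)
  from iso obtain F where F: "m = n" "F \<in> inv_mats UNIV m" "F * B = cmat A * sigm q F"
    using isomorphic_base_change[OF norm_q B M] by auto
  then have "F \<in> inv_mats conv_fls n" using formal_gauge_converges[OF A] BI by simp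
  then show "isomorphic_in (Bq q) N M" using isomorphic_conv[OF norm_q B M] F by blast
next
  have Q: "qfield q conv_fls" by (rule qfield_conv[OF norm_q])
  have S: "subfld conv_fls" by (rule subfld_conv_fls)
  have c: "coord conv_fls M n h" using M by (simp add: pres_def)
  obtain L P where L: "L \<in> qop_carrier" "\<And>i. fls_subdegree (L i) \<ge> 0" "\<And>i. i \<notin> {0..int n} \<Longrightarrow> L i = 0"
    "L 0 \<noteq> 0" "fls_subdegree (L 0) = 0" "L (int n) = 1"
    and P: "P \<in> inv_mats conv_fls n" "P * companion n L = cmat A * sigm q P"
    using normal_form_cyclic[OF A(1)] by blast
  have "\<exists>k. pres conv_fls q (cyclic_qmod q L) n (companion n L) k"
    by (rule pres_cyclic[OF norm_q L(1,4)]) (use L(3,6) in auto)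
  then obtain k where k: "pres conv_fls q (cyclic_qmod q L) n (companion n L) k" by blast
  then have d: "coord conv_fls (cyclic_qmod q L) n k" and compI: "companion n L \<in> inv_mats conv_fls n" by (auto simp: pres_def)
  obtain R where PR: "P \<in> mats conv_fls n n" "R \<in> mats conv_fls n n" "P * R = 1\<^sub>m n" "R * P = 1\<^sub>m n"
    using P(1) by (auto simp: inv_mats_def)
  have Ac: "cmat A \<in> carrier_mat n n" using A(1) by (simp add: normal_form_def)
  have R: "R * cmat A = companion n L * sigm q R" "R \<in> inv_mats conv_fls n"
    using inverse_intertwine[OF q_nz mats_carrier[OF PR(1)] mats_carrier[OF PR(2)] PR(3,4) inv_mats_carrier[OF compI] Ac P(2)] PR
    by (auto simp: inv_mats_def)
  have "finite_slopes (newton_polygon L) \<subseteq> {0}"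
    by (rule zero_slope_if_subdegrees[of L n]) (use L in auto)
  moreover have "cyclic_presentation q M L"
    unfolding cyclic_presentation_def
  proof (intro conjI allI impI bexI)
    show "bij_betw (\<lambda>x\<in>carrier M. cinv k (cyclic_qmod q L) (R *\<^sub>v h x)) (carrier M) (carrier (cyclic_qmod q L))"
      by (rule matrix_qmod_bij[OF S c d R(2)])
    show "(\<lambda>x\<in>carrier M. cinv k (cyclic_qmod q L) (R *\<^sub>v h x)) \<in> qmod_hom K_conv M (cyclic_qmod q L)"
      using matrix_qmod_hom[OF Q M k PR(2) R(1)] by (simp add: K_conv_eq)
    show "L i = 0" if "i \<notin> {0..int (vectorspace.dim K_conv M)}" for i
      using that L(3) coord_fin_dim(2)[OF S c] by (simp add: K_conv_eq)
  qed (rule L)+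
  ultimately show "only_slope_zero q M" unfolding only_slope_zero_def by blast
qed

text \<open>Slope zero yields a matrix invertible at 0, hence a formal normal form \<open>A\<close>.
  Isoformality of \<open>M\<close> is then used twice: for a module with matrix \<open>A\<close>,
  which makes the reduction itself convergent, and for the perturbations of \<open>A\<close>, which
  yields \<open>cond\<close>.\<close>

lemma normal_form_if_Bq_iso_f:
  fixes M :: "'m qmod"
  assumes M: "M \<in> Obj (Bq_iso_f q)" and e: "\<exists>e :: (nat \<Rightarrow> complex fls) \<Rightarrow> 'm. inj e"
  shows "\<exists>n A h. normal_form q n A \<and> cond q n A \<and> pres conv_fls q M n (cmat A) h"
proof -
  have Q: "qfield q conv_fls" by (rule qfield_conv[OF norm_q])
  have S: "subfld conv_fls" by (rule subfld_conv_fls)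
  have MK: "q_difference_module (subfld_ring conv_fls) q M"
    and iso: "\<And>N. q_difference_module K_conv q N \<Longrightarrow> isomorphic_in (Bq_hat q) (base_change q N) (base_change q M) \<Longrightarrow>
       isomorphic_in (Bq q) N M"
    and slope: "only_slope_zero q M"
    using M by (auto simp: Bq_iso_f_obj K_conv_eq)
  define n where "n = vectorspace.dim K_conv M"
  obtain L g where L: "L \<in> qop_carrier" "\<And>i. fls_subdegree (L i) \<ge> 0" "\<And>i. i \<notin> {0..int n} \<Longrightarrow> L i = 0"
    and g: "g \<in> qmod_hom K_conv M (cyclic_qmod q L)" "bij_betw g (carrier M) (carrier (cyclic_qmod q L))"
    and sl: "finite_slopes (newton_polygon L) \<subseteq> {0}"
    using slope by (auto simp: only_slope_zero_def cyclic_presentation_def n_def)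
  have Lne: "L \<noteq> (\<lambda>i. 0)" using cyclic_presentation_nonzero[OF _ g] MK by (simp add: K_conv_eq)
  let ?I = "{i. L i \<noteq> 0}"
  have I: "finite ?I" "?I \<noteq> {}" "?I \<subseteq> {0..int n}" using L(1,3) Lne by (auto simp: qop_carrier_def)
  define a where "a = Min ?I"
  define b where "b = Max ?I"
  have a: "L a \<noteq> 0" and b: "L b \<noteq> 0" using Min_in[OF I(1,2)] Max_in[OF I(1,2)] by (auto simp: a_def b_def)
  have ab: "a \<le> i \<and> i \<le> b" if "L i \<noteq> 0" for i using Min_le[OF I(1)] Max_ge[OF I(1)] that by (auto simp: a_def b_def)
  have ab0: "0 \<le> a" "b \<le> int n" "a \<le> b" using a b I(3) ab by auto
  \<comment> \<open>A presentation does not say that the coefficients of index 0 and n are nonzero.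
    After removal of the lowest power of \<open>\<sigma>\<^sub>q\<close> the quotient has dimension
    b - a. As this dimension is n and both indices lie between 0 and n, it follows that a = 0 and b
    = n.\<close>
  define m where "m = nat (b - a)"
  define L' where "L' = twist q (- a) L"
  have qa: "norm (q powi (- a)) = 1" by (rule norm_powi)
  have L'0: "L' i = 0 \<longleftrightarrow> L (i + a) = 0" for i
    using sigma_q_inverse(2)[of "q powi (- a)" "L (i + a)"] q_nz by (auto simp: L'_def twist_def)
  have L'Q: "L' \<in> qop_carrier"
  proof -
    have "{i. L' i \<noteq> 0} \<subseteq> (\<lambda>i. i - a) ` ?I"
    proof
      fix i assume "i \<in> {i. L' i \<noteq> 0}"
      then show "i \<in> (\<lambda>i. i - a) ` ?I" using image_eqI[of i "\<lambda>i. i - a" "i + a"] by (simp add: L'0)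
    qed
    then have "finite {i. L' i \<noteq> 0}" using I(1) by (auto intro: finite_subset)
    moreover have "L' i \<in> conv_fls" for i
      using sigma_q_conv_fls[OF qa] L(1) by (simp add: L'_def twist_def qop_carrier_def K_conv_eq)
    ultimately show ?thesis by (simp add: qop_carrier_def K_conv_eq)
  qed
  have "\<exists>k. pres conv_fls q (cyclic_qmod q L') m (companion m L') k"
  proof (rule pres_cyclic[OF norm_q L'Q])
    show "L' 0 \<noteq> 0" "L' (int m) \<noteq> 0" using a b ab0 by (auto simp: L'0 m_def)
    show "L' i = 0" if "i \<notin> {0..int m}" for i
    proof (rule ccontr)
      assume "L' i \<noteq> 0"
      then show False using that ab[of "i + a"] ab0 by (simp add: L'0 m_def)
    qed
  qed
  moreover have "cyclic_qmod q L' = cyclic_qmod q L" unfolding L'_def by (rule cyclic_qmod_shift[OF q_nz])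
  ultimately obtain k where k: "pres conv_fls q (cyclic_qmod q L) m (companion m L') k" by auto
  have Mm: "pres conv_fls q M m (companion m L') (\<lambda>x. k (g x))"
    by (rule pres_transport[OF Q k MK]) (use g in \<open>auto simp: K_conv_eq\<close>)
  then have "coord conv_fls M m (\<lambda>x. k (g x))" by (simp add: pres_def)
  then have mn: "m = n" using coord_fin_dim(2)[OF S, of M m "\<lambda>x. k (g x)"] by (simp add: n_def K_conv_eq)
  then have ab': "a = 0" "b = int n" using ab0 by (auto simp: m_def)
  have L'L: "L' = L" by (auto simp: L'_def ab' twist_def fun_eq_iff sigma_q_nth intro!: fls_eqI)
  have Mn: "pres conv_fls q M n (companion n L) (\<lambda>x. k (g x))" using Mm by (simp add: mn L'L)
  have L0n: "L 0 \<noteq> 0" "L (int n) \<noteq> 0" using a b ab' by auto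
  obtain C where C: "C \<in> carrier_mat n n" "companion n L = fmat C" "det (map_mat (\<lambda>f. fps_nth f 0) C) \<noteq> 0"
    using companion_regular[OF L0n only_zero_slope_subdegrees(2)[OF L0n L(3) sl] only_zero_slope_subdegrees(1)[OF L0n L(3) sl]]
    by blast
  obtain A P where A: "normal_form q n A" and P: "P \<in> inv_mats UNIV n" "P * cmat A = fmat C * sigm q P"
    using formal_normal_form[OF C(1,3)] by blast
  have AI: "cmat A \<in> inv_mats conv_fls n" by (rule normal_form_cmat_inv[OF A])
  \<comment> \<open>Isoformality in terms of matrices: a formal gauge transformation to a matrix of
    \<open>M\<close> can be replaced by a convergent one. The module \<open>N\<close> is a copy
    inside the type of \<open>M\<close>.\<close>
  have realize: "\<exists>T\<in>inv_mats conv_fls n. T * B = D * sigm q T"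
    if B: "B \<in> inv_mats conv_fls n" and F: "F \<in> inv_mats UNIV n" "F * B = D * sigm q F" and MD: "pres conv_fls q M n D h"
    for B F D h
  proof -
    obtain N :: "'m qmod" and l where N: "pres conv_fls q N n B l" using pres_copy_exists[OF Q B e] by blast
    have "isomorphic_in (Bq_hat q) (base_change q N) (base_change q M)"
      using isomorphic_base_change[OF norm_q N MD] F by blast
    then have "isomorphic_in (Bq q) N M" using iso pres_qmod[OF Q N] by (simp add: K_conv_eq)
    then show ?thesis using isomorphic_conv[OF norm_q N MD] by blast
  qed
  obtain T where T: "T \<in> inv_mats conv_fls n" "T * cmat A = companion n L * sigm q T"
    using realize[OF AI P(1) _ Mn] P(2) C(2) by auto
  obtain R where TR: "T \<in> mats conv_fls n n" "R \<in> mats conv_fls n n" "T * R = 1\<^sub>m n" "R * T = 1\<^sub>m n"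
    using T(1) by (auto simp: inv_mats_def)
  have compc: "companion n L \<in> carrier_mat n n" by (simp add: companion_def)
  have R: "R * companion n L = cmat A * sigm q R" "R \<in> inv_mats conv_fls n"
    using inverse_intertwine[OF q_nz mats_carrier[OF TR(1)] mats_carrier[OF TR(2)] TR(3,4) inv_mats_carrier[OF AI] compc T(2)] TR
    by (auto simp: inv_mats_def)
  have MA: "pres conv_fls q M n (cmat A) (\<lambda>x. R *\<^sub>v k (g x))" by (rule pres_change[OF Q Mn AI R(2,1)])
  have "cond q n A"
    by (rule cond_if_formal_gauges_converge[OF A]) (rule realize[OF _ _ _ MA])
  then show ?thesis using A MA by blast
qed

text \<open>Matrices of morphisms are constant by \<open>formal_hom_const\<close>, and on constant
  matrices \<open>sigma_q\<close> acts trivially, so the intertwining relation becomes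
  \<open>P * A = B * P\<close>.\<close>

lemma qmod_hom_normal_form:
  assumes A: "normal_form q n A" and B: "normal_form q m B"
    and M: "pres conv_fls q M n (cmat A) h" and N: "pres conv_fls q N m (cmat B) k"
  shows "f \<in> qmod_hom K_conv M N \<Longrightarrow> \<exists>P\<in>nf_hom (n, A) (m, B). \<forall>x\<in>carrier M. k (f x) = cmat P *\<^sub>v h x"
    "P \<in> nf_hom (n, A) (m, B) \<Longrightarrow> \<exists>f\<in>qmod_hom K_conv M N. \<forall>x\<in>carrier M. k (f x) = cmat P *\<^sub>v h x"
proof -
  have Q: "qfield q conv_fls" by (rule qfield_conv[OF norm_q])
  have Ac: "A \<in> carrier_mat n n" and Bc: "B \<in> carrier_mat m m" using A B by (auto simp: normal_form_def)
  have c: "coord conv_fls M n h" "coord conv_fls N m k" using M N by (auto simp: pres_def)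
  {
    assume "f \<in> qmod_hom K_conv M N"
    then obtain P where P: "P \<in> mats conv_fls m n" "P * cmat A = cmat B * sigm q P" "\<forall>x\<in>carrier M. k (f x) = P *\<^sub>v h x"
      using qmod_hom_matrix[OF Q M N] by (auto simp: K_conv_eq)
    obtain P0 where "P0 \<in> carrier_mat m n" "P = cmat P0" "P0 * A = B * P0"
      "\<forall>i<m. \<forall>j<n. P0 $$ (i, j) \<noteq> 0 \<longrightarrow> B $$ (i, i) = A $$ (j, j)"
      using formal_hom_const[OF A B mats_carrier[OF P(1)] P(2)] by blast
    then show "\<exists>P\<in>nf_hom (n, A) (m, B). \<forall>x\<in>carrier M. k (f x) = cmat P *\<^sub>v h x"
      using P(3) by (intro bexI[of _ P0]) (auto simp: nf_hom_def)
  next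
    assume P: "P \<in> nf_hom (n, A) (m, B)"
    then have Pc: "P \<in> carrier_mat m n" and eq: "P * A = B * P" by (auto simp: nf_hom_def)
    have "cmat P * cmat A = cmat B * sigm q (cmat P)"
      using cmat_mult[OF Pc Ac] cmat_mult[OF Bc Pc] eq sigm_cmat[OF q_nz, of P] by simp
    from matrix_qmod_hom[OF Q M N cmat_mats[OF Pc] this]
    show "\<exists>f\<in>qmod_hom K_conv M N. \<forall>x\<in>carrier M. k (f x) = cmat P *\<^sub>v h x"
      using matrix_coord_hom(2)[OF subfld_conv_fls c cmat_mats[OF Pc]]
      by (intro bexI[of _ "\<lambda>x\<in>carrier M. cinv k N (cmat P *\<^sub>v h x)"]) (auto simp: K_conv_eq)
  }
qed

end

lemma cmat_inj: "P \<in> carrier_mat m n \<Longrightarrow> Q \<in> carrier_mat m n \<Longrightarrow> cmat P = cmat Q \<Longrightarrow> P = Q"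
proof (rule eq_matI)
  fix i j assume P: "P \<in> carrier_mat m n" "Q \<in> carrier_mat m n" "cmat P = cmat Q" "i < dim_row Q" "j < dim_col Q"
  have "fls_nth (cmat P $$ (i, j)) 0 = fls_nth (cmat Q $$ (i, j)) 0" unfolding P(3) ..
  then show "P $$ (i, j) = Q $$ (i, j)" using P(1,2,4,5) by simp
qed auto

text \<open>Both categories of the theorem consist of vector spaces with coordinate maps in which the morphisms are
  exactly the maps given by the morphisms of normal forms; \<open>T\<close> embeds complex matrices into those over the base field.\<close>

lemma functor_to_normal_forms:
  fixes C :: "(('a::field, 'm, 'z) module_scheme, 'm \<Rightarrow> 'm) cat" and T :: "complex mat \<Rightarrow> 'a mat"
  assumes C: "is_category C" and S: "subfld S"
    and id: "\<And>M. Ident C M = (\<lambda>m\<in>carrier M. m)"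
    and comp: "\<And>L M N g f. Comp C L M N g f = compose (carrier L) g f"
    and hom: "\<And>M N f. f \<in> Hom C M N \<Longrightarrow> f \<in> extensional (carrier M) \<and> f \<in> carrier M \<rightarrow> carrier N"
    and Tc: "\<And>P m n. P \<in> carrier_mat m n \<Longrightarrow> T P \<in> carrier_mat m n"
    and T_inj: "\<And>P Q m n. P \<in> carrier_mat m n \<Longrightarrow> Q \<in> carrier_mat m n \<Longrightarrow> T P = T Q \<Longrightarrow> P = Q"
    and T_one: "\<And>n. T (1\<^sub>m n) = 1\<^sub>m n"
    and T_mult: "\<And>P Q l m n. P \<in> carrier_mat l m \<Longrightarrow> Q \<in> carrier_mat m n \<Longrightarrow> T (P * Q) = T P * T Q"
    and co: "\<And>M X h. pr M X h \<Longrightarrow> coord S M (fst X) h"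
    and ex: "\<And>M. M \<in> Obj C \<Longrightarrow> \<exists>X\<in>Obj (nf_category q). \<exists>h. pr M X h"
    and copy: "\<And>X. X \<in> Obj (nf_category q) \<Longrightarrow> \<exists>M\<in>Obj C. \<exists>h. pr M X h"
    and mat: "\<And>M X h N Y k f. X \<in> Obj (nf_category q) \<Longrightarrow> Y \<in> Obj (nf_category q) \<Longrightarrow> pr M X h \<Longrightarrow> pr N Y k \<Longrightarrow>
      f \<in> Hom C M N \<Longrightarrow> \<exists>P\<in>nf_hom X Y. \<forall>x\<in>carrier M. k (f x) = T P *\<^sub>v h x"
    and tam: "\<And>M X h N Y k P. X \<in> Obj (nf_category q) \<Longrightarrow> Y \<in> Obj (nf_category q) \<Longrightarrow> pr M X h \<Longrightarrow> pr N Y k \<Longrightarrow>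
      P \<in> nf_hom X Y \<Longrightarrow> \<exists>f\<in>Hom C M N. \<forall>x\<in>carrier M. k (f x) = T P *\<^sub>v h x"
  shows "\<exists>Uo Ua. fully_faithful C (nf_category q) Uo Ua \<and> ess_surj C (nf_category q) Uo"
proof -
  let ?S = "nf_category q"
  have HomS: "Hom ?S = nf_hom" by (simp add: nf_category_def)
  have "\<forall>M\<in>Obj C. \<exists>X h. X \<in> Obj ?S \<and> pr M X h" using ex by blast
  then obtain s h where sh: "\<And>M. M \<in> Obj C \<Longrightarrow> s M \<in> Obj ?S \<and> pr M (s M) (h M)" by metis
  have sO: "s M \<in> Obj ?S" and pM: "pr M (s M) (h M)" if "M \<in> Obj C" for M using sh[OF that] by auto
  have cM: "coord S M (fst (s M)) (h M)" if "M \<in> Obj C" for M by (rule co[OF pM[OF that]])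
  have Pc: "P \<in> carrier_mat (fst Y) (fst X)" if "P \<in> nf_hom X Y" for P X Y using that by (simp add: nf_hom_def)
  define R where "R M N f P \<longleftrightarrow> (\<forall>x\<in>carrier M. h N (f x) = T P *\<^sub>v h M x)" for M N f P
  have fM: "f x \<in> carrier N" if "f \<in> Hom C M N" "x \<in> carrier M" for M N f x
    using hom[OF that(1)] that(2) by auto
  have "\<exists>Ua. fully_faithful C ?S s Ua"
  proof (rule functor_from_relation[OF C is_category_nf, where R = R])
    fix M N f assume M: "M \<in> Obj C" and N: "N \<in> Obj C" and f: "f \<in> Hom C M N"
    show "\<exists>P\<in>Hom ?S (s M) (s N). R M N f P"
      using mat[OF sO[OF M] sO[OF N] pM[OF M] pM[OF N] f] by (simp add: R_def HomS)
    show "P = P'" if P: "P \<in> Hom ?S (s M) (s N)" "P' \<in> Hom ?S (s M) (s N)" "R M N f P" "R M N f P'" for P P'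
    proof (rule T_inj)
      show Pc': "P \<in> carrier_mat (fst (s N)) (fst (s M))" "P' \<in> carrier_mat (fst (s N)) (fst (s M))"
        using P(1,2) by (auto simp: HomS intro: Pc)
      show "T P = T P'"
      proof (rule mats_eqI[OF S Tc[OF Pc'(1)] Tc[OF Pc'(2)]])
        fix v assume v: "v \<in> vecs S (fst (s M))"
        then show "T P *\<^sub>v v = T P' *\<^sub>v v"
          using P(3,4) coord_cinv(1,2)[OF cM[OF M] v] unfolding R_def by metis
      qed
    qed
    show "f = g" if g: "g \<in> Hom C M N" and P: "R M N f P" "R M N g P" for g P
    proof
      fix x
      show "f x = g x"
      proof (cases "x \<in> carrier M")
        case True
        then show ?thesis using P coord_eqI[OF cM[OF N] fM[OF f True] fM[OF g True]] by (simp add: R_def)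
      next
        case False
        then show ?thesis using hom[OF f] hom[OF g] by (simp add: extensional_def)
      qed
    qed
  next
    fix M N P assume M: "M \<in> Obj C" and N: "N \<in> Obj C" and P: "P \<in> Hom ?S (s M) (s N)"
    then show "\<exists>f\<in>Hom C M N. R M N f P"
      using tam[OF sO[OF M] sO[OF N] pM[OF M] pM[OF N]] by (simp add: R_def HomS)
  next
    fix M assume M: "M \<in> Obj C"
    show "R M M (Ident C M) (Ident ?S (s M))"
      using coordD(4)[OF cM[OF M]] by (simp add: R_def id nf_category_def T_one)
  next
    fix L M N f g P P' assume L: "L \<in> Obj C" and M: "M \<in> Obj C" and N: "N \<in> Obj C" and f: "f \<in> Hom C L M" and g: "g \<in> Hom C M N"
      and P: "P \<in> Hom ?S (s L) (s M)" "P' \<in> Hom ?S (s M) (s N)" and R: "R L M f P" "R M N g P'"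
    note c = Pc[OF P(1)[unfolded HomS]] Pc[OF P(2)[unfolded HomS]]
    show "R L N (Comp C L M N g f) (Comp ?S (s L) (s M) (s N) P' P)"
      unfolding R_def
    proof
      fix x assume x: "x \<in> carrier L"
      have "h N (g (f x)) = T P' *\<^sub>v (T P *\<^sub>v h L x)"
        using R x fM[OF f x] by (simp add: R_def)
      also have "\<dots> = T P' * T P *\<^sub>v h L x"
        by (rule assoc_mult_mat_vec[OF Tc[OF c(2)] Tc[OF c(1)] coordD(4)[OF cM[OF L] x], symmetric])
      finally show "h N (Comp C L M N g f x) = T (Comp ?S (s L) (s M) (s N) P' P) *\<^sub>v h L x"
        using x T_mult[OF c(2,1)] by (simp add: comp compose_def nf_category_def)
    qed
  qed (use sO in auto)
  moreover have "ess_surj C ?S s"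
    unfolding ess_surj_def
  proof
    fix X assume X: "X \<in> Obj ?S"
    obtain M k where MO: "M \<in> Obj C" and k: "pr M X k" using copy[OF X] by blast
    note kc = co[OF k]
    \<comment> \<open>The identity of \<open>M\<close>, read in the coordinates chosen for
      \<open>M\<close> and in those of the copy of \<open>X\<close>, gives two mutually inverse
      changes of basis.\<close>
    have iM: "(\<lambda>m\<in>carrier M. m) \<in> Hom C M M" using cat_ident[OF C MO] by (simp add: id)
    obtain P where P: "P \<in> nf_hom (s M) X" "\<And>x. x \<in> carrier M \<Longrightarrow> k x = T P *\<^sub>v h M x"
      using mat[OF sO[OF MO] X pM[OF MO] k iM] by auto
    obtain P' where P': "P' \<in> nf_hom X (s M)" "\<And>x. x \<in> carrier M \<Longrightarrow> h M x = T P' *\<^sub>v k x"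
      using mat[OF X sO[OF MO] k pM[OF MO] iM] by auto
    have inv: "Q * Q' = 1\<^sub>m n"
      if d: "coord S M n l" and Q: "Q \<in> carrier_mat n m" "\<And>x. x \<in> carrier M \<Longrightarrow> l x = T Q *\<^sub>v l' x"
        and Q': "Q' \<in> carrier_mat m n" "\<And>x. x \<in> carrier M \<Longrightarrow> l' x = T Q' *\<^sub>v l x" for n m l l' Q Q'
    proof (rule T_inj)
      show QQ: "Q * Q' \<in> carrier_mat n n" using Q(1) Q'(1) by simp
      show "T (Q * Q') = T (1\<^sub>m n)"
        unfolding T_one
      proof (rule mats_eqI[OF S Tc[OF QQ]])
        fix v assume v: "v \<in> vecs S n"
        obtain x where x: "x \<in> carrier M" "l x = v" using coord_cinv(1,2)[OF d v] by blast
        have "T (Q * Q') *\<^sub>v v = T Q *\<^sub>v (T Q' *\<^sub>v v)"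
          unfolding T_mult[OF Q(1) Q'(1)] by (rule assoc_mult_mat_vec[OF Tc[OF Q(1)] Tc[OF Q'(1)] vecs_carrier[OF v]])
        also have "\<dots> = v" using Q(2)[OF x(1)] Q'(2)[OF x(1)] x(2) by simp
        finally show "T (Q * Q') *\<^sub>v v = 1\<^sub>m n *\<^sub>v v" using vecs_carrier[OF v] by simp
      qed auto
    qed auto
    have "P * P' = 1\<^sub>m (fst X)" by (rule inv[OF kc Pc[OF P(1)] P(2) Pc[OF P'(1)] P'(2)])
    moreover have "P' * P = 1\<^sub>m (fst (s M))" by (rule inv[OF cM[OF MO] Pc[OF P'(1)] P'(2) Pc[OF P(1)] P(2)])
    ultimately have "is_iso ?S (s M) X P"
      using P(1) P'(1) by (auto simp: is_iso_def nf_category_def)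
    then show "\<exists>M\<in>Obj C. \<exists>i. is_iso ?S (s M) X i" using MO by blast
  qed
  ultimately show ?thesis by blast
qed

lemma (in small_q) Bq_iso_f_functor:
  assumes e: "\<exists>e :: (nat \<Rightarrow> complex fls) \<Rightarrow> 'm. inj e"
  shows "\<exists>Uo Ua. fully_faithful (Bq_iso_f q :: ('m qmod, 'm \<Rightarrow> 'm) cat) (nf_category q) Uo Ua \<and>
    ess_surj (Bq_iso_f q :: ('m qmod, 'm \<Rightarrow> 'm) cat) (nf_category q) Uo"
proof (rule functor_to_normal_forms[OF _ subfld_conv_fls, where T = cmat and
      pr = "\<lambda>M X h. pres conv_fls q M (fst X) (cmat (snd X)) h"])
  let ?C = "Bq_iso_f q :: ('m qmod, 'm \<Rightarrow> 'm) cat"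
  have HomC: "Hom ?C = qmod_hom K_conv" "Ident ?C = (\<lambda>M. \<lambda>m\<in>carrier M. m)"
    "Comp ?C = (\<lambda>L M N g f. compose (carrier L) g f)"
    by (auto simp: Bq_iso_f_def Bq_iso_def full_subcategory_def qmod_category_def)
  show "is_category ?C"
    unfolding Bq_iso_f_def Bq_iso_def by (intro full_subcategory_category is_category_qmod)
  show "Ident ?C M = (\<lambda>m\<in>carrier M. m)" "Comp ?C L M N g f = compose (carrier L) g f" for L M N f g
    by (simp_all add: HomC)
  show "f \<in> extensional (carrier M) \<and> f \<in> carrier M \<rightarrow> carrier N" if "f \<in> Hom ?C M N" for M N f
    using that by (auto simp: HomC qmod_hom_def module_hom_def)
  show "coord conv_fls M (fst X) h" if "pres conv_fls q M (fst X) (cmat (snd X)) h" for M :: "'m qmod" and X h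
    using that by (simp add: pres_def)
  have nf: "normal_form q (fst X) (snd X)" "cond q (fst X) (snd X)" if "X \<in> Obj (nf_category q)" for X
    using that by (auto simp: nf_category_def)
  show "\<exists>X\<in>Obj (nf_category q). \<exists>h. pres conv_fls q M (fst X) (cmat (snd X)) h" if M: "M \<in> Obj ?C" for M
  proof -
    obtain n A h where "normal_form q n A \<and> cond q n A \<and> pres conv_fls q M n (cmat A) h"
      using normal_form_if_Bq_iso_f[OF M e] by blast
    then show ?thesis by (intro bexI[of _ "(n, A)"]) (auto simp: nf_category_def)
  qed
  show "\<exists>M\<in>Obj ?C. \<exists>h. pres conv_fls q M (fst X) (cmat (snd X)) h" if X: "X \<in> Obj (nf_category q)" for X
  proof -
    obtain M :: "'m qmod" and k where M: "pres conv_fls q M (fst X) (cmat (snd X)) k"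
      using pres_copy_exists[OF qfield_conv[OF norm_q] normal_form_cmat_inv[OF nf(1)[OF X]] e] by blast
    then show ?thesis using Bq_iso_f_if_normal_form[OF nf[OF X] M] by blast
  qed
  show "\<exists>P\<in>nf_hom X Y. \<forall>x\<in>carrier M. k (f x) = cmat P *\<^sub>v h x"
    if "X \<in> Obj (nf_category q)" "Y \<in> Obj (nf_category q)" "pres conv_fls q M (fst X) (cmat (snd X)) h"
      "pres conv_fls q N (fst Y) (cmat (snd Y)) k" "f \<in> Hom ?C M N" for X Y M N h k f
    using qmod_hom_normal_form(1)[OF nf(1)[OF that(1)] nf(1)[OF that(2)] that(3,4)] that(5) by (simp add: HomC)
  show "\<exists>f\<in>Hom ?C M N. \<forall>x\<in>carrier M. k (f x) = cmat P *\<^sub>v h x"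
    if "X \<in> Obj (nf_category q)" "Y \<in> Obj (nf_category q)" "pres conv_fls q M (fst X) (cmat (snd X)) h"
      "pres conv_fls q N (fst Y) (cmat (snd Y)) k" "P \<in> nf_hom X Y" for X Y M N h k P
    using qmod_hom_normal_form(2)[OF nf(1)[OF that(1)] nf(1)[OF that(2)] that(3,4)] that(5) by (simp add: HomC)
qed (auto simp: cmat_one intro: cmat_inj cmat_mult)

section \<open>Graded vector spaces with nilpotent operators\<close>

lemma mat_vec_index:
  "A \<in> carrier_mat m n \<Longrightarrow> v \<in> carrier_vec n \<Longrightarrow> i < m \<Longrightarrow> (A *\<^sub>v v) $ i = (\<Sum>l<n. A $$ (i, l) * v $ l)"
  by (auto simp: scalar_prod_def atLeast0LessThan)

text \<open>An additive splitting of \<open>A\<close>, without the logarithm of a unipotent part: a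
  map that preserves the grading intertwines the full matrices if and only if it intertwines these
  parts.\<close>

definition nilpart :: "nat \<Rightarrow> complex mat \<Rightarrow> complex mat" where
  "nilpart n A = mat n n (\<lambda>(i, j). if i = j then 0 else A $$ (i, j))"

lemma nilpart_carrier [simp]: "nilpart n A \<in> carrier_mat n n" "dim_row (nilpart n A) = n" "dim_col (nilpart n A) = n"
  by (simp_all add: nilpart_def)

text \<open>The i-th basis vector is homogeneous, of degree the class of \<open>A $$ (i, i)\<close>.
  The graded side thus sees the diagonal of \<open>A\<close> only up to powers of \<open>q\<close>,
  which is why representatives had to be fixed.\<close>

definition graded_coord :: "complex \<Rightarrow> 'v grnil \<Rightarrow> nat \<Rightarrow> complex mat \<Rightarrow> ('v \<Rightarrow> complex vec) \<Rightarrow> bool" where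
  "graded_coord q V n A h \<longleftrightarrow> coord UNIV V n h \<and>
     (\<forall>c\<in>q_classes q. component V c = {x \<in> carrier V. \<forall>i<n. h x $ i \<noteq> 0 \<longrightarrow> q_class q (A $$ (i, i)) = c}) \<and>
     (\<forall>x\<in>carrier V. Nil_op V x \<in> carrier V \<and> h (Nil_op V x) = nilpart n A *\<^sub>v h x)"

lemma vecs_UNIV: "vecs UNIV n = carrier_vec n"
  by (auto simp: vecs_def)

lemma mats_UNIV: "mats UNIV m n = carrier_mat m n"
  by (auto simp: mats_def)

lemma q_class_in: "a \<noteq> 0 \<Longrightarrow> q_class q a \<in> q_classes q"
  by (simp add: q_classes_def)

lemma normal_form_carrier: "normal_form q n A \<Longrightarrow> A \<in> carrier_mat n n"
  unfolding normal_form_def by blast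

lemma normal_form_rep: "normal_form q n A \<Longrightarrow> i < n \<Longrightarrow> is_rep q (A $$ (i, i))"
  unfolding normal_form_def by blast

lemma normal_form_diag_nz: "normal_form q n A \<Longrightarrow> i < n \<Longrightarrow> A $$ (i, i) \<noteq> 0"
  unfolding normal_form_def is_rep_def by blast

lemma normal_form_entry:
  "normal_form q n A \<Longrightarrow> i < n \<Longrightarrow> j < n \<Longrightarrow> A $$ (i, j) \<noteq> 0 \<Longrightarrow> i \<le> j \<and> A $$ (i, i) = A $$ (j, j)"
  unfolding normal_form_def by blast

lemma nilpart_entry:
  assumes "normal_form q n A" "i < n" "j < n" "nilpart n A $$ (i, j) \<noteq> 0"
  shows "i < j \<and> A $$ (i, i) = A $$ (j, j)"
  using normal_form_entry[OF assms(1-3)] assms(2-4) by (auto simp: nilpart_def split: if_splits)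

lemma graded_coord_copy_exists:
  assumes e: "\<exists>e :: (nat \<Rightarrow> complex) \<Rightarrow> 'v. inj e"
  shows "\<exists>(V :: 'v grnil) h. graded_coord q V n A h"
proof -
  obtain e :: "(nat \<Rightarrow> complex) \<Rightarrow> 'v" where e: "inj e" using e by blast
  define enc where "enc v = e (\<lambda>i. if i < n then v $ i else 0)" for v :: "complex vec"
  define dec where "dec = inv_into (carrier_vec n) enc"
  define V :: "'v grnil" where "V = \<lparr>carrier = enc ` carrier_vec n, mult = undefined, one = undefined, zero = enc (0\<^sub>v n),
    add = \<lambda>x y. enc (dec x + dec y), smult = \<lambda>a x. enc (a \<cdot>\<^sub>v dec x),
    component = \<lambda>c. {x \<in> enc ` carrier_vec n. \<forall>i<n. dec x $ i \<noteq> 0 \<longrightarrow> q_class q (A $$ (i, i)) = c},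
    Nil_op = \<lambda>x. enc (nilpart n A *\<^sub>v dec x)\<rparr>"
  have inj: "inj_on enc (carrier_vec n)"
  proof (rule inj_onI)
    fix v w :: "complex vec" assume v: "v \<in> carrier_vec n" and w: "w \<in> carrier_vec n" and "enc v = enc w"
    then have eq: "(\<lambda>i. if i < n then v $ i else 0) = (\<lambda>i. if i < n then w $ i else 0)"
      using e by (auto simp: enc_def inj_def)
    have "v $ i = w $ i" if "i < n" for i using fun_cong[OF eq, of i] that by simp
    then show "v = w" using v w by (intro eq_vecI) auto
  qed
  have de: "dec (enc v) = v" if "v \<in> carrier_vec n" for v
    using inj that by (simp add: dec_def)
  have Nc: "nilpart n A *\<^sub>v v \<in> carrier_vec n" for v by (rule carrier_vecI) simp
  have "graded_coord q V n A dec"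
    unfolding graded_coord_def coord_def vecs_UNIV
    using inj_on_inv_into[of "enc ` carrier_vec n" enc "carrier_vec n"]
    by (auto simp: V_def de Nc bij_betw_def image_image simp flip: dec_def)
  then show ?thesis by blast
qed

text \<open>Different components use disjoint sets of coordinates, so only one summand contributes
  to the coordinate \<open>i\<close>.\<close>

lemma graded_coord_finsum:
  assumes V: "graded_coord q V n A h" and nz: "\<And>i. i < n \<Longrightarrow> A $$ (i, i) \<noteq> 0"
    and w: "w \<in> Pi\<^sub>E (q_classes q) (component V)" and fin: "finite {c \<in> q_classes q. w c \<noteq> \<zero>\<^bsub>V\<^esub>}" and i: "i < n"
  shows "h (finsum V w {c \<in> q_classes q. w c \<noteq> \<zero>\<^bsub>V\<^esub>}) $ i = h (w (q_class q (A $$ (i, i)))) $ i"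
proof -
  let ?C = "{c \<in> q_classes q. w c \<noteq> \<zero>\<^bsub>V\<^esub>}" and ?d = "q_class q (A $$ (i, i))"
  have c: "coord UNIV V n h" using V by (simp add: graded_coord_def)
  have comp: "w c \<in> carrier V" "h (w c) $ i \<noteq> 0 \<Longrightarrow> ?d = c" if "c \<in> q_classes q" for c
    using PiE_mem[OF w that] V that i by (auto simp: graded_coord_def)
  have d: "?d \<in> q_classes q" by (rule q_class_in[OF nz[OF i]])
  have "h (finsum V w ?C) $ i = (\<Sum>c\<in>?C. h (w c) $ i)"
    by (rule coord_finsum[OF subfld_UNIV c fin _ i]) (use comp in auto)
  also have "\<dots> = (\<Sum>c\<in>?C. if c = ?d then h (w ?d) $ i else 0)"
    by (rule sum.cong) (use comp in auto)
  also have "\<dots> = h (w ?d) $ i"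
    using fin d coordD(10)[OF c] i by auto
  finally show ?thesis .
qed

lemma graded_coord_component:
  assumes V: "graded_coord q V n A h" and c: "c \<in> q_classes q"
  shows "x \<in> component V c \<longleftrightarrow> x \<in> carrier V \<and> (\<forall>i<n. h x $ i \<noteq> 0 \<longrightarrow> q_class q (A $$ (i, i)) = c)"
  using V c by (simp add: graded_coord_def)

lemma graded_nilpotent_space_if_graded_coord:
  assumes A: "normal_form q n A" and V: "graded_coord q V n A h"
  shows "graded_nilpotent_space q V"
proof -
  have c: "coord UNIV V n h" and Nil: "\<And>x. x \<in> carrier V \<Longrightarrow> Nil_op V x \<in> carrier V \<and> h (Nil_op V x) = nilpart n A *\<^sub>v h x"
    using V by (auto simp: graded_coord_def)
  note D = coordD[OF c] and comp = graded_coord_component[OF V]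
  have vs: "vectorspace C_field V" using coord_vectorspace[OF subfld_UNIV c] by (simp add: subfld_ring_UNIV)
  interpret vectorspace C_field V by (rule vs)
  have fd: "fin_dim" using coord_fin_dim(1)[OF subfld_UNIV c] by (simp add: subfld_ring_UNIV)
  have nz: "A $$ (i, i) \<noteq> 0" if "i < n" for i by (rule normal_form_diag_nz[OF A that])
  have sub: "VectorSpace.subspace C_field (component V d) V" if d: "d \<in> q_classes q" for d
  proof (intro subspace.intro submodule.intro vs)
    show "module C_field V" ..
    show "component V d \<subseteq> carrier V" "\<zero>\<^bsub>V\<^esub> \<in> component V d"
      using D(9,10) by (auto simp: comp[OF d])
    fix v assume v: "v \<in> component V d"
    then have v': "v \<in> carrier V" "h v \<in> carrier_vec n" by (auto simp: comp[OF d] D(4))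
    show "a \<odot>\<^bsub>V\<^esub> v \<in> component V d" for a
      using v v' D(7,8)[of a v] by (auto simp: comp[OF d])
    fix w assume w: "w \<in> component V d"
    then have w': "w \<in> carrier V" "h w \<in> carrier_vec n" by (auto simp: comp[OF d] D(4))
    show "v \<oplus>\<^bsub>V\<^esub> w \<in> component V d"
      using v v' w w' D(5,6)[of v w] by (auto simp: comp[OF d])
  qed
  have dec: "\<exists>!w. w \<in> Pi\<^sub>E (q_classes q) (component V) \<and> finite {c \<in> q_classes q. w c \<noteq> \<zero>\<^bsub>V\<^esub>} \<and>
        v = finsum V w {c \<in> q_classes q. w c \<noteq> \<zero>\<^bsub>V\<^esub>}" if v: "v \<in> carrier V" for v
  proof -
    let ?cl = "\<lambda>i. q_class q (A $$ (i, i))"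
    \<comment> \<open>The homogeneous part of \<open>v\<close> of degree \<open>d\<close>: all other
      coordinates are set to 0.\<close>
    define p where "p d = vec n (\<lambda>i. if ?cl i = d then h v $ i else 0)" for d
    define w where "w = (\<lambda>d\<in>q_classes q. cinv h V (p d))"
    have pc: "p d \<in> vecs UNIV n" for d by (simp add: p_def vecs_UNIV)
    have hw: "h (w d) = p d" "w d \<in> carrier V" if "d \<in> q_classes q" for d
      using coord_cinv(1,2)[OF c pc] that by (auto simp: w_def)
    have wP: "w \<in> Pi\<^sub>E (q_classes q) (component V)"
    proof (rule PiE_I)
      fix d assume d: "d \<in> q_classes q"
      show "w d \<in> component V d" unfolding comp[OF d] using hw[OF d] by (auto simp: p_def)
    qed (simp add: w_def)
    have "{d \<in> q_classes q. w d \<noteq> \<zero>\<^bsub>V\<^esub>} \<subseteq> ?cl ` {..<n}"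
    proof
      fix d assume "d \<in> {d \<in> q_classes q. w d \<noteq> \<zero>\<^bsub>V\<^esub>}"
      then have d: "d \<in> q_classes q" "w d \<noteq> \<zero>\<^bsub>V\<^esub>" by auto
      then have "p d \<noteq> 0\<^sub>v n" using coord_eqI[OF c hw(2)[OF d(1)] D(9)] hw(1)[OF d(1)] D(10) by auto
      then obtain i where "i < n" "p d $ i \<noteq> 0" by (metis (no_types, lifting) eq_vecI dim_vec index_zero_vec p_def)
      then show "d \<in> ?cl ` {..<n}" by (auto simp: p_def split: if_splits)
    qed
    then have fin: "finite {d \<in> q_classes q. w d \<noteq> \<zero>\<^bsub>V\<^esub>}" by (rule finite_subset) simp
    show ?thesis
    proof (rule ex1I[of _ w])
      let ?s = "finsum V w {c \<in> q_classes q. w c \<noteq> \<zero>\<^bsub>V\<^esub>}"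
      have s: "?s \<in> carrier V" by (rule finsum_closed) (use hw in auto)
      have "h v = h ?s"
      proof (rule eq_vecI)
        fix i assume "i < dim_vec (h ?s)"
        then have i: "i < n" using D(4)[OF s] by simp
        have "h ?s $ i = h (w (?cl i)) $ i" by (rule graded_coord_finsum[OF V nz wP fin i])
        then show "h v $ i = h ?s $ i" using hw(1)[OF q_class_in[OF nz[OF i]]] i by (simp add: p_def)
      qed (use D(4)[OF s] D(4)[OF v] in simp)
      then have "v = ?s" by (rule coord_eqI[OF c v s])
      then show "w \<in> Pi\<^sub>E (q_classes q) (component V) \<and> finite {c \<in> q_classes q. w c \<noteq> \<zero>\<^bsub>V\<^esub>} \<and> v = ?s" using wP fin by blast
    next
      fix u assume u: "u \<in> Pi\<^sub>E (q_classes q) (component V) \<and> finite {c \<in> q_classes q. u c \<noteq> \<zero>\<^bsub>V\<^esub>} \<and>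
        v = finsum V u {c \<in> q_classes q. u c \<noteq> \<zero>\<^bsub>V\<^esub>}"
      show "u = w"
      proof (rule PiE_ext)
        show "u \<in> Pi\<^sub>E (q_classes q) (component V)" "w \<in> Pi\<^sub>E (q_classes q) (component V)" using u wP by auto
        fix d assume d: "d \<in> q_classes q"
        have ud: "u d \<in> carrier V" "\<And>i. i < n \<Longrightarrow> h (u d) $ i \<noteq> 0 \<Longrightarrow> ?cl i = d"
          using PiE_mem[OF conjunct1[OF u] d] by (auto simp: comp[OF d])
        have "h (u d) = p d"
        proof (rule eq_vecI)
          fix i assume "i < dim_vec (p d)"
          then have i: "i < n" by (simp add: p_def)
          have uv: "finsum V u {c \<in> q_classes q. u c \<noteq> \<zero>\<^bsub>V\<^esub>} = v" using u by simp
          have "h v $ i = h (u (?cl i)) $ i"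
            by (rule graded_coord_finsum[OF V nz conjunct1[OF u] conjunct1[OF conjunct2[OF u]] i, unfolded uv])
          then show "h (u d) $ i = p d $ i" using ud(2)[OF i] i by (auto simp: p_def)
        qed (use D(4)[OF ud(1)] in \<open>simp add: p_def\<close>)
        then show "u d = w d" using coord_eqI[OF c ud(1) hw(2)[OF d]] hw(1)[OF d] by simp
      qed
    qed
  qed
  have hom: "Nil_op V \<in> module_hom C_field V V"
  proof -
    have "Nil_op V (x \<oplus>\<^bsub>V\<^esub> y) = Nil_op V x \<oplus>\<^bsub>V\<^esub> Nil_op V y" if xy: "x \<in> carrier V" "y \<in> carrier V" for x y
    proof (rule coord_eqI[OF c])
      show "h (Nil_op V (x \<oplus>\<^bsub>V\<^esub> y)) = h (Nil_op V x \<oplus>\<^bsub>V\<^esub> Nil_op V y)"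
        using xy Nil D(5,6) mult_add_distrib_mat_vec[OF nilpart_carrier(1) D(4)[OF xy(1)] D(4)[OF xy(2)]] by simp
    qed (use xy Nil D(5) in auto)
    moreover have "Nil_op V (a \<odot>\<^bsub>V\<^esub> x) = a \<odot>\<^bsub>V\<^esub> Nil_op V x" if x: "x \<in> carrier V" for a x
    proof (rule coord_eqI[OF c])
      show "h (Nil_op V (a \<odot>\<^bsub>V\<^esub> x)) = h (a \<odot>\<^bsub>V\<^esub> Nil_op V x)"
        using x Nil D(7,8) mult_mat_vec[OF nilpart_carrier(1) D(4)[OF x]] by simp
    qed (use x Nil D(7) in auto)
    ultimately show ?thesis using Nil by (auto simp: module_hom_def)
  qed
  have pres: "Nil_op V ` component V d \<subseteq> component V d" if d: "d \<in> q_classes q" for d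
  proof
    fix y assume "y \<in> Nil_op V ` component V d"
    then obtain x where x: "x \<in> component V d" "y = Nil_op V x" by blast
    then have xc: "x \<in> carrier V" by (simp add: comp[OF d])
    have "q_class q (A $$ (i, i)) = d" if i: "i < n" and "h y $ i \<noteq> 0" for i
    proof -
      have "(\<Sum>l<n. nilpart n A $$ (i, l) * h x $ l) \<noteq> 0"
        using that x(2) Nil[OF xc] mat_vec_index[OF nilpart_carrier(1) D(4)[OF xc] i] by simp
      then obtain l where "l < n" "nilpart n A $$ (i, l) * h x $ l \<noteq> 0"
        by (metis (no_types, lifting) lessThan_iff sum.neutral)
      then have l: "l < n" "nilpart n A $$ (i, l) \<noteq> 0" "h x $ l \<noteq> 0" by auto
      then have "q_class q (A $$ (l, l)) = d" using x(1) by (simp add: comp[OF d])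
      then show ?thesis using nilpart_entry[OF A i l(1,2)] by simp
    qed
    then show "y \<in> component V d" using x Nil[OF xc] by (simp add: comp[OF d])
  qed
  have nilp: "\<forall>v\<in>carrier V. (Nil_op V ^^ n) v = \<zero>\<^bsub>V\<^esub>"
  proof
    fix v assume v: "v \<in> carrier V"
    \<comment> \<open>Strict upper triangularity: after \<open>k\<close> applications the last
      \<open>k\<close> coordinates vanish.\<close>
    have "(Nil_op V ^^ k) v \<in> carrier V \<and> (\<forall>i<n. i + k \<ge> n \<longrightarrow> h ((Nil_op V ^^ k) v) $ i = 0)" for k
    proof (induction k)
      case 0
      then show ?case using v by simp
    next
      case (Suc k)
      let ?x = "(Nil_op V ^^ k) v"
      have x: "?x \<in> carrier V" using Suc by blast
      have "h (Nil_op V ?x) $ i = 0" if i: "i < n" "i + Suc k \<ge> n" for i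
      proof -
        have "h (Nil_op V ?x) $ i = (\<Sum>l<n. nilpart n A $$ (i, l) * h ?x $ l)"
          using Nil[OF x] mat_vec_index[OF nilpart_carrier(1) D(4)[OF x] i(1)] by simp
        also have "\<dots> = 0"
        proof (rule sum.neutral, rule ballI)
          fix l assume "l \<in> {..<n}"
          then have l: "l < n" by simp
          show "nilpart n A $$ (i, l) * h ?x $ l = 0"
            using nilpart_entry[OF A i(1) l] Suc l i(2) by (cases "nilpart n A $$ (i, l) = 0") auto
        qed
        finally show ?thesis .
      qed
      then show ?case using Nil[OF x] by simp
    qed
    from this[of n] have N: "(Nil_op V ^^ n) v \<in> carrier V" "\<forall>i<n. h ((Nil_op V ^^ n) v) $ i = 0" by auto
    have "h ((Nil_op V ^^ n) v) = h \<zero>\<^bsub>V\<^esub>"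
      unfolding D(10) using N D(4)[OF N(1)] by (intro eq_vecI) auto
    then show "(Nil_op V ^^ n) v = \<zero>\<^bsub>V\<^esub>" by (rule coord_eqI[OF c N(1) D(9)])
  qed
  show ?thesis
    unfolding graded_nilpotent_space_def
    by (intro conjI ballI vs fd sub dec hom pres exI[of _ n] nilp)
qed

text \<open>A graded space with nilpotent operator, transported to column vectors:
  \<open>H c\<close> is the component of degree \<open>c\<close>. The direct sum decomposition is
  split into \<open>generated\<close> and \<open>independent\<close>, with sums taken coordinate by
  coordinate.\<close>

locale graded_matrix =
  fixes q :: complex and n :: nat and H :: "complex set \<Rightarrow> complex vec set" and N :: "complex mat"
  assumes q0: "q \<noteq> 0" and N: "N \<in> carrier_mat n n"
    and H_carrier: "c \<in> q_classes q \<Longrightarrow> v \<in> H c \<Longrightarrow> v \<in> carrier_vec n"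
    and H_zero: "c \<in> q_classes q \<Longrightarrow> 0\<^sub>v n \<in> H c"
    and H_add: "c \<in> q_classes q \<Longrightarrow> v \<in> H c \<Longrightarrow> w \<in> H c \<Longrightarrow> v + w \<in> H c"
    and H_smult: "c \<in> q_classes q \<Longrightarrow> v \<in> H c \<Longrightarrow> a \<cdot>\<^sub>v v \<in> H c"
    and H_N: "c \<in> q_classes q \<Longrightarrow> v \<in> H c \<Longrightarrow> N *\<^sub>v v \<in> H c"
    and nilpotent: "\<exists>k. \<forall>v\<in>carrier_vec n. ((*\<^sub>v) N ^^ k) v = 0\<^sub>v n"
    and generated: "v \<in> carrier_vec n \<Longrightarrow> \<exists>C x. finite C \<and> C \<subseteq> q_classes q \<and> (\<forall>c\<in>C. x c \<in> H c) \<and> (\<forall>i<n. v $ i = (\<Sum>c\<in>C. x c $ i))"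
    and independent: "finite C \<Longrightarrow> C \<subseteq> q_classes q \<Longrightarrow> (\<And>c. c \<in> C \<Longrightarrow> x c \<in> H c) \<Longrightarrow> (\<And>i. i < n \<Longrightarrow> (\<Sum>c\<in>C. x c $ i) = 0) \<Longrightarrow>
      c \<in> C \<Longrightarrow> x c = 0\<^sub>v n"
begin

lemma mult_graded:
  assumes d: "d \<in> q_classes q" and G: "G \<in> carrier_mat n m" and col: "\<And>j. j < m \<Longrightarrow> u $ j \<noteq> 0 \<Longrightarrow> col G j \<in> H d"
    and u: "u \<in> carrier_vec m"
  shows "G *\<^sub>v u \<in> H d"
proof -
  have *: "vec n (\<lambda>i. \<Sum>j<l. G $$ (i, j) * u $ j) \<in> H d" if "l \<le> m" for l
    using that
  proof (induction l)
    case 0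
    then show ?case using H_zero[OF d] by (simp add: zero_vec_def)
  next
    case (Suc l)
    have eq: "vec n (\<lambda>i. \<Sum>j<Suc l. G $$ (i, j) * u $ j) = vec n (\<lambda>i. \<Sum>j<l. G $$ (i, j) * u $ j) + u $ l \<cdot>\<^sub>v col G l"
      using G Suc.prems by (intro eq_vecI) auto
    have "u $ l \<cdot>\<^sub>v col G l \<in> H d"
    proof (cases "u $ l = 0")
      case True
      then have "u $ l \<cdot>\<^sub>v col G l = 0\<^sub>v n" using G by (intro eq_vecI) auto
      then show ?thesis using H_zero[OF d] by simp
    next
      case False
      then show ?thesis using H_smult[OF d] col[of l] Suc.prems by simp
    qed
    then show ?case unfolding eq using H_add[OF d] Suc by simp
  qed
  have "G *\<^sub>v u = vec n (\<lambda>i. \<Sum>j<m. G $$ (i, j) * u $ j)"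
    using G u by (intro eq_vecI) (auto simp: mat_vec_index simp del: index_mult_mat_vec)
  then show ?thesis using *[of m] by simp
qed

text \<open>Sort \<open>G *\<^sub>v u\<close> by the degrees of the columns of \<open>G\<close>. As
  the vector lies in \<open>H d\<close>, independence of the components leaves only the part of
  degree \<open>d\<close>, and the left inverse \<open>Q\<close> carries this back to
  \<open>u\<close>.\<close>

lemma coefficients_graded:
  assumes d: "d \<in> q_classes q" and G: "G \<in> carrier_mat n m" and Q: "Q \<in> carrier_mat m n" "Q * G = 1\<^sub>m m"
    and nz: "\<And>j. j < m \<Longrightarrow> a j \<noteq> 0" and col: "\<And>j. j < m \<Longrightarrow> col G j \<in> H (q_class q (a j))"
    and u: "u \<in> carrier_vec m" and Gu: "G *\<^sub>v u \<in> H d" and j: "j < m" "u $ j \<noteq> 0"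
  shows "q_class q (a j) = d"
proof -
  define r where "r c = vec m (\<lambda>j. if q_class q (a j) = c then u $ j else 0)" for c
  define C where "C = insert d ((\<lambda>j. q_class q (a j)) ` {..<m})"
  \<comment> \<open>The homogeneous parts of \<open>G *\<^sub>v u\<close>, with the vector itself
    subtracted in degree \<open>d\<close>; in total they add up to 0.\<close>
  define x where "x c = G *\<^sub>v r c + (if c = d then - 1 else 0) \<cdot>\<^sub>v (G *\<^sub>v u)" for c
  have rc: "r c \<in> carrier_vec m" for c by (simp add: r_def)
  have C: "finite C" "C \<subseteq> q_classes q" using d nz by (auto simp: C_def q_class_in)
  have Gr: "G *\<^sub>v r c \<in> H c" if "c \<in> q_classes q" for c
    by (rule mult_graded[OF that G _ rc]) (use col in \<open>auto simp: r_def split: if_splits\<close>)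
  have xH: "x c \<in> H c" if c: "c \<in> C" for c
  proof -
    have cq: "c \<in> q_classes q" using c C by blast
    have "(if c = d then - 1 else 0) \<cdot>\<^sub>v (G *\<^sub>v u) \<in> H c"
    proof (cases "c = d")
      case True
      then show ?thesis using H_smult[OF d Gu] by simp
    next
      case False
      then have "(if c = d then - 1 else 0) \<cdot>\<^sub>v (G *\<^sub>v u) = 0\<^sub>v n" using G by (intro eq_vecI) auto
      then show ?thesis using H_zero[OF cq] by simp
    qed
    then show ?thesis unfolding x_def by (rule H_add[OF cq Gr[OF cq]])
  qed
  have sum: "(\<Sum>c\<in>C. x c $ i) = 0" if i: "i < n" for i
  proof -
    have xi: "x c $ i = (\<Sum>j<m. G $$ (i, j) * r c $ j) + (if c = d then - ((G *\<^sub>v u) $ i) else 0)" for c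
      using i G mat_vec_index[OF G rc i] by (simp add: x_def del: index_mult_mat_vec)
    have "(\<Sum>c\<in>C. x c $ i) = (\<Sum>c\<in>C. \<Sum>j<m. G $$ (i, j) * r c $ j) - (G *\<^sub>v u) $ i"
      unfolding xi sum.distrib using C(1) by (simp add: C_def del: index_mult_mat_vec)
    also have "(\<Sum>c\<in>C. \<Sum>j<m. G $$ (i, j) * r c $ j) = (\<Sum>j<m. \<Sum>c\<in>C. if c = q_class q (a j) then G $$ (i, j) * u $ j else 0)"
      unfolding sum.swap[of _ "{..<m}"] by (intro sum.cong refl) (auto simp: r_def)
    also have "\<dots> = (\<Sum>j<m. G $$ (i, j) * u $ j)" using C(1) by (intro sum.cong refl) (auto simp: C_def)
    also have "\<dots> = (G *\<^sub>v u) $ i" using mat_vec_index[OF G u i] by simp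
    finally show ?thesis by simp
  qed
  have "x d = 0\<^sub>v n" by (rule independent[OF C xH sum]) (auto simp: C_def)
  moreover have "x d $ i = (G *\<^sub>v r d) $ i - (G *\<^sub>v u) $ i" if "i < n" for i
    using that G by (simp add: x_def del: index_mult_mat_vec)
  ultimately have eq: "(G *\<^sub>v r d) $ i = (G *\<^sub>v u) $ i" if "i < n" for i using that by simp
  have GG: "G *\<^sub>v r d = G *\<^sub>v u" by (rule eq_vecI) (use G eq in auto)
  have inv: "Q *\<^sub>v (G *\<^sub>v v) = v" if "v \<in> carrier_vec m" for v
    using assoc_mult_mat_vec[OF Q(1) G that] Q(2) that by simp
  have "r d = u" using inv[OF rc] inv[OF u] GG by metis
  then have "r d $ j \<noteq> 0" using j by simp
  then show ?thesis using j by (simp add: r_def split: if_splits)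
qed

text \<open>The columns of \<open>G\<close> are \<open>m\<close> independent homogeneous vectors on
  whose span \<open>N\<close> is strictly upper triangular. To add one, a homogeneous vector outside
  the span is followed under \<open>N\<close> to its last image before entering the span.
  \<open>G * Q\<close> is a projection onto the span, so being fixed by it tests membership.\<close>

lemma partial_normal_form:
  assumes "m \<le> n"
  shows "\<exists>A G Q. normal_form q m A \<and> G \<in> carrier_mat n m \<and> Q \<in> carrier_mat m n \<and> Q * G = 1\<^sub>m m \<and>
    (\<forall>j<m. col G j \<in> H (q_class q (A $$ (j, j)))) \<and> N * G = G * nilpart m A"
  using assms
proof (induction m)
  case 0
  have "normal_form q 0 (0\<^sub>m 0 0)" by (simp add: normal_form_def)
  moreover have "N * 0\<^sub>m n 0 = 0\<^sub>m n 0 * nilpart 0 (0\<^sub>m 0 0)" using N by (intro eq_matI) auto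
  ultimately show ?case
    by (intro exI[of _ "0\<^sub>m 0 0"] exI[of _ "0\<^sub>m n 0"] exI[of _ "0\<^sub>m 0 n"]) auto
next
  case (Suc m)
  then obtain A G Q where A: "normal_form q m A" and G: "G \<in> carrier_mat n m" and Q: "Q \<in> carrier_mat m n" "Q * G = 1\<^sub>m m"
    and col: "\<And>j. j < m \<Longrightarrow> col G j \<in> H (q_class q (A $$ (j, j)))" and NG: "N * G = G * nilpart m A" by auto
  let ?P = "G * Q"
  have P: "?P \<in> carrier_mat n n" using G Q by simp
  have Ac: "A \<in> carrier_mat m m" by (rule normal_form_carrier[OF A])
  \<comment> \<open>Otherwise the span contains all components and hence every vector, which
    contradicts m < n.\<close>
  have "\<exists>d\<in>q_classes q. \<exists>x\<in>H d. ?P *\<^sub>v x \<noteq> x"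
  proof (rule ccontr)
    assume "\<not> ?thesis"
    then have fixH: "?P *\<^sub>v x = x" if "d \<in> q_classes q" "x \<in> H d" for d x using that by blast
    have "?P = 1\<^sub>m n"
    proof (rule mats_eqI[OF subfld_UNIV P])
      fix v :: "complex vec" assume "v \<in> vecs UNIV n"
      then have v: "v \<in> carrier_vec n" by (simp add: vecs_UNIV)
      obtain C x where C: "finite C" "C \<subseteq> q_classes q" "\<And>c. c \<in> C \<Longrightarrow> x c \<in> H c" "\<And>i. i < n \<Longrightarrow> v $ i = (\<Sum>c\<in>C. x c $ i)"
        using generated[OF v] by blast
      have "?P *\<^sub>v v = v"
      proof (rule eq_vecI)
        fix i assume "i < dim_vec v"
        then have i: "i < n" using v by simp
        have "(?P *\<^sub>v v) $ i = (\<Sum>l<n. ?P $$ (i, l) * (\<Sum>c\<in>C. x c $ l))"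
          unfolding mat_vec_index[OF P v i] using C(4) by simp
        also have "\<dots> = (\<Sum>c\<in>C. \<Sum>l<n. ?P $$ (i, l) * x c $ l)"
          unfolding sum_distrib_left by (rule sum.swap)
        also have "\<dots> = (\<Sum>c\<in>C. x c $ i)"
        proof (rule sum.cong[OF refl])
          fix c assume c: "c \<in> C"
          then have cq: "c \<in> q_classes q" "x c \<in> H c" using C by auto
          note xc = H_carrier[OF cq] fixH[OF cq]
          show "(\<Sum>l<n. ?P $$ (i, l) * x c $ l) = x c $ i"
            using mat_vec_index[OF P xc(1) i] xc(2) by simp
        qed
        finally show "(?P *\<^sub>v v) $ i = v $ i" using C(4)[OF i] by simp
      qed (use G v in simp)
      then show "?P *\<^sub>v v = 1\<^sub>m n *\<^sub>v v" using v by simp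
    qed simp
    then have "n \<le> m" by (rule right_inverse_dim_le[OF G Q(1)])
    then show False using Suc.prems by simp
  qed
  then obtain d x0 where d: "d \<in> q_classes q" and x0: "x0 \<in> H d" "?P *\<^sub>v x0 \<noteq> x0" by blast
  let ?x = "\<lambda>k. ((*\<^sub>v) N ^^ k) x0"
  have xH: "?x k \<in> H d" for k by (induction k) (simp_all add: x0 H_N[OF d])
  obtain k0 where "?x k0 = 0\<^sub>v n" using nilpotent H_carrier[OF d x0(1)] by blast
  then have "?P *\<^sub>v ?x k0 = ?x k0" using mult_mat_zero_vec[OF P] by simp
  then have ex: "\<exists>k. ?P *\<^sub>v ?x k = ?x k" by blast
  define k where "k = (LEAST k. ?P *\<^sub>v ?x k = ?x k)"
  have k: "?P *\<^sub>v ?x k = ?x k" "\<And>j. j < k \<Longrightarrow> ?P *\<^sub>v ?x j \<noteq> ?x j"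
    using LeastI_ex[OF ex] not_less_Least[of _ "\<lambda>k. ?P *\<^sub>v ?x k = ?x k"] by (auto simp: k_def)
  have "k \<noteq> 0" using k(1) x0(2) by (metis funpow_0)
  then obtain j0 where j0: "k = Suc j0" using not0_implies_Suc by blast
  define x where "x = ?x j0"
  have x: "x \<in> H d" "?P *\<^sub>v x \<noteq> x" "?P *\<^sub>v (N *\<^sub>v x) = N *\<^sub>v x"
    using xH[of j0] k j0 by (auto simp: x_def)
  note xc = H_carrier[OF d x(1)] and Nxc = H_carrier[OF d H_N[OF d x(1)]]
  \<comment> \<open>The coordinates of \<open>N *\<^sub>v x\<close> in the span. By homogeneity they
    live on the columns of degree \<open>d\<close>, so the new column of \<open>A'\<close> links
    equal eigenvalues only.\<close>
  define u where "u = Q *\<^sub>v (N *\<^sub>v x)"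
  have u: "u \<in> carrier_vec m" using Q(1) Nxc by (simp add: u_def)
  have Gu: "G *\<^sub>v u = N *\<^sub>v x" using assoc_mult_mat_vec[OF G Q(1) Nxc] x(3) by (simp add: u_def)
  have uj: "q_class q (A $$ (j, j)) = d" if "j < m" "u $ j \<noteq> 0" for j
    by (rule coefficients_graded[OF d G Q, where a = "\<lambda>j. A $$ (j, j)" and u = u])
      (use that u Gu H_N[OF d x(1)] col normal_form_diag_nz[OF A] in auto)
  obtain b where b: "b \<noteq> 0" "d = q_class q b" using d by (auto simp: q_classes_def)
  define a where "a = qrep q b"
  have a: "is_rep q a" "q_class q a = d"
    using is_rep_qrep[OF q0 b(1)] q_class_eq[OF q0 qrep_in] by (auto simp: a_def b(2))
  have ua: "A $$ (j, j) = a" if "j < m" "u $ j \<noteq> 0" for j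
    by (rule is_rep_unique[OF q0 normal_form_rep[OF A that(1)] a(1)]) (simp add: uj[OF that] a(2))
  obtain i0 where i0: "i0 < n" "(?P *\<^sub>v x) $ i0 \<noteq> x $ i0"
    using x(2) xc P by (metis eq_vecI carrier_vecD dim_mult_mat_vec carrier_matD(1))
  \<comment> \<open>A row of \<open>1 - G * Q\<close>: a functional that vanishes on the span and
    takes the nonzero value \<open>y\<close> at \<open>x\<close>. It supplies the new row of the
    left inverse and corrects the old ones.\<close>
  define \<phi> where "\<phi> l = (if l = i0 then 1 else 0) - ?P $$ (i0, l)" for l
  define y where "y = x $ i0 - (?P *\<^sub>v x) $ i0"
  have y: "y \<noteq> 0" using i0(2) by (simp add: y_def)
  have \<phi>x: "(\<Sum>l<n. \<phi> l * x $ l) = y"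
    using i0(1) by (simp add: \<phi>_def y_def mat_vec_index[OF P xc i0(1)] left_diff_distrib sum_subtractf if_distrib[of "\<lambda>t. t * _"] cong: if_cong del: index_mult_mat index_mult_mat_vec)
  have PG: "?P * G = G" using assoc_mult_mat[OF G Q(1) G] Q(2) G by simp
  have \<phi>G: "(\<Sum>l<n. \<phi> l * G $$ (l, j)) = 0" if j: "j < m" for j
  proof -
    have "(\<Sum>l<n. ?P $$ (i0, l) * G $$ (l, j)) = G $$ (i0, j)" using mat_mult_index[OF P G i0(1) j] PG by simp
    then show ?thesis
      using i0(1) by (simp add: \<phi>_def left_diff_distrib sum_subtractf if_distrib[of "\<lambda>t. t * _"] cong: if_cong del: index_mult_mat)
  qed
  define A' where "A' = mat (Suc m) (Suc m) (\<lambda>(i, j). if i < m \<and> j < m then A $$ (i, j) else if i = m \<and> j = m then a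
    else if i < m then u $ i else 0)"
  define G' where "G' = mat n (Suc m) (\<lambda>(i, j). if j < m then G $$ (i, j) else x $ i)"
  define Q' where "Q' = mat (Suc m) n (\<lambda>(i, l). if i < m then Q $$ (i, l) - (Q *\<^sub>v x) $ i * \<phi> l / y else \<phi> l / y)"
  have G': "G' \<in> carrier_mat n (Suc m)" and Q': "Q' \<in> carrier_mat (Suc m) n" and A'c: "A' \<in> carrier_mat (Suc m) (Suc m)"
    by (simp_all add: G'_def Q'_def A'_def)
  have nf: "normal_form q (Suc m) A'"
    unfolding normal_form_def
  proof (intro conjI allI impI A'c)
    show "is_rep q (A' $$ (i, i))" if "i < Suc m" for i
      using that normal_form_rep[OF A, of i] a(1) by (auto simp: A'_def less_Suc_eq)
    fix i j assume ij: "i < Suc m" "j < Suc m" "A' $$ (i, j) \<noteq> 0"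
    show "i \<le> j" "A' $$ (i, i) = A' $$ (j, j)"
      using ij normal_form_entry[OF A, of i j] ua[of i] by (auto simp: A'_def less_Suc_eq split: if_splits)
  qed
  have colG: "col G' j = (if j < m then col G j else x)" if "j < Suc m" for j
    using that G xc by (intro eq_vecI) (auto simp: G'_def less_Suc_eq)
  have col': "col G' j \<in> H (q_class q (A' $$ (j, j)))" if "j < Suc m" for j
    unfolding colG[OF that] using that col[of j] x(1) a(2) by (auto simp: A'_def less_Suc_eq)
  have QG: "Q' * G' = 1\<^sub>m (Suc m)"
  proof (rule eq_matI)
    fix i j assume "i < dim_row (1\<^sub>m (Suc m) :: complex mat)" "j < dim_col (1\<^sub>m (Suc m) :: complex mat)"
    then have ij: "i < Suc m" "j < Suc m" by auto
    let ?g = "\<lambda>l. if j < m then G $$ (l, j) else x $ l"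
    have \<phi>g: "(\<Sum>l<n. \<phi> l * ?g l) = (if j < m then 0 else y)" using \<phi>G \<phi>x by simp
    have \<phi>c: "(\<Sum>l<n. c * \<phi> l / y * ?g l) = (if j < m then 0 else c)" for c
    proof -
      have "(\<Sum>l<n. c * \<phi> l / y * ?g l) = c / y * (\<Sum>l<n. \<phi> l * ?g l)"
        unfolding sum_distrib_left by (intro sum.cong) auto
      then show ?thesis using \<phi>g y by simp
    qed
    have "(Q' * G') $$ (i, j) = (\<Sum>l<n. Q' $$ (i, l) * ?g l)"
      unfolding mat_mult_index[OF Q' G' ij] using ij by (intro sum.cong) (auto simp: G'_def)
    also have "\<dots> = 1\<^sub>m (Suc m) $$ (i, j)"
    proof (cases "i < m")
      case True
      have "(\<Sum>l<n. Q' $$ (i, l) * ?g l) = (\<Sum>l<n. Q $$ (i, l) * ?g l) - (\<Sum>l<n. (Q *\<^sub>v x) $ i * \<phi> l / y * ?g l)"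
        unfolding sum_subtractf[symmetric] using True by (intro sum.cong) (auto simp: Q'_def left_diff_distrib)
      also have "(\<Sum>l<n. Q $$ (i, l) * ?g l) = (if j < m then (Q * G) $$ (i, j) else (Q *\<^sub>v x) $ i)"
        using mat_mult_index[OF Q(1) G True, of j] mat_vec_index[OF Q(1) xc True] by simp
      finally show ?thesis unfolding \<phi>c Q(2) using True ij by auto
    next
      case False
      then have "(\<Sum>l<n. Q' $$ (i, l) * ?g l) = (\<Sum>l<n. 1 * \<phi> l / y * ?g l)"
        using ij by (intro sum.cong) (auto simp: Q'_def)
      then show ?thesis unfolding \<phi>c using False ij by auto
    qed
    finally show "(Q' * G') $$ (i, j) = 1\<^sub>m (Suc m) $$ (i, j)" .
  qed (use G' Q' in auto)
  have NG': "N * G' = G' * nilpart (Suc m) A'"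
  proof (rule eq_matI)
    fix i j assume "i < dim_row (G' * nilpart (Suc m) A')" "j < dim_col (G' * nilpart (Suc m) A')"
    then have i: "i < n" and j: "j < Suc m" using G' by auto
    have R: "(G' * nilpart (Suc m) A') $$ (i, j) = (\<Sum>l<m. G $$ (i, l) * nilpart (Suc m) A' $$ (l, j)) + x $ i * nilpart (Suc m) A' $$ (m, j)"
      unfolding mat_mult_index[OF G' nilpart_carrier(1) i j] using i by (simp add: G'_def)
    have bottom: "nilpart (Suc m) A' $$ (m, j) = 0" using j by (simp add: nilpart_def A'_def)
    show "(N * G') $$ (i, j) = (G' * nilpart (Suc m) A') $$ (i, j)"
    proof (cases "j < m")
      case True
      have "(N * G') $$ (i, j) = (N * G) $$ (i, j)"
        unfolding mat_mult_index[OF N G' i j] mat_mult_index[OF N G i True] using True j by (simp add: G'_def)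
      also have "\<dots> = (\<Sum>l<m. G $$ (i, l) * nilpart m A $$ (l, j))" unfolding NG by (rule mat_mult_index[OF G nilpart_carrier(1) i True])
      also have "\<dots> = (\<Sum>l<m. G $$ (i, l) * nilpart (Suc m) A' $$ (l, j))"
        using True by (intro sum.cong) (auto simp: nilpart_def A'_def)
      finally show ?thesis unfolding R bottom by simp
    next
      case False
      then have jm: "j = m" using j by simp
      have "(N * G') $$ (i, j) = (N *\<^sub>v x) $ i"
        unfolding mat_mult_index[OF N G' i j] mat_vec_index[OF N xc i] using jm by (simp add: G'_def)
      also have "\<dots> = (\<Sum>l<m. G $$ (i, l) * u $ l)" using Gu mat_vec_index[OF G u i] by simp
      also have "\<dots> = (\<Sum>l<m. G $$ (i, l) * nilpart (Suc m) A' $$ (l, j))"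
        by (intro sum.cong) (auto simp: nilpart_def A'_def jm)
      finally show ?thesis unfolding R bottom by simp
    qed
  qed (use G' N in auto)
  show ?case using nf G' Q' QG col' NG' by blast
qed

end

lemma graded_coord_exists:
  assumes q0: "q \<noteq> 0" and V: "graded_nilpotent_space q V"
  shows "\<exists>n A h. normal_form q n A \<and> graded_coord q V n A h"
proof -
  have vs: "vectorspace C_field V" and fd: "vectorspace.fin_dim C_field V"
    and sub: "\<And>c. c \<in> q_classes q \<Longrightarrow> VectorSpace.subspace C_field (component V c) V"
    and dec: "\<And>v. v \<in> carrier V \<Longrightarrow> \<exists>!w. w \<in> Pi\<^sub>E (q_classes q) (component V) \<and> finite {c \<in> q_classes q. w c \<noteq> \<zero>\<^bsub>V\<^esub>} \<and>
        v = finsum V w {c \<in> q_classes q. w c \<noteq> \<zero>\<^bsub>V\<^esub>}"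
    and hom: "Nil_op V \<in> module_hom C_field V V"
    and Nc: "\<And>c. c \<in> q_classes q \<Longrightarrow> Nil_op V ` component V c \<subseteq> component V c"
    and nil: "\<exists>k. \<forall>v\<in>carrier V. (Nil_op V ^^ k) v = \<zero>\<^bsub>V\<^esub>"
    using V by (simp_all add: graded_nilpotent_space_def)
  interpret vectorspace C_field V by (rule vs)
  obtain n k where c: "coord UNIV V n k"
    using coord_exists[OF subfld_UNIV, of V] vs fd by (auto simp: subfld_ring_UNIV)
  note D = coordD[OF c]
  obtain N where N: "N \<in> carrier_mat n n" "\<And>x. x \<in> carrier V \<Longrightarrow> k (Nil_op V x) = N *\<^sub>v k x"
    using coord_hom_matrix[OF subfld_UNIV c c, of "Nil_op V"] hom by (auto simp: subfld_ring_UNIV mats_UNIV)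
  have NV: "Nil_op V x \<in> carrier V" if "x \<in> carrier V" for x using hom that by (auto simp: module_hom_def)
  have compV: "x \<in> carrier V" if "d \<in> q_classes q" "x \<in> component V d" for d x
    using submodule.subset[OF subspace.submod[OF sub[OF that(1)]]] that(2) by blast
  have sub0: "\<zero>\<^bsub>V\<^esub> \<in> component V d" if "d \<in> q_classes q" for d
    by (rule submodule.zero_closed[OF subspace.submod[OF sub[OF that]]])
  define H where "H d = k ` component V d" for d
  have cinvk: "cinv k V v \<in> carrier V" "k (cinv k V v) = v" if "v \<in> carrier_vec n" for v
    using coord_cinv(1,2)[OF c] that by (auto simp: vecs_UNIV)
  have fs: "k (finsum V w C) $ i = (\<Sum>d\<in>C. k (w d) $ i)" if "finite C" "w \<in> C \<rightarrow> carrier V" "i < n" for w :: "complex set \<Rightarrow> 'a" and C i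
    by (rule coord_finsum[OF subfld_UNIV c that])
  interpret g: graded_matrix q n H N
  proof
    fix d v assume d: "d \<in> q_classes q"
    interpret W: submodule C_field "component V d" V by (rule subspace.submod[OF sub[OF d]])
    show "0\<^sub>v n \<in> H d" using sub0[OF d] D(10) by (auto simp: H_def intro!: image_eqI[of _ k "\<zero>\<^bsub>V\<^esub>"])
    assume v: "v \<in> H d"
    then obtain x where x: "x \<in> component V d" "v = k x" by (auto simp: H_def)
    note xV = compV[OF d x(1)]
    show "v \<in> carrier_vec n" using x(2) D(4)[OF xV] by simp
    show "N *\<^sub>v v \<in> H d" using N(2)[OF xV] Nc[OF d] x by (force simp: H_def)
    show "a \<cdot>\<^sub>v v \<in> H d" for a
      unfolding H_def by (rule image_eqI[of _ k "a \<odot>\<^bsub>V\<^esub> x"]) (simp_all add: x D(8) xV W.smult_closed)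
    fix w assume "w \<in> H d"
    then obtain y where y: "y \<in> component V d" "w = k y" by (auto simp: H_def)
    show "v + w \<in> H d"
      unfolding H_def
      by (rule image_eqI[of _ k "x \<oplus>\<^bsub>V\<^esub> y"]) (simp_all add: x y D(6) xV compV[OF d] W.m_closed)
  next
    obtain m where m: "\<And>v. v \<in> carrier V \<Longrightarrow> (Nil_op V ^^ m) v = \<zero>\<^bsub>V\<^esub>" using nil by blast
    have "((*\<^sub>v) N ^^ m) v = 0\<^sub>v n" if v: "v \<in> carrier_vec n" for v
    proof -
      have "(Nil_op V ^^ l) (cinv k V v) \<in> carrier V \<and> k ((Nil_op V ^^ l) (cinv k V v)) = ((*\<^sub>v) N ^^ l) v" for l
        by (induction l) (use cinvk[OF v] N(2) NV in auto)
      from this[of m] show ?thesis using m[OF cinvk(1)[OF v]] D(10) by simp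
    qed
    then show "\<exists>m. \<forall>v\<in>carrier_vec n. ((*\<^sub>v) N ^^ m) v = 0\<^sub>v n" by blast
  next
    fix v :: "complex vec" assume v: "v \<in> carrier_vec n"
    obtain w where w: "w \<in> Pi\<^sub>E (q_classes q) (component V)" "finite {c \<in> q_classes q. w c \<noteq> \<zero>\<^bsub>V\<^esub>}"
      "cinv k V v = finsum V w {c \<in> q_classes q. w c \<noteq> \<zero>\<^bsub>V\<^esub>}" using dec[OF cinvk(1)[OF v]] by blast
    let ?C = "{c \<in> q_classes q. w c \<noteq> \<zero>\<^bsub>V\<^esub>}"
    have wc: "w d \<in> component V d" if "d \<in> q_classes q" for d using PiE_mem[OF w(1) that] .
    have "v $ i = (\<Sum>d\<in>?C. k (w d) $ i)" if i: "i < n" for i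
    proof -
      have "k (finsum V w ?C) $ i = (\<Sum>d\<in>?C. k (w d) $ i)" by (rule fs[OF w(2) _ i]) (use wc compV in auto)
      then show ?thesis using cinvk(2)[OF v] unfolding w(3) by simp
    qed
    then show "\<exists>C x. finite C \<and> C \<subseteq> q_classes q \<and> (\<forall>c\<in>C. x c \<in> H c) \<and> (\<forall>i<n. v $ i = (\<Sum>c\<in>C. x c $ i))"
      using w(2) wc by (intro exI[of _ ?C] exI[of _ "\<lambda>d. k (w d)"]) (auto simp: H_def)
  next
    fix C x c0 assume C: "finite C" "C \<subseteq> q_classes q" and x: "\<And>c. c \<in> C \<Longrightarrow> x c \<in> H c"
      and s0: "\<And>i. i < n \<Longrightarrow> (\<Sum>c\<in>C. x c $ i) = 0" and c0: "c0 \<in> C"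
    have "\<exists>y. y \<in> component V c \<and> x c = k y" if "c \<in> C" for c using x[OF that] by (auto simp: H_def)
    then obtain y where y: "\<And>c. c \<in> C \<Longrightarrow> y c \<in> component V c \<and> x c = k (y c)" by metis
    \<comment> \<open>\<open>w\<close> and \<open>z\<close> are two decompositions of 0 into
      homogeneous parts; uniqueness identifies them.\<close>
    define w where "w = (\<lambda>c\<in>q_classes q. if c \<in> C then y c else \<zero>\<^bsub>V\<^esub>)"
    define z where "z = (\<lambda>c\<in>q_classes q. \<zero>\<^bsub>V\<^esub>)"
    have wP: "w \<in> Pi\<^sub>E (q_classes q) (component V)" and zP: "z \<in> Pi\<^sub>E (q_classes q) (component V)"
      using y sub0 by (auto simp: w_def z_def)
    let ?S = "\<lambda>w. {c \<in> q_classes q. w c \<noteq> \<zero>\<^bsub>V\<^esub>}"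
    have wS: "?S w \<subseteq> C" and wfin: "finite (?S w)" by (auto simp: w_def intro: finite_subset[OF _ C(1)])
    have zS: "?S z = {}" by (auto simp: z_def)
    have wV: "w \<in> ?S w \<rightarrow> carrier V" using PiE_mem[OF wP] compV by auto
    have sc: "finsum V w (?S w) \<in> carrier V" by (rule finsum_closed[OF wV])
    have "k (finsum V w (?S w)) = k \<zero>\<^bsub>V\<^esub>"
    proof (rule eq_vecI)
      fix i assume "i < dim_vec (k \<zero>\<^bsub>V\<^esub>)"
      then have i: "i < n" by (simp add: D(10))
      have "k (finsum V w (?S w)) $ i = (\<Sum>d\<in>?S w. k (w d) $ i)" by (rule fs[OF wfin wV i])
      also have "\<dots> = (\<Sum>d\<in>C. x d $ i)"
        by (rule sum.mono_neutral_cong_left[OF C(1) wS]) (use y C(2) D(10) i in \<open>auto simp: w_def\<close>)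
      finally show "k (finsum V w (?S w)) $ i = k \<zero>\<^bsub>V\<^esub> $ i" using s0[OF i] i by (simp add: D(10))
    qed (use D(4)[OF sc] D(10) in simp)
    then have "finsum V w (?S w) = \<zero>\<^bsub>V\<^esub>" by (rule coord_eqI[OF c sc D(9)])
    moreover have "finsum V z (?S z) = \<zero>\<^bsub>V\<^esub>" unfolding zS by simp
    ultimately have "w = z" using dec[OF D(9)] wP zP wfin zS by (metis (no_types, lifting) finite.emptyI)
    then have "w c0 = z c0" by simp
    then show "x c0 = 0\<^sub>v n" using y[OF c0] c0 C(2) D(10) by (auto simp: w_def z_def)
  qed (use q0 N in auto)
  obtain A G Q where A: "normal_form q n A" and G: "G \<in> carrier_mat n n" and Q: "Q \<in> carrier_mat n n" "Q * G = 1\<^sub>m n"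
    and col: "\<And>j. j < n \<Longrightarrow> col G j \<in> H (q_class q (A $$ (j, j)))" and NG: "N * G = G * nilpart n A"
    using g.partial_normal_form[OF order.refl] by blast
  have GQ: "G * Q = 1\<^sub>m n" by (rule mat_mult_left_right_inverse[OF Q(1) G Q(2)])
  define h where "h x = Q *\<^sub>v k x" for x
  have QG': "Q *\<^sub>v (G *\<^sub>v v) = v" "G *\<^sub>v (Q *\<^sub>v v) = v" if "v \<in> carrier_vec n" for v
    using assoc_mult_mat_vec[OF Q(1) G that] assoc_mult_mat_vec[OF G Q(1) that] Q(2) GQ that by auto
  have bQ: "bij_betw (\<lambda>v. Q *\<^sub>v v) (vecs UNIV n) (vecs UNIV n)"
    unfolding vecs_UNIV
    by (rule bij_betw_byWitness[where f' = "\<lambda>v. G *\<^sub>v v"]) (use QG' Q(1) G in auto)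
  have "bij_betw h (carrier V) (vecs UNIV n)"
    using bij_betw_trans[OF coordD(1)[OF c] bQ] by (simp add: comp_def h_def[abs_def])
  then have ch: "coord UNIV V n h"
    unfolding coord_def h_def
    using D(4-10) Q(1) by (auto simp: mult_add_distrib_mat_vec mult_mat_vec mult_mat_zero_vec)
  have Gh: "G *\<^sub>v h x = k x" if "x \<in> carrier V" for x using QG'(2)[OF D(4)[OF that]] by (simp add: h_def)
  have hc: "h x \<in> carrier_vec n" if "x \<in> carrier V" for x by (rule coordD(4)[OF ch that])
  have "graded_coord q V n A h"
    unfolding graded_coord_def
  proof (intro conjI ballI ch)
    fix d assume d: "d \<in> q_classes q"
    show "component V d = {x \<in> carrier V. \<forall>i<n. h x $ i \<noteq> 0 \<longrightarrow> q_class q (A $$ (i, i)) = d}"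
    proof (intro equalityI subsetI)
      fix x assume x: "x \<in> component V d"
      have xV: "x \<in> carrier V" by (rule compV[OF d x])
      have GH: "G *\<^sub>v h x \<in> H d" using x Gh[OF xV] by (simp add: H_def)
      have "q_class q (A $$ (i, i)) = d" if i: "i < n" "h x $ i \<noteq> 0" for i
        using g.coefficients_graded[OF d G Q, where a = "\<lambda>i. A $$ (i, i)" and u = "h x" and j = i]
          normal_form_diag_nz[OF A] col hc[OF xV] i GH by simp
      then show "x \<in> {x \<in> carrier V. \<forall>i<n. h x $ i \<noteq> 0 \<longrightarrow> q_class q (A $$ (i, i)) = d}" using xV by blast
    next
      fix x assume "x \<in> {x \<in> carrier V. \<forall>i<n. h x $ i \<noteq> 0 \<longrightarrow> q_class q (A $$ (i, i)) = d}"
      then have x: "x \<in> carrier V" "\<forall>i<n. h x $ i \<noteq> 0 \<longrightarrow> q_class q (A $$ (i, i)) = d" by auto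
      have "G *\<^sub>v h x \<in> H d"
        by (rule g.mult_graded[OF d G _ hc[OF x(1)]]) (use x(2) col in auto)
      then obtain y where y: "y \<in> component V d" "k x = k y" using Gh[OF x(1)] by (auto simp: H_def)
      then show "x \<in> component V d" using coord_eqI[OF c x(1) compV[OF d y(1)] y(2)] by simp
    qed
  next
    fix x assume x: "x \<in> carrier V"
    show "Nil_op V x \<in> carrier V" by (rule NV[OF x])
    have "h (Nil_op V x) = Q *\<^sub>v (N *\<^sub>v (G *\<^sub>v h x))" using N(2)[OF x] Gh[OF x] by (simp add: h_def)
    also have "N *\<^sub>v (G *\<^sub>v h x) = G *\<^sub>v (nilpart n A *\<^sub>v h x)"
      using assoc_mult_mat_vec[OF N(1) G hc[OF x]] assoc_mult_mat_vec[OF G nilpart_carrier(1) hc[OF x]] NG by simp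
    also have "Q *\<^sub>v (G *\<^sub>v (nilpart n A *\<^sub>v h x)) = nilpart n A *\<^sub>v h x"
      by (rule QG'(1), rule mult_mat_vec_carrier[OF nilpart_carrier(1) hc[OF x]])
    finally show "h (Nil_op V x) = nilpart n A *\<^sub>v h x" .
  qed
  then show ?thesis using A by blast
qed

lemma graded_coord_nonzero_components:
  assumes A: "normal_form q n A" and V: "graded_coord q V n A h"
  shows "{c \<in> q_classes q. component V c \<noteq> {\<zero>\<^bsub>V\<^esub>}} = (\<lambda>i. q_class q (A $$ (i, i))) ` {..<n}"
proof -
  have c: "coord UNIV V n h" using V by (simp add: graded_coord_def)
  note D = coordD[OF c] and comp = graded_coord_component[OF V]
  show ?thesis
  proof (intro equalityI subsetI)
    fix d assume "d \<in> {c \<in> q_classes q. component V c \<noteq> {\<zero>\<^bsub>V\<^esub>}}"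
    then have d: "d \<in> q_classes q" "component V d \<noteq> {\<zero>\<^bsub>V\<^esub>}" by auto
    have "\<zero>\<^bsub>V\<^esub> \<in> component V d" unfolding comp[OF d(1)] using D(9,10) by simp
    then obtain x where x: "x \<in> component V d" "x \<noteq> \<zero>\<^bsub>V\<^esub>" using d(2) by blast
    then have xV: "x \<in> carrier V" by (simp add: comp[OF d(1)])
    have "h x \<noteq> 0\<^sub>v n" using coord_eqI[OF c xV D(9)] x(2) D(10) by auto
    then obtain i where i: "i < n" "h x $ i \<noteq> 0"
      using D(4)[OF xV] by (metis eq_vecI carrier_vecD index_zero_vec)
    then show "d \<in> (\<lambda>i. q_class q (A $$ (i, i))) ` {..<n}" using x(1) by (auto simp: comp[OF d(1)])
  next
    fix d assume "d \<in> (\<lambda>i. q_class q (A $$ (i, i))) ` {..<n}"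
    then obtain i where i: "i < n" "d = q_class q (A $$ (i, i))" by auto
    have cl: "d \<in> q_classes q" unfolding i(2) by (rule q_class_in[OF normal_form_diag_nz[OF A i(1)]])
    let ?x = "cinv h V (unit_vec n i)"
    have x: "?x \<in> carrier V" "h ?x = unit_vec n i" using coord_cinv(1,2)[OF c] by (auto simp: vecs_UNIV)
    have xd: "?x \<in> component V d"
      unfolding comp[OF cl] x(2) using x(1) i by (auto simp: unit_vec_def split: if_splits)
    have "component V d \<noteq> {\<zero>\<^bsub>V\<^esub>}"
    proof
      assume "component V d = {\<zero>\<^bsub>V\<^esub>}"
      then have "h ?x = 0\<^sub>v n" using xd D(10) by simp
      then have "unit_vec n i $ i = (0\<^sub>v n $ i :: complex)" using x(2) by simp
      then show False using i by simp
    qed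
    then show "d \<in> {c \<in> q_classes q. component V c \<noteq> {\<zero>\<^bsub>V\<^esub>}}" using cl by blast
  qed
qed

section \<open>Convergence of \<phi> and small divisors\<close>

context small_q
begin

lemma qpoch_nonzero: "a \<notin> {q powi k | k. k \<le> 0} \<Longrightarrow> qpoch q a n \<noteq> 0"
  and power_mult_not_1: "a \<notin> {q powi k | k. k \<le> 0} \<Longrightarrow> q ^ n * a \<noteq> 1"
proof -
  assume a: "a \<notin> {q powi k | k. k \<le> 0}"
  show *: "q ^ n * a \<noteq> 1" for n
  proof
    assume "q ^ n * a = 1"
    then have "a = q powi (- int n)" using q_nz by (simp add: power_int_minus field_simps)
    then show False using a by auto
  qed
  then show "qpoch q a n \<noteq> 0" by (auto simp: qpoch_def)
qed

text \<open>In one direction, multiplying by the symbols of the other elements isolates a single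
  one, and these factors grow at most geometrically. In the other direction, the coefficients are
  products of finitely many sequences controlled by \<open>geo_qpoch_if_small_div\<close>.\<close>

lemma phi_radius:
  assumes L: "finite L" "L \<inter> {q powi k | k. k \<le> 0} = {}"
  shows "fps_conv_radius (phi q L) > 0 \<longleftrightarrow> (\<forall>a\<in>L. small_div q a)"
proof -
  have nL: "a \<notin> {q powi k | k. k \<le> 0}" if "a \<in> L" for a using L that by blast
  have rad: "fps_conv_radius (phi q L) > 0 \<longleftrightarrow> geo (\<lambda>n. 1 / (\<Prod>a\<in>L. qpoch q a n))"
    unfolding geo_conv_radius by (simp add: fps_conv_radius_def phi_def)
  show ?thesis
    unfolding rad
  proof
    assume g: "geo (\<lambda>n. 1 / (\<Prod>a\<in>L. qpoch q a n))"
    show "\<forall>a\<in>L. small_div q a"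
    proof
      fix a assume a: "a \<in> L"
      have "geo (\<lambda>n. 1 / (\<Prod>a\<in>L. qpoch q a n) * (\<Prod>b\<in>L - {a}. qpoch q b n))"
        by (intro geo_mult g geo_prod geo_qpoch norm_q)
      also have "(\<lambda>n. 1 / (\<Prod>a\<in>L. qpoch q a n) * (\<Prod>b\<in>L - {a}. qpoch q b n)) = (\<lambda>n. 1 / qpoch q a n)"
      proof
        fix n
        have "\<forall>b\<in>L. qpoch q b n \<noteq> 0" using qpoch_nonzero[OF nL] by blast
        then have "(\<Prod>b\<in>L - {a}. qpoch q b n) \<noteq> 0" using L(1) by (simp add: prod_zero_iff)
        then show "1 / (\<Prod>a\<in>L. qpoch q a n) * (\<Prod>b\<in>L - {a}. qpoch q b n) = 1 / qpoch q a n"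
          using prod.remove[OF L(1) a, of "\<lambda>a. qpoch q a n"] qpoch_nonzero[OF nL[OF a]] by simp
      qed
      finally show "small_div q a" using small_div_if_geo_qpoch[OF norm_q] qpoch_nonzero[OF nL[OF a]] by blast
    qed
  next
    assume "\<forall>a\<in>L. small_div q a"
    then have "geo (\<lambda>n. \<Prod>a\<in>L. 1 / qpoch q a n)"
      using geo_qpoch_if_small_div[OF norm_q not_root geo_qq] power_mult_not_1[OF nL] by (intro geo_prod) blast
    then show "geo (\<lambda>n. 1 / (\<Prod>a\<in>L. qpoch q a n))" by (simp add: prod_dividef)
  qed
qed

text \<open>Any system of representatives differs from the diagonal of \<open>A\<close> by powers of
  \<open>q\<close>, which do not affect \<open>small_div\<close>. Ratios of different eigenvalues
  are never powers of \<open>q\<close>, so none is removed from \<open>ratio_set\<close>; within one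
  class the only ratio is 1, which is removed.\<close>

lemma phi_condition_iff_cond:
  assumes A: "normal_form q n A" and V: "graded_coord q V n A h"
  shows "phi_condition q V \<longleftrightarrow> cond q n A"
proof -
  let ?cl = "\<lambda>i. q_class q (A $$ (i, i))"
  note Z = graded_coord_nonzero_components[OF A V]
  have ratio: "fps_conv_radius (phi q (ratio_set q R)) > 0 \<longleftrightarrow> (\<forall>a\<in>ratio_set q R. small_div q a)" if "finite R" for R
  proof (rule phi_radius)
    have "{a * inverse b | a b. a \<in> R \<and> b \<in> R} = (\<lambda>(a, b). a * inverse b) ` (R \<times> R)" by auto
    then show "finite (ratio_set q R)" using that by (simp add: ratio_set_def)
  qed (auto simp: ratio_set_def)
  show ?thesis
  proof
    assume phi: "phi_condition q V"
    let ?R = "(\<lambda>i. A $$ (i, i)) ` {..<n}"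
    have nz: "?R \<subseteq> - {0}" using normal_form_diag_nz[OF A] by auto
    have "bij_betw (q_class q) ?R {c \<in> q_classes q. component V c \<noteq> {\<zero>\<^bsub>V\<^esub>}}"
      unfolding Z bij_betw_def
      using is_rep_unique[OF q_nz] normal_form_rep[OF A] by (auto intro!: inj_onI simp: image_image)
    then have "fps_conv_radius (phi q (ratio_set q ?R)) > 0" using phi nz unfolding phi_condition_def by blast
    then have sd: "\<forall>a\<in>ratio_set q ?R. small_div q a" using ratio[of ?R] by simp
    show "cond q n A"
      unfolding cond_def
    proof (intro allI impI)
      fix i j assume i: "i < n" and j: "j < n" and ne: "A $$ (i, i) \<noteq> A $$ (j, j)"
      have "A $$ (i, i) * inverse (A $$ (j, j)) \<noteq> q powi k" for k
      proof
        assume "A $$ (i, i) * inverse (A $$ (j, j)) = q powi k"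
        then have "q powi k * A $$ (j, j) = A $$ (i, i)" using normal_form_diag_nz[OF A j] by (simp add: field_simps)
        then show False
          using is_rep_resonance[OF q_nz not_root normal_form_rep[OF A j] normal_form_rep[OF A i]] ne by auto
      qed
      then have "A $$ (i, i) * inverse (A $$ (j, j)) \<in> ratio_set q ?R" using i j unfolding ratio_set_def by blast
      then show "small_div q (A $$ (i, i) / A $$ (j, j))" using sd by (simp add: divide_inverse)
    qed
  next
    assume cond: "cond q n A"
    show "phi_condition q V"
      unfolding phi_condition_def Z
    proof (intro allI impI)
      fix R assume R: "R \<subseteq> - {0} \<and> bij_betw (q_class q) R (?cl ` {..<n})"
      then have "finite R" using bij_betw_finite by blast
      moreover have "small_div q x" if x: "x \<in> ratio_set q R" for x
      proof -
        obtain r s where rs: "r \<in> R" "s \<in> R" "x = r * inverse s" "x \<noteq> q powi 0"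
          using x unfolding ratio_set_def by blast
        have s0: "s \<noteq> 0" using rs(2) R by blast
        have "q_class q r \<in> ?cl ` {..<n}" "q_class q s \<in> ?cl ` {..<n}" using R rs by (auto simp: bij_betw_def)
        then obtain i j where i: "i < n" "q_class q r = ?cl i" and j: "j < n" "q_class q s = ?cl j" by auto
        have "r \<in> ?cl i" "s \<in> ?cl j" using q_class_self[of r q] q_class_self[of s q] i j by auto
        then obtain k l where kl: "r = A $$ (i, i) * q powi k" "s = A $$ (j, j) * q powi l" by (auto simp: q_class_def)
        have "A $$ (i, i) \<noteq> A $$ (j, j)"
        proof
          assume "A $$ (i, i) = A $$ (j, j)"
          then have "q_class q r = q_class q s" using i j by simp
          then have "r = s" using R rs(1,2) by (auto simp: bij_betw_def dest: inj_onD)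
          then show False using rs(3,4) s0 by simp
        qed
        then have sd: "small_div q (A $$ (i, i) / A $$ (j, j))" using cond i j by (simp add: cond_def)
        have xe: "x = q powi (k - l) * (A $$ (i, i) / A $$ (j, j))"
          using q_nz by (simp add: rs(3) kl power_int_diff divide_inverse mult_ac)
        show ?thesis unfolding xe small_div_powi[OF q_nz] by (rule sd)
      qed
      ultimately show "fps_conv_radius (phi q (ratio_set q R)) > 0" using ratio by blast
    qed
  qed
qed

end

text \<open>The diagonal contributions to the two sides agree entry by entry, since \<open>P\<close>
  links equal eigenvalues only.\<close>

lemma nf_intertwine_nilpart:
  assumes A: "A \<in> carrier_mat n n" and B: "B \<in> carrier_mat m m" and P: "P \<in> carrier_mat m n"
    and gr: "\<And>i j. i < m \<Longrightarrow> j < n \<Longrightarrow> P $$ (i, j) \<noteq> 0 \<Longrightarrow> B $$ (i, i) = A $$ (j, j)"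
  shows "P * A = B * P \<longleftrightarrow> P * nilpart n A = nilpart m B * P"
proof -
  have L: "(P * A) $$ (i, j) = (P * nilpart n A) $$ (i, j) + P $$ (i, j) * A $$ (j, j)" if ij: "i < m" "j < n" for i j
  proof -
    have "(P * A) $$ (i, j) = (\<Sum>l<n. P $$ (i, l) * nilpart n A $$ (l, j) + (if l = j then P $$ (i, j) * A $$ (j, j) else 0))"
      unfolding mat_mult_index[OF P A ij] using ij by (intro sum.cong) (auto simp: nilpart_def)
    then show ?thesis unfolding sum.distrib mat_mult_index[OF P nilpart_carrier(1) ij] using ij by simp
  qed
  have R: "(B * P) $$ (i, j) = (nilpart m B * P) $$ (i, j) + B $$ (i, i) * P $$ (i, j)" if ij: "i < m" "j < n" for i j
  proof -
    have "(B * P) $$ (i, j) = (\<Sum>l<m. nilpart m B $$ (i, l) * P $$ (l, j) + (if l = i then B $$ (i, i) * P $$ (i, j) else 0))"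
      unfolding mat_mult_index[OF B P ij] using ij by (intro sum.cong) (auto simp: nilpart_def)
    then show ?thesis unfolding sum.distrib mat_mult_index[OF nilpart_carrier(1) P ij] using ij by simp
  qed
  have D: "P $$ (i, j) * A $$ (j, j) = B $$ (i, i) * P $$ (i, j)" if "i < m" "j < n" for i j
    using gr[OF that] by (cases "P $$ (i, j) = 0") auto
  have "P * A = B * P \<longleftrightarrow> (\<forall>i<m. \<forall>j<n. (P * A) $$ (i, j) = (B * P) $$ (i, j))"
    using A B P by (auto intro!: eq_matI simp del: index_mult_mat(1))
  also have "\<dots> \<longleftrightarrow> (\<forall>i<m. \<forall>j<n. (P * nilpart n A) $$ (i, j) = (nilpart m B * P) $$ (i, j))"
    using L R D by simp
  also have "\<dots> \<longleftrightarrow> P * nilpart n A = nilpart m B * P"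
    using A B P by (auto intro!: eq_matI simp del: index_mult_mat(1))
  finally show ?thesis .
qed

lemma grnil_hom_normal_form:
  assumes q0: "q \<noteq> 0" and A: "normal_form q n A" and B: "normal_form q m B"
    and V: "graded_coord q V n A h" and W: "graded_coord q W m B k"
  shows "f \<in> grnil_hom q V W \<Longrightarrow> \<exists>P\<in>nf_hom (n, A) (m, B). \<forall>x\<in>carrier V. k (f x) = P *\<^sub>v h x"
    "P \<in> nf_hom (n, A) (m, B) \<Longrightarrow> \<exists>f\<in>grnil_hom q V W. \<forall>x\<in>carrier V. k (f x) = P *\<^sub>v h x"
proof -
  have c: "coord UNIV V n h" and d: "coord UNIV W m k" using V W by (auto simp: graded_coord_def)
  have NV: "\<And>x. x \<in> carrier V \<Longrightarrow> Nil_op V x \<in> carrier V \<and> h (Nil_op V x) = nilpart n A *\<^sub>v h x"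
    and NW: "\<And>x. x \<in> carrier W \<Longrightarrow> Nil_op W x \<in> carrier W \<and> k (Nil_op W x) = nilpart m B *\<^sub>v k x"
    using V W by (auto simp: graded_coord_def)
  note compV = graded_coord_component[OF V] and compW = graded_coord_component[OF W]
  note Ac = normal_form_carrier[OF A] and Bc = normal_form_carrier[OF B]
  have cinv: "cinv h V v \<in> carrier V" "h (cinv h V v) = v" if "v \<in> carrier_vec n" for v
    using coord_cinv(1,2)[OF c] that by (auto simp: vecs_UNIV)
  {
    assume f: "f \<in> grnil_hom q V W"
    have fW: "f x \<in> carrier W" if "x \<in> carrier V" for x using f that by (auto simp: grnil_hom_def module_hom_def)
    obtain P where P: "P \<in> carrier_mat m n" "\<And>x. x \<in> carrier V \<Longrightarrow> k (f x) = P *\<^sub>v h x"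
      using coord_hom_matrix[OF subfld_UNIV c d, of f] f by (auto simp: grnil_hom_def subfld_ring_UNIV mats_UNIV)
    \<comment> \<open>Tested on the j-th basis vector, which is homogeneous. Equality of degrees
      gives equality of eigenvalues because both are chosen representatives.\<close>
    have gr: "B $$ (i, i) = A $$ (j, j)" if ij: "i < m" "j < n" "P $$ (i, j) \<noteq> 0" for i j
    proof -
      let ?x = "cinv h V (unit_vec n j)" and ?c = "q_class q (A $$ (j, j))"
      have x: "?x \<in> carrier V" "h ?x = unit_vec n j" using cinv[of "unit_vec n j"] by simp_all
      have cl: "?c \<in> q_classes q" by (rule q_class_in[OF normal_form_diag_nz[OF A ij(2)]])
      have "?x \<in> component V ?c"
        unfolding compV[OF cl] x(2) using x(1) ij by (auto simp: unit_vec_def split: if_splits)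
      then have "f ?x \<in> component W ?c" using f cl by (auto simp: grnil_hom_def)
      moreover have "k (f ?x) $ i = P $$ (i, j)" unfolding P(2)[OF x(1)] x(2) using P(1) ij by simp
      ultimately have "q_class q (B $$ (i, i)) = ?c" using ij by (simp add: compW[OF cl])
      then show ?thesis by (rule is_rep_unique[OF q0 normal_form_rep[OF B ij(1)] normal_form_rep[OF A ij(2)]])
    qed
    have "P * nilpart n A = nilpart m B * P"
    proof (rule mats_eqI[OF subfld_UNIV])
      fix v :: "complex vec" assume "v \<in> vecs UNIV n"
      then have v: "v \<in> carrier_vec n" by (simp add: vecs_UNIV)
      let ?x = "cinv h V v"
      note x = cinv[OF v]
      have "P * nilpart n A *\<^sub>v v = k (f (Nil_op V ?x))"
        using assoc_mult_mat_vec[OF P(1) nilpart_carrier(1) v] P(2) NV[OF x(1)] x(2) by simp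
      also have "f (Nil_op V ?x) = Nil_op W (f ?x)" using f x(1) by (simp add: grnil_hom_def)
      also have "k (Nil_op W (f ?x)) = nilpart m B * P *\<^sub>v v"
        using assoc_mult_mat_vec[OF nilpart_carrier(1) P(1) v] NW[OF fW[OF x(1)]] P(2)[OF x(1)] x(2) by simp
      finally show "P * nilpart n A *\<^sub>v v = nilpart m B * P *\<^sub>v v" .
    qed (rule mult_carrier_mat[OF P(1) nilpart_carrier(1)], rule mult_carrier_mat[OF nilpart_carrier(1) P(1)])
    then have "P * A = B * P" using nf_intertwine_nilpart[OF Ac Bc P(1) gr] by simp
    then show "\<exists>P\<in>nf_hom (n, A) (m, B). \<forall>x\<in>carrier V. k (f x) = P *\<^sub>v h x"
      using P gr by (intro bexI[of _ P]) (auto simp: nf_hom_def)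
  next
    assume "P \<in> nf_hom (n, A) (m, B)"
    then have P: "P \<in> carrier_mat m n" "P * A = B * P"
      and gr: "\<And>i j. i < m \<Longrightarrow> j < n \<Longrightarrow> P $$ (i, j) \<noteq> 0 \<Longrightarrow> B $$ (i, i) = A $$ (j, j)" by (auto simp: nf_hom_def)
    have PN: "P * nilpart n A = nilpart m B * P" using nf_intertwine_nilpart[OF Ac Bc P(1) gr] P(2) by simp
    define f where "f = (\<lambda>x\<in>carrier V. cinv k W (P *\<^sub>v h x))"
    note hm = matrix_coord_hom[OF subfld_UNIV c d, of P, unfolded mats_UNIV, OF P(1)]
    have f: "f x \<in> carrier W" "k (f x) = P *\<^sub>v h x" if "x \<in> carrier V" for x
      using hm(2,3)[OF that] that by (simp_all add: f_def)
    have "f ` component V e \<subseteq> component W e" if e: "e \<in> q_classes q" for e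
    proof
      fix y assume "y \<in> f ` component V e"
      then obtain x where x: "x \<in> component V e" "y = f x" by blast
      then have xV: "x \<in> carrier V" by (simp add: compV[OF e])
      have "q_class q (B $$ (i, i)) = e" if i: "i < m" and nz: "k y $ i \<noteq> 0" for i
      proof -
        have "(\<Sum>l<n. P $$ (i, l) * h x $ l) \<noteq> 0"
          using nz x(2) f(2)[OF xV] mat_vec_index[OF P(1) coordD(4)[OF c xV] i] by simp
        then obtain l where "l < n" "P $$ (i, l) * h x $ l \<noteq> 0"
          by (metis (no_types, lifting) lessThan_iff sum.neutral)
        then have l: "l < n" "P $$ (i, l) \<noteq> 0" "h x $ l \<noteq> 0" by auto
        then show ?thesis using gr[OF i l(1,2)] x(1) by (simp add: compV[OF e])
      qed
      then show "y \<in> component W e" using f(1)[OF xV] x(2) by (simp add: compW[OF e])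
    qed
    moreover have "f (Nil_op V x) = Nil_op W (f x)" if x: "x \<in> carrier V" for x
    proof (rule coord_eqI[OF d])
      note hx = coordD(4)[OF c x]
      have "k (f (Nil_op V x)) = P * nilpart n A *\<^sub>v h x"
        unfolding assoc_mult_mat_vec[OF P(1) nilpart_carrier(1) hx] using f(2)[of "Nil_op V x"] NV[OF x] by simp
      also have "\<dots> = k (Nil_op W (f x))"
        unfolding PN assoc_mult_mat_vec[OF nilpart_carrier(1) P(1) hx] using f[OF x] NW[OF f(1)[OF x]] by simp
      finally show "k (f (Nil_op V x)) = k (Nil_op W (f x))" .
    qed (use f NV[OF x] NW x in auto)
    ultimately have "f \<in> grnil_hom q V W"
      using hm(1) by (auto simp: grnil_hom_def f_def subfld_ring_UNIV)
    then show "\<exists>f\<in>grnil_hom q V W. \<forall>x\<in>carrier V. k (f x) = P *\<^sub>v h x" using f(2) by blast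
  }
qed

lemma is_category_grnil: "is_category (grnil_category q)"
proof -
  have comp: "compose (carrier L) g f \<in> grnil_hom q L N"
    if L: "graded_nilpotent_space q L" and f: "f \<in> grnil_hom q L M" and g: "g \<in> grnil_hom q M N"
    for L M N :: "'a grnil" and f g
  proof -
    have vs: "vectorspace C_field L" and sub: "\<And>c. c \<in> q_classes q \<Longrightarrow> VectorSpace.subspace C_field (component L c) L"
      and nil: "Nil_op L \<in> module_hom C_field L L"
      using L by (auto simp: graded_nilpotent_space_def)
    interpret vectorspace C_field L by (rule vs)
    have Nx: "Nil_op L x \<in> carrier L" if "x \<in> carrier L" for x using nil that by (auto simp: module_hom_def)
    have cL: "x \<in> carrier L" if "c \<in> q_classes q" "x \<in> component L c" for c x
      using submodule.subset[OF subspace.submod[OF sub[OF that(1)]]] that(2) by blast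
    have "compose (carrier L) g f ` component L c \<subseteq> component N c" if c: "c \<in> q_classes q" for c
    proof
      fix y assume "y \<in> compose (carrier L) g f ` component L c"
      then obtain x where x: "x \<in> component L c" "y = g (f x)" using cL[OF c] by (auto simp: compose_def)
      have "f x \<in> component M c" using f c x(1) by (auto simp: grnil_hom_def)
      then show "y \<in> component N c" using g c x(2) by (auto simp: grnil_hom_def)
    qed
    moreover have "compose (carrier L) g f \<in> module_hom C_field L N"
      using f g by (auto simp: grnil_hom_def module_hom_def compose_def Pi_def)
    moreover have "compose (carrier L) g f (Nil_op L x) = Nil_op N (compose (carrier L) g f x)" if x: "x \<in> carrier L" for x
      using x Nx[OF x] f g by (auto simp: grnil_hom_def module_hom_def compose_def Pi_def)
    ultimately show ?thesis by (simp add: grnil_hom_def)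
  qed
  have idn: "(\<lambda>m\<in>carrier M. m) \<in> grnil_hom q M M" if L: "graded_nilpotent_space q M" for M :: "'a grnil"
  proof -
    have vs: "vectorspace C_field M" and sub: "\<And>c. c \<in> q_classes q \<Longrightarrow> VectorSpace.subspace C_field (component M c) M"
      and nil: "Nil_op M \<in> module_hom C_field M M"
      using L by (auto simp: graded_nilpotent_space_def)
    interpret vectorspace C_field M by (rule vs)
    have Nx: "Nil_op M x \<in> carrier M" if "x \<in> carrier M" for x using nil that by (auto simp: module_hom_def)
    have cL: "x \<in> carrier M" if "c \<in> q_classes q" "x \<in> component M c" for c x
      using submodule.subset[OF subspace.submod[OF sub[OF that(1)]]] that(2) by blast
    show ?thesis using Nx cL by (auto simp: grnil_hom_def module_hom_def)
  qed
  show ?thesis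
    unfolding is_category_def
  proof (intro conjI ballI)
    fix A B :: "'a grnil" and f assume "f \<in> Hom (grnil_category q) A B"
    then have f: "f \<in> carrier A \<rightarrow> carrier B" "f \<in> extensional (carrier A)" by (auto simp: grnil_category_def grnil_hom_def module_hom_def)
    show "Comp (grnil_category q) A A B f (Ident (grnil_category q) A) = f"
      "Comp (grnil_category q) A B B (Ident (grnil_category q) B) f = f"
      using f by (auto simp: grnil_category_def compose_def extensional_def Pi_def fun_eq_iff)
  next
    fix A B D E :: "'a grnil" and f g h
    assume "f \<in> Hom (grnil_category q) A B" "g \<in> Hom (grnil_category q) B D"
    then have "f \<in> carrier A \<rightarrow> carrier B" by (auto simp: grnil_category_def grnil_hom_def module_hom_def)
    then show "Comp (grnil_category q) A D E h (Comp (grnil_category q) A B D g f) =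
        Comp (grnil_category q) A B E (Comp (grnil_category q) B D E h g) f"
      by (auto simp: grnil_category_def compose_def Pi_def fun_eq_iff)
  qed (auto simp: grnil_category_def comp idn)
qed

lemma (in small_q) grnil_functor:
  assumes e: "\<exists>e :: (nat \<Rightarrow> complex) \<Rightarrow> 'v. inj e"
  defines "C \<equiv> full_subcategory (grnil_category q) (phi_condition q) :: ('v grnil, 'v \<Rightarrow> 'v) cat"
  shows "\<exists>Uo Ua. fully_faithful C (nf_category q) Uo Ua \<and> ess_surj C (nf_category q) Uo"
proof (rule functor_to_normal_forms[OF _ subfld_UNIV, where T = "\<lambda>P. P" and
      pr = "\<lambda>V X h. graded_coord q V (fst X) (snd X) h"])
  have ObjC: "Obj C = {V. graded_nilpotent_space q V \<and> phi_condition q V}"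
    and HomC: "Hom C = grnil_hom q" "Ident C = (\<lambda>M. \<lambda>m\<in>carrier M. m)"
    "Comp C = (\<lambda>L M N g f. compose (carrier L) g f)"
    by (auto simp: C_def full_subcategory_def grnil_category_def)
  show "is_category C" unfolding C_def by (intro full_subcategory_category is_category_grnil)
  show "Ident C M = (\<lambda>m\<in>carrier M. m)" "Comp C L M N g f = compose (carrier L) g f" for L M N f g
    by (simp_all add: HomC)
  show "f \<in> extensional (carrier M) \<and> f \<in> carrier M \<rightarrow> carrier N" if "f \<in> Hom C M N" for M N f
    using that by (auto simp: HomC grnil_hom_def module_hom_def)
  show "coord UNIV V (fst X) h" if "graded_coord q V (fst X) (snd X) h" for V :: "'v grnil" and X h
    using that by (simp add: graded_coord_def)
  have nf: "normal_form q (fst X) (snd X)" "cond q (fst X) (snd X)" if "X \<in> Obj (nf_category q)" for X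
    using that by (auto simp: nf_category_def)
  show "\<exists>X\<in>Obj (nf_category q). \<exists>h. graded_coord q V (fst X) (snd X) h" if V: "V \<in> Obj C" for V
  proof -
    obtain n A h where A: "normal_form q n A" "graded_coord q V n A h"
      using graded_coord_exists[OF q_nz, of V] V by (auto simp: ObjC)
    moreover have "cond q n A" using phi_condition_iff_cond[OF A] V by (simp add: ObjC)
    ultimately show ?thesis by (intro bexI[of _ "(n, A)"]) (auto simp: nf_category_def)
  qed
  show "\<exists>V\<in>Obj C. \<exists>h. graded_coord q V (fst X) (snd X) h" if X: "X \<in> Obj (nf_category q)" for X
  proof -
    obtain V :: "'v grnil" and h where V: "graded_coord q V (fst X) (snd X) h"
      using graded_coord_copy_exists[OF e] by blast
    have "V \<in> Obj C"
      using graded_nilpotent_space_if_graded_coord[OF nf(1)[OF X] V] phi_condition_iff_cond[OF nf(1)[OF X] V] nf(2)[OF X]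
      by (simp add: ObjC)
    then show ?thesis using V by blast
  qed
  show "\<exists>P\<in>nf_hom X Y. \<forall>x\<in>carrier M. k (f x) = P *\<^sub>v h x"
    if "X \<in> Obj (nf_category q)" "Y \<in> Obj (nf_category q)" "graded_coord q M (fst X) (snd X) h"
      "graded_coord q N (fst Y) (snd Y) k" "f \<in> Hom C M N" for X Y M N h k f
    using grnil_hom_normal_form(1)[OF q_nz nf(1)[OF that(1)] nf(1)[OF that(2)] that(3,4)] that(5) by (simp add: HomC)
  show "\<exists>f\<in>Hom C M N. \<forall>x\<in>carrier M. k (f x) = P *\<^sub>v h x"
    if "X \<in> Obj (nf_category q)" "Y \<in> Obj (nf_category q)" "graded_coord q M (fst X) (snd X) h"
      "graded_coord q N (fst Y) (snd Y) k" "P \<in> nf_hom X Y" for X Y M N h k P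
    using grnil_hom_normal_form(2)[OF q_nz nf(1)[OF that(1)] nf(1)[OF that(2)] that(3,4)] that(5) by (simp add: HomC)
qed auto

theorem theorem3:
  fixes q :: complex
  assumes "norm q = 1"
    and "\<forall>n>0. q ^ n \<noteq> 1"
    and "fps_conv_radius (Abs_fps (\<lambda>n. 1 / qpoch q q n)) > 0"
    and "\<exists>e :: (nat \<Rightarrow> complex fls) \<Rightarrow> 'm. inj e"
    and "\<exists>e :: (nat \<Rightarrow> complex) \<Rightarrow> 'v. inj e"
  shows "equivalent_categories
    (Bq_iso_f q :: ('m qmod, 'm \<Rightarrow> 'm) cat)
    (full_subcategory (grnil_category q) (phi_condition q) :: ('v grnil, 'v \<Rightarrow> 'v) cat)"
proof -
  interpret small_q q
    by unfold_locales (use assms(1-3) in \<open>auto simp: geo_conv_radius fps_conv_radius_def\<close>)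
  let ?C = "Bq_iso_f q :: ('m qmod, 'm \<Rightarrow> 'm) cat"
  let ?D = "full_subcategory (grnil_category q) (phi_condition q) :: ('v grnil, 'v \<Rightarrow> 'v) cat"
  obtain Uo Ua where U: "fully_faithful ?C (nf_category q) Uo Ua" "ess_surj ?C (nf_category q) Uo"
    using Bq_iso_f_functor[OF assms(4)] by blast
  obtain Wo Wa where W: "fully_faithful ?D (nf_category q) Wo Wa" "ess_surj ?D (nf_category q) Wo"
    using grnil_functor[OF assms(5)] by blast
  have "is_category ?C"
    unfolding Bq_iso_f_def Bq_iso_def by (intro full_subcategory_category is_category_qmod)
  moreover have "is_category ?D" by (intro full_subcategory_category is_category_grnil)
  ultimately show ?thesis by (rule equivalent_if_common_skeleton[OF _ _ is_category_nf U W])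
qed

end
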